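(* Let $v$ be a place of $F$ and $a\in F_v^\times-\{1\}$, and set $$\mathfrak F^{(z)}_v(a)=\int_{F_v}\left(\int_{\mathbf K_v}\Phi_v\!\left(k^{-1}\begin{pmatrix}a&(a-1)x\\0&1\end{pmatrix}k\right)dk\right)\varphi_v^{(0,z)}\!\left(\begin{pmatrix}1&x\\0&1\end{pmatrix}\right)dx.$$ (1) If $v\in\Sigma_\infty$, then on $|\mathrm{Re}(z)|<2l_v-1$: $\mathfrak F^{(z)}_v(a)=\frac{4\pi}{\Gamma(l_v)}\frac{\Gamma(l_v+\frac{z-1}{2})\Gamma(l_v+\frac{-z-1}{2})}{\Gamma_{\mathbb R}(\frac{1+z}{2})\Gamma_{\mathbb R}(\frac{1-z}{2})}\delta(a>0)|a|_v^{1/2}|a-1|_v^{-1}\mathfrak P^{1-l_v}_{\frac{z-1}{2}}(\lambda_v(a)^{-1/2})$ with $\lambda_v(a)=|(a-1)/(a+1)|_v^2$. (2) If $v\in\Sigma_{\mathrm{fin}}-(S\cup S(\mathfrak n))$, then $\mathfrak F^{(z)}_v(a)=\delta(a\in\mathcal O_v^\times)q_v^{-d_v/2}\mathcal O^{1,(z)}_{v,0}((a-1)^{-2}a)$; in particular $\mathfrak F^{(z)}_v(a)=q_v^{-d_v/2}$ if $|a|_v=|a-1|_v=1$. (3) If $v\in S(\mathfrak n)$, then $\mathfrak F^{(z)}_v(a)=\delta(a\in\mathcal O_v^\times)q_v^{-d_v/2}\mathcal O^{1,(z)}_{v,1}((a-1)^{-2}a)$. (4) If $v\in S$, then for $2\mathrm{Re}(s_v)+1>|\mathrm{Re}(z)|$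 (with $\Phi_v=\Phi_v(s_v;\cdot)$): $\mathfrak F^{(z)}_v(s_v;a)=q_v^{-d_v/2}\mathcal S^{1,(z)}_v(s_v;(a-1)^{-2}a)$.
   Context: $F$ totally real number field; $\mathfrak n\subset\mathcal O$ non-zero square-free; $S$ finite set of finite places with $S\cap S(\mathfrak n)=\emptyset$ ($S(\mathfrak n)$ = finite places dividing $\mathfrak n$); $l=(l_v)$ even, $l_v\ge4$. For finite $v$: $\mathcal O_v,\mathfrak p_v$, $q_v$, $|\cdot|_v$, $d_v$ exponent of the local different, $\mathbf K_v=\mathrm{GL}_2(\mathcal O_v)$; real $v$: $\mathbf K_v=\mathrm O(2)$. $dk$ probability Haar measure; $dx$ on $F_v$ with $\int_{\mathcal O_v}dx=q_v^{-d_v/2}$ (finite), Lebesgue (real). $\delta(P)=1$ if $P$ holds, else $0$. Test functions: real $v$: $\Phi_v(g)=\delta(\det g>0)(4\det g)^{l_v/2}\{(a+d)-i(b-c)\}^{-l_v}$ for $g=\begin{pmatrix}a&b\\c&d\end{pmatrix}$; $v\in S$: $\Phi_v(s;g)=(q_v^{-(s+1)/2}-q_v^{(s+1)/2})^{-1}\{|\det g|_v^{-1}\max(|a|_v,|b|_v,|c|_v,|d|_v)^2\}^{-(s+1)/2}$; $v\in S(\mathfrak n)$: $\Phi_v=\mathrm{ch}_{Z_v\mathbf K_0(\mathfrak p_v)}$ with $\mathbf K_0(\mathfrak p_v)=\{\begin{pmatrix}a&b\\c&d\end{pmatrix}\in\mathbf K_v:c\in\mathfrak p_v\}$, $Z_v$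 the center; other finite $v$: $\Phi_v=\mathrm{ch}_{Z_v\mathbf K_v}$. Spherical function: $\zeta_{F_v}(s)=(1-q_v^{-s})^{-1}$ (finite), $=\Gamma_{\mathbb R}(s)=\pi^{-s/2}\Gamma(s/2)$ (real); $A_v(0,z)=\zeta_{F_v}(1)\zeta_{F_v}(-z)\zeta_{F_v}(\frac{1-z}{2})^{-2}$; $h_v^{(0,z)}(x)=\max(1,|x|_v)^{-(z+1)/2}$ (finite) and $(1+x^2)^{-(z+1)/4}{}_2F_1(\frac{z+1}{4},\frac{z+1}{4};\frac{z+2}{2};\frac{1}{x^2+1})$ (real); $\varphi_v^{(0,z)}\!\left(\begin{pmatrix}1&x\\0&1\end{pmatrix}\right)=A_v(0,z)h_v^{(0,z)}(x)+A_v(0,-z)h_v^{(0,-z)}(x)$ (singularities removable). $\mathfrak P^\mu_\nu$ is the Legendre function of the first kind on $\mathbb C-(-\infty,1]$. For finite $v$, $\epsilon\in\{0,1\}$, $b\in F_v^\times$: $\mathcal O^{1,(z)}_{v,\epsilon}(b)=\frac{\zeta_{F_v}(-z)}{\zeta_{F_v}(\frac{-z+1}{2})}\big(\frac{1+q_v^{(z+1)/2}}{1+q_v}\big)^\epsilon|b|_v^{\frac{-z+1}{4}}+\frac{\zeta_{F_v}(z)}{\zeta_{F_v}(\frac{z+1}{2})}\big(\frac{1+q_v^{(-z+1)/2}}{1+q_v}\big)^\epsilon|b|_v^{\frac{z+1}{4}}$; $\mathcal S^{1,(z)}_v(s;b)=-q_v^{-\frac{s+1}{2}}\frac{\zeta_{F_v}(s+\frac{z+1}{2})\zeta_{F_v}(s+\frac{-z+1}{2})}{\zeta_{F_v}(s+1)}|b|_v^{\frac{s+1}{2}}$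 if $|b|_v\le1$, and $-q_v^{-\frac{s+1}{2}}\{\frac{\zeta_{F_v}(-z)\zeta_{F_v}(s+\frac{z+1}{2})}{\zeta_{F_v}(\frac{-z+1}{2})}|b|_v^{\frac{-z+1}{4}}+\frac{\zeta_{F_v}(z)\zeta_{F_v}(s+\frac{-z+1}{2})}{\zeta_{F_v}(\frac{z+1}{2})}|b|_v^{\frac{z+1}{4}}\}$ if $|b|_v>1$. *)

theory Defs
  imports
    "HOL-Complex_Analysis.Complex_Analysis"
    "HOL-Algebra.Ideal_Product"
begin

section \<open>Number fields, ideals and places\<close>

text \<open>A number field is a type of class \<open>field_char_0\<close> that is finite-dimensional over the
  rationals.\<close>

definition is_ring_hom :: "('a::field \<Rightarrow> 'b::field) \<Rightarrow> bool" where
  "is_ring_hom h \<longleftrightarrow> h 1 = 1 \<and> (\<forall>x y. h (x + y) = h x + h y) \<and> (\<forall>x y. h (x * y) = h x * h y)"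

definition number_field :: "'f::field_char_0 itself \<Rightarrow> bool" where
  "number_field _ \<longleftrightarrow>
     (\<exists>B :: 'f set. finite B \<and> module.span (\<lambda>(r::rat) x. of_rat r * x) B = UNIV)"

definition totally_real :: "'f::field_char_0 itself \<Rightarrow> bool" where
  "totally_real _ \<longleftrightarrow> (\<forall>\<tau> :: 'f \<Rightarrow> complex. is_ring_hom \<tau> \<longrightarrow> (\<forall>x. \<tau> x \<in> \<real>))"

definition int_ring :: "'f::field_char_0 ring" where
  "int_ring = \<lparr>carrier = {x. algebraic_int x}, mult = (*), one = 1, zero = 0, add = (+)\<rparr>"

definition ideal_dvd :: "'f::field_char_0 set \<Rightarrow> 'f set \<Rightarrow> bool" where
  "ideal_dvd I J \<longleftrightarrow> (\<exists>K. ideal K int_ring \<and> J = ideal_prod int_ring I K)"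

definition squarefree_ideal :: "'f::field_char_0 set \<Rightarrow> bool" where
  "squarefree_ideal I \<longleftrightarrow>
     (\<forall>J. ideal J int_ring \<and> ideal_dvd (ideal_prod int_ring J J) I \<longrightarrow> J = carrier int_ring)"

text \<open>The archimedean places of a totally real field are its embeddings into the reals; the
  completion at such a place is \<open>real\<close> with its usual absolute value and Lebesgue measure.
  The finite places are the non-zero prime ideals of the ring of integers.\<close>

definition real_places :: "('f::field_char_0 \<Rightarrow> real) set" where
  "real_places = {\<sigma>. is_ring_hom \<sigma>}"

definition finite_places :: "'f::field_char_0 set set" where
  "finite_places = {P. primeideal P int_ring \<and> P \<noteq> {0}}"

definition places_dividing :: "'f::field_char_0 set \<Rightarrow> 'f set set" where
  "places_dividing I = {P \<in> finite_places. ideal_dvd P I}"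


section \<open>Completions at finite places\<close>

text \<open>The completion \<open>F\<^sub>v\<close> at a finite place is modelled by a field type \<open>'k\<close> whose metric is
  induced by the normalised absolute value \<open>vabs\<close>; completeness comes from the class
  \<open>complete_space\<close>.\<close>

definition vabs :: "'k::{field_char_0,metric_space} \<Rightarrow> real" where
  "vabs x = dist x 0"

definition val_ring :: "'k::{field_char_0,metric_space} set" where
  "val_ring = {x. vabs x \<le> 1}"

definition val_ideal :: "'k::{field_char_0,metric_space} set" where
  "val_ideal = {x. vabs x < 1}"

definition qv :: "'k::{field_char_0,metric_space} itself \<Rightarrow> nat" where
  "qv _ = card ((val_ring :: 'k set) // {(x, y). x \<in> val_ring \<and> y \<in> val_ring \<and> x - y \<in> val_ideal})"

text \<open>\<open>\<iota>\<close> exhibits \<open>'k\<close> as the completion at the prime \<open>P\<close>. The conjunct on algebraic integers says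
  that the restriction of \<open>vabs\<close> along \<open>\<iota>\<close> belongs to the place \<open>P\<close>; the last one fixes the
  normalisation, namely a prime element has absolute value \<open>1 / q\<^sub>v\<close>.\<close>

definition is_completion_at ::
    "'f::field_char_0 set \<Rightarrow> ('f \<Rightarrow> 'k::{field_char_0,complete_space}) \<Rightarrow> bool" where
  "is_completion_at P \<iota> \<longleftrightarrow>
     is_ring_hom \<iota> \<and> closure (range \<iota>) = UNIV \<and>
     (\<forall>x y::'k. dist x y = vabs (x - y)) \<and>
     (\<forall>x y::'k. vabs (x * y) = vabs x * vabs y) \<and>
     (\<forall>x y::'k. vabs (x + y) \<le> max (vabs x) (vabs y)) \<and>
     (\<forall>a. algebraic_int a \<longrightarrow> vabs (\<iota> a) \<le> 1 \<and> (vabs (\<iota> a) < 1 \<longleftrightarrow> a \<in> P)) \<and>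
     (\<exists>\<pi>::'k. val_ideal = {\<pi> * y | y. y \<in> val_ring} \<and> vabs \<pi> = 1 / real (qv TYPE('k)))"


subsection \<open>The exponent of the local different\<close>

text \<open>The closure of the rationals in \<open>F\<^sub>v\<close> is the field of p-adic numbers, p being the residue
  characteristic.\<close>

definition Qp :: "'k::{field_char_0,metric_space} set" where
  "Qp = closure (range of_rat)"

definition is_coords :: "'k::field set \<Rightarrow> 'k set \<Rightarrow> 'k \<Rightarrow> ('k \<Rightarrow> 'k) \<Rightarrow> bool" where
  "is_coords K B x c \<longleftrightarrow> (\<forall>b\<in>B. c b \<in> K) \<and> (\<forall>b. b \<notin> B \<longrightarrow> c b = 0) \<and> x = (\<Sum>b\<in>B. c b * b)"

definition is_basis_over :: "'k::field set \<Rightarrow> 'k set \<Rightarrow> bool" where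
  "is_basis_over K B \<longleftrightarrow> finite B \<and> (\<forall>x. \<exists>!c. is_coords K B x c)"

definition trace_over :: "'k::field set \<Rightarrow> 'k \<Rightarrow> 'k" where
  "trace_over K x =
     (let B = (SOME B. is_basis_over K B) in \<Sum>b\<in>B. (THE c. is_coords K B (x * b) c) b)"

definition codifferent :: "'k::{field_char_0,metric_space} set" where
  "codifferent = {x. \<forall>y\<in>val_ring. trace_over Qp (x * y) \<in> Qp \<inter> val_ring}"

definition different :: "'k::{field_char_0,metric_space} set" where
  "different = {x. \<forall>y\<in>codifferent. x * y \<in> val_ring}"

definition dv :: "'k::{field_char_0,metric_space} itself \<Rightarrow> nat" where
  "dv _ = (THE d. (different :: 'k set) = {x. vabs x \<le> 1 / real (qv TYPE('k)) ^ d})"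


subsection \<open>Haar measures\<close>

text \<open>The Haar measure on \<open>F\<^sub>v\<close> giving the valuation ring volume \<open>q\<^sub>v\<close> to the \<open>-d\<^sub>v/2\<close>, and
  the Haar probability measure on a compact group of matrices. Both are determined uniquely.\<close>

definition is_haar_field :: "'k::{field_char_0,metric_space} measure \<Rightarrow> bool" where
  "is_haar_field \<mu> \<longleftrightarrow>
     sets \<mu> = sets borel \<and>
     (\<forall>t. \<forall>A\<in>sets \<mu>. emeasure \<mu> ((+) t ` A) = emeasure \<mu> A) \<and>
     emeasure \<mu> val_ring = ennreal (real (qv TYPE('k)) powr (- real (dv TYPE('k)) / 2))"

definition is_haar_prob ::
    "('k::{field,metric_space}^2^2) set \<Rightarrow> ('k^2^2) measure \<Rightarrow> bool" where
  "is_haar_prob K \<nu> \<longleftrightarrow>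
     sets \<nu> = sets (restrict_space borel K) \<and>
     emeasure \<nu> K = 1 \<and>
     (\<forall>k\<in>K. \<forall>A\<in>sets \<nu>. emeasure \<nu> ((\<lambda>g. k ** g) ` A) = emeasure \<nu> A)"


section \<open>Matrix groups\<close>

definition mat2 :: "'a::zero \<Rightarrow> 'a \<Rightarrow> 'a \<Rightarrow> 'a \<Rightarrow> 'a^2^2" where
  "mat2 a b c d = vector [vector [a, b], vector [c, d]]"

definition O2 :: "(real^2^2) set" where
  "O2 = {g. orthogonal_matrix g}"

definition GL2_val_ring :: "('k::{field_char_0,metric_space}^2^2) set" where
  "GL2_val_ring = {g. (\<forall>i j. g $ i $ j \<in> val_ring) \<and> vabs (det g) = 1}"

definition K0 :: "('k::{field_char_0,metric_space}^2^2) set" where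
  "K0 = {g \<in> GL2_val_ring. g $ 2 $ 1 \<in> val_ideal}"

definition center_GL2 :: "('k::field^2^2) set" where
  "center_GL2 = {t. invertible t \<and> (\<forall>g. invertible g \<longrightarrow> t ** g = g ** t)}"

definition center_times :: "('k::field^2^2) set \<Rightarrow> ('k^2^2) set" where
  "center_times K = {t ** k | t k. t \<in> center_GL2 \<and> k \<in> K}"


section \<open>Test functions\<close>

definition Phi_real :: "nat \<Rightarrow> real^2^2 \<Rightarrow> complex" where
  "Phi_real l g =
     (if det g > 0
      then complex_of_real ((4 * det g) ^ (l div 2)) *
           inverse ((Complex (g $ 1 $ 1 + g $ 2 $ 2) (- (g $ 1 $ 2 - g $ 2 $ 1))) ^ l)
      else 0)"

definition Phi_S :: "complex \<Rightarrow> 'k::{field_char_0,metric_space}^2^2 \<Rightarrow> complex" where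
  "Phi_S s g =
     (let q = complex_of_real (real (qv TYPE('k)));
          m = max (max (vabs (g $ 1 $ 1)) (vabs (g $ 1 $ 2)))
                  (max (vabs (g $ 2 $ 1)) (vabs (g $ 2 $ 2)))
      in inverse (q powr (- (s + 1) / 2) - q powr ((s + 1) / 2)) *
         complex_of_real (inverse (vabs (det g)) * m ^ 2) powr (- (s + 1) / 2))"

definition Phi_n :: "'k::{field_char_0,metric_space}^2^2 \<Rightarrow> complex" where
  "Phi_n = indicator (center_times K0)"

definition Phi_unram :: "'k::{field_char_0,metric_space}^2^2 \<Rightarrow> complex" where
  "Phi_unram = indicator (center_times GL2_val_ring)"


section \<open>Special functions\<close>

definition zeta_fin :: "nat \<Rightarrow> complex \<Rightarrow> complex" where
  "zeta_fin q s = 1 / (1 - complex_of_real (real q) powr (- s))"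

definition Gamma_R :: "complex \<Rightarrow> complex" where
  "Gamma_R s = complex_of_real pi powr (- s / 2) * Gamma (s / 2)"

definition hyp2F1_series :: "complex \<Rightarrow> complex \<Rightarrow> complex \<Rightarrow> complex \<Rightarrow> nat \<Rightarrow> complex" where
  "hyp2F1_series a b c w n =
     pochhammer a n * pochhammer b n / (pochhammer c n * fact n) * w ^ n"

text \<open>The Gauss series where it converges, and otherwise its analytic continuation from the unit
  disc to the plane cut along \<open>[1, \<infinity>)\<close>. The value at a nonpositive integer \<open>c\<close> is meaningless.\<close>

definition hyp2F1 :: "complex \<Rightarrow> complex \<Rightarrow> complex \<Rightarrow> complex \<Rightarrow> complex" where
  "hyp2F1 a b c w =
     (if summable (hyp2F1_series a b c w) then \<Sum>n. hyp2F1_series a b c w n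
      else (SOME f. f holomorphic_on (- complex_of_real ` {1..}) \<and>
                    (\<forall>u\<in>ball 0 1. f u = (\<Sum>n. hyp2F1_series a b c u n))) w)"

text \<open>The Legendre function of the first kind on the plane cut along \<open>(-\<infinity>, 1]\<close>, for \<open>\<mu>\<close> not a
  positive integer.\<close>

definition Legendre_P :: "complex \<Rightarrow> complex \<Rightarrow> complex \<Rightarrow> complex" where
  "Legendre_P \<mu> \<nu> x =
     1 / Gamma (1 - \<mu>) * ((x + 1) / (x - 1)) powr (\<mu> / 2) *
     hyp2F1 (- \<nu>) (\<nu> + 1) (1 - \<mu>) ((1 - x) / 2)"

text \<open>\<open>remove_sings\<close> replaces the value of a function of \<open>z\<close> by its limit at the point. It
  does not change values at regular points, so it only gives meaning to the formulas below at
  the poles of the individual terms, such as \<open>z = 0\<close>.\<close>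

definition A_coeff :: "(complex \<Rightarrow> complex) \<Rightarrow> complex \<Rightarrow> complex" where
  "A_coeff \<zeta> z = \<zeta> 1 * \<zeta> (- z) / (\<zeta> ((1 - z) / 2)) ^ 2"

definition h_fin :: "complex \<Rightarrow> 'k::{field_char_0,metric_space} \<Rightarrow> complex" where
  "h_fin z x = complex_of_real (max 1 (vabs x)) powr (- (z + 1) / 2)"

definition h_real :: "complex \<Rightarrow> real \<Rightarrow> complex" where
  "h_real z x =
     complex_of_real (1 + x ^ 2) powr (- (z + 1) / 4) *
     hyp2F1 ((z + 1) / 4) ((z + 1) / 4) ((z + 2) / 2) (complex_of_real (1 / (x ^ 2 + 1)))"

text \<open>The spherical functions, as functions of the upper right entry of a unipotent matrix.\<close>

definition phi_fin :: "complex \<Rightarrow> 'k::{field_char_0,metric_space} \<Rightarrow> complex" where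
  "phi_fin z x =
     remove_sings (\<lambda>w. A_coeff (zeta_fin (qv TYPE('k))) w * h_fin w x
                       + A_coeff (zeta_fin (qv TYPE('k))) (- w) * h_fin (- w) x) z"

definition phi_real :: "complex \<Rightarrow> real \<Rightarrow> complex" where
  "phi_real z x =
     remove_sings (\<lambda>w. A_coeff Gamma_R w * h_real w x + A_coeff Gamma_R (- w) * h_real (- w) x) z"

definition O1 :: "nat \<Rightarrow> complex \<Rightarrow> 'k::{field_char_0,metric_space} \<Rightarrow> complex" where
  "O1 \<epsilon> z b =
     (let q = complex_of_real (real (qv TYPE('k)));
          \<zeta> = zeta_fin (qv TYPE('k));
          B = complex_of_real (vabs b)
      in remove_sings (\<lambda>w.
           \<zeta> (- w) / \<zeta> ((- w + 1) / 2) * ((1 + q powr ((w + 1) / 2)) / (1 + q)) ^ \<epsilon>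
             * B powr ((- w + 1) / 4)
         + \<zeta> w / \<zeta> ((w + 1) / 2) * ((1 + q powr ((- w + 1) / 2)) / (1 + q)) ^ \<epsilon>
             * B powr ((w + 1) / 4)) z)"

definition S1 :: "complex \<Rightarrow> complex \<Rightarrow> 'k::{field_char_0,metric_space} \<Rightarrow> complex" where
  "S1 z s b =
     (let q = complex_of_real (real (qv TYPE('k)));
          \<zeta> = zeta_fin (qv TYPE('k));
          B = complex_of_real (vabs b)
      in if vabs b \<le> 1
         then - (q powr (- (s + 1) / 2)) *
              (\<zeta> (s + (z + 1) / 2) * \<zeta> (s + (- z + 1) / 2) / \<zeta> (s + 1)) * B powr ((s + 1) / 2)
         else - (q powr (- (s + 1) / 2)) *
              remove_sings (\<lambda>w.
                \<zeta> (- w) * \<zeta> (s + (w + 1) / 2) / \<zeta> ((- w + 1) / 2) * B powr ((- w + 1) / 4)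
              + \<zeta> w * \<zeta> (s + (- w + 1) / 2) / \<zeta> ((w + 1) / 2) * B powr ((w + 1) / 4)) z)"


section \<open>The local orbital integral\<close>

definition conj_unip :: "'k::field \<Rightarrow> 'k \<Rightarrow> 'k^2^2 \<Rightarrow> 'k^2^2" where
  "conj_unip a x k = matrix_inv k ** mat2 a ((a - 1) * x) 0 1 ** k"

definition frakF ::
    "('k::field^2^2) measure \<Rightarrow> 'k measure \<Rightarrow> ('k^2^2 \<Rightarrow> complex) \<Rightarrow> ('k \<Rightarrow> complex) \<Rightarrow> 'k \<Rightarrow> complex" where
  "frakF dk dx \<Phi> \<phi> a = (LINT x|dx. (LINT k|dk. \<Phi> (conj_unip a x k)) * \<phi> x)"

text \<open>The Bochner integral of a non-integrable function is 0 by convention; absolute convergence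
  of the iterated integral is expressed separately.\<close>

definition frakF_converges ::
    "('k::field^2^2) measure \<Rightarrow> 'k measure \<Rightarrow> ('k^2^2 \<Rightarrow> complex) \<Rightarrow> ('k \<Rightarrow> complex) \<Rightarrow> 'k \<Rightarrow> bool" where
  "frakF_converges dk dx \<Phi> \<phi> a \<longleftrightarrow>
     (\<forall>x. integrable dk (\<lambda>k. \<Phi> (conj_unip a x k))) \<and>
     integrable dx (\<lambda>x. (LINT k|dk. \<Phi> (conj_unip a x k)) * \<phi> x)"

end

theory Submission
  imports Defs "HOL-Real_Asymp.Real_Asymp"
begin

text \<open>At a real place the average over the orthogonal group reduces the orbital integral to the integral
  of \<open>(t + i x)\<close> to the power \<open>-l\<close> against the spherical function, where \<open>t = (a + 1) / |a - 1|\<close>.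
  The connection formula removes the singularities of the spherical function, which for \<open>|Re z| < 1\<close> is
  the Fourier type integral of \<open>exp (z u / 2)\<close> against the even part of \<open>(cosh u + i x)\<close> to the power
  \<open>-1/2\<close>. Interchanging the integrals leaves an elementary kernel integral in \<open>x\<close> and an integral in \<open>u\<close> of
  \<open>(t + cosh u)\<close> to the power \<open>1/2 - l\<close>, whose expansion at \<open>t = 1\<close> is the Legendre function; both sides
  are holomorphic in \<open>z\<close> on the whole strip.

  At a finite place all functions of \<open>x\<close> depend only on \<open>max 1 |x|\<close>, a power of \<open>q\<close>. On these levels the
  spherical function obeys a two-term linear recursion with roots \<open>\<alpha>\<close>, \<open>\<beta>\<close>, \<open>\<alpha> \<beta> = 1 / q\<close>. The recursion
  has no singularities, so the level sums are continuous in \<open>z\<close>; they agree with the closed formulas for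
  \<open>\<alpha> \<noteq> \<beta>\<close>, and the remaining values of \<open>z\<close> are limits.\<close>

section \<open>The Gauss hypergeometric series\<close>

text \<open>The two summands of a spherical function have poles in \<open>z\<close> that cancel only
  in the sum. At a real place they belong to the two exponents of a hypergeometric equation at one
  singular point, and their sum is the solution regular at another one, with third parameter 1/2 and
  no poles in \<open>z\<close>. The constants of this connection come from Gauss's summation
  theorem, obtained from Beta integrals for positive parameters; hence the detour over real
  \<open>0 < w < 1\<close> and the identity theorem. A second obstacle is \<open>Legendre_P\<close>
  at \<open>t > 1\<close>: the argument \<open>(1 - t) / 2\<close> of \<open>hyp2F1\<close> may lie
  outside the unit disc, where the value is that of an unspecified continuation. The integral over
  \<open>cosh\<close>, read as a function of a complex shift \<open>s\<close> off the cut
  \<open>s \<le> -1\<close>, is an explicit continuation. It converges for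
  \<open>\<bar>Re z\<bar> < 1\<close> only in the representation of the spherical function, but on
  the whole strip in the result, which is why continuation in \<open>z\<close> is the last real
  step. At a finite place the group measure enters through the mass \<open>1 / (q + 1)\<close> of
  \<open>K0\<close>, and the field measure through the volumes of balls.\<close>

text \<open>Cauchy's estimate bounds the derivative by the local majorant of \<open>f\<close>
  itself, so dominated convergence applies to the difference quotients without any hypothesis on
  derivatives.\<close>

lemma holomorphic_on_lebesgue_integral:
  fixes f :: "complex \<Rightarrow> 'a \<Rightarrow> complex"
  assumes U: "open U"
    and hol: "\<And>x. x \<in> space M \<Longrightarrow> (\<lambda>z. f z x) holomorphic_on U"
    and meas: "\<And>z. z \<in> U \<Longrightarrow> f z \<in> borel_measurable M"
    and dom: "\<And>z0. z0 \<in> U \<Longrightarrow> \<exists>r>0. \<exists>g. integrable M g \<and>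
                (\<forall>z\<in>ball z0 r. \<forall>x\<in>space M. norm (f z x) \<le> g x)"
  shows "(\<lambda>z. LINT x|M. f z x) holomorphic_on U"
proof -
  have "\<exists>D. ((\<lambda>z. LINT x|M. f z x) has_field_derivative D) (at z0)" if z0: "z0 \<in> U" for z0
  proof -
    obtain r1 where r1: "r1 > 0" "ball z0 r1 \<subseteq> U" using U z0 by (meson openE)
    obtain r2 g where r2: "r2 > 0" and g: "integrable M g"
      and bd2: "\<And>z x. z \<in> ball z0 r2 \<Longrightarrow> x \<in> space M \<Longrightarrow> norm (f z x) \<le> g x"
      using dom[OF z0] by blast
    define r where "r = min r1 r2"
    have r: "r > 0" "ball z0 r \<subseteq> U" using r1 r2 by (auto simp: r_def)
    have bd: "\<And>z x. z \<in> ball z0 r \<Longrightarrow> x \<in> space M \<Longrightarrow> norm (f z x) \<le> g x"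
      using bd2 by (auto simp: r_def)
    have int: "integrable M (f z)" if "z \<in> ball z0 r" for z
      using bd that r by (intro Bochner_Integration.integrable_bound[OF g] meas AE_I2) (auto intro: order_trans[OF _ abs_ge_self])
    \<comment> \<open>For \<open>w\<close> within \<open>r/2\<close> of \<open>z0\<close> the disc
      of radius \<open>r/3\<close> about \<open>w\<close> stays in \<open>ball z0 r\<close>, because
      1/2 + 1/3 < 1; its radius produces the factor \<open>3 / r\<close>.\<close>
    have der_bd: "norm (deriv (\<lambda>z. f z x) w) \<le> 3 / r * g x"
      if w: "w \<in> ball z0 (r/2)" and x: "x \<in> space M" for w x
    proof -
      have sub: "cball w (r/3) \<subseteq> ball z0 r"
      proof
        fix y assume "y \<in> cball w (r/3)"
        then show "y \<in> ball z0 r" using w dist_triangle[of z0 y w] r by (auto simp: dist_commute)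
      qed
      have h: "(\<lambda>z. f z x) holomorphic_on cball w (r/3)"
        using hol[OF x] sub r by (meson holomorphic_on_subset order_trans)
      have "norm ((deriv ^^ 1) (\<lambda>z. f z x) w) \<le> fact 1 * g x / (r/3)^1"
      proof (rule Cauchy_inequality)
        show "(\<lambda>z. f z x) holomorphic_on ball w (r/3)"
          using h by (meson ball_subset_cball holomorphic_on_subset)
        show "continuous_on (cball w (r/3)) (\<lambda>z. f z x)" using h by (rule holomorphic_on_imp_continuous_on)
        show "norm (f y x) \<le> g x" if "norm (w - y) = r/3" for y
          using bd[OF _ x, of y] sub that by (auto simp: dist_norm)
      qed (use r in auto)
      then show ?thesis by (simp add: mult.commute)
    qed
    have lip: "norm (f w x - f z0 x) \<le> 3 / r * g x * norm (w - z0)"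
      if w: "w \<in> ball z0 (r/2)" and x: "x \<in> space M" for w x
    proof (rule field_differentiable_bound[where S = "ball z0 (r/2)" and f' = "deriv (\<lambda>z. f z x)"])
      show "((\<lambda>z. f z x) has_field_derivative deriv (\<lambda>z. f z x) z) (at z within ball z0 (r/2))"
        if "z \<in> ball z0 (r/2)" for z
        using hol[OF x] U r that
        by (intro DERIV_subset[OF holomorphic_derivI[OF hol[OF x] U]]) auto
    qed (use w x r der_bd in auto)
    define D where "D = (\<lambda>x. deriv (\<lambda>z. f z x) z0)"
    have "((\<lambda>z. ((LINT x|M. f z x) - (LINT x|M. f z0 x)) / (z - z0)) \<longlongrightarrow> (LINT x|M. D x)) (at z0)"
      unfolding tendsto_at_iff_sequentially comp_def
    proof (intro allI impI)
      fix X assume X: "\<forall>i. X i \<in> UNIV - {z0}" and lim: "X \<longlonglongrightarrow> z0"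
      have "eventually (\<lambda>n. X n \<in> ball z0 (r/2)) sequentially"
        using lim r by (intro topological_tendstoD) auto
      then obtain N where N: "\<And>n. n \<ge> N \<Longrightarrow> X n \<in> ball z0 (r/2)"
        by (auto simp: eventually_sequentially)
      \<comment> \<open>The finitely many terms outside the half-size ball are shifted away, so that
        the Lipschitz bound holds at every index.\<close>
      define Y where "Y = (\<lambda>n. X (n + N))"
      have Y: "Y n \<in> ball z0 (r/2)" "Y n \<noteq> z0" for n using N X by (auto simp: Y_def)
      have Yr: "Y n \<in> ball z0 r" for n using Y(1)[of n] r by auto
      have limY: "Y \<longlonglongrightarrow> z0" unfolding Y_def using lim by (rule LIMSEQ_ignore_initial_segment)
      define s where "s = (\<lambda>n x. (f (Y n) x - f z0 x) / (Y n - z0))"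
      have s_meas: "s n \<in> borel_measurable M" for n
        unfolding s_def using meas[of "Y n"] meas[OF z0] subsetD[OF r(2) Yr[of n]]
        by (intro borel_measurable_divide borel_measurable_diff) auto
      have s_lim: "(\<lambda>n. s n x) \<longlonglongrightarrow> D x" if x: "x \<in> space M" for x
      proof -
        have "((\<lambda>z. f z x) has_field_derivative D x) (at z0)"
          unfolding D_def using holomorphic_derivI[OF hol[OF x] U z0] .
        then have "((\<lambda>z. (f z x - f z0 x) / (z - z0)) \<longlongrightarrow> D x) (at z0)"
          by (simp add: has_field_derivative_iff)
        then show ?thesis using limY Y(2)
          unfolding tendsto_at_iff_sequentially comp_def s_def by blast
      qed
      have "(\<lambda>n. integral\<^sup>L M (s n)) \<longlonglongrightarrow> integral\<^sup>L M D"
      proof (rule integral_dominated_convergence[where w = "\<lambda>x. 3 / r * g x"])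
        show "D \<in> borel_measurable M" using s_meas s_lim by (rule borel_measurable_LIMSEQ_metric)
        show "integrable M (\<lambda>x. 3 / r * g x)" using g by simp
        show "AE x in M. norm (s n x) \<le> 3 / r * g x" for n
        proof (rule AE_I2)
          fix x assume x: "x \<in> space M"
          show "norm (s n x) \<le> 3 / r * g x"
            using lip[OF Y(1)[of n] x] Y(2)[of n] by (simp add: s_def norm_divide divide_le_eq)
        qed
      qed (use s_meas s_lim in auto)
      moreover have "integral\<^sup>L M (s n) = ((LINT x|M. f (Y n) x) - (LINT x|M. f z0 x)) / (Y n - z0)" for n
        unfolding s_def integral_divide_zero
        using Bochner_Integration.integral_diff[OF int[OF Yr] int[OF centre_in_ball[THEN iffD2, OF r(1)]]] by simp
      ultimately have "(\<lambda>n. ((LINT x|M. f (Y n) x) - (LINT x|M. f z0 x)) / (Y n - z0)) \<longlonglongrightarrow> (LINT x|M. D x)"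
        by simp
      then show "(\<lambda>n. ((LINT x|M. f (X n) x) - (LINT x|M. f z0 x)) / (X n - z0)) \<longlonglongrightarrow> (LINT x|M. D x)"
        unfolding Y_def by (rule LIMSEQ_offset)
    qed
    then show ?thesis by (auto simp: has_field_derivative_iff)
  qed
  then show ?thesis
    using holomorphic_on_open[OF U] by blast
qed

section \<open>Growth of the hypergeometric coefficients and holomorphy in the parameters\<close>

definition hyp_coeff :: "complex \<Rightarrow> complex \<Rightarrow> complex \<Rightarrow> nat \<Rightarrow> complex" where
  "hyp_coeff a b c n = pochhammer a n * pochhammer b n / (pochhammer c n * fact n)"

definition gauss_F :: "complex \<Rightarrow> complex \<Rightarrow> complex \<Rightarrow> complex \<Rightarrow> complex" where
  "gauss_F a b c u = (\<Sum>n. hyp_coeff a b c n * u ^ n)"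

lemma hyp2F1_series_eq: "hyp2F1_series a b c u n = hyp_coeff a b c n * u ^ n"
  by (simp add: hyp2F1_series_def hyp_coeff_def)

lemma hyp_coeff_0 [simp]: "hyp_coeff a b c 0 = 1"
  by (simp add: hyp_coeff_def)

lemma hyp_coeff_Suc:
  "hyp_coeff a b c (Suc n) = hyp_coeff a b c n * ((a + of_nat n) * (b + of_nat n) / ((c + of_nat n) * of_nat (Suc n)))"
  by (simp add: hyp_coeff_def pochhammer_Suc fact_Suc mult_ac del: of_nat_Suc)

text \<open>The ratio of consecutive coefficients tends to 1 uniformly for parameters in a disc. The
  index \<open>N\<close> depends only on \<open>R\<close> and \<open>\<rho>\<close>, as local
  uniformity in the parameters requires.\<close>

lemma hyp_coeff_geometric:
  assumes R: "R \<ge> 0" and \<rho>: "\<rho> > 1"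
  shows "\<exists>N. \<forall>n\<ge>N. \<forall>a b c. norm a \<le> R \<longrightarrow> norm b \<le> R \<longrightarrow> norm c \<le> R \<longrightarrow>
           norm (hyp_coeff a b c n) \<le> norm (hyp_coeff a b c N) * \<rho> ^ (n - N)"
proof -
  have "((\<lambda>n::nat. (R + real n)\<^sup>2 / ((real n - R) * (real n + 1))) \<longlongrightarrow> 1) at_top"
    by real_asymp
  then have "eventually (\<lambda>n::nat. (R + real n)\<^sup>2 / ((real n - R) * (real n + 1)) < \<rho>) at_top"
    using \<rho> by (rule order_tendstoD)
  moreover have "eventually (\<lambda>n::nat. real n > R) at_top"
    using filterlim_real_sequentially by (simp add: filterlim_at_top_dense)
  ultimately have "eventually (\<lambda>n::nat. (R + real n)\<^sup>2 / ((real n - R) * (real n + 1)) < \<rho> \<and> real n > R) at_top"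
    by (rule eventually_conj)
  then obtain N where N: "\<And>n. n \<ge> N \<Longrightarrow> (R + real n)\<^sup>2 / ((real n - R) * (real n + 1)) < \<rho> \<and> real n > R"
    by (auto simp: eventually_at_top_linorder)
  have stepR: "norm (hyp_coeff a b c (Suc n)) \<le> norm (hyp_coeff a b c n) * \<rho>"
    if "n \<ge> N" "norm a \<le> R" "norm b \<le> R" "norm c \<le> R" for n a b c
  proof -
    have n: "real n - R > 0" using N that by force
    have "norm ((a + of_nat n) * (b + of_nat n) / ((c + of_nat n) * of_nat (Suc n)))
      \<le> (R + real n)\<^sup>2 / ((real n - R) * (real n + 1))"
      unfolding norm_divide norm_mult power2_eq_square
    proof (rule frac_le)
      show "cmod (a + of_nat n) * cmod (b + of_nat n) \<le> (R + real n) * (R + real n)"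
        using that norm_triangle_ineq[of a "of_nat n"] norm_triangle_ineq[of b "of_nat n"] R
        by (intro mult_mono) auto
      have "real n - R \<le> cmod (c + of_nat n)"
        using that norm_diff_ineq[of "of_nat n" c] by (simp add: add.commute)
      then show "(real n - R) * (real n + 1) \<le> cmod (c + of_nat n) * cmod (of_nat (Suc n))"
        using n by (intro mult_mono) (auto simp del: of_nat_Suc simp: norm_of_nat)
    qed (use R n in auto)
    also have "\<dots> \<le> \<rho>" using N that by force
    finally show ?thesis unfolding hyp_coeff_Suc norm_mult[of "hyp_coeff a b c n"]
      by (rule mult_left_mono) auto
  qed
  show ?thesis
  proof (intro exI[of _ N] allI impI)
    fix n :: nat and a b c :: complex
    assume "N \<le> n" and *: "norm a \<le> R" "norm b \<le> R" "norm c \<le> R"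
    then show "norm (hyp_coeff a b c n) \<le> norm (hyp_coeff a b c N) * \<rho> ^ (n - N)"
    proof (induction n rule: dec_induct)
      case (step n)
      have "norm (hyp_coeff a b c (Suc n)) \<le> norm (hyp_coeff a b c n) * \<rho>"
        using step(1) * by (intro stepR) auto
      also have "\<dots> \<le> norm (hyp_coeff a b c N) * \<rho> ^ (n - N) * \<rho>"
        using step * \<rho> by (intro mult_right_mono) auto
      finally show ?case using step by (simp add: Suc_diff_le mult_ac)
    qed simp
  qed
qed

lemma summable_gauss_F:
  assumes "norm u < 1"
  shows "summable (\<lambda>n. norm (hyp_coeff a b c n * u ^ n))"
proof -
  \<comment> \<open>The reciprocal of \<open>\<rho>\<close> is the mean of 1 and
    \<open>norm u\<close>; hence \<open>\<rho> > 1\<close> and still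
    \<open>\<rho> * norm u < 1\<close>.\<close>
  define \<rho> where "\<rho> = 2 / (1 + norm u)"
  define R where "R = norm a + norm b + norm c"
  have \<rho>: "\<rho> > 1" "\<rho> * norm u < 1"
    using assms norm_ge_zero[of u] by (auto simp: \<rho>_def divide_simps simp del: norm_ge_zero)
  obtain N where N: "\<And>n. n \<ge> N \<Longrightarrow> norm (hyp_coeff a b c n) \<le> norm (hyp_coeff a b c N) * \<rho> ^ (n - N)"
  proof -
    have "R \<ge> 0" "norm a \<le> R" "norm b \<le> R" "norm c \<le> R" by (auto simp: R_def)
    then show thesis using hyp_coeff_geometric[of R \<rho>] \<rho> that by blast
  qed
  have "summable (\<lambda>n. norm (hyp_coeff a b c N) * inverse \<rho> ^ N * (\<rho> * norm u) ^ n)"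
    using \<rho> by (intro summable_mult summable_geometric) auto
  then show ?thesis
  proof (rule summable_comparison_test'[where N = N])
    fix n assume n: "n \<ge> N"
    have "norm (hyp_coeff a b c n) * norm u ^ n \<le> norm (hyp_coeff a b c N) * \<rho> ^ (n - N) * norm u ^ n"
      using N[OF n] by (intro mult_right_mono) auto
    also have "\<dots> = norm (hyp_coeff a b c N) * inverse \<rho> ^ N * (\<rho> * norm u) ^ n"
      using n \<rho> by (simp add: power_diff field_simps)
    finally show "norm (norm (hyp_coeff a b c n * u ^ n)) \<le> norm (hyp_coeff a b c N) * inverse \<rho> ^ N * (\<rho> * norm u) ^ n"
      by (simp add: norm_mult norm_power)
  qed
qed

lemma hyp2F1_eq_gauss_F:
  assumes "norm u < 1"
  shows "hyp2F1 a b c u = gauss_F a b c u"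
proof -
  have "summable (hyp2F1_series a b c u)"
    using summable_norm_cancel[OF summable_gauss_F[OF assms, of a b c]]
    by (simp add: hyp2F1_series_eq[abs_def])
  then show ?thesis by (simp add: hyp2F1_def gauss_F_def hyp2F1_series_eq[abs_def])
qed

text \<open>The partial sums are holomorphic in the parameters, and the uniform geometric bound
  makes them converge locally uniformly.\<close>

lemma gauss_F_holomorphic_params:
  assumes U: "open U" and A: "A holomorphic_on U" "B holomorphic_on U" "C holomorphic_on U"
    and C: "\<And>w. w \<in> U \<Longrightarrow> C w \<notin> \<int>\<^sub>\<le>\<^sub>0" and u: "norm u < 1"
  shows "(\<lambda>w. gauss_F (A w) (B w) (C w) u) holomorphic_on U"
proof -
  define T where "T = (\<lambda>n w. hyp_coeff (A w) (B w) (C w) n)"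
  have holT: "T n holomorphic_on U" for n
  proof -
    have "pochhammer (C w) n \<noteq> 0" if "w \<in> U" for w
      using C[OF that] by (auto simp: pochhammer_eq_0_iff)
    then show ?thesis unfolding T_def hyp_coeff_def
      by (intro holomorphic_intros A) (auto simp: pochhammer_prod intro!: holomorphic_intros A)
  qed
  define \<rho> where "\<rho> = 2 / (1 + norm u)"
  have \<rho>: "\<rho> > 1" "\<rho> * norm u < 1"
    using u norm_ge_zero[of u] by (auto simp: \<rho>_def divide_simps simp del: norm_ge_zero)
  show ?thesis
  proof (rule holomorphic_uniform_sequence[OF U, where f = "\<lambda>n w. \<Sum>i<n. T i w * u ^ i"])
    show "(\<lambda>w. \<Sum>i<n. T i w * u ^ i) holomorphic_on U" for n
      by (intro holomorphic_intros holT)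
  next
    fix w assume "w \<in> U"
    then obtain d where d: "d > 0" "cball w d \<subseteq> U" using U by (meson open_contains_cball)
    have bnd: "\<exists>K. \<forall>v\<in>cball w d. norm (f v) \<le> K" if "f holomorphic_on U" for f :: "complex \<Rightarrow> complex"
    proof -
      have "continuous_on (cball w d) f"
        using that d by (meson holomorphic_on_imp_continuous_on holomorphic_on_subset)
      then have "compact (f ` cball w d)" by (intro compact_continuous_image) auto
      then show ?thesis using compact_imp_bounded by (fastforce simp: bounded_iff)
    qed
    obtain KA KB KC where K: "\<And>v. v \<in> cball w d \<Longrightarrow> norm (A v) \<le> KA" "\<And>v. v \<in> cball w d \<Longrightarrow> norm (B v) \<le> KB"
      "\<And>v. v \<in> cball w d \<Longrightarrow> norm (C v) \<le> KC" using bnd A by metis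
    define R where "R = \<bar>KA\<bar> + \<bar>KB\<bar> + \<bar>KC\<bar>"
    have KR: "norm (A v) \<le> R" "norm (B v) \<le> R" "norm (C v) \<le> R" if "v \<in> cball w d" for v
      using K[OF that] by (auto simp: R_def)
    have "R \<ge> 0" by (auto simp: R_def)
    then obtain N where N: "\<And>n a b c. n \<ge> N \<Longrightarrow> norm a \<le> R \<Longrightarrow> norm b \<le> R \<Longrightarrow> norm c \<le> R \<Longrightarrow>
        norm (hyp_coeff a b c n) \<le> norm (hyp_coeff a b c N) * \<rho> ^ (n - N)"
      using hyp_coeff_geometric[of R \<rho>] \<rho> by blast
    obtain K where K: "\<And>v. v \<in> cball w d \<Longrightarrow> norm (T N v) \<le> K" using bnd[OF holT] by metis
    have "uniform_limit (cball w d) (\<lambda>n v. \<Sum>i<n. T i v * u ^ i) (\<lambda>v. \<Sum>i. T i v * u ^ i) sequentially"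
    proof (rule Weierstrass_m_test_ev)
      show "\<forall>\<^sub>F n in sequentially. \<forall>v\<in>cball w d. norm (T n v * u ^ n) \<le> K * inverse \<rho> ^ N * (\<rho> * norm u) ^ n"
        unfolding eventually_sequentially
      proof (intro exI[of _ N] allI impI ballI)
        fix n v assume n: "N \<le> n" and v: "v \<in> cball w d"
        have "norm (T n v) * norm u ^ n \<le> (norm (T N v) * \<rho> ^ (n - N)) * norm u ^ n"
          unfolding T_def using N[OF n] KR[OF v] by (intro mult_right_mono) auto
        also have "\<dots> \<le> (K * \<rho> ^ (n - N)) * norm u ^ n"
          using K[OF v] \<rho> by (intro mult_right_mono) auto
        also have "\<dots> = K * inverse \<rho> ^ N * (\<rho> * norm u) ^ n"
          using n \<rho> by (simp add: power_diff field_simps)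
        finally show "norm (T n v * u ^ n) \<le> K * inverse \<rho> ^ N * (\<rho> * norm u) ^ n"
          by (simp add: norm_mult norm_power)
      qed
      show "summable (\<lambda>n. K * inverse \<rho> ^ N * (\<rho> * norm u) ^ n)"
        using \<rho> by (intro summable_mult summable_geometric) auto
    qed
    then show "\<exists>d>0. cball w d \<subseteq> U \<and>
        uniform_limit (cball w d) (\<lambda>n v. \<Sum>i<n. T i v * u ^ i) (\<lambda>w. gauss_F (A w) (B w) (C w) u) sequentially"
      using d unfolding gauss_F_def T_def by (intro exI[of _ d]) simp
  qed
qed

section \<open>The hypergeometric differential equation\<close>

definition hyp_fps :: "complex \<Rightarrow> complex \<Rightarrow> complex \<Rightarrow> complex fps" where
  "hyp_fps a b c = Abs_fps (hyp_coeff a b c)"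

lemma hyp_fps_conv_radius: "fps_conv_radius (hyp_fps a b c) \<ge> 1"
  unfolding fps_conv_radius_def hyp_fps_def
proof (rule conv_radius_geI_ex)
  fix r :: real assume "r > 0" "ereal r < 1"
  then show "\<exists>z. norm z = r \<and> summable (\<lambda>n. fps_nth (Abs_fps (hyp_coeff a b c)) n * z ^ n)"
    using summable_norm_cancel[OF summable_gauss_F[of "of_real r" a b c]]
    by (intro exI[of _ "of_real r"]) auto
qed

lemma gauss_F_eq_eval_fps: "gauss_F a b c = eval_fps (hyp_fps a b c)"
  by (auto simp: gauss_F_def eval_fps_def hyp_fps_def)

lemma gauss_F_0 [simp]: "gauss_F a b c 0 = 1"
  by (simp add: gauss_F_eq_eval_fps eval_fps_at_0 hyp_fps_def)

lemma gauss_F_holomorphic: "gauss_F a b c holomorphic_on ball 0 1"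
proof -
  have sub: "ball 0 1 \<subseteq> eball (0::complex) (fps_conv_radius (hyp_fps a b c))"
    using hyp_fps_conv_radius[of a b c] by (auto simp: less_le_trans[of _ 1])
  then show ?thesis
    unfolding gauss_F_eq_eval_fps by (intro holomorphic_on_eval_fps)
qed

text \<open>On coefficients the hypergeometric operator is a recursion of order one. Read in one
  direction it shows that the Gauss series solves the equation, in the other that a power series
  solution is determined by its constant term.\<close>

lemma hyp_ode_fps_nth:
  fixes H :: "complex fps"
  shows "fps_nth (fps_X * (1 - fps_X) * fps_deriv (fps_deriv H)
    + (fps_const c - fps_const (a + b + 1) * fps_X) * fps_deriv H - fps_const (a * b) * H) n
    = of_nat (Suc n) * (c + of_nat n) * fps_nth H (Suc n) - (a + of_nat n) * (b + of_nat n) * fps_nth H n"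
proof -
  have X: "fps_X * (1 - fps_X) * fps_deriv (fps_deriv H)
    + (fps_const c - fps_const (a + b + 1) * fps_X) * fps_deriv H - fps_const (a * b) * H
    = fps_X * fps_deriv (fps_deriv H) - fps_X * (fps_X * fps_deriv (fps_deriv H))
      + fps_const c * fps_deriv H - fps_const (a + b + 1) * (fps_X * fps_deriv H) - fps_const (a * b) * H"
    by (simp add: algebra_simps del: fps_const_add fps_const_mult)
  \<comment> \<open>The factors \<open>fps_X\<close> shift the index by one and by two, so the
    coefficients 0 and 1 are separate cases.\<close>
  consider "n = 0" | "n = 1" | m where "n = Suc (Suc m)"
    by (metis One_nat_def not0_implies_Suc)
  then show ?thesis
  proof cases
    case 3
    have "fps_nth (fps_X * F) n = fps_nth F (Suc m)" "fps_nth (fps_X * (fps_X * F)) n = fps_nth F m" for F :: "complex fps"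
      using 3 by simp_all
    then show ?thesis unfolding X fps_add_nth fps_sub_nth fps_mult_left_const_nth fps_deriv_nth
      by (simp add: 3) (simp add: algebra_simps)
    next
    case 1
    then show ?thesis unfolding X fps_add_nth fps_sub_nth fps_mult_left_const_nth fps_deriv_nth
      by simp
  next
    case 2
    have "fps_nth (fps_X * F) n = fps_nth F 0" "fps_nth (fps_X * (fps_X * F)) n = 0" for F :: "complex fps"
      using 2 by simp_all
    then show ?thesis unfolding X fps_add_nth fps_sub_nth fps_mult_left_const_nth fps_deriv_nth
      by (simp add: 2) (simp add: algebra_simps)
  qed
qed

lemma gauss_F_ode:
  assumes c: "c \<notin> \<int>\<^sub>\<le>\<^sub>0"
  shows "\<exists>F1 F2. (\<forall>u\<in>ball 0 1. (gauss_F a b c has_field_derivative F1 u) (at u)) \<and>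
     (\<forall>u\<in>ball 0 1. (F1 has_field_derivative F2 u) (at u)) \<and>
     (\<forall>u\<in>ball 0 1. u * (1 - u) * F2 u + (c - (a + b + 1) * u) * F1 u - a * b * gauss_F a b c u = 0)"
proof -
  let ?H = "hyp_fps a b c"
  have r1: "fps_conv_radius (fps_deriv ?H) \<ge> 1" "fps_conv_radius (fps_deriv (fps_deriv ?H)) \<ge> 1"
    using hyp_fps_conv_radius[of a b c] fps_conv_radius_deriv by (auto intro: order_trans)
  have "fps_X * (1 - fps_X) * fps_deriv (fps_deriv ?H)
    + (fps_const c - fps_const (a + b + 1) * fps_X) * fps_deriv ?H - fps_const (a * b) * ?H = 0" (is "?L = 0")
  proof (rule fps_ext)
    fix n
    have "c + of_nat n \<noteq> 0"
      using c by (metis add.commute add_eq_0_iff minus_of_nat_in_nonpos_Ints)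
    then show "fps_nth ?L n = fps_nth 0 n"
      unfolding hyp_ode_fps_nth by (simp add: hyp_fps_def hyp_coeff_Suc del: of_nat_Suc)
  qed
  \<comment> \<open>Both sides are now sums of products, and only these two operations have to be
    carried through evaluation, together with their radii of convergence.\<close>
  then have L0: "fps_X * fps_deriv (fps_deriv ?H) + (fps_const c * fps_deriv ?H) =
      fps_X * (fps_X * fps_deriv (fps_deriv ?H)) + fps_const (a + b + 1) * (fps_X * fps_deriv ?H) + fps_const (a * b) * ?H"
    by (simp add: algebra_simps del: fps_const_add fps_const_mult)
  have ode: "u * (1 - u) * eval_fps (fps_deriv (fps_deriv ?H)) u
     + (c - (a + b + 1) * u) * eval_fps (fps_deriv ?H) u - a * b * eval_fps ?H u = 0"
    if u: "u \<in> ball 0 1" for u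
  proof -
    have lt: "ereal (norm u) < fps_conv_radius G" if "fps_conv_radius G \<ge> 1" for G :: "complex fps"
      using that(1) u by (intro less_le_trans[of _ 1 "fps_conv_radius G"]) auto
    have mx: "fps_conv_radius (fps_X * G) \<ge> 1" if "fps_conv_radius G \<ge> 1" for G :: "complex fps"
      using that fps_conv_radius_mult[of fps_X G] by (auto intro: order_trans[rotated])
    have mc: "fps_conv_radius (fps_const k * G) \<ge> 1" if "fps_conv_radius G \<ge> 1" for G :: "complex fps" and k
      using that fps_conv_radius_mult[of "fps_const k" G] by (auto intro: order_trans[rotated])
    have ma: "fps_conv_radius (F + G) \<ge> 1" if "fps_conv_radius F \<ge> 1" "fps_conv_radius G \<ge> 1" for F G :: "complex fps"
      using that fps_conv_radius_add[of F G] by (auto intro: order_trans[rotated])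
    note R = hyp_fps_conv_radius[of a b c] r1
    have "eval_fps (fps_X * fps_deriv (fps_deriv ?H) + (fps_const c * fps_deriv ?H)) u =
       u * eval_fps (fps_deriv (fps_deriv ?H)) u + c * eval_fps (fps_deriv ?H) u"
      by (simp add: eval_fps_add eval_fps_mult lt mx mc R)
    moreover have "eval_fps (fps_X * (fps_X * fps_deriv (fps_deriv ?H)) + fps_const (a + b + 1) * (fps_X * fps_deriv ?H)
         + fps_const (a * b) * ?H) u =
       u * (u * eval_fps (fps_deriv (fps_deriv ?H)) u) + (a + b + 1) * (u * eval_fps (fps_deriv ?H) u)
         + a * b * eval_fps ?H u"
      by (simp add: eval_fps_add eval_fps_mult lt mx mc ma R del: fps_const_add fps_const_mult)
    ultimately show ?thesis using L0 by (simp add: algebra_simps)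
  qed
  have der: "(eval_fps G has_field_derivative eval_fps (fps_deriv G) u) (at u)"
    if "u \<in> ball 0 1" "fps_conv_radius G \<ge> 1" for u and G :: "complex fps"
    using that by (intro has_field_derivative_eval_fps less_le_trans[of _ 1 "fps_conv_radius G"]) auto
  show ?thesis
    unfolding gauss_F_eq_eval_fps
    by (intro exI[of _ "eval_fps (fps_deriv ?H)"] exI[of _ "eval_fps (fps_deriv (fps_deriv ?H))"] conjI ballI
        ode der r1 hyp_fps_conv_radius)
qed

text \<open>The exponents at 0 are 0 and \<open>1 - c\<close>. As \<open>c + n\<close> never
  vanishes, the coefficient recursion can be solved at every step, so the holomorphic solutions form
  a line; analytic continuation carries the equality from a neighbourhood of 0 to the ball.\<close>

lemma gauss_F_unique:
  assumes r: "0 < r" "r \<le> 1" and c: "c \<notin> \<int>\<^sub>\<le>\<^sub>0"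
    and f1: "\<And>u. u \<in> ball 0 r \<Longrightarrow> (f has_field_derivative f1 u) (at u)"
    and f2: "\<And>u. u \<in> ball 0 r \<Longrightarrow> (f1 has_field_derivative f2 u) (at u)"
    and ode: "\<And>u. u \<in> ball 0 r \<Longrightarrow> u * (1 - u) * f2 u + (c - (a + b + 1) * u) * f1 u - a * b * f u = 0"
    and u: "u \<in> ball 0 r"
  shows "f u = f 0 * gauss_F a b c u"
proof -
  have hol: "f holomorphic_on ball 0 r" using f1 holomorphic_on_open[of "ball 0 r" f] by blast
  then have an: "f analytic_on {0}" using r by (auto simp: analytic_at intro!: exI[of _ "ball 0 r"])
  define G where "G = fps_expansion f 0"
  have G: "f has_fps_expansion G" unfolding G_def using an by (rule analytic_at_imp_has_fps_expansion_0)
  have ev: "eventually (\<lambda>u. u \<in> ball 0 r) (nhds (0::complex))"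
    using r by (intro eventually_nhds_in_open) auto
  have G1: "f1 has_fps_expansion fps_deriv G"
    using has_fps_expansion_deriv[OF G]
    by (rule has_fps_expansion_cong[THEN iffD1, rotated 2]) (use ev f1 in \<open>auto elim!: eventually_mono intro!: DERIV_imp_deriv\<close>)
  have G2: "f2 has_fps_expansion fps_deriv (fps_deriv G)"
    using has_fps_expansion_deriv[OF G1]
    by (rule has_fps_expansion_cong[THEN iffD1, rotated 2]) (use ev f2 in \<open>auto elim!: eventually_mono intro!: DERIV_imp_deriv\<close>)
  have "(\<lambda>u. u * (1 - u) * f2 u + (c - (a + b + 1) * u) * f1 u - a * b * f u) has_fps_expansion
     (fps_X * (1 - fps_X) * fps_deriv (fps_deriv G)
    + (fps_const c - fps_const (a + b + 1) * fps_X) * fps_deriv G - fps_const (a * b) * G)"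
    by (intro fps_expansion_intros G G1 G2)
  then have "(\<lambda>u. 0) has_fps_expansion (fps_X * (1 - fps_X) * fps_deriv (fps_deriv G)
    + (fps_const c - fps_const (a + b + 1) * fps_X) * fps_deriv G - fps_const (a * b) * G)"
    by (rule has_fps_expansion_cong[THEN iffD1, rotated 2]) (use ev ode in \<open>auto elim!: eventually_mono\<close>)
  then have L0: "fps_X * (1 - fps_X) * fps_deriv (fps_deriv G)
    + (fps_const c - fps_const (a + b + 1) * fps_X) * fps_deriv G - fps_const (a * b) * G = 0"
    using has_fps_expansion_0 fps_expansion_unique_complex by blast
  have rec: "fps_nth G n = f 0 * hyp_coeff a b c n" for n
  proof (induction n)
    case 0
    then show ?case using G by (simp add: has_fps_expansion_imp_0_eq_fps_nth_0)
  next
    case (Suc n)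
    have ne: "c + of_nat n \<noteq> 0"
      using c by (metis add.commute add_eq_0_iff minus_of_nat_in_nonpos_Ints)
    have "of_nat (Suc n) * (c + of_nat n) * fps_nth G (Suc n) = (a + of_nat n) * (b + of_nat n) * fps_nth G n"
      using hyp_ode_fps_nth[where H = G and c = c and a = a and b = b and n = n] L0 by simp
    moreover have "of_nat (Suc n) \<noteq> (0 :: complex)" by (simp del: of_nat_Suc)
    ultimately have "fps_nth G (Suc n) = fps_nth G n * ((a + of_nat n) * (b + of_nat n) / ((c + of_nat n) * of_nat (Suc n)))"
      using ne unfolding times_divide_eq_right
      by (subst eq_divide_eq) (simp add: mult_ac del: of_nat_Suc)
    then show ?case using Suc by (simp add: hyp_coeff_Suc del: of_nat_Suc)
  qed
  then have "G = fps_const (f 0) * hyp_fps a b c"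
    by (intro fps_ext) (simp add: hyp_fps_def)
  moreover have "(\<lambda>u. f 0 * gauss_F a b c u) has_fps_expansion fps_const (f 0) * hyp_fps a b c"
    unfolding gauss_F_eq_eval_fps using hyp_fps_conv_radius[of a b c]
    by (intro fps_expansion_intros eval_fps_has_fps_expansion less_le_trans[of 0 1 "fps_conv_radius (hyp_fps a b c)"]) auto
  ultimately have "(\<lambda>u. f 0 * gauss_F a b c u) has_fps_expansion G" by simp
  then have "eventually (\<lambda>u. f u = f 0 * gauss_F a b c u) (nhds 0)"
    using G unfolding has_fps_expansion_def by (auto elim: eventually_elim2)
  then obtain S where S: "open S" "0 \<in> S" "\<And>u. u \<in> S \<Longrightarrow> f u = f 0 * gauss_F a b c u"
    by (auto simp: eventually_nhds)
  show ?thesis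
  proof (rule analytic_continuation_open[of "S \<inter> ball 0 r" "ball 0 r" f "\<lambda>u. f 0 * gauss_F a b c u"])
    show "(\<lambda>u. f 0 * gauss_F a b c u) holomorphic_on ball 0 r"
      using r by (intro holomorphic_intros holomorphic_on_subset[OF gauss_F_holomorphic]) auto
    show "S \<inter> ball 0 r \<noteq> {}" using S r by auto
    show "open (S \<inter> ball 0 r)" using S(1) by auto
    show "f z = f 0 * gauss_F a b c z" if "z \<in> S \<inter> ball 0 r" for z using S(3) that by blast
  qed (use u hol in auto)
qed

text \<open>The derivatives are explicit functions, so that a transformed solution is verified by
  the chain rule and pure algebra.\<close>

definition hyp_ode ::
    "complex \<Rightarrow> complex \<Rightarrow> complex \<Rightarrow> complex set \<Rightarrow> (complex \<Rightarrow> complex) \<Rightarrow> (complex \<Rightarrow> complex) \<Rightarrow> (complex \<Rightarrow> complex) \<Rightarrow> bool" where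
  "hyp_ode a b c S f f1 f2 \<longleftrightarrow> (\<forall>u\<in>S. (f has_field_derivative f1 u) (at u) \<and> (f1 has_field_derivative f2 u) (at u) \<and>
     u * (1 - u) * f2 u + (c - (a + b + 1) * u) * f1 u - a * b * f u = 0)"

lemma hyp_odeD:
  assumes "hyp_ode a b c S f f1 f2" "u \<in> S"
  shows "(f has_field_derivative f1 u) (at u)" "(f1 has_field_derivative f2 u) (at u)"
    "u * (1 - u) * f2 u + (c - (a + b + 1) * u) * f1 u - a * b * f u = 0"
  using assms by (auto simp: hyp_ode_def)

lemma hyp_ode_subset: "hyp_ode a b c S f f1 f2 \<Longrightarrow> T \<subseteq> S \<Longrightarrow> hyp_ode a b c T f f1 f2"
  by (auto simp: hyp_ode_def)

lemma gauss_F_hyp_ode: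
  assumes "c \<notin> \<int>\<^sub>\<le>\<^sub>0"
  obtains F1 F2 where "hyp_ode a b c (ball 0 1) (gauss_F a b c) F1 F2"
  using gauss_F_ode[OF assms, of a b] unfolding hyp_ode_def by blast

text \<open>The substitution \<open>1 - u\<close> exchanges the singular points 0 and 1 and replaces
  \<open>c\<close> by \<open>a + b + 1 - c\<close>.\<close>

lemma hyp_ode_reflect:
  assumes "hyp_ode a b (a + b + 1 - c) S f f1 f2"
  shows "hyp_ode a b c {u. 1 - u \<in> S} (\<lambda>u. f (1 - u)) (\<lambda>u. - f1 (1 - u)) (\<lambda>u. f2 (1 - u))"
  unfolding hyp_ode_def
proof (intro ballI conjI)
  fix u assume u: "u \<in> {u. 1 - u \<in> S}"
  then have v: "1 - u \<in> S" by simp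
  have m: "((\<lambda>u::complex. 1 - u) has_field_derivative - 1) (at u)" by (auto intro!: derivative_eq_intros)
  show "((\<lambda>u. f (1 - u)) has_field_derivative - f1 (1 - u)) (at u)"
    using DERIV_chain2[OF hyp_odeD(1)[OF assms v] m] by simp
  show "((\<lambda>u. - f1 (1 - u)) has_field_derivative f2 (1 - u)) (at u)"
    using DERIV_minus[OF DERIV_chain2[OF hyp_odeD(2)[OF assms v] m]] by simp
  show "u * (1 - u) * f2 (1 - u) + (c - (a + b + 1) * u) * - f1 (1 - u) - a * b * f (1 - u) = 0"
    using hyp_odeD(3)[OF assms v] by (simp add: algebra_simps)
qed

text \<open>Multiplication by the power \<open>c - a - b\<close> of \<open>1 - u\<close> exchanges
  the two exponents at the point 1.\<close>

lemma hyp_ode_euler: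
  assumes F: "hyp_ode (c - a) (c - b) c S f f1 f2" and slit: "\<And>u. u \<in> S \<Longrightarrow> 1 - u \<notin> \<real>\<^sub>\<le>\<^sub>0"
    and \<kappa>: "\<kappa> = c - a - b"
  shows "hyp_ode a b c S (\<lambda>u. (1 - u) powr \<kappa> * f u)
     (\<lambda>u. (1 - u) powr \<kappa> * (f1 u - \<kappa> * inverse (1 - u) * f u))
     (\<lambda>u. (1 - u) powr \<kappa> * (f2 u - 2 * \<kappa> * inverse (1 - u) * f1 u + \<kappa> * (\<kappa> - 1) * (inverse (1 - u))\<^sup>2 * f u))"
  unfolding hyp_ode_def
proof (intro ballI conjI)
  fix u assume u: "u \<in> S"
  note sl = slit[OF u] and F1 = hyp_odeD(1)[OF F u] and F2 = hyp_odeD(2)[OF F u] and ode = hyp_odeD(3)[OF F u]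
  have ne: "1 - u \<noteq> 0" using sl by force
  have P: "((\<lambda>u. (1 - u) powr \<kappa>) has_field_derivative - \<kappa> * inverse (1 - u) * (1 - u) powr \<kappa>) (at u)"
    using sl ne by (auto intro!: derivative_eq_intros simp: powr_diff field_simps)
  have I: "((\<lambda>u. inverse (1 - u)) has_field_derivative (inverse (1 - u))\<^sup>2) (at u)"
    using ne by (auto intro!: derivative_eq_intros simp: power2_eq_square)
  show "((\<lambda>u. (1 - u) powr \<kappa> * f u) has_field_derivative (1 - u) powr \<kappa> * (f1 u - \<kappa> * inverse (1 - u) * f u)) (at u)"
    by (rule DERIV_cong[OF DERIV_mult[OF P F1]]) (simp add: algebra_simps)
  show "((\<lambda>u. (1 - u) powr \<kappa> * (f1 u - \<kappa> * inverse (1 - u) * f u)) has_field_derivative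
     (1 - u) powr \<kappa> * (f2 u - 2 * \<kappa> * inverse (1 - u) * f1 u + \<kappa> * (\<kappa> - 1) * (inverse (1 - u))\<^sup>2 * f u)) (at u)"
    by (rule DERIV_cong[OF DERIV_mult[OF P DERIV_diff[OF F2 DERIV_mult[OF DERIV_cmult[OF I, of \<kappa>] F1]]]])
       (simp add: algebra_simps power2_eq_square)
  \<comment> \<open>With the inverse as an atom the equation is a polynomial identity modulo
    \<open>(1 - u) * q = 1\<close>; the last summand below is the explicit multiple of that
    relation.\<close>
  define q where "q = inverse (1 - u)"
  have q: "(1 - u) * q = 1" using ne by (simp add: q_def)
  have "u * (1 - u) * (f2 u - 2 * \<kappa> * q * f1 u + \<kappa> * (\<kappa> - 1) * q\<^sup>2 * f u)
      + (c - (a + b + 1) * u) * (f1 u - \<kappa> * q * f u) - a * b * f u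
    = (u * (1 - u) * f2 u + (c - ((c - a) + (c - b) + 1) * u) * f1 u - (c - a) * (c - b) * f u)
      + ((1 - u) * q - 1) * (- 2 * \<kappa> * u * f1 u + \<kappa> * (\<kappa> - 1) * u * q * f u - \<kappa> * c * f u)"
    by (simp add: algebra_simps power2_eq_square \<kappa>)
  then have 0: "u * (1 - u) * (f2 u - 2 * \<kappa> * q * f1 u + \<kappa> * (\<kappa> - 1) * q\<^sup>2 * f u)
      + (c - (a + b + 1) * u) * (f1 u - \<kappa> * q * f u) - a * b * f u = 0"
    using ode q by simp
  have "u * (1 - u) * (P * X) + Y * (P * Z) - a * b * (P * W) = P * (u * (1 - u) * X + Y * Z - a * b * W)" for P X Y Z W
    by (simp add: algebra_simps)
  then show "u * (1 - u) * ((1 - u) powr \<kappa> * (f2 u - 2 * \<kappa> * inverse (1 - u) * f1 u + \<kappa> * (\<kappa> - 1) * (inverse (1 - u))\<^sup>2 * f u))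
      + (c - (a + b + 1) * u) * ((1 - u) powr \<kappa> * (f1 u - \<kappa> * inverse (1 - u) * f u))
      - a * b * ((1 - u) powr \<kappa> * f u) = 0"
    using 0 unfolding q_def by (metis mult_zero_right)
qed

lemma slit_ball: "u \<in> ball 0 1 \<Longrightarrow> 1 - u \<notin> \<real>\<^sub>\<le>\<^sub>0" for u :: complex
  using complex_Re_le_cmod[of u] by (auto simp: complex_nonpos_Reals_iff)

text \<open>Both sides solve the same equation, are holomorphic at 0 and take the value 1
  there.\<close>

lemma gauss_F_euler:
  assumes c: "c \<notin> \<int>\<^sub>\<le>\<^sub>0" and u: "norm u < 1"
  shows "gauss_F a b c u = (1 - u) powr (c - a - b) * gauss_F (c - a) (c - b) c u"
proof -
  obtain F1 F2 where F: "hyp_ode (c - a) (c - b) c (ball 0 1) (gauss_F (c - a) (c - b) c) F1 F2"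
    using gauss_F_hyp_ode[OF c] .
  note E = hyp_odeD[OF hyp_ode_euler[OF F slit_ball refl]]
  show ?thesis
    using gauss_F_unique[OF _ _ c E, of 1 u] u by simp
qed

text \<open>Abel's identity: the Wronskian satisfies a first order equation whose coefficient has
  the partial fractions \<open>d / (1 - u) - c / u\<close>, and the two powers are the integrating
  factor.\<close>

lemma hyp_ode_wronskian:
  assumes S: "open S" "convex S" and slit: "\<And>u. u \<in> S \<Longrightarrow> u \<notin> \<real>\<^sub>\<le>\<^sub>0 \<and> 1 - u \<notin> \<real>\<^sub>\<le>\<^sub>0"
    and f: "hyp_ode a b c S f f1 f2" and g: "hyp_ode a b c S g g1 g2"
  shows "\<exists>k. \<forall>u\<in>S. u powr c * (1 - u) powr (a + b + 1 - c) * (f u * g1 u - f1 u * g u) = k"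
proof (rule has_field_derivative_zero_constant[OF S(2)])
  fix u assume u: "u \<in> S"
  note sl = slit[OF u]
  have ne: "u \<noteq> 0" "1 - u \<noteq> 0" using sl by force+
  define d where "d = a + b + 1 - c"
  define p q where "p = inverse u" and "q = inverse (1 - u)"
  have pq: "u * p = 1" "(1 - u) * q = 1" using ne by (auto simp: p_def q_def)
  have P: "((\<lambda>u. u powr c) has_field_derivative c * p * u powr c) (at u)"
    using sl ne by (auto intro!: derivative_eq_intros simp: powr_diff field_simps p_def)
  have Q: "((\<lambda>u. (1 - u) powr d) has_field_derivative - d * q * (1 - u) powr d) (at u)"
    using sl ne by (auto intro!: derivative_eq_intros simp: powr_diff field_simps q_def)
  have W: "((\<lambda>u. f u * g1 u - f1 u * g u) has_field_derivative f u * g2 u - f2 u * g u) (at u)"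
    by (rule DERIV_cong[OF DERIV_diff[OF DERIV_mult[OF hyp_odeD(1)[OF f u] hyp_odeD(2)[OF g u]]
          DERIV_mult[OF hyp_odeD(2)[OF f u] hyp_odeD(1)[OF g u]]]]) (simp add: algebra_simps)
  have "u * (1 - u) * (f u * g2 u - f2 u * g u) = - (c - (a + b + 1) * u) * (f u * g1 u - f1 u * g u)
     + f u * (u * (1 - u) * g2 u + (c - (a + b + 1) * u) * g1 u - a * b * g u)
     - g u * (u * (1 - u) * f2 u + (c - (a + b + 1) * u) * f1 u - a * b * f u)"
    by (simp add: algebra_simps)
  then have "u * (1 - u) * (f u * g2 u - f2 u * g u) = - (c - (a + b + 1) * u) * (f u * g1 u - f1 u * g u)"
    by (simp only: hyp_odeD(3)[OF f u] hyp_odeD(3)[OF g u] mult_zero_right add_0_right diff_zero)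
  moreover have "p * q * (u * (1 - u) * X) = X" for X using pq by (simp add: mult_ac)
  ultimately have "f u * g2 u - f2 u * g u = p * q * (- (c - (a + b + 1) * u) * (f u * g1 u - f1 u * g u))"
    by metis
  also have "p * q * (- (c - (a + b + 1) * u)) = d * q - c * p"
  proof -
    have eq: "c - (a + b + 1) * u = c * (1 - u) - d * u" by (simp add: d_def algebra_simps)
    have "p * q * (- (c - (a + b + 1) * u)) = d * q * (u * p) - c * p * ((1 - u) * q)"
      unfolding eq by (simp add: algebra_simps)
    then show ?thesis using pq by simp
  qed
  then have "p * q * (- (c - (a + b + 1) * u) * (f u * g1 u - f1 u * g u)) = (d * q - c * p) * (f u * g1 u - f1 u * g u)"
    by (metis mult.assoc)
  finally have W': "f u * g2 u - f2 u * g u = (d * q - c * p) * (f u * g1 u - f1 u * g u)" .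
  have "((\<lambda>u. u powr c * (1 - u) powr d * (f u * g1 u - f1 u * g u)) has_field_derivative 0) (at u)"
    by (rule DERIV_cong[OF DERIV_mult[OF DERIV_mult[OF P Q] W]]) (simp add: W' algebra_simps)
  then show "((\<lambda>u. u powr c * (1 - u) powr (a + b + 1 - c) * (f u * g1 u - f1 u * g u)) has_field_derivative 0) (at u within S)"
    unfolding d_def by (rule has_field_derivative_at_within)
qed

text \<open>The right-hand side is another solution of the equation of \<open>gauss_F a b c\<close>
  with value 1 at 0. The radius 1/2 keeps \<open>u / (u - 1)\<close> in the unit disc.\<close>

lemma gauss_F_pfaff:
  assumes c: "c \<notin> \<int>\<^sub>\<le>\<^sub>0" and u: "norm u < 1 / 2"
  shows "gauss_F a b c u = (1 - u) powr (- a) * gauss_F a (c - b) c (u / (u - 1))"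
proof -
  obtain F1 F2 where F1: "\<And>u. u \<in> ball 0 1 \<Longrightarrow> (gauss_F a (c - b) c has_field_derivative F1 u) (at u)"
    and F2: "\<And>u. u \<in> ball 0 1 \<Longrightarrow> (F1 has_field_derivative F2 u) (at u)"
    and ode: "\<And>u. u \<in> ball 0 1 \<Longrightarrow> u * (1 - u) * F2 u + (c - (a + (c - b) + 1) * u) * F1 u
        - a * (c - b) * gauss_F a (c - b) c u = 0"
    using gauss_F_ode[OF c, of a "c - b"] by blast
  let ?F = "gauss_F a (c - b) c"
  \<comment> \<open>The inner argument equals \<open>1 - q u\<close> with
    \<open>q u = inverse (1 - u)\<close>, so all derivatives are polynomials in \<open>q u\<close>
    and values of \<open>?F\<close>, \<open>F1\<close>, \<open>F2\<close>.\<close>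
  define m where "m = (\<lambda>u::complex. - u * inverse (1 - u))"
  define q where "q = (\<lambda>u::complex. inverse (1 - u))"
  have slit: "1 - u \<notin> \<real>\<^sub>\<le>\<^sub>0 \<and> 1 - u \<noteq> 0" if "u \<in> ball 0 (1/2)" for u :: complex
    using that complex_Re_le_cmod[of u] by (auto simp: complex_nonpos_Reals_iff)
  have m1: "m u \<in> ball 0 1" if "u \<in> ball 0 (1/2)" for u
  proof -
    have "norm (1 - u) > 1 / 2" using that norm_triangle_ineq2[of 1 u] by simp
    then have "norm u < norm (1 - u)" using that by simp
    then have "norm u / norm (1 - u) < 1" by (subst divide_less_eq_1_pos) auto
    then show ?thesis by (simp add: m_def norm_divide flip: divide_inverse)
  qed
  have "(1 - u) powr (-a) * ?F (m u) = ((1 - 0) powr (-a) * ?F (m 0)) * gauss_F a b c u"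
  proof (rule gauss_F_unique[where r = "1/2" and f = "\<lambda>u. (1 - u) powr (-a) * ?F (m u)"
      and ?f1.0 = "\<lambda>u. (1 - u) powr (-a) * (a * q u * ?F (m u) - (q u)\<^sup>2 * F1 (m u))"
      and ?f2.0 = "\<lambda>u. (1 - u) powr (-a) * (a * (a + 1) * (q u)\<^sup>2 * ?F (m u) - (2 * a + 2) * (q u)^3 * F1 (m u) + (q u)^4 * F2 (m u))"])
    fix u :: complex assume u: "u \<in> ball 0 (1/2)"
    note sl = slit[OF u]
    have q: "(1 - u) * q u = 1" using sl by (simp add: q_def)
    have P: "((\<lambda>u. (1 - u) powr (-a)) has_field_derivative a * q u * (1 - u) powr (-a)) (at u)"
      using sl by (auto intro!: derivative_eq_intros simp: powr_diff field_simps q_def)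
    have Q: "(q has_field_derivative (q u)\<^sup>2) (at u)"
      using sl unfolding q_def by (auto intro!: derivative_eq_intros simp: power2_eq_square)
    have uq: "u * q u = q u - 1" using q by (simp add: algebra_simps)
    have M: "(m has_field_derivative - ((q u)\<^sup>2)) (at u)"
    proof -
      have "(m has_field_derivative (- 1) * q u + (q u)\<^sup>2 * (- u)) (at u)"
        unfolding m_def q_def[symmetric]
        using DERIV_mult[OF DERIV_minus[OF DERIV_ident] Q] by (simp add: q_def)
      moreover have "(- 1) * q u + (q u)\<^sup>2 * (- u) = - ((q u)\<^sup>2)"
      proof -
        have "(q u)\<^sup>2 * (- u) = - (q u * (u * q u))" by (simp add: power2_eq_square)
        then show ?thesis unfolding uq by (simp add: algebra_simps power2_eq_square)
      qed
      ultimately show ?thesis by simp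
    qed
    have FM: "((\<lambda>u. ?F (m u)) has_field_derivative F1 (m u) * (- ((q u)\<^sup>2))) (at u)"
      by (rule DERIV_chain2[OF F1[OF m1[OF u]] M])
    have F1M: "((\<lambda>u. F1 (m u)) has_field_derivative F2 (m u) * (- ((q u)\<^sup>2))) (at u)"
      by (rule DERIV_chain2[OF F2[OF m1[OF u]] M])
    show "((\<lambda>u. (1 - u) powr (-a) * ?F (m u)) has_field_derivative
       (1 - u) powr (-a) * (a * q u * ?F (m u) - (q u)\<^sup>2 * F1 (m u))) (at u)"
      by (rule DERIV_cong[OF DERIV_mult[OF P FM]]) (simp add: algebra_simps)
    have Q2: "((\<lambda>u. (q u)\<^sup>2) has_field_derivative 2 * q u * (q u)\<^sup>2) (at u)"
      by (rule DERIV_cong[OF DERIV_power[OF Q, of 2]]) simp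
    show "((\<lambda>u. (1 - u) powr (-a) * (a * q u * ?F (m u) - (q u)\<^sup>2 * F1 (m u))) has_field_derivative
       (1 - u) powr (-a) * (a * (a + 1) * (q u)\<^sup>2 * ?F (m u) - (2 * a + 2) * (q u)^3 * F1 (m u) + (q u)^4 * F2 (m u))) (at u)"
      by (rule DERIV_cong[OF DERIV_mult[OF P DERIV_diff[OF DERIV_mult[OF DERIV_cmult[OF Q, of a] FM] DERIV_mult[OF Q2 F1M]]]])
         (simp add: algebra_simps power2_eq_square power3_eq_cube power4_eq_xxxx)
    have muq: "m u = 1 - q u" using uq by (simp add: m_def q_def)
    have od: "(1 - q u) * q u * F2 (m u) + (c - (a + (c - b) + 1) * (1 - q u)) * F1 (m u) - a * (c - b) * ?F (m u) = 0"
      using ode[OF m1[OF u]] muq by simp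
    have 0: "u * (1 - u) * (a * (a + 1) * (q u)\<^sup>2 * ?F (m u) - (2 * a + 2) * (q u)^3 * F1 (m u) + (q u)^4 * F2 (m u))
        + (c - (a + b + 1) * u) * (a * q u * ?F (m u) - (q u)\<^sup>2 * F1 (m u)) - a * b * ?F (m u) = 0"
    proof -
      have uuq: "u * (1 - u) * (q u)\<^sup>2 = q u - 1"
      proof -
        have "u * (1 - u) * (q u)\<^sup>2 = (u * q u) * ((1 - u) * q u)" by (simp add: power2_eq_square)
        then show ?thesis using q uq by simp
      qed
      have "u * (1 - u) * (a * (a + 1) * (q u)\<^sup>2 * ?F (m u) - (2 * a + 2) * (q u)^3 * F1 (m u) + (q u)^4 * F2 (m u))
          = (u * (1 - u) * (q u)\<^sup>2) * (a * (a + 1) * ?F (m u) - (2 * a + 2) * q u * F1 (m u) + (q u)\<^sup>2 * F2 (m u))"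
        by (simp add: algebra_simps power2_eq_square power3_eq_cube power4_eq_xxxx)
      moreover have "(c - (a + b + 1) * u) * (a * q u * ?F (m u) - (q u)\<^sup>2 * F1 (m u))
          = (c * q u - (a + b + 1) * (u * q u)) * (a * ?F (m u) - q u * F1 (m u))"
        by (simp add: algebra_simps power2_eq_square)
      \<comment> \<open>The transformed equation is \<open>- q u\<close> times the equation of the
        inner function at \<open>m u\<close>.\<close>
      moreover have "(q u - 1) * (a * (a + 1) * ?F (m u) - (2 * a + 2) * q u * F1 (m u) + (q u)\<^sup>2 * F2 (m u))
          + (c * q u - (a + b + 1) * (q u - 1)) * (a * ?F (m u) - q u * F1 (m u)) - a * b * ?F (m u)
          = - q u * ((1 - q u) * q u * F2 (m u) + (c - (a + (c - b) + 1) * (1 - q u)) * F1 (m u) - a * (c - b) * ?F (m u))"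
        by (simp add: algebra_simps power2_eq_square)
      ultimately show ?thesis unfolding uuq uq od by simp
    qed
    have "u * (1 - u) * (P * X) + Y * (P * Z) - a * b * (P * W) = P * (u * (1 - u) * X + Y * Z - a * b * W)" for P X Y Z W
      by (simp add: algebra_simps)
    then show "u * (1 - u) * ((1 - u) powr (-a) * (a * (a + 1) * (q u)\<^sup>2 * ?F (m u) - (2 * a + 2) * (q u)^3 * F1 (m u) + (q u)^4 * F2 (m u)))
        + (c - (a + b + 1) * u) * ((1 - u) powr (-a) * (a * q u * ?F (m u) - (q u)\<^sup>2 * F1 (m u)))
        - a * b * ((1 - u) powr (-a) * ?F (m u)) = 0"
      using 0 by (metis mult_zero_right)
  qed (use u c in auto)
  moreover have "m u = u / (u - 1)" by (simp add: m_def divide_simps) (metis minus_diff_eq minus_mult_right)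
  ultimately show ?thesis by (simp add: m_def)
qed

section \<open>Gauss's summation theorem and boundary values of the series\<close>

lemma hyp_coeff_of_real:
  "hyp_coeff (of_real a) (of_real b) (of_real c) n = of_real (pochhammer a n * pochhammer b n / (pochhammer c n * fact n))"
  by (simp add: hyp_coeff_def pochhammer_of_real)

text \<open>After multiplication by \<open>Beta b (c - b)\<close> each term is a Beta integral, and
  under the integral sign the sum over \<open>n\<close> is the binomial series of
  \<open>(1 - t) powr (- a)\<close>, which leaves one Beta integral. Positivity of the parameters
  makes all terms nonnegative.\<close>

lemma gauss_sum:
  fixes a b c :: real
  assumes a: "a > 0" and b: "b > 0" and cab: "c - a - b > 0"
  shows "(\<lambda>n. pochhammer a n * pochhammer b n / (pochhammer c n * fact n)) sums
           (Gamma c * Gamma (c - a - b) / (Gamma (c - a) * Gamma (c - b)))"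
proof -
  define r where "r n = pochhammer a n * pochhammer b n / (pochhammer c n * fact n)" for n
  define B where "B = Beta b (c - b)"
  have c: "c > 0" "c - b > 0" "c - a > 0" using a b cab by auto
  have nonpos: "x \<notin> \<int>\<^sub>\<le>\<^sub>0" if "x > 0" for x :: real
    using that by (auto elim!: nonpos_Ints_cases)
  have Bpos: "B > 0" using b c by (simp add: B_def Beta_def Gamma_real_pos)
  have rpos: "r n \<ge> 0" for n using a b c by (simp add: r_def pochhammer_nonneg)
  have beta: "(\<integral>\<^sup>+t. ennreal (t powr (x - 1) * (1 - t) powr (y - 1)) * indicator {0..1} t \<partial>lborel) = ennreal (Beta x y)"
    if "x > 0" "y > 0" for x y :: real
    by (rule nn_integral_has_integral_lebesgue'[OF _ has_integral_Beta_real[OF that]]) auto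
  have trm: "B * r n = pochhammer a n / fact n * Beta (b + n) (c - b)" for n
  proof -
    have g: "Gamma b > 0" "Gamma c > 0" "pochhammer c n > 0" using b c by (auto intro!: Gamma_real_pos pochhammer_pos)
    have "Gamma (b + n) = pochhammer b n * Gamma b" "Gamma (c + n) = pochhammer c n * Gamma c"
      using pochhammer_Gamma[OF nonpos[OF b], of n] pochhammer_Gamma[OF nonpos[OF c(1)], of n] g by auto
    moreover have "b + n + (c - b) = c + n" by simp
    ultimately have bt: "Beta (b + n) (c - b) = pochhammer b n * Gamma b * Gamma (c - b) / (pochhammer c n * Gamma c)"
      unfolding Beta_def by metis
    show ?thesis unfolding bt using g by (simp add: B_def r_def Beta_def field_simps)
  qed
  \<comment> \<open>With values in \<open>ennreal\<close> sum and integral commute without prior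
    knowledge of convergence; finiteness of the result then yields summability.\<close>
  have "(\<Sum>n. ennreal (B * r n)) = (\<Sum>n. ennreal (pochhammer a n / fact n) *
      (\<integral>\<^sup>+t. ennreal (t powr (b + n - 1) * (1 - t) powr (c - b - 1)) * indicator {0..1} t \<partial>lborel))"
  proof (intro suminf_cong)
    fix n :: nat
    have "b + real n > 0" using b by simp
    then show "ennreal (B * r n) = ennreal (pochhammer a n / fact n) *
      (\<integral>\<^sup>+t. ennreal (t powr (b + n - 1) * (1 - t) powr (c - b - 1)) * indicator {0..1} t \<partial>lborel)"
      unfolding trm using c(2) a by (subst beta) (auto simp: ennreal_mult'[symmetric] pochhammer_nonneg)
  qed
  also have "\<dots> = (\<Sum>n. \<integral>\<^sup>+t. ennreal (pochhammer a n / fact n) *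
      (ennreal (t powr (b + n - 1) * (1 - t) powr (c - b - 1)) * indicator {0..1} t) \<partial>lborel)"
    by (intro suminf_cong nn_integral_cmult[symmetric]) measurable
  also have "\<dots> = (\<integral>\<^sup>+t. (\<Sum>n. ennreal (pochhammer a n / fact n) *
      (ennreal (t powr (b + n - 1) * (1 - t) powr (c - b - 1)) * indicator {0..1} t)) \<partial>lborel)"
    by (intro nn_integral_suminf[symmetric]) measurable
  also have "\<dots> = (\<integral>\<^sup>+t. ennreal (t powr (b - 1) * (1 - t) powr (c - a - b - 1)) * indicator {0..1} t \<partial>lborel)"
  \<comment> \<open>The end points form a null set; strictly between them the binomial series
    converges and the powers of \<open>t\<close> combine.\<close>
  proof (rule nn_integral_cong_AE, rule AE_mp[OF AE_lborel_singleton[of 0] AE_mp[OF AE_lborel_singleton[of 1]]], intro AE_I2 impI)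
    fix t :: real assume ne: "t \<noteq> 1" "t \<noteq> 0"
    show "(\<Sum>n. ennreal (pochhammer a n / fact n) * (ennreal (t powr (b + n - 1) * (1 - t) powr (c - b - 1)) * indicator {0..1} t))
       = ennreal (t powr (b - 1) * (1 - t) powr (c - a - b - 1)) * indicator {0..1} t"
    proof (cases "t \<in> {0..1}")
      case True
      then have t: "0 < t" "t < 1" using ne by auto
      have "(\<lambda>n. (- a gchoose n) * (- t) ^ n) sums (1 + - t) powr (- a)"
        using t by (intro gen_binomial_real) auto
      moreover have "(- a gchoose n) * (- t) ^ n = pochhammer a n / fact n * t ^ n" for n
      proof -
        have "(- 1) ^ n * (- 1) ^ n = (1::real)" by (simp flip: power_mult_distrib)
        then show ?thesis unfolding gbinomial_pochhammer power_minus[of t n] by (simp add: field_simps)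
      qed
      ultimately have "(\<lambda>n. pochhammer a n / fact n * t ^ n) sums (1 - t) powr (- a)" by simp
      from sums_mult[OF this, of "t powr (b - 1) * (1 - t) powr (c - b - 1)"]
      have "(\<lambda>n. pochhammer a n / fact n * (t powr (b + n - 1) * (1 - t) powr (c - b - 1))) sums
          (t powr (b - 1) * (1 - t) powr (c - a - b - 1))"
        using t by (simp add: powr_diff powr_add powr_minus powr_realpow field_simps)
      then have "(\<Sum>n. ennreal (pochhammer a n / fact n * (t powr (b + n - 1) * (1 - t) powr (c - b - 1))))
         = ennreal (t powr (b - 1) * (1 - t) powr (c - a - b - 1))"
        using a by (intro suminf_ennreal_eq) (auto simp: pochhammer_nonneg)
      moreover have "ennreal (pochhammer a n / fact n) * (ennreal q * indicator {0..1} t) = ennreal (pochhammer a n / fact n * q)" for n q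
        using True a by (simp add: ennreal_mult'[symmetric] pochhammer_nonneg)
      ultimately show ?thesis using True by simp
    qed auto
  qed
  also have "\<dots> = ennreal (Beta b (c - a - b))" using beta[OF b cab] by simp
  finally have S: "(\<Sum>n. ennreal (B * r n)) = ennreal (Beta b (c - a - b))" .
  have pos: "B * r n \<ge> 0" for n using Bpos rpos by simp
  have sm: "summable (\<lambda>n. B * r n)"
    using S pos by (intro summable_suminf_not_top) auto
  have "(\<Sum>n. ennreal (B * r n)) = ennreal (\<Sum>n. B * r n)"
    by (rule suminf_ennreal2[OF pos sm])
  then have "(\<Sum>n. B * r n) = Beta b (c - a - b)"
    using S suminf_nonneg[OF sm pos] b cab by (simp add: Beta_def Gamma_real_pos less_imp_le)
  then have "(\<lambda>n. B * r n) sums Beta b (c - a - b)" using sm by (simp add: sums_iff)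
  then have "(\<lambda>n. inverse B * (B * r n)) sums (inverse B * Beta b (c - a - b))" by (rule sums_mult)
  moreover have "inverse B * (B * r n) = r n" for n using Bpos by simp
  moreover have "inverse B * Beta b (c - a - b) = Gamma c * Gamma (c - a - b) / (Gamma (c - a) * Gamma (c - b))"
  proof -
    have "Gamma b > 0" using b by (simp add: Gamma_real_pos)
    then show ?thesis by (simp add: B_def Beta_def divide_simps)
  qed
  ultimately show ?thesis unfolding r_def[symmetric] by (simp only:)
qed

lemma gauss_F_continuous_cball:
  assumes "summable (\<lambda>n. norm (hyp_coeff a b c n))"
  shows "continuous_on (cball 0 1) (gauss_F a b c)"
proof -
  have "uniform_limit (cball 0 1) (\<lambda>n u. \<Sum>i<n. hyp_coeff a b c i * u ^ i) (\<lambda>u. \<Sum>i. hyp_coeff a b c i * u ^ i) sequentially"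
  proof (rule Weierstrass_m_test[OF _ assms])
    fix n and u :: complex assume "u \<in> cball 0 1"
    then show "norm (hyp_coeff a b c n * u ^ n) \<le> norm (hyp_coeff a b c n)"
      by (auto simp: norm_mult norm_power intro!: mult_left_le power_le_one)
  qed
  then show ?thesis unfolding gauss_F_def[abs_def]
    by (rule uniform_limit_theorem[rotated]) (auto intro!: always_eventually continuous_intros)
qed

text \<open>The coefficients are nonnegative, so Gauss's theorem at 1 is absolute summability and
  gives continuity up to the boundary circle.\<close>

lemma gauss_F_real_tendsto:
  fixes a b c :: real
  assumes "a > 0" "b > 0" "c - a - b > 0" and lim: "(f \<longlongrightarrow> 1) F" and ev: "eventually (\<lambda>y. norm (f y) < 1) F"
  shows "((\<lambda>y. gauss_F (of_real a) (of_real b) (of_real c) (f y)) \<longlongrightarrow>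
     of_real (Gamma c * Gamma (c - a - b) / (Gamma (c - a) * Gamma (c - b)))) F"
proof -
  have nn: "pochhammer a n * pochhammer b n / (pochhammer c n * fact n) \<ge> 0" for n
    using assms by (simp add: pochhammer_nonneg)
  have sm: "summable (\<lambda>n. norm (hyp_coeff (of_real a) (of_real b) (of_real c) n))"
    using gauss_sum[OF assms(1-3)] unfolding hyp_coeff_of_real norm_of_real abs_of_nonneg[OF nn]
    by (simp add: sums_iff)
  have val: "gauss_F (of_real a) (of_real b) (of_real c) 1 = of_real (Gamma c * Gamma (c - a - b) / (Gamma (c - a) * Gamma (c - b)))"
    unfolding gauss_F_def hyp_coeff_of_real using sums_of_real[OF gauss_sum[OF assms(1-3)], where 'a = complex]
    by (simp add: sums_iff)
  have "(gauss_F (of_real a) (of_real b) (of_real c) \<longlongrightarrow> gauss_F (of_real a) (of_real b) (of_real c) 1) (at 1 within cball 0 1)"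
    using gauss_F_continuous_cball[OF sm] by (auto simp: continuous_on_def)
  moreover have "filterlim f (at 1 within cball 0 1) F"
    unfolding filterlim_at using lim ev by (auto elim!: eventually_mono)
  ultimately show ?thesis unfolding val by (rule filterlim_compose)
qed

section \<open>The connection formula between the points 0 and 1\<close>

text \<open>Here the series about 0 and about 1 both converge, and \<open>u\<close> and
  \<open>1 - u\<close> both avoid the cut of the complex power.\<close>

definition lens :: "complex set" where "lens = ball 0 1 \<inter> ball 1 1"

lemma lens: "open lens" "convex lens" "u \<in> lens \<Longrightarrow> u \<notin> \<real>\<^sub>\<le>\<^sub>0 \<and> 1 - u \<notin> \<real>\<^sub>\<le>\<^sub>0"
  "u \<in> lens \<Longrightarrow> 1 - u \<in> ball 0 1" "0 < y \<Longrightarrow> y < 1 \<Longrightarrow> of_real y \<in> lens"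
proof -
  show "u \<in> lens \<Longrightarrow> u \<notin> \<real>\<^sub>\<le>\<^sub>0 \<and> 1 - u \<notin> \<real>\<^sub>\<le>\<^sub>0"
    using slit_ball[of u] slit_ball[of "1 - u"] by (auto simp: lens_def dist_norm norm_minus_commute)
  show "0 < y \<Longrightarrow> y < 1 \<Longrightarrow> of_real y \<in> lens"
    using norm_of_real[of "1 - y", where 'a = complex] by (auto simp: lens_def dist_norm)
qed (auto simp: lens_def convex_Int dist_norm norm_minus_commute)

lemma sin_sq_diff: "(sin A)\<^sup>2 - (sin B)\<^sup>2 = sin (A + B) * sin (A - B)" for A B :: real
proof -
  have "sin (A + B) * sin (A - B) = (sin A)\<^sup>2 * (cos B)\<^sup>2 - (cos A)\<^sup>2 * (sin B)\<^sup>2"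
    by (simp add: sin_add sin_diff algebra_simps power2_eq_square)
  also have "\<dots> = (sin A)\<^sup>2 - (sin B)\<^sup>2" unfolding cos_squared_eq by (simp add: algebra_simps)
  finally show ?thesis by simp
qed

lemma Gamma_reflection_real: "Gamma x * Gamma (1 - x) = pi / sin (pi * x)" for x :: real
proof -
  have "complex_of_real (Gamma x * Gamma (1 - x)) = of_real (pi / sin (pi * x))"
    using Gamma_reflection_complex[of "of_real x"]
    by (simp flip: Gamma_complex_of_real sin_of_real)
  then show ?thesis by (simp only: of_real_eq_iff)
qed

text \<open>The connection formula in the limit \<open>y = 0\<close>. Reflection turns each Gamma
  quotient into sines, and the identity becomes \<open>sin_sq_diff\<close> for the angles
  \<open>pi * a\<close> and \<open>pi * b\<close>, whose sum is \<open>pi / 2\<close> and whose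
  difference is \<open>pi * w / 2\<close>.\<close>

lemma connection_trig:
  fixes w :: real
  assumes w: "0 < w" "w < 1"
  defines "a \<equiv> (1 + w) / 4" and "b \<equiv> (1 - w) / 4"
  shows "sqrt pi * Gamma (- w / 2) / (Gamma b)\<^sup>2 * (Gamma (2 * a + 1/2) * Gamma (1/2) / (Gamma (a + 1/2) * Gamma (a + 1/2)))
     + sqrt pi * Gamma (w / 2) / (Gamma a)\<^sup>2 * (Gamma (2 * b + 1/2) * Gamma (1/2) / (Gamma (b + 1/2) * Gamma (b + 1/2))) = 1"
proof -
  have s: "sqrt pi * sqrt pi = pi" by simp
  have ab: "a + 1/2 = 1 - b" "b + 1/2 = 1 - a" "2 * a + 1/2 = 1 - (- w / 2)" "2 * b + 1/2 = 1 - w/2"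
    by (simp_all add: a_def b_def field_simps)
  have sw: "sin (pi * (w / 2)) > 0" using w by (intro sin_gt_zero) auto
  have sa: "sin (pi * a) > 0" "sin (pi * b) > 0"
    using w by (auto intro!: sin_gt_zero simp: a_def b_def)
  have G: "sqrt pi * Gamma v / (Gamma x)\<^sup>2 * (Gamma (1 - v) * Gamma (1/2) / (Gamma (1 - x) * Gamma (1 - x)))
      = pi * (Gamma v * Gamma (1 - v)) / (Gamma x * Gamma (1 - x))\<^sup>2" for v x :: real
    unfolding Gamma_one_half_real by (simp add: power2_eq_square field_simps)
  have "sqrt pi * Gamma (- w / 2) / (Gamma b)\<^sup>2 * (Gamma (2 * a + 1/2) * Gamma (1/2) / (Gamma (a + 1/2) * Gamma (a + 1/2)))
     + sqrt pi * Gamma (w / 2) / (Gamma a)\<^sup>2 * (Gamma (2 * b + 1/2) * Gamma (1/2) / (Gamma (b + 1/2) * Gamma (b + 1/2)))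
     = pi * (pi / sin (pi * (- w / 2))) / (pi / sin (pi * b))\<^sup>2 + pi * (pi / sin (pi * (w / 2))) / (pi / sin (pi * a))\<^sup>2"
    unfolding ab G Gamma_reflection_real ..
  also have "\<dots> = ((sin (pi * a))\<^sup>2 - (sin (pi * b))\<^sup>2) / sin (pi * (w / 2))"
    using sw sa by (simp add: divide_simps power2_eq_square)
  also have "(sin (pi * a))\<^sup>2 - (sin (pi * b))\<^sup>2 = sin (pi / 2) * sin (pi * (w / 2))"
    unfolding sin_sq_diff by (simp add: a_def b_def field_simps)
  finally show ?thesis using sw by simp
qed

text \<open>Wronskians show that the identity holds with some constants; the behaviour at \<open>y = 1\<close> gives
  one of them and the value at \<open>y = 0\<close> the other.\<close>

lemma gauss_F_connection:
  fixes w y :: real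
  assumes w: "0 < w" "w < 1" and y: "0 < y" "y < 1"
  defines "a \<equiv> (1 + w) / 4" and "b \<equiv> (1 - w) / 4"
  shows "gauss_F (of_real a) (of_real a) (1/2) (of_real y) =
      of_real (sqrt pi * Gamma (- w / 2) / (Gamma b)\<^sup>2) * gauss_F (of_real a) (of_real a) (of_real (2 * a + 1/2)) (1 - of_real y)
    + of_real (sqrt pi * Gamma (w / 2) / (Gamma a)\<^sup>2) * ((1 - of_real y) powr (of_real (- w / 2)) *
        gauss_F (of_real b) (of_real b) (of_real (2 * b + 1/2)) (1 - of_real y))"
proof -
  define A B \<kappa> where "A = complex_of_real a" and "B = complex_of_real b" and "\<kappa> = complex_of_real (- w / 2)"
  have AB: "1/2 - A = B" "\<kappa> = 1/2 - A - A" "A + A + 1 - 1/2 = complex_of_real (2 * a + 1/2)"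
    "B + B + 1 - 1/2 = complex_of_real (2 * b + 1/2)" "\<kappa> \<noteq> 0" "A + A + 1 - 1/2 = 1 - \<kappa>"
    using w by (auto simp: A_def B_def \<kappa>_def a_def b_def complex_eq_iff field_simps)
  have abpos: "a > 0" "b > 0" using w by (auto simp: a_def b_def)
  have np: "complex_of_real x \<notin> \<int>\<^sub>\<le>\<^sub>0" if "x > 0" for x :: real
    using that by (auto simp: complex_eq_iff elim!: nonpos_Ints_cases)
  have half: "(1/2 :: complex) \<notin> \<int>\<^sub>\<le>\<^sub>0" using np[of "1/2"] by simp
  define E where "E = gauss_F A A (1/2)"
  define H where "H = gauss_F A A (A + A + 1 - 1/2)"
  define K where "K = gauss_F B B (B + B + 1 - 1/2)"
  obtain E1 E2 where "hyp_ode A A (1/2) (ball 0 1) E E1 E2"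
    unfolding E_def using gauss_F_hyp_ode[OF half] .
  then have E: "hyp_ode A A (1/2) lens E E1 E2" by (rule hyp_ode_subset) (auto simp: lens_def)
  have "A + A + 1 - 1/2 \<notin> \<int>\<^sub>\<le>\<^sub>0" "B + B + 1 - 1/2 \<notin> \<int>\<^sub>\<le>\<^sub>0" unfolding AB(3,4) by (rule np, use abpos in simp)+
  then obtain H1 H2 K1 K2 where H0: "hyp_ode A A (A + A + 1 - 1/2) (ball 0 1) H H1 H2"
    and K0: "hyp_ode B B (B + B + 1 - 1/2) (ball 0 1) K K1 K2"
    unfolding H_def K_def by (metis gauss_F_hyp_ode)
  have sub: "lens \<subseteq> {u. 1 - u \<in> ball 0 1}" using lens(4) by auto
  have Hr: "hyp_ode A A (1/2) lens (\<lambda>u. H (1 - u)) (\<lambda>u. - H1 (1 - u)) (\<lambda>u. H2 (1 - u))"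
    by (rule hyp_ode_subset[OF hyp_ode_reflect[OF H0] sub])
  have Kr: "hyp_ode (1/2 - A) (1/2 - A) (1/2) lens (\<lambda>u. K (1 - u)) (\<lambda>u. - K1 (1 - u)) (\<lambda>u. K2 (1 - u))"
    unfolding AB(1) by (rule hyp_ode_subset[OF hyp_ode_reflect[OF K0] sub])
  note Ke = hyp_ode_euler[OF Kr lens(3)[THEN conjunct2] AB(2)]
  \<comment> \<open>The exponents at the point 1 are 0 and \<open>\<kappa> = 1/2 - 2 * A\<close>:
    \<open>H (1 - u)\<close> belongs to the first, \<open>L u\<close> to the second.\<close>
  define L where "L u = (1 - u) powr \<kappa> * K (1 - u)" for u
  define L1 where "L1 u = (1 - u) powr \<kappa> * (- K1 (1 - u) - \<kappa> * inverse (1 - u) * K (1 - u))" for u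
  define p where "p u = u powr (1/2) * (1 - u) powr (A + A + 1 - 1/2)" for u :: complex
  have pne: "p u \<noteq> 0" if "u \<in> lens" for u using lens(3)[OF that] by (auto simp: p_def)
  obtain k1 where k1: "\<And>u. u \<in> lens \<Longrightarrow> p u * (H (1 - u) * L1 u - - H1 (1 - u) * L u) = k1"
    using hyp_ode_wronskian[OF lens(1-3) Hr Ke] unfolding p_def L_def L1_def by blast
  obtain k2 where k2: "\<And>u. u \<in> lens \<Longrightarrow> p u * (E u * L1 u - E1 u * L u) = k2"
    using hyp_ode_wronskian[OF lens(1-3) E Ke] unfolding p_def L_def L1_def by blast
  obtain k3 where k3: "\<And>u. u \<in> lens \<Longrightarrow> p u * (E u * - H1 (1 - u) - E1 u * H (1 - u)) = k3"
    using hyp_ode_wronskian[OF lens(1-3) E Hr] unfolding p_def by blast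
  \<comment> \<open>Three solutions of a second order equation are linearly dependent, with their
    mutual Wronskians as coefficients.\<close>
  have cr: "E u * k1 = H (1 - u) * k2 - L u * k3" if u: "u \<in> lens" for u
    unfolding k1[OF u, symmetric] k2[OF u, symmetric] k3[OF u, symmetric] by (simp add: algebra_simps)
  have ev0: "eventually (\<lambda>y::real. 0 < y \<and> y < 1) (at_right 0)"
    unfolding eventually_at_right_field by (intro exI[of _ 1]) auto
  have ev1: "eventually (\<lambda>y::real. 0 < y \<and> y < 1) (at_left 1)"
    unfolding eventually_at_left_field by (intro exI[of _ 0]) auto
  have lim1: "((\<lambda>y::real. 1 - complex_of_real y) \<longlongrightarrow> 0) (at_left 1)"
    by (auto intro!: tendsto_eq_intros)
  have isC: "isCont H 0" "isCont H1 0" "isCont K 0" "isCont K1 0"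
    using hyp_odeD(1,2)[OF H0, of 0] hyp_odeD(1,2)[OF K0, of 0] by (auto intro: DERIV_isCont)
  have HK0: "H 0 = 1" "K 0 = 1" by (auto simp: H_def K_def)
  \<comment> \<open>Near 1 the weight \<open>p\<close>, of exponent \<open>1 - \<kappa>\<close> in
    \<open>1 - y\<close>, cancels the power in \<open>L\<close> up to one factor
    \<open>1 - y\<close>. Only the derivative of that power then keeps a nonzero limit, namely
    \<open>- \<kappa>\<close>.\<close>
  have k1v: "k1 = - \<kappa>"
  proof -
    have "((\<lambda>y::real. of_real y powr (1/2) * ((1 - of_real y) * (H (1 - of_real y) * - K1 (1 - of_real y) + H1 (1 - of_real y) * K (1 - of_real y))
        - \<kappa> * (H (1 - of_real y) * K (1 - of_real y)))) \<longlongrightarrow> 1 powr (1/2) * (0 * (H 0 * - K1 0 + H1 0 * K 0) - \<kappa> * (H 0 * K 0))) (at_left 1)"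
      by (intro tendsto_intros isCont_tendsto_compose[OF isC(1)] isCont_tendsto_compose[OF isC(2)]
          isCont_tendsto_compose[OF isC(3)] isCont_tendsto_compose[OF isC(4)] lim1 tendsto_eq_rhs[OF tendsto_of_real]) auto
    moreover have "eventually (\<lambda>y::real. of_real y powr (1/2) * ((1 - of_real y) * (H (1 - of_real y) * - K1 (1 - of_real y) + H1 (1 - of_real y) * K (1 - of_real y))
        - \<kappa> * (H (1 - of_real y) * K (1 - of_real y))) = k1) (at_left 1)"
      using ev1
    proof eventually_elim
      case (elim y)
      define v where "v = 1 - complex_of_real y"
      have vne: "v \<noteq> 0" using elim by (auto simp: v_def)
      have pw: "v powr (A + A + 1 - 1/2) * v powr \<kappa> = v"
        unfolding AB(6) using vne by (simp flip: powr_add)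
      have "k1 = of_real y powr (1/2) * (v powr (A + A + 1 - 1/2) * v powr \<kappa>) *
         (H v * (- K1 v - \<kappa> * inverse v * K v) + H1 v * K v)"
        using k1[OF lens(5)[of y]] elim by (simp add: p_def L_def L1_def v_def algebra_simps)
      also have "\<dots> = of_real y powr (1/2) * (v * (H v * - K1 v + H1 v * K v) - \<kappa> * (H v * K v))"
        unfolding pw using vne by (simp add: field_simps)
      finally show ?case by (simp add: v_def)
    qed
    ultimately have "((\<lambda>y::real. k1) \<longlongrightarrow> - \<kappa>) (at_left 1)"
      by (auto simp: HK0 elim: Lim_transform_eventually)
    then show ?thesis using tendsto_const_iff trivial_limit_at_left_real by metis
  qed
  define \<alpha> \<beta> where "\<alpha> = k2 / k1" and "\<beta> = - k3 / k1"
  have EHL: "E u = \<alpha> * H (1 - u) + \<beta> * L u" if "u \<in> lens" for u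
  proof -
    have "k1 \<noteq> 0" using k1v AB(5) by simp
    then show ?thesis using cr[OF that] by (simp add: \<alpha>_def \<beta>_def field_simps)
  qed
  \<comment> \<open>Gauss's theorem does not apply to \<open>E\<close> at 1, since
    \<open>1/2 - 2 * a\<close> is negative. Euler's transformation replaces the parameter by
    \<open>b\<close>, and \<open>1/2 - 2 * b = w / 2\<close> is positive.\<close>
  have G1: "((\<lambda>y::real. gauss_F B B (1/2) (of_real y)) \<longlongrightarrow> of_real (Gamma (1/2) * Gamma (w/2) / (Gamma a)\<^sup>2)) (at_left 1)"
  proof -
    have "((\<lambda>y::real. gauss_F (of_real b) (of_real b) (of_real (1/2)) (of_real y)) \<longlongrightarrow>
        of_real (Gamma (1/2) * Gamma (1/2 - b - b) / (Gamma (1/2 - b) * Gamma (1/2 - b)))) (at_left 1)"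
    proof (rule gauss_F_real_tendsto)
      show "\<forall>\<^sub>F y in at_left 1. norm (complex_of_real y) < 1" using ev1 by eventually_elim auto
    qed (use w in \<open>auto intro!: tendsto_eq_intros simp: b_def field_simps\<close>)
    moreover have "1/2 - b = a" "a - b = w / 2" by (simp_all add: a_def b_def field_simps)
    ultimately show ?thesis by (simp only: B_def power2_eq_square) simp
  qed
  \<comment> \<open>Multiplication by \<open>(1 - y) powr (w/2)\<close> suppresses the solution of
    exponent 0 in the limit and isolates \<open>\<beta>\<close>.\<close>
  have \<beta>: "\<beta> = of_real (sqrt pi * Gamma (w / 2) / (Gamma a)\<^sup>2)"
  proof -
    have "((\<lambda>y::real. \<alpha> * ((1 - of_real y) powr (of_real (w/2)) * H (1 - of_real y)) + \<beta> * K (1 - of_real y)) \<longlongrightarrow>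
        \<alpha> * (0 * H 0) + \<beta> * K 0) (at_left 1)"
    proof (intro tendsto_intros isCont_tendsto_compose[OF isC(1)] isCont_tendsto_compose[OF isC(3)] lim1)
      have "((\<lambda>y::real. complex_of_real ((1 - y) powr (w/2))) \<longlongrightarrow> of_real 0) (at_left 1)"
      proof (rule tendsto_of_real)
        have "((\<lambda>y::real. (1 - y) powr (w/2)) \<longlongrightarrow> (1 - 1) powr (w/2)) (at_left 1)"
          using w ev1 by (intro tendsto_powr' tendsto_intros) (auto elim: eventually_mono)
        then show "((\<lambda>y::real. (1 - y) powr (w/2)) \<longlongrightarrow> 0) (at_left 1)" by simp
      qed
      moreover have "\<forall>\<^sub>F y in at_left 1. complex_of_real ((1 - y) powr (w/2)) = (1 - complex_of_real y) powr (of_real (w/2))"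
        using ev1
      proof eventually_elim
        case (elim y)
        then show ?case using powr_of_real[of "1 - y" "w/2"] by simp
      qed
      ultimately show "((\<lambda>y::real. (1 - complex_of_real y) powr (of_real (w/2))) \<longlongrightarrow> 0) (at_left 1)"
        by (auto elim: Lim_transform_eventually)
    qed
    moreover have "eventually (\<lambda>y::real. \<alpha> * ((1 - of_real y) powr (of_real (w/2)) * H (1 - of_real y)) + \<beta> * K (1 - of_real y)
       = gauss_F B B (1/2) (of_real y)) (at_left 1)"
      using ev1
    proof eventually_elim
      case (elim y)
      define v where "v = 1 - complex_of_real y"
      have vne: "v \<noteq> 0" using elim by (auto simp: v_def)
      have pk: "of_real (w/2) = - \<kappa>" by (simp add: \<kappa>_def)
      have pw: "v powr (- \<kappa>) * v powr \<kappa> = 1" using vne by (simp flip: powr_add)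
      have "E (of_real y) = v powr \<kappa> * gauss_F B B (1/2) (of_real y)"
      proof -
        have "1/2 - A - A = \<kappa>" using AB(2) by simp
        then show ?thesis using gauss_F_euler[OF half, of "of_real y" A A] elim
          unfolding E_def v_def by (simp only: AB(1)) simp
      qed
      then have "v powr (- \<kappa>) * E (of_real y) = gauss_F B B (1/2) (of_real y)"
        using pw by (simp flip: mult.assoc)
      then show ?case using EHL[OF lens(5)[of y]] elim pw
        unfolding pk L_def v_def by (simp add: algebra_simps)
    qed
    ultimately have "((\<lambda>y::real. gauss_F B B (1/2) (of_real y)) \<longlongrightarrow> \<beta>) (at_left 1)"
      by (auto simp: HK0 elim: Lim_transform_eventually)
    from tendsto_unique[OF _ this G1] show ?thesis
      by (simp add: Gamma_one_half_real)
  qed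
  define GA GB where "GA = Gamma (2 * a + 1/2) * Gamma (1/2) / (Gamma (a + 1/2) * Gamma (a + 1/2))"
    and "GB = Gamma (2 * b + 1/2) * Gamma (1/2) / (Gamma (b + 1/2) * Gamma (b + 1/2))"
  have lim0: "((\<lambda>y::real. 1 - complex_of_real y) \<longlongrightarrow> 1) (at_right 0)"
    by (auto intro!: tendsto_eq_intros)
  have nrm: "\<forall>\<^sub>F y in at_right 0. norm (1 - complex_of_real y) < 1"
    using ev0
  proof eventually_elim
    case (elim y)
    then show ?case using norm_of_real[of "1 - y", where 'a = complex] by simp
  qed
  have HL: "((\<lambda>y::real. H (1 - of_real y)) \<longlongrightarrow> of_real GA) (at_right 0)"
  proof -
    have *: "2 * a + 1/2 - a - a = 1/2" "2 * a + 1/2 - a = a + 1/2" by simp_all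
    show ?thesis using gauss_F_real_tendsto[OF abpos(1,1) _ lim0 nrm, of "2 * a + 1/2"]
      unfolding H_def AB(3) A_def GA_def * by (simp add: add.commute)
  qed
  have KL: "((\<lambda>y::real. K (1 - of_real y)) \<longlongrightarrow> of_real GB) (at_right 0)"
  proof -
    have *: "2 * b + 1/2 - b - b = 1/2" "2 * b + 1/2 - b = b + 1/2" by simp_all
    show ?thesis using gauss_F_real_tendsto[OF abpos(2,2) _ lim0 nrm, of "2 * b + 1/2"]
      unfolding K_def AB(4) B_def GB_def * by (simp add: add.commute)
  qed
  have "((\<lambda>y::real. \<alpha> * H (1 - of_real y) + \<beta> * ((1 - of_real y) powr \<kappa> * K (1 - of_real y))) \<longlongrightarrow> \<alpha> * of_real GA + \<beta> * (1 powr \<kappa> * of_real GB)) (at_right 0)"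
    by (intro tendsto_intros HL KL lim0) auto
  moreover have "eventually (\<lambda>y::real. \<alpha> * H (1 - of_real y) + \<beta> * ((1 - of_real y) powr \<kappa> * K (1 - of_real y)) = E (of_real y)) (at_right 0)"
    using ev0 by eventually_elim (simp add: EHL[OF lens(5)] L_def)
  ultimately have "((\<lambda>y::real. E (of_real y)) \<longlongrightarrow> \<alpha> * of_real GA + \<beta> * (1 powr \<kappa> * of_real GB)) (at_right 0)"
    by (rule Lim_transform_eventually)
  moreover have "((\<lambda>y::real. E (of_real y)) \<longlongrightarrow> E 0) (at_right 0)"
  proof (rule isCont_tendsto_compose[of 0 E])
    show "isCont E 0" using gauss_F_holomorphic[of A A "1/2"] unfolding E_def
      by (metis centre_in_ball continuous_on_eq_continuous_at holomorphic_on_imp_continuous_on open_ball zero_less_one)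
  qed (auto intro!: tendsto_eq_intros)
  ultimately have "\<alpha> * of_real GA + \<beta> * of_real GB = 1"
    using tendsto_unique[OF trivial_limit_at_right_real] by (fastforce simp: E_def)
  \<comment> \<open>The limit at 0 is one linear equation for \<open>\<alpha>\<close>. The expected
    constant satisfies it by \<open>connection_trig\<close>, and the coefficient \<open>GA\<close>
    is nonzero.\<close>
  moreover have "complex_of_real (sqrt pi * Gamma (- w / 2) / (Gamma b)\<^sup>2) * of_real GA + \<beta> * of_real GB = 1"
    using connection_trig[OF w] unfolding \<beta> GA_def GB_def a_def b_def
    by (simp only: of_real_mult[symmetric] of_real_add[symmetric] of_real_1)
  moreover have "GA \<noteq> 0"
  proof -
    have "Gamma (2 * a + 1/2) > 0" "Gamma (1/2 :: real) > 0" "Gamma (a + 1/2) > 0"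
      using abpos by (auto intro!: Gamma_real_pos)
    then have "GA > 0" unfolding GA_def by (intro divide_pos_pos mult_pos_pos)
    then show ?thesis by simp
  qed
  ultimately have \<alpha>: "\<alpha> = of_real (sqrt pi * Gamma (- w / 2) / (Gamma b)\<^sup>2)"
    by (metis add_right_cancel mult_right_cancel of_real_eq_0_iff)
  show ?thesis
    using EHL[OF lens(5)[OF y]] unfolding \<alpha> \<beta> E_def L_def H_def K_def AB(3,4)
    unfolding \<kappa>_def A_def B_def .
qed

section \<open>The real spherical function\<close>

lemma Gamma_R_1: "Gamma_R 1 = 1"
proof -
  have "complex_of_real pi powr (- 1 / 2) * complex_of_real (sqrt pi) = of_real (pi powr (- 1 / 2) * pi powr (1 / 2))"
    using powr_of_real[of pi "- 1 / 2"] by (simp add: powr_half_sqrt)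
  also have "\<dots> = 1" by (simp flip: powr_add)
  finally show ?thesis by (simp add: Gamma_R_def Gamma_one_half_complex)
qed

text \<open>The powers of \<open>pi\<close> collapse to \<open>sqrt pi\<close>, and with the entire
  function \<open>rGamma\<close> the factor \<open>Gamma (- w / 2)\<close> is the only source of
  poles.\<close>

lemma A_coeff_Gamma_R:
  "A_coeff Gamma_R w = of_real (sqrt pi) * Gamma (- w / 2) * (rGamma ((1 - w) / 4))\<^sup>2"
proof -
  define p where "p = complex_of_real pi"
  have p: "p \<noteq> 0" by (simp add: p_def)
  have sq: "p powr (1/2) = of_real (sqrt pi)"
    using powr_of_real[of pi "1/2"] by (simp add: p_def powr_half_sqrt)
  have "p powr (w / 2) = p powr (- (1 - w) / 4) * p powr (- (1 - w) / 4) * p powr (1/2)"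
    using p by (simp flip: powr_add add: field_simps)
  then have e: "p powr (w / 2) = (p powr (- (1 - w) / 4))\<^sup>2 * of_real (sqrt pi)"
    unfolding sq by (simp add: power2_eq_square)
  have "A_coeff Gamma_R w = (p powr (w / 2) * Gamma (- w / 2)) / (p powr (- (1 - w) / 4) * Gamma ((1 - w) / 4))\<^sup>2"
  proof -
    have "- (- w) / 2 = w / 2" "- ((1 - w) / 2) / 2 = - (1 - w) / 4" "(1 - w) / 2 / 2 = (1 - w) / 4" by (simp_all add: field_simps)
    then show ?thesis unfolding A_coeff_def Gamma_R_1 unfolding Gamma_R_def p_def by (simp only: mult_1)
  qed
  also have "\<dots> = of_real (sqrt pi) * Gamma (- w / 2) * (inverse (Gamma ((1 - w) / 4)))\<^sup>2"
    unfolding e using p by (simp add: field_simps)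
  finally show ?thesis by (simp add: rGamma_inverse_Gamma)
qed

text \<open>The pole-free form of \<open>phi_real\<close>: one series in
  \<open>x^2 / (1 + x^2)\<close>, the complement of the argument in \<open>h_real\<close>, with
  fixed third parameter 1/2. It is entire in \<open>z\<close>, continuous in \<open>x\<close>
  including 0, and even in \<open>x\<close>.\<close>

definition sph :: "complex \<Rightarrow> real \<Rightarrow> complex" where
  "sph z x = complex_of_real (1 + x\<^sup>2) powr (- (z + 1) / 4) *
     gauss_F ((z + 1) / 4) ((z + 1) / 4) (1/2) (of_real (x\<^sup>2 / (1 + x\<^sup>2)))"

lemma half_not_nonpos_Int: "(1/2 :: complex) \<notin> \<int>\<^sub>\<le>\<^sub>0"
  by (auto simp: complex_eq_iff elim!: nonpos_Ints_cases)

lemma sph_arg: "norm (complex_of_real (x\<^sup>2 / (1 + x\<^sup>2))) < 1"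
proof -
  have "1 + x\<^sup>2 > 0" by (simp add: add_pos_nonneg)
  then show ?thesis unfolding norm_of_real by (simp add: abs_of_nonneg)
qed

lemma sph_holomorphic: "(\<lambda>z. sph z x) holomorphic_on U"
proof -
  have "1 + x\<^sup>2 > 0" by (simp add: add_pos_nonneg)
  then have ne: "complex_of_real (1 + x\<^sup>2) \<noteq> 0" by (simp only: of_real_eq_0_iff)
  have "(\<lambda>z. sph z x) holomorphic_on UNIV"
    unfolding sph_def
    by (intro holomorphic_on_mult gauss_F_holomorphic_params holomorphic_intros half_not_nonpos_Int sph_arg)
       (use ne in auto)
  then show ?thesis by (rule holomorphic_on_subset) simp
qed

lemma sph_continuous: "continuous_on UNIV (sph z)"
proof -
  have p: "1 + x\<^sup>2 > 0" for x :: real by (simp add: add_pos_nonneg)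
  have 1: "continuous_on UNIV (\<lambda>x. gauss_F ((z + 1) / 4) ((z + 1) / 4) (1/2) (of_real (x\<^sup>2 / (1 + x\<^sup>2))))"
  proof (rule continuous_on_compose2[OF holomorphic_on_imp_continuous_on[OF gauss_F_holomorphic]])
    show "continuous_on UNIV (\<lambda>x::real. complex_of_real (x\<^sup>2 / (1 + x\<^sup>2)))"
      using p by (intro continuous_intros) (auto simp: less_imp_neq[symmetric] add_nonneg_eq_0_iff)
    show "range (\<lambda>x::real. complex_of_real (x\<^sup>2 / (1 + x\<^sup>2))) \<subseteq> ball 0 1"
      using sph_arg by (auto simp: dist_norm simp del: of_real_divide of_real_add of_real_power)
  qed
  have 2: "continuous_on UNIV (\<lambda>x::real. complex_of_real (1 + x\<^sup>2) powr (- (z + 1) / 4))"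
  proof (rule continuous_on_powr_complex)
    have "complex_of_real (1 + x\<^sup>2) \<notin> \<real>\<^sub>\<le>\<^sub>0" for x :: real
      using p[of x] by (simp only: nonpos_Reals_of_real_iff not_le)
    then show "UNIV \<subseteq> {x. 0 \<le> Re (complex_of_real (1 + x\<^sup>2)) \<or> Im (complex_of_real (1 + x\<^sup>2)) \<noteq> 0}"
      using p by (auto simp: less_imp_le)
    show "0 < Re (- (z + 1) / 4)" if "complex_of_real (1 + x\<^sup>2) = 0" for x
      using that p[of x] by (metis less_irrefl of_real_eq_0_iff)
  qed (auto intro!: continuous_intros)
  show ?thesis unfolding sph_def[abs_def] by (intro continuous_intros 1 2)
qed

lemma h_real_arg:
  assumes "x \<noteq> 0"
  shows "norm (complex_of_real (1 / (x\<^sup>2 + 1))) < 1"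
proof -
  have "x\<^sup>2 > 0" "x\<^sup>2 + 1 > 0" using assms by (auto simp: add_nonneg_pos)
  then show ?thesis unfolding norm_of_real by (simp add: abs_of_nonneg divide_less_eq_1)
qed

lemma h_real_eq:
  assumes "x \<noteq> 0"
  shows "h_real z x = complex_of_real (1 + x\<^sup>2) powr (- (z + 1) / 4) *
     gauss_F ((z + 1) / 4) ((z + 1) / 4) ((z + 2) / 2) (of_real (1 / (x\<^sup>2 + 1)))"
  using h_real_arg[OF assms] by (simp only: h_real_def hyp2F1_eq_gauss_F)

lemma half_not_Int:
  fixes w :: complex
  assumes "w / 2 \<notin> \<int>"
  shows "(w + 2) / 2 \<notin> \<int>\<^sub>\<le>\<^sub>0" "- w / 2 \<notin> \<int>\<^sub>\<le>\<^sub>0"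
proof -
  show "(w + 2) / 2 \<notin> \<int>\<^sub>\<le>\<^sub>0"
  proof
    assume "(w + 2) / 2 \<in> \<int>\<^sub>\<le>\<^sub>0"
    then have "(w + 2) / 2 - 1 \<in> \<int>" using nonpos_Ints_subset_Ints by (intro Ints_diff) auto
    moreover have "(w + 2) / 2 - 1 = w / 2" by (simp add: field_simps)
    ultimately show False using assms by simp
  qed
  show "- w / 2 \<notin> \<int>\<^sub>\<le>\<^sub>0"
  proof
    assume "- w / 2 \<in> \<int>\<^sub>\<le>\<^sub>0"
    then have "- (- w / 2) \<in> \<int>" using nonpos_Ints_subset_Ints by (intro Ints_minus) auto
    then show False using assms by simp
  qed
qed

lemma A_h_holomorphic:
  assumes x: "x \<noteq> 0" and U: "open U" "\<And>w. w \<in> U \<Longrightarrow> w / 2 \<notin> \<int>"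
  shows "(\<lambda>w. A_coeff Gamma_R w * h_real w x) holomorphic_on U"
proof -
  have "1 + x\<^sup>2 > 0" by (simp add: add_pos_nonneg)
  then have ne: "complex_of_real (1 + x\<^sup>2) \<noteq> 0" by (simp only: of_real_eq_0_iff)
  show ?thesis unfolding A_coeff_Gamma_R h_real_eq[OF x]
    by (intro holomorphic_on_mult gauss_F_holomorphic_params holomorphic_intros U h_real_arg x)
       (use ne half_not_Int U in auto)
qed

lemma sph_eq_real:
  fixes w x :: real
  assumes w: "0 < w" "w < 1" and x: "x \<noteq> 0"
  shows "A_coeff Gamma_R w * h_real w x + A_coeff Gamma_R (- complex_of_real w) * h_real (- complex_of_real w) x = sph w x"
proof -
  define a b y X where "a = (1 + w) / 4" and "b = (1 - w) / 4" and "y = x\<^sup>2 / (1 + x\<^sup>2)" and "X = complex_of_real (1 + x\<^sup>2)"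
  have X0: "1 + x\<^sup>2 > 0" by (simp add: add_pos_nonneg)
  have y: "0 < y" "y < 1" using x X0 by (auto simp: y_def)
  have Xne: "X \<noteq> 0" using X0 by (simp only: X_def of_real_eq_0_iff)
  have iy: "1 - complex_of_real y = of_real (1 / (x\<^sup>2 + 1))"
  proof -
    have "1 - y = 1 / (x\<^sup>2 + 1)" using X0 by (simp add: y_def field_simps)
    then show ?thesis by (metis of_real_1 of_real_diff)
  qed
  have ab: "- (complex_of_real w + 1) / 4 = - of_real a" "- (- complex_of_real w + 1) / 4 = - of_real b"
    "(complex_of_real w + 1) / 4 = of_real a" "(- complex_of_real w + 1) / 4 = of_real b"
    "(complex_of_real w + 2) / 2 = of_real (2 * a + 1/2)" "(- complex_of_real w + 2) / 2 = of_real (2 * b + 1/2)"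
    by (simp_all add: a_def b_def field_simps)
  have A1: "A_coeff Gamma_R w = of_real (sqrt pi * Gamma (- w / 2) / (Gamma b)\<^sup>2)"
  proof -
    have "(1 - complex_of_real w) / 4 = of_real b" "- complex_of_real w / 2 = of_real (- w / 2)" by (simp_all add: b_def)
    then show ?thesis unfolding A_coeff_Gamma_R rGamma_inverse_Gamma
      by (simp only: Gamma_complex_of_real) (simp add: field_simps)
  qed
  have A2: "A_coeff Gamma_R (- complex_of_real w) = of_real (sqrt pi * Gamma (w / 2) / (Gamma a)\<^sup>2)"
  proof -
    have "(1 - - complex_of_real w) / 4 = of_real a" "- (- complex_of_real w) / 2 = of_real (w / 2)" by (simp_all add: a_def)
    then show ?thesis unfolding A_coeff_Gamma_R rGamma_inverse_Gamma
      by (simp only: Gamma_complex_of_real) (simp add: field_simps)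
  qed
  \<comment> \<open>As \<open>1 - y\<close> is the reciprocal of \<open>1 + x^2\<close>, its power
    \<open>- w / 2\<close> turns the exponent \<open>- a\<close> into the exponent
    \<open>- b\<close> that \<open>h_real\<close> carries at \<open>- w\<close>.\<close>
  have pw: "X powr (- of_real a) * (of_real (1 / (x\<^sup>2 + 1))) powr (of_real (- w / 2)) = X powr (- of_real b)"
  proof -
    have "complex_of_real (1 / (x\<^sup>2 + 1)) powr (of_real (- w / 2)) = of_real ((1 / (x\<^sup>2 + 1)) powr (- w / 2))"
      using X0 by (intro powr_of_real) (auto simp: add.commute)
    also have "(1 / (x\<^sup>2 + 1)) powr (- w / 2) = (1 + x\<^sup>2) powr (w / 2)"
      using X0 by (simp add: powr_minus powr_divide add.commute)
    also have "complex_of_real \<dots> = X powr (of_real (w / 2))"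
      unfolding X_def using X0 by (intro powr_of_real[symmetric]) auto
    finally have "X powr (- of_real a) * (of_real (1 / (x\<^sup>2 + 1))) powr (of_real (- w / 2)) = X powr (- of_real a + of_real (w / 2))"
      by (simp only: powr_add)
    also have "- complex_of_real a + of_real (w / 2) = - of_real b" by (simp add: a_def b_def field_simps)
    finally show ?thesis .
  qed
  have "sph w x = X powr (- of_real a) * gauss_F (of_real a) (of_real a) (1/2) (of_real y)"
    unfolding sph_def X_def y_def ab ..
  also have "\<dots> = of_real (sqrt pi * Gamma (- w / 2) / (Gamma b)\<^sup>2) * (X powr (- of_real a) *
      gauss_F (of_real a) (of_real a) (of_real (2 * a + 1/2)) (of_real (1 / (x\<^sup>2 + 1))))
    + of_real (sqrt pi * Gamma (w / 2) / (Gamma a)\<^sup>2) * ((X powr (- of_real a) * (of_real (1 / (x\<^sup>2 + 1))) powr (of_real (- w / 2))) *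
      gauss_F (of_real b) (of_real b) (of_real (2 * b + 1/2)) (of_real (1 / (x\<^sup>2 + 1))))"
    using gauss_F_connection[OF w y, folded a_def b_def] unfolding iy by (simp only: algebra_simps)
  also have "\<dots> = A_coeff Gamma_R w * h_real w x + A_coeff Gamma_R (- complex_of_real w) * h_real (- complex_of_real w) x"
    unfolding pw A1 A2 h_real_eq[OF x] ab X_def[symmetric] ..
  finally show ?thesis ..
qed

text \<open>Both sides are holomorphic off the even integers. The complement of this countable
  closed set is connected, so the real interval \<open>0 < w < 1\<close> determines the
  identity.\<close>

lemma sph_eq:
  assumes x: "x \<noteq> 0" and w: "w / 2 \<notin> \<int>"
  shows "A_coeff Gamma_R w * h_real w x + A_coeff Gamma_R (- w) * h_real (- w) x = sph w x"
proof -
  define U where "U = {w::complex. w / 2 \<notin> \<int>}"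
  have "U = - (\<lambda>k. 2 * k) ` \<int>"
    by (auto simp: U_def image_iff) (metis mult.commute nonzero_eq_divide_eq zero_neq_numeral)
  moreover have "countable (\<int> :: complex set)" by (rule countable_int)
  ultimately have con: "connected U"
    by (auto intro!: path_connected_imp_connected path_connected_complement_countable)
  have "closed ((\<lambda>w::complex. w / 2) -` \<int>)" by (intro continuous_closed_vimage closed_Ints) auto
  moreover have "U = - ((\<lambda>w::complex. w / 2) -` \<int>)" by (auto simp: U_def)
  ultimately have op: "open U" by (simp add: open_Compl)
  have U: "w / 2 \<notin> \<int>" "- w / 2 \<notin> \<int>" if "w \<in> U" for w
    using that minus_in_Ints_iff[of "w / 2"] by (auto simp: U_def)
  have "- w \<in> U" if "w \<in> U" for w using U(2)[OF that] by (simp add: U_def)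
  then have im: "uminus ` U \<subseteq> U" by auto
  have hol1: "(\<lambda>w. A_coeff Gamma_R w * h_real w x) holomorphic_on U"
    by (rule A_h_holomorphic[OF x op]) (rule U)
  have hol2: "(\<lambda>w. A_coeff Gamma_R (- w) * h_real (- w) x) holomorphic_on U"
    using holomorphic_on_compose_gen[OF holomorphic_on_minus[OF holomorphic_on_id] hol1, of U] im
    by (simp add: o_def)
  define V where "V = complex_of_real ` {0<..<1}"
  have "(A_coeff Gamma_R w * h_real w x + A_coeff Gamma_R (- w) * h_real (- w) x) - sph w x = 0"
  proof (rule analytic_continuation[of "\<lambda>w. (A_coeff Gamma_R w * h_real w x + A_coeff Gamma_R (- w) * h_real (- w) x) - sph w x" U V "1/2"])
    show "(\<lambda>w. (A_coeff Gamma_R w * h_real w x + A_coeff Gamma_R (- w) * h_real (- w) x) - sph w x) holomorphic_on U"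
      by (intro holomorphic_on_diff holomorphic_on_add hol1 hol2 sph_holomorphic)
    have nI: "complex_of_real r / 2 \<notin> \<int>" if "0 < r" "r < 1" for r
    proof
      assume "complex_of_real r / 2 \<in> \<int>"
      then obtain k :: int where "complex_of_real r / 2 = of_int k" by (auto elim: Ints_cases)
      then have "r / 2 = of_int k" by (metis of_real_divide of_real_numeral of_real_of_int_eq of_real_eq_iff)
      then have "0 < real_of_int k" "real_of_int k < 1" using that by auto
      then show False by simp
    qed
    then show "V \<subseteq> U" by (auto simp: V_def U_def)
    show "1 / 2 \<in> U" using nI[of "1/2"] by (simp add: U_def)
    show "1/2 islimpt V"
    proof -
      have "(1/2::real) islimpt {0<..<1}" by (rule open_imp_islimpt) auto
      then have "complex_of_real (1/2) islimpt complex_of_real ` {0<..<1}"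
        unfolding islimpt_approachable
        by (metis (no_types, lifting) dist_of_real imageI of_real_eq_iff)
      then show ?thesis by (simp add: V_def)
    qed
    show "(A_coeff Gamma_R z * h_real z x + A_coeff Gamma_R (- z) * h_real (- z) x) - sph z x = 0" if "z \<in> V" for z
      using that sph_eq_real[OF _ _ x] by (auto simp: V_def)
  qed (use op con w in \<open>auto simp: U_def\<close>)
  then show ?thesis by simp
qed

text \<open>\<open>remove_sings\<close> takes a limit, even integers are isolated, and
  \<open>sph\<close> is continuous in its first argument. The point \<open>x = 0\<close>, where the
  series in \<open>h_real\<close> has argument 1, is left out.\<close>

lemma phi_real_eq_sph:
  assumes x: "x \<noteq> 0"
  shows "phi_real z x = sph z x"
  unfolding phi_real_def
proof (rule remove_sings_eqI)
  have "continuous_on UNIV (\<lambda>w. sph w x)" by (rule holomorphic_on_imp_continuous_on[OF sph_holomorphic])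
  then have "((\<lambda>w. sph w x) \<longlongrightarrow> sph z x) (at z)" by (simp add: continuous_on_def)
  moreover have "eventually (\<lambda>w. sph w x = A_coeff Gamma_R w * h_real w x + A_coeff Gamma_R (- w) * h_real (- w) x) (at z)"
  proof -
    have "\<not> z / 2 islimpt (\<int> :: complex set)"
      by (rule discrete_imp_not_islimpt[of 1]) (auto elim!: Ints_cases simp: dist_of_int)
    then have "eventually (\<lambda>u. u \<notin> (\<int> :: complex set)) (at (z / 2))"
      by (simp add: islimpt_iff_eventually)
    moreover have "filterlim (\<lambda>w::complex. w / 2) (at (z / 2)) (at z)"
      by (rule filterlim_atI) (auto intro!: tendsto_eq_intros simp: eventually_at_filter)
    ultimately have "eventually (\<lambda>w. w / 2 \<notin> (\<int> :: complex set)) (at z)"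
      by (rule eventually_compose_filterlim)
    then show ?thesis by eventually_elim (simp add: sph_eq[OF x])
  qed
  ultimately show "((\<lambda>w. A_coeff Gamma_R w * h_real w x + A_coeff Gamma_R (- w) * h_real (- w) x) \<longlongrightarrow> sph z x) (at z)"
    by (rule Lim_transform_eventually)
qed

section \<open>Growth of the spherical function in the real variable\<close>

lemma norm_pochhammer_le: "norm (pochhammer a n) \<le> pochhammer R n" if "norm a \<le> R" for a :: complex
proof (induction n)
  case (Suc n)
  have R: "R \<ge> 0" using that norm_ge_zero[of a] by linarith
  have "norm (pochhammer a (Suc n)) = norm (pochhammer a n) * norm (a + of_nat n)"
    by (simp add: pochhammer_Suc norm_mult)
  also have "\<dots> \<le> pochhammer R n * (R + of_nat n)"
    using that norm_triangle_ineq[of a "of_nat n"] R by (intro mult_mono Suc order_trans[OF norm_ge_zero Suc]) auto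
  finally show ?case by (simp add: pochhammer_Suc)
qed simp

text \<open>The comparison series is that of \<open>(1 - y) powr (- \<tau>)\<close>. The ratio test
  compares \<open>(norm (a + n))^2\<close> with \<open>(n + 1/2) * (n + \<tau>)\<close>: the margin
  \<open>\<delta>\<close> in the linear term absorbs the constant \<open>R^2\<close> from
  \<open>n = R^2 / \<delta>\<close> on, and the earlier coefficients are put into
  \<open>C\<close>.\<close>

lemma hyp_coeff_half_bound:
  fixes R \<tau> \<delta> :: real
  assumes R: "R > 0" and \<tau>: "\<tau> > 0" and \<delta>: "\<delta> > 0"
  shows "\<exists>C\<ge>0. \<forall>a n. norm a \<le> R \<longrightarrow> 2 * Re a + \<delta> \<le> \<tau> + 1/2 \<longrightarrow>
     norm (hyp_coeff a a (1/2) n) \<le> C * (pochhammer \<tau> n / fact n)"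
proof -
  obtain N :: nat where N: "real N > R\<^sup>2 / \<delta>" using reals_Archimedean2 by blast
  define p where "p n = pochhammer \<tau> n / fact n" for n
  define D where "D n = (pochhammer R n)\<^sup>2 / (pochhammer (1/2) n * fact n)" for n
  have ppos: "p n > 0" for n using \<tau> by (simp add: p_def pochhammer_pos)
  have Dpos: "D n \<ge> 0" for n using R by (simp add: D_def pochhammer_nonneg)
  define C where "C = (\<Sum>n\<le>N. D n / p n)"
  have C0: "C \<ge> 0" unfolding C_def by (intro sum_nonneg divide_nonneg_pos Dpos ppos)
  have half: "norm (pochhammer (1/2 :: complex) n) = pochhammer (1/2) n" for n
  proof -
    have "pochhammer (1/2 :: complex) n = of_real (pochhammer (1/2) n)"
      using pochhammer_of_real[of "1/2" n, where 'a = complex] by simp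
    then show ?thesis by (simp add: pochhammer_nonneg)
  qed
  have "norm (hyp_coeff a a (1/2) n) \<le> C * p n" if a: "norm a \<le> R" "2 * Re a + \<delta> \<le> \<tau> + 1/2" for a n
  proof (cases "n \<le> N")
    case True
    have "norm (hyp_coeff a a (1/2) n) = (norm (pochhammer a n))\<^sup>2 / (pochhammer (1/2) n * fact n)"
      by (simp add: hyp_coeff_def norm_divide norm_mult half power2_eq_square)
    also have "\<dots> \<le> D n" unfolding D_def
      using norm_pochhammer_le[OF a(1)] by (intro divide_right_mono power_mono) (auto simp: pochhammer_nonneg)
    also have "\<dots> = (D n / p n) * p n" using ppos[of n] by simp
    also have "\<dots> \<le> C * p n" unfolding C_def
      using True ppos Dpos by (intro mult_right_mono member_le_sum) (auto intro: less_imp_le divide_nonneg_pos)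
    finally show ?thesis .
  next
    case False
    then have "N \<le> n" by simp
    then show ?thesis
    proof (induction n rule: dec_induct)
      case base
      have "norm (hyp_coeff a a (1/2) N) = (norm (pochhammer a N))\<^sup>2 / (pochhammer (1/2) N * fact N)"
        by (simp add: hyp_coeff_def norm_divide norm_mult half power2_eq_square)
      also have "\<dots> \<le> D N" unfolding D_def
        using norm_pochhammer_le[OF a(1)] by (intro divide_right_mono power_mono) (auto simp: pochhammer_nonneg)
      also have "\<dots> = (D N / p N) * p N" using ppos[of N] by simp
      also have "\<dots> \<le> C * p N" unfolding C_def
        using ppos Dpos by (intro mult_right_mono member_le_sum) (auto intro: less_imp_le divide_nonneg_pos)
      finally show ?case .
    next
      case (step n)
      have nN: "R\<^sup>2 \<le> real n * \<delta>"
      proof -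
        have "R\<^sup>2 < real N * \<delta>" using N \<delta> by (simp add: field_simps)
        also have "\<dots> \<le> real n * \<delta>" using step \<delta> by (intro mult_right_mono) auto
        finally show ?thesis by simp
      qed
      have "(norm (a + of_nat n))\<^sup>2 = (norm a)\<^sup>2 + real n * (2 * Re a) + (real n)\<^sup>2"
        unfolding cmod_power2 by (simp add: algebra_simps power2_eq_square)
      also have "\<dots> \<le> R\<^sup>2 + real n * (\<tau> + 1/2 - \<delta>) + (real n)\<^sup>2"
        using a by (intro add_mono mult_left_mono power_mono) auto
      also have "\<dots> \<le> (real n + 1/2) * (real n + \<tau>)"
        using nN \<tau> by (simp add: algebra_simps power2_eq_square add_divide_distrib)
      finally have sq: "(norm (a + of_nat n))\<^sup>2 \<le> (real n + 1/2) * (real n + \<tau>)" .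
      have nrm: "norm (1/2 + of_nat n :: complex) = real n + 1/2"
      proof -
        have "(1/2 + of_nat n :: complex) = of_real (real n + 1/2)" by simp
        then show ?thesis by (simp only: norm_of_real)
      qed
      have "norm (hyp_coeff a a (1/2) (Suc n)) = norm (hyp_coeff a a (1/2) n) * ((norm (a + of_nat n))\<^sup>2 / ((real n + 1/2) * real (Suc n)))"
        unfolding hyp_coeff_Suc norm_mult[of "hyp_coeff a a (1/2) n"] norm_divide norm_mult[of "a + of_nat n"]
          norm_mult[of "1/2 + of_nat n"] nrm norm_of_nat power2_eq_square ..
      also have "\<dots> \<le> (C * p n) * ((real n + \<tau>) / real (Suc n))"
      proof (intro mult_mono step.IH)
        show "(norm (a + of_nat n))\<^sup>2 / ((real n + 1/2) * real (Suc n)) \<le> (real n + \<tau>) / real (Suc n)"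
          using divide_right_mono[OF sq, of "(real n + 1/2) * real (Suc n)"] by simp
        show "0 \<le> C * p n" using C0 ppos[of n] by simp
      qed auto
      also have "\<dots> = C * p (Suc n)" by (simp add: p_def pochhammer_Suc add.commute mult_ac)
      finally show ?case .
    qed
  qed
  then show ?thesis using C0 unfolding p_def by blast
qed

lemma pochhammer_fact_sums:
  fixes \<tau> y :: real
  assumes y: "\<bar>y\<bar> < 1"
  shows "(\<lambda>n. pochhammer \<tau> n / fact n * y ^ n) sums (1 - y) powr (- \<tau>)"
proof -
  have "(\<lambda>n. (- \<tau> gchoose n) * (- y) ^ n) sums (1 + - y) powr (- \<tau>)"
    using y by (intro gen_binomial_real) auto
  moreover have "(- \<tau> gchoose n) * (- y) ^ n = pochhammer \<tau> n / fact n * y ^ n" for n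
  proof -
    have "(- 1) ^ n * (- 1) ^ n = (1::real)" by (simp flip: power_mult_distrib)
    then show ?thesis unfolding gbinomial_pochhammer power_minus[of y n] by (simp add: field_simps)
  qed
  ultimately show ?thesis by simp
qed

text \<open>The majorant sums to \<open>(1 - y) powr (- \<tau>)\<close>, which is
  \<open>(1 + x^2) powr \<tau>\<close> for \<open>y = x^2 / (1 + x^2)\<close>.\<close>

lemma sph_bound:
  fixes R \<tau> \<delta> :: real
  assumes "R > 0" and \<tau>: "\<tau> > 0" and "\<delta> > 0"
  shows "\<exists>C\<ge>0. \<forall>z x. norm ((z + 1) / 4) \<le> R \<longrightarrow> 2 * Re ((z + 1) / 4) + \<delta> \<le> \<tau> + 1/2 \<longrightarrow>
     norm (sph z x) \<le> C * (1 + x\<^sup>2) powr (\<tau> - Re ((z + 1) / 4))"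
proof -
  obtain C where C: "C \<ge> 0" "\<And>a n. norm a \<le> R \<Longrightarrow> 2 * Re a + \<delta> \<le> \<tau> + 1/2 \<Longrightarrow>
     norm (hyp_coeff a a (1/2) n) \<le> C * (pochhammer \<tau> n / fact n)"
    using hyp_coeff_half_bound[OF assms] by blast
  have "norm (sph z x) \<le> C * (1 + x\<^sup>2) powr (\<tau> - Re ((z + 1) / 4))"
    if z: "norm ((z + 1) / 4) \<le> R" "2 * Re ((z + 1) / 4) + \<delta> \<le> \<tau> + 1/2" for z x
  proof -
    define a where "a = (z + 1) / 4"
    define y where "y = x\<^sup>2 / (1 + x\<^sup>2)"
    have X0: "1 + x\<^sup>2 > 0" by (simp add: add_pos_nonneg)
    have y: "0 \<le> y" "y < 1" using X0 by (auto simp: y_def)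
    have iy: "1 - y = inverse (1 + x\<^sup>2)" using X0 by (simp add: y_def field_simps)
    have ny: "norm (complex_of_real y) < 1" using y by simp
    have sm: "(\<lambda>n. C * (pochhammer \<tau> n / fact n * y ^ n)) sums (C * (1 - y) powr (- \<tau>))"
      using y by (intro sums_mult pochhammer_fact_sums) auto
    have "norm (gauss_F a a (1/2) (of_real y)) \<le> (\<Sum>n. norm (hyp_coeff a a (1/2) n * of_real y ^ n))"
      unfolding gauss_F_def by (rule summable_norm[OF summable_gauss_F[OF ny]])
    also have "\<dots> \<le> (\<Sum>n. C * (pochhammer \<tau> n / fact n * y ^ n))"
    proof (rule suminf_le[OF _ summable_gauss_F[OF ny] sums_summable[OF sm]])
      show "norm (hyp_coeff a a (1/2) n * of_real y ^ n) \<le> C * (pochhammer \<tau> n / fact n * y ^ n)" for n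
        using mult_right_mono[OF C(2)[OF z, of n, folded a_def], of "y ^ n"] y
        by (simp add: norm_mult norm_power mult_ac)
    qed
    also have "\<dots> = C * (1 - y) powr (- \<tau>)" using sm by (simp add: sums_iff)
    also have "\<dots> = C * (1 + x\<^sup>2) powr \<tau>" unfolding iy using X0 by (simp add: powr_minus inverse_powr)
    finally have F: "norm (gauss_F a a (1/2) (of_real y)) \<le> C * (1 + x\<^sup>2) powr \<tau>" .
    have "norm (sph z x) = (1 + x\<^sup>2) powr (- Re a) * norm (gauss_F a a (1/2) (of_real y))"
    proof -
      have "- (z + 1) / 4 = - a" unfolding a_def by (rule minus_divide_left[symmetric])
      then show ?thesis using X0 unfolding sph_def a_def[symmetric] y_def[symmetric] norm_mult
        by (subst norm_powr_real_powr) (simp_all del: of_real_add of_real_power add: less_imp_le)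
    qed
    also have "\<dots> \<le> (1 + x\<^sup>2) powr (- Re a) * (C * (1 + x\<^sup>2) powr \<tau>)"
      by (intro mult_left_mono F) auto
    also have "\<dots> = C * (1 + x\<^sup>2) powr (\<tau> - Re a)"
      using X0 by (simp add: powr_diff powr_minus field_simps)
    finally show ?thesis by (simp add: a_def)
  qed
  then show ?thesis using C(1) by blast
qed

lemma sph_bound_local:
  fixes L :: real
  assumes z0: "\<bar>Re z0\<bar> < 2 * L - 1"
  shows "\<exists>r>0. \<exists>C\<ge>0. \<exists>\<sigma>>1/2. \<forall>z\<in>ball z0 r. \<forall>x. norm (sph z x) \<le> C * (1 + x\<^sup>2) powr (L / 2 - \<sigma>)"
proof -
  define a0 m where "a0 = (Re z0 + 1) / 4" and "m = max 0 (2 * a0 - 1/2)"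
  \<comment> \<open>The bound on coefficients needs \<open>\<tau> > m\<close>, integrability needs
    \<open>\<tau> < a0 + (L - 1) / 2\<close>, and \<open>\<tau>\<close> is the midpoint. The two
    inequalities hidden in \<open>\<bar>Re z0\<bar> < 2 * L - 1\<close> say exactly that this
    interval is nonempty; \<open>g\<close> is half its length.\<close>
  define \<tau> where "\<tau> = (m + a0 + (L - 1) / 2) / 2"
  define g where "g = \<tau> - m"
  have "m < a0 + (L - 1) / 2" using z0 unfolding m_def a0_def by (simp add: abs_less_iff field_simps)
  then have g: "g > 0" "g = a0 + (L - 1) / 2 - \<tau>" by (auto simp: g_def \<tau>_def field_simps)
  have m: "m \<ge> 0" "m \<ge> 2 * a0 - 1/2" by (auto simp: m_def)
  have \<tau>: "\<tau> > 0" using g m by (auto simp: g_def)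
  define R where "R = norm z0 + g + 1"
  have R: "R > 0" using g norm_ge_zero[of z0] unfolding R_def by linarith
  obtain C where C: "C \<ge> 0" "\<And>z x. norm ((z + 1) / 4) \<le> R \<Longrightarrow> 2 * Re ((z + 1) / 4) + g/2 \<le> \<tau> + 1/2 \<Longrightarrow>
     norm (sph z x) \<le> C * (1 + x\<^sup>2) powr (\<tau> - Re ((z + 1) / 4))"
    using sph_bound[OF R \<tau>, of "g/2"] g by auto
  \<comment> \<open>Within distance \<open>g\<close> of \<open>z0\<close> the quantity
    \<open>Re ((z + 1) / 4)\<close> moves by less than \<open>g / 4\<close>, and
    \<open>\<tau> - a0 = (L - 1) / 2 - g\<close>; this leaves the margin \<open>3 / 4 * g\<close>
    beyond 1/2.\<close>
  have "norm (sph z x) \<le> C * (1 + x\<^sup>2) powr (L / 2 - (1/2 + g * 3/4))" if z: "z \<in> ball z0 g" for z x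
  proof -
    have d: "norm (z - z0) < g" using z by (simp add: dist_norm norm_minus_commute)
    have re: "\<bar>Re z - Re z0\<bar> < g" using d abs_Re_le_cmod[of "z - z0"] by simp
    have "norm (sph z x) \<le> C * (1 + x\<^sup>2) powr (\<tau> - Re ((z + 1) / 4))"
    proof (rule C(2))
      have "norm z \<le> norm z0 + g" using d norm_triangle_ineq2[of z z0] by linarith
      then have "norm (z + 1) \<le> R" using norm_triangle_ineq[of z 1] by (simp add: R_def)
      then show "norm ((z + 1) / 4) \<le> R" using norm_ge_zero[of "z + 1"] R by (simp add: norm_divide)
      show "2 * Re ((z + 1) / 4) + g/2 \<le> \<tau> + 1/2"
        using re m(2) by (simp add: g_def a0_def field_simps)
    qed
    also have "\<dots> \<le> C * (1 + x\<^sup>2) powr (L / 2 - (1/2 + g * 3/4))"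
    proof (intro mult_left_mono powr_mono C(1))
      show "\<tau> - Re ((z + 1) / 4) \<le> L / 2 - (1/2 + g * 3/4)"
      proof -
        have "Re z0 - Re z < g" using re by linarith
        then show ?thesis using g(2) by (simp add: a0_def field_simps)
      qed
    qed simp
    finally show ?thesis .
  qed
  then have "\<forall>z\<in>ball z0 g. \<forall>x. norm (sph z x) \<le> C * (1 + x\<^sup>2) powr (L / 2 - (1/2 + g * 3/4))" by blast
  moreover have "1/2 + g * 3/4 > 1/2" using g(1) by simp
  ultimately show ?thesis using g(1) C(1) by blast
qed

section \<open>Integrable majorants on the real line\<close>

lemma integrable_even_of_half_line:
  fixes g :: "real \<Rightarrow> real"
  assumes int: "(g has_integral I) {0..}" and nn: "\<And>x. x \<ge> 0 \<Longrightarrow> g x \<ge> 0"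
    and m: "g \<in> borel_measurable borel"
  shows "integrable lborel (\<lambda>x. g \<bar>x\<bar>)"
proof -
  have "g absolutely_integrable_on {0..}"
    using int nn by (subst absolutely_integrable_on_iff_nonneg) (auto simp: integrable_on_def)
  then have "integrable lebesgue (\<lambda>x. indicator {0..} x * g x)"
    by (simp add: set_integrable_def)
  then have 1: "integrable lborel (\<lambda>x. indicator {0..} x * g x)"
    using m by (subst (asm) integrable_completion) auto
  have 2: "integrable lborel (\<lambda>x. indicator {0..} (- x) * g (- x))"
    using lborel_integrable_real_affine[OF 1, of "- 1" 0] by simp
  show ?thesis
  proof (rule Bochner_Integration.integrable_bound[OF Bochner_Integration.integrable_add[OF 1 2] _ AE_I2])
    show "(\<lambda>x. g \<bar>x\<bar>) \<in> borel_measurable lborel" using m by measurable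
    show "norm (g \<bar>x\<bar>) \<le> norm (indicator {0..} x * g x + indicator {0..} (- x) * g (- x))" for x
      using nn[of "\<bar>x\<bar>"] nn[of x] nn[of "-x"] by (cases "x > 0"; cases "x = 0") (auto simp: indicator_def)
  qed
qed

lemma integrable_exp_abs:
  assumes "c > 0"
  shows "integrable lborel (\<lambda>x::real. exp (- c * \<bar>x\<bar>))"
  by (rule integrable_even_of_half_line[OF has_integral_exp_minus_to_infinity[OF assms, of 0]]) auto

lemma integrable_one_plus_sq_powr:
  assumes \<sigma>: "\<sigma> > 1/2"
  shows "integrable lborel (\<lambda>x::real. (1 + x\<^sup>2) powr (- \<sigma>))"
proof -
  define g where "g x = (if x \<le> 1 then 1 else x powr (- 2 * \<sigma>))" for x :: real
  have "((\<lambda>x::real. 1::real) has_integral 1) {0..1}" using has_integral_const_real[of "1::real" 0 1] by simp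
  then have 1: "(g has_integral 1) {0..1}" by (rule has_integral_eq[rotated]) (auto simp: g_def)
  have "((\<lambda>x. x powr (- 2 * \<sigma>)) has_integral -(1 powr (- 2 * \<sigma> + 1)) / (- 2 * \<sigma> + 1)) {1..}"
    using \<sigma> by (intro has_integral_powr_to_inf) auto
  then have 2: "(g has_integral -(1 powr (- 2 * \<sigma> + 1)) / (- 2 * \<sigma> + 1)) {1..}" by (rule has_integral_eq[rotated]) (auto simp: g_def)
  have "negligible ({0..1} \<inter> {1..} :: real set)"
  proof -
    have "{0..1} \<inter> {1..} = {1::real}" by auto
    then show ?thesis by simp
  qed
  from has_integral_Un[OF 1 2 this]
  have "(g has_integral (1 + -(1 powr (- 2 * \<sigma> + 1)) / (- 2 * \<sigma> + 1))) ({0..1} \<union> {1..})" .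
  moreover have "{0..1} \<union> {1..} = {0::real..}" by auto
  ultimately have "(g has_integral (1 + -(1 powr (- 2 * \<sigma> + 1)) / (- 2 * \<sigma> + 1))) {0..}" by simp
  then have "integrable lborel (\<lambda>x. g \<bar>x\<bar>)"
    by (rule integrable_even_of_half_line) (auto simp: g_def[abs_def])
  then show ?thesis
  proof (rule Bochner_Integration.integrable_bound[OF _ _ AE_I2])
    fix x :: real
    have "(1 + x\<^sup>2) powr (- \<sigma>) \<le> g \<bar>x\<bar>"
    proof (cases "\<bar>x\<bar> \<le> 1")
      case True
      have "(1 + x\<^sup>2) powr (- \<sigma>) \<le> 1 powr (- \<sigma>)" using \<sigma> by (intro powr_mono2') auto
      then show ?thesis using True by (simp add: g_def)
    next
      case False
      then have "(1 + x\<^sup>2) powr (- \<sigma>) \<le> (x\<^sup>2) powr (- \<sigma>)" using \<sigma> by (intro powr_mono2') auto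
      also have "(x\<^sup>2) powr (- \<sigma>) = \<bar>x\<bar> powr (- 2 * \<sigma>)"
      proof -
        have "x\<^sup>2 = \<bar>x\<bar> powr 2" using False by (simp add: powr_numeral)
        then show ?thesis unfolding \<open>x\<^sup>2 = _\<close> powr_powr by simp
      qed
      finally show ?thesis using False by (simp add: g_def)
    qed
    then show "norm ((1 + x\<^sup>2) powr (- \<sigma>)) \<le> norm (g \<bar>x\<bar>)" by (simp add: abs_of_nonneg)
  qed auto
qed

section \<open>Kernel integrals over the real line\<close>

lemma lebesgue_integral_real_line_FTC:
  fixes f F :: "real \<Rightarrow> complex"
  assumes F: "\<And>x. (F has_vector_derivative f x) (at x)" and f: "\<And>x. isCont f x"
    and int: "integrable lborel f" and lim: "(F \<longlongrightarrow> 0) at_top" "(F \<longlongrightarrow> 0) at_bot"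
  shows "(LINT x|lborel. f x) = 0"
proof -
  have "(LBINT x=-\<infinity>..\<infinity>. f x) = 0 - 0"
  proof (rule interval_integral_FTC_integrable)
    show "set_integrable lborel (einterval (-\<infinity>) \<infinity>) f" using int by (simp add: set_integrable_def)
    show "((F \<circ> real_of_ereal) \<longlongrightarrow> 0) (at_right (-\<infinity>))" "((F \<circ> real_of_ereal) \<longlongrightarrow> 0) (at_left \<infinity>)"
      using lim by (simp_all add: ereal_tendsto_simps1)
  qed (use F f in auto)
  then show ?thesis by (simp add: interval_lebesgue_integral_def set_lebesgue_integral_def)
qed

text \<open>The contour is closed by a half circle, whose contribution is at most its length times
  \<open>R powr (- p)\<close> and so tends to 0 for \<open>p > 1\<close>. Holomorphy slightly below
  the real axis puts the whole contour into an open convex set.\<close>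

lemma lebesgue_integral_upper_half_plane:
  fixes G :: "complex \<Rightarrow> complex"
  assumes hol: "G holomorphic_on {u. Im u > - \<epsilon>}" and \<epsilon>: "\<epsilon> > 0" and p: "p > 1"
    and bd: "\<And>u. Im u \<ge> 0 \<Longrightarrow> norm u \<ge> R0 \<Longrightarrow> norm (G u) \<le> C * norm u powr (- p)"
    and int: "integrable lborel (\<lambda>x::real. G (of_real x))"
  shows "(LINT x|lborel. G (of_real x)) = 0"
proof -
  let ?S = "{u. Im u > - \<epsilon>}"
  have conv: "convex ?S" by (rule convex_halfspace_Im_gt)
  have arc: "path_image (part_circlepath 0 R 0 pi) \<subseteq> {u. Im u \<ge> 0 \<and> norm u = R}" if "R > 0" for R
  proof
    fix u assume "u \<in> path_image (part_circlepath 0 R 0 pi)"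
    then obtain x where x: "x \<in> {0..pi}" "u = of_real R * cis x"
      by (auto simp: path_image_part_circlepath' closed_segment_eq_real_ivl)
    then show "u \<in> {u. Im u \<ge> 0 \<and> norm u = R}" using that sin_ge_zero[of x] by (auto simp: norm_mult)
  qed
  have bnd: "norm (integral {-R..R} (\<lambda>x. G (of_real x))) \<le> \<bar>C\<bar> * R powr (1 - p) * pi" if R: "R > 0" "R \<ge> R0" for R
  proof -
    have sub: "path_image (part_circlepath 0 R 0 pi) \<subseteq> ?S" using arc[OF R(1)] \<epsilon> by force
    have seg: "closed_segment (of_real (-R)) (of_real R) \<subseteq> ?S" using \<epsilon> by (auto simp: closed_segment_def)
    have vp: "valid_path (linepath (of_real (-R)) (of_real R) +++ part_circlepath 0 R 0 pi)"
      by (intro valid_path_join) auto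
    have "(G has_contour_integral 0) (linepath (of_real (-R)) (of_real R) +++ part_circlepath 0 R 0 pi)"
    proof (rule Cauchy_theorem_convex_simple[OF hol conv vp])
      show "path_image (linepath (of_real (- R)) (of_real R) +++ part_circlepath 0 R 0 pi) \<subseteq> ?S"
        using sub seg by (intro subset_path_image_join) auto
    qed auto
    then have z: "contour_integral (linepath (of_real (-R)) (of_real R) +++ part_circlepath 0 R 0 pi) G = 0"
      by (rule contour_integral_unique)
    have i1: "G contour_integrable_on linepath (of_real (-R)) (of_real R)"
      using hol seg by (intro contour_integrable_continuous_linepath)
         (meson holomorphic_on_imp_continuous_on holomorphic_on_subset)
    have i2: "G contour_integrable_on part_circlepath 0 R 0 pi"
      using hol sub by (intro contour_integrable_continuous_part_circlepath)
         (meson holomorphic_on_imp_continuous_on holomorphic_on_subset)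
    have "contour_integral (linepath (of_real (-R)) (of_real R)) G = - contour_integral (part_circlepath 0 R 0 pi) G"
      using z i1 i2 by (simp add: add_eq_0_iff2)
    moreover have "norm (contour_integral (part_circlepath 0 R 0 pi) G) \<le> (\<bar>C\<bar> * R powr (- p)) * R * \<bar>pi - 0\<bar>"
    proof (rule contour_integral_bound_part_circlepath[OF i2])
      fix x assume "x \<in> path_image (part_circlepath 0 R 0 pi)"
      then have x: "Im x \<ge> 0" "norm x = R" using arc[OF R(1)] by auto
      have "norm (G x) \<le> C * norm x powr (- p)" using bd x R by auto
      also have "\<dots> \<le> \<bar>C\<bar> * R powr (- p)" using x by (intro mult_mono) auto
      finally show "norm (G x) \<le> \<bar>C\<bar> * R powr (- p)" .
    qed (use R in auto)
    moreover have "contour_integral (linepath (of_real (-R)) (of_real R)) G = integral {-R..R} (\<lambda>x. G (of_real x))"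
      using R by (subst contour_integral_linepath_Reals_eq) auto
    moreover have "R powr (- p) * R = R powr (1 - p)" using R by (simp add: powr_diff powr_minus field_simps)
    ultimately show ?thesis by (metis abs_of_pos diff_zero mult.assoc norm_minus_cancel pi_gt_zero)
  qed
  have cont: "continuous_on UNIV (\<lambda>x::real. G (of_real x))"
    by (rule continuous_on_compose2[OF holomorphic_on_imp_continuous_on[OF hol]]) (use \<epsilon> in \<open>auto intro!: continuous_intros\<close>)
  have "(\<lambda>n::nat. LINT x|lborel. indicator {- real n..real n} x *\<^sub>R G (of_real x)) \<longlonglongrightarrow> (LINT x|lborel. G (of_real x))"
  proof (rule integral_dominated_convergence[where w = "\<lambda>x. norm (G (of_real x))"])
    show "AE x in lborel. (\<lambda>n. indicator {- real n..real n} x *\<^sub>R G (of_real x)) \<longlonglongrightarrow> G (of_real x)"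
    proof (rule AE_I2)
      fix x :: real
      obtain N :: nat where N: "\<bar>x\<bar> \<le> real N" using real_arch_simple by blast
      have "eventually (\<lambda>n. indicator {- real n..real n} x *\<^sub>R G (of_real x) = G (of_real x)) sequentially"
        using eventually_ge_at_top[of N] by eventually_elim (use N in \<open>auto simp: indicator_def\<close>)
      then show "(\<lambda>n. indicator {- real n..real n} x *\<^sub>R G (of_real x)) \<longlonglongrightarrow> G (of_real x)"
        by (rule tendsto_eventually)
    qed
  qed (use int in \<open>auto simp: indicator_def intro!: borel_measurable_scaleR borel_measurable_integrable\<close>)
  moreover have "(LINT x|lborel. indicator {- real n..real n} x *\<^sub>R G (of_real x)) = integral {-real n..real n} (\<lambda>x. G (of_real x))" for n
  proof -
    have "set_integrable lborel {- real n..real n} (\<lambda>x. G (of_real x))"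
      by (rule borel_integrable_atLeastAtMost') (rule continuous_on_subset[OF cont], simp)
    from set_borel_integral_eq_integral(2)[OF this] show ?thesis by (simp add: set_lebesgue_integral_def)
  qed
  ultimately have lim1: "(\<lambda>n::nat. integral {-real n..real n} (\<lambda>x. G (of_real x))) \<longlonglongrightarrow> (LINT x|lborel. G (of_real x))"
    by simp
  have "(\<lambda>n::nat. integral {-real n..real n} (\<lambda>x. G (of_real x))) \<longlonglongrightarrow> 0"
  proof (rule Lim_null_comparison)
    show "\<forall>\<^sub>F n in sequentially. norm (integral {-real n..real n} (\<lambda>x. G (of_real x))) \<le> \<bar>C\<bar> * real n powr (1 - p) * pi"
    proof -
      obtain N :: nat where N: "R0 \<le> real N" using real_arch_simple by blast
      show ?thesis using eventually_ge_at_top[of "N + 1"]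
        by eventually_elim (rule bnd, use N in auto)
    qed
    show "(\<lambda>n. \<bar>C\<bar> * real n powr (1 - p) * pi) \<longlonglongrightarrow> 0"
      using p by real_asymp
  qed
  then show ?thesis using lim1 LIMSEQ_unique by blast
qed

lemma norm_powr_of_real_exponent:
  fixes z :: complex
  assumes "z \<noteq> 0"
  shows "norm (z powr of_real q) = norm z powr q"
  using assms by (simp add: powr_def)

lemma norm_add_ii_ge:
  fixes t x :: real
  assumes "t > 0"
  shows "norm (of_real t + \<i> * of_real x) \<ge> min 1 t * sqrt (1 + x\<^sup>2)"
proof -
  have "(min 1 t)\<^sup>2 * (1 + x\<^sup>2) \<le> t\<^sup>2 + x\<^sup>2"
  proof -
    have "(min 1 t)\<^sup>2 \<le> 1" "(min 1 t)\<^sup>2 \<le> t\<^sup>2" using assms by (auto simp: min_def power2_le_iff_abs_le power_le_one)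
    then have "(min 1 t)\<^sup>2 * x\<^sup>2 \<le> 1 * x\<^sup>2" by (intro mult_right_mono) auto
    then show ?thesis using \<open>(min 1 t)\<^sup>2 \<le> t\<^sup>2\<close> by (simp add: algebra_simps)
  qed
  then have "sqrt ((min 1 t)\<^sup>2 * (1 + x\<^sup>2)) \<le> sqrt (t\<^sup>2 + x\<^sup>2)" by (rule real_sqrt_le_mono)
  then show ?thesis using assms by (simp add: cmod_def real_sqrt_mult)
qed

text \<open>The integrand in \<open>x\<close> after the interchange: the first factor comes from the
  test function, the second from the spherical function with \<open>T\<close> a value of
  \<open>cosh\<close>. The zero of the first base lies in the upper half plane, that of the second
  in the lower one, so the integral need not vanish.\<close>

definition line_kernel :: "real \<Rightarrow> real \<Rightarrow> nat \<Rightarrow> real \<Rightarrow> real \<Rightarrow> complex" where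
  "line_kernel t T k q x = inverse ((of_real t + \<i> * of_real x) ^ k) * (of_real T - \<i> * of_real x) powr (- of_real q)"

lemma Re_pos_slit: "Re z > 0 \<Longrightarrow> z \<notin> \<real>\<^sub>\<le>\<^sub>0 \<and> z \<noteq> 0" for z :: complex
  by (auto simp: complex_nonpos_Reals_iff)

lemma line_kernel_bound:
  assumes t: "t > 0" and T: "T > 0" and q: "q \<ge> 0"
  shows "norm (line_kernel t T k q x) \<le> (min 1 (min t T)) powr (- (real k + q)) * (1 + x\<^sup>2) powr (- (real k + q) / 2)"
proof -
  define m s where "m = min 1 (min t T)" and "s = sqrt (1 + x\<^sup>2)"
  have m: "m > 0" using t T by (simp add: m_def)
  have s: "s > 0" by (simp add: s_def add_pos_nonneg)
  have 1: "norm (of_real t + \<i> * of_real x) \<ge> m * s"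
    using order_trans[OF mult_right_mono[of m "min 1 t" s] norm_add_ii_ge[OF t, of x, folded s_def]] s
    by (simp add: m_def)
  have 2: "norm (of_real T - \<i> * of_real x) \<ge> m * s"
    using order_trans[OF mult_right_mono[of m "min 1 T" s] norm_add_ii_ge[OF T, of "- x", unfolded power2_minus, folded s_def]] s
    by (simp add: m_def)
  have ms: "m * s > 0" using m s by simp
  have ne: "of_real T - \<i> * of_real x \<noteq> 0" using T by (auto simp: complex_eq_iff)
  have e: "- complex_of_real q = of_real (- q)" by simp
  have "norm (line_kernel t T k q x) = inverse (norm (of_real t + \<i> * of_real x) ^ k) * norm (of_real T - \<i> * of_real x) powr (- q)"
    unfolding line_kernel_def norm_mult norm_inverse norm_power e norm_powr_of_real_exponent[OF ne] ..
  also have "\<dots> \<le> inverse ((m * s) ^ k) * (m * s) powr (- q)"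
    using ms 1 2 q by (intro mult_mono le_imp_inverse_le power_mono powr_mono2') auto
  also have "\<dots> = (m * s) powr (- (real k + q))"
    using ms by (simp add: powr_diff powr_minus powr_realpow field_simps)
  also have "\<dots> = m powr (- (real k + q)) * s powr (- (real k + q))"
    using m s by (simp add: powr_mult)
  also have "s powr (- (real k + q)) = (1 + x\<^sup>2) powr (- (real k + q) / 2)"
    unfolding s_def by (subst powr_half_sqrt[symmetric]) (auto simp: powr_powr)
  finally show ?thesis by (simp add: m_def)
qed

lemma line_kernel_continuous:
  assumes t: "t > 0" and T: "T > 0"
  shows "continuous_on UNIV (line_kernel t T k q)"
proof -
  have 1: "of_real t + \<i> * of_real x \<noteq> 0" for x
    using Re_pos_slit[of "of_real t + \<i> * of_real x"] t by simp
  have 2: "of_real T - \<i> * of_real x \<noteq> 0" for x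
    using Re_pos_slit[of "of_real T - \<i> * of_real x"] T by simp
  have "continuous_on UNIV (\<lambda>x::real. (of_real T - \<i> * of_real x) powr (- of_real q))"
  proof (rule continuous_on_powr_complex)
    show "UNIV \<subseteq> {x. 0 \<le> Re (of_real T - \<i> * of_real x) \<or> Im (of_real T - \<i> * of_real x) \<noteq> 0}" using T by auto
    show "0 < Re (- complex_of_real q)" if "of_real T - \<i> * of_real x = 0" for x using 2 that by blast
  qed (intro continuous_intros)+
  moreover have "continuous_on UNIV (\<lambda>x::real. inverse ((of_real t + \<i> * of_real x) ^ k))"
    by (intro continuous_on_inverse continuous_intros ballI power_not_zero 1)
  ultimately show ?thesis unfolding line_kernel_def[abs_def] by (intro continuous_on_mult)
qed

lemma line_kernel_integrable:
  assumes t: "t > 0" and T: "T > 0" and q: "q \<ge> 0" "real k + q > 1"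
  shows "integrable lborel (line_kernel t T k q)"
proof (rule Bochner_Integration.integrable_bound)
  show "integrable lborel (\<lambda>x. (min 1 (min t T)) powr (- (real k + q)) * (1 + x\<^sup>2) powr (- ((real k + q) / 2)))"
    using q by (intro integrable_mult_right integrable_one_plus_sq_powr) auto
  show "line_kernel t T k q \<in> borel_measurable lborel"
    using line_kernel_continuous[OF t T] by (simp add: borel_measurable_continuous_onI)
  show "AE x in lborel. norm (line_kernel t T k q x) \<le> norm ((min 1 (min t T)) powr (- (real k + q)) * (1 + x\<^sup>2) powr (- ((real k + q) / 2)))"
  proof (rule AE_I2)
    fix x
    have "- ((real k + q) / 2) = - (real k + q) / 2" by (rule minus_divide_left)
    then show "norm (line_kernel t T k q x) \<le> norm ((min 1 (min t T)) powr (- (real k + q)) * (1 + x\<^sup>2) powr (- ((real k + q) / 2)))"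
      using line_kernel_bound[OF t T q(1), of k x] by (simp only: real_norm_def abs_mult abs_of_nonneg powr_ge_zero)
  qed
qed

lemma integral_poisson_kernel:
  assumes t: "t > 0"
  shows "integrable lborel (\<lambda>x::real. inverse (t\<^sup>2 + x\<^sup>2))" "(LINT x|lborel. inverse (t\<^sup>2 + x\<^sup>2)) = pi / t"
proof -
  have F: "DERIV (\<lambda>x. arctan (x / t) / t) x :> inverse (t\<^sup>2 + x\<^sup>2)" for x
  proof -
    have p: "t\<^sup>2 + x\<^sup>2 > 0" using t by (simp add: add_pos_nonneg)
    have "((\<lambda>x. arctan (x / t) / t) has_real_derivative (inverse (1 + (x / t)\<^sup>2) * (1 / t)) / t) (at x)"
      using t by (auto intro!: derivative_eq_intros)
    moreover have "1 + (x / t)\<^sup>2 = (t\<^sup>2 + x\<^sup>2) / t\<^sup>2" using t by (simp add: field_simps)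
    ultimately show ?thesis using t p by (simp add: power2_eq_square inverse_eq_divide)
  qed
  have cont: "isCont (\<lambda>x. inverse (t\<^sup>2 + x\<^sup>2)) x" for x
  proof -
    have "t\<^sup>2 + x\<^sup>2 > 0" using t by (simp add: add_pos_nonneg)
    then show ?thesis using t by (intro continuous_intros) simp
  qed
  have lt: "((\<lambda>x. arctan (x / t) / t) \<longlongrightarrow> pi / 2 / t) at_top"
  proof -
    have "((\<lambda>x. arctan (x / t) / t) \<longlongrightarrow> pi * inverse t / 2) at_top" using t by real_asymp
    moreover have "pi * inverse t / 2 = pi / 2 / t" using t by (simp add: field_simps)
    ultimately show ?thesis by (simp only:)
  qed
  have lb: "((\<lambda>x. arctan (x / t) / t) \<longlongrightarrow> - (pi / 2) / t) at_bot"
  proof -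
    have "((\<lambda>x. - (arctan (x / t) / t)) \<longlongrightarrow> - (pi / 2 / t)) at_top" using lt by (rule tendsto_minus)
    then show ?thesis unfolding filterlim_at_bot_mirror by (simp add: arctan_minus)
  qed
  have nn: "0 \<le> inverse (t\<^sup>2 + x\<^sup>2)" for x by simp
  note FTC = interval_integral_FTC_nonneg[of "-\<infinity>" "\<infinity>" "\<lambda>x. arctan (x / t) / t" "\<lambda>x. inverse (t\<^sup>2 + x\<^sup>2)" "- (pi / 2) / t" "pi / 2 / t",
      OF _ F cont AE_I2]
  have ends: "(((\<lambda>x. arctan (x / t) / t) \<circ> real_of_ereal) \<longlongrightarrow> - (pi / 2) / t) (at_right (-\<infinity>))"
    "(((\<lambda>x. arctan (x / t) / t) \<circ> real_of_ereal) \<longlongrightarrow> pi / 2 / t) (at_left \<infinity>)"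
    using lt lb by (simp_all only: ereal_tendsto_simps1)
  have si: "set_integrable lborel (einterval (-\<infinity>) \<infinity>) (\<lambda>x. inverse (t\<^sup>2 + x\<^sup>2))"
    by (rule FTC(1)) (use nn ends in simp_all)
  have val: "(LBINT x=-\<infinity>..\<infinity>. inverse (t\<^sup>2 + x\<^sup>2)) = pi / 2 / t - (- (pi / 2) / t)"
    by (rule FTC(2)) (use nn ends in simp_all)
  show "integrable lborel (\<lambda>x::real. inverse (t\<^sup>2 + x\<^sup>2))" using si by (simp add: set_integrable_def)
  show "(LINT x|lborel. inverse (t\<^sup>2 + x\<^sup>2)) = pi / t"
    using val by (simp add: interval_lebesgue_integral_def set_lebesgue_integral_def)
qed

lemma half_plane_norms:
  fixes u :: complex
  assumes "Im u \<ge> 0" "T > 0"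
  shows "norm u \<le> norm (of_real T - \<i> * u)" "Re (of_real T - \<i> * u) > 0"
proof -
  have "(norm u)\<^sup>2 \<le> (norm (of_real T - \<i> * u))\<^sup>2"
    unfolding cmod_power2 using assms by (simp add: power2_eq_square algebra_simps)
  then show "norm u \<le> norm (of_real T - \<i> * u)" by (rule power2_le_imp_le) simp
qed (use assms in simp)

text \<open>With equal signs both bases have positive real part on the upper half plane, so the
  integrand is holomorphic there and the contour can be closed.\<close>

lemma integral_conj_line_kernel:
  assumes t: "t > 0" and T: "T > 0" and q: "q \<ge> 0" "real k + q > 1"
  shows "integrable lborel (\<lambda>x. inverse ((of_real t - \<i> * of_real x) ^ k) * (of_real T - \<i> * of_real x) powr (- of_real q))"
    and "(LINT x|lborel. inverse ((of_real t - \<i> * of_real x) ^ k) * (of_real T - \<i> * of_real x) powr (- of_real q)) = 0"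
proof -
  define G where "G u = inverse ((of_real t - \<i> * u) ^ k) * (of_real T - \<i> * u) powr (- of_real q)" for u
  have re: "Re (of_real t - \<i> * u) > 0" "Re (of_real T - \<i> * u) > 0" if "Im u > - min t T" for u
    using that by auto
  have hol: "G holomorphic_on {u. Im u > - min t T}"
    unfolding G_def using Re_pos_slit[OF re(1)] Re_pos_slit[OF re(2)]
    by (intro holomorphic_intros) auto
  have cont: "continuous_on UNIV (\<lambda>x::real. G (of_real x))"
    by (rule continuous_on_compose2[OF holomorphic_on_imp_continuous_on[OF hol]]) (use t T in \<open>auto intro!: continuous_intros\<close>)
  have eq: "norm (G (of_real x)) = norm (line_kernel t T k q x)" for x
  proof -
    have "norm (of_real t - \<i> * of_real x) = norm (of_real t + \<i> * of_real x)" by (simp add: cmod_def)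
    then show ?thesis by (simp add: G_def line_kernel_def norm_mult norm_inverse norm_power)
  qed
  have int: "integrable lborel (\<lambda>x. G (of_real x))"
    by (rule Bochner_Integration.integrable_bound[OF line_kernel_integrable[OF t T q] _ AE_I2])
       (use cont eq in \<open>auto simp: borel_measurable_continuous_onI\<close>)
  then show "integrable lborel (\<lambda>x. inverse ((of_real t - \<i> * of_real x) ^ k) * (of_real T - \<i> * of_real x) powr (- of_real q))"
    by (simp add: G_def)
  have "(LINT x|lborel. G (of_real x)) = 0"
  proof (rule lebesgue_integral_upper_half_plane[OF hol _ q(2), of 1 1])
    fix u :: complex assume u: "Im u \<ge> 0" "norm u \<ge> 1"
    note n = half_plane_norms[OF u(1) t] half_plane_norms[OF u(1) T]
    have e: "- complex_of_real q = of_real (- q)" by simp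
    have ne: "of_real T - \<i> * u \<noteq> 0" using Re_pos_slit[OF n(4)] by simp
    have "norm (G u) = inverse (norm (of_real t - \<i> * u) ^ k) * norm (of_real T - \<i> * u) powr (- q)"
      unfolding G_def norm_mult norm_inverse norm_power e norm_powr_of_real_exponent[OF ne] ..
    also have "\<dots> \<le> inverse (norm u ^ k) * norm u powr (- q)"
      using n u q less_le_trans[OF zero_less_one u(2)] by (intro mult_mono le_imp_inverse_le power_mono powr_mono2') auto
    also have "\<dots> = 1 * norm u powr (- (real k + q))"
    proof -
      have "norm u > 0" using u by linarith
      then show ?thesis by (simp add: powr_diff powr_minus powr_realpow field_simps)
    qed
    finally show "norm (G u) \<le> 1 * norm u powr (- (real k + q))" .
  qed (use t T int in auto)
  then show "(LINT x|lborel. inverse ((of_real t - \<i> * of_real x) ^ k) * (of_real T - \<i> * of_real x) powr (- of_real q)) = 0"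
    by (simp add: G_def)
qed

text \<open>Subtracting a multiple of the Poisson kernel removes the pole in the half plane in which the
  other factor is holomorphic, so that Cauchy's theorem applies.\<close>

lemma integral_line_kernel_1:
  assumes t: "t > 0" and T: "T > 0" and q: "q > 0"
  shows "(LINT x|lborel. line_kernel t T 1 q x) = of_real (2 * pi * (t + T) powr (- q))"
proof -
  \<comment> \<open>\<open>K\<close> is the value of the second factor at the pole
    \<open>u = \<i> * t\<close>, where \<open>2 * t / (t - \<i> * u)\<close> equals 1; hence
    \<open>N\<close> vanishes at the pole.\<close>
  define K where "K = complex_of_real ((t + T) powr (- q))"
  define N where "N u = (of_real T - \<i> * u) powr (- of_real q) - K * (2 * of_real t / (of_real t - \<i> * u))" for u
  define S where "S = {u. Im u > - min t T}"
  have S: "open S" unfolding S_def by (rule open_halfspace_Im_gt)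
  have re: "Re (of_real t - \<i> * u) > 0" "Re (of_real T - \<i> * u) > 0" if "u \<in> S" for u
    using that by (auto simp: S_def)
  have e: "- complex_of_real q = of_real (- q)" by simp
  have holN: "N holomorphic_on S"
    unfolding N_def using Re_pos_slit[OF re(1)] Re_pos_slit[OF re(2)]
    by (intro holomorphic_intros) auto
  have N0: "N (\<i> * of_real t) = 0"
  proof -
    have *: "of_real T - \<i> * (\<i> * complex_of_real t) = of_real (t + T)" "of_real t - \<i> * (\<i> * complex_of_real t) = of_real (2 * t)"
      by (simp_all add: complex_eq_iff)
    have "complex_of_real (t + T) powr of_real (- q) = K"
      unfolding K_def using t T by (intro powr_of_real) auto
    then show ?thesis unfolding N_def * e using t by simp
  qed
  \<comment> \<open>The quotient of \<open>N\<close> by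
    \<open>t + \<i> * u = \<i> * (u - \<i> * t)\<close>, with the removable singularity filled in by
    the derivative.\<close>
  define G where "G u = (if u = \<i> * of_real t then deriv N (\<i> * of_real t) else (N u - N (\<i> * of_real t)) / (u - \<i> * of_real t)) / \<i>" for u
  have hol: "G holomorphic_on S"
    unfolding G_def by (intro holomorphic_on_divide pole_lemma_open[OF holN S] holomorphic_intros) auto
  have Gx: "G (of_real x) = line_kernel t T 1 q x - of_real (2 * t * (t + T) powr (- q)) * of_real (inverse (t\<^sup>2 + x\<^sup>2))" for x
  proof -
    have ne: "of_real x \<noteq> \<i> * complex_of_real t" using t by (auto simp: complex_eq_iff)
    have a: "\<i> * (of_real x - \<i> * of_real t) = of_real t + \<i> * of_real x" by (simp add: complex_eq_iff)
    have b: "(of_real t + \<i> * of_real x) * (of_real t - \<i> * of_real x) = complex_of_real (t\<^sup>2 + x\<^sup>2)"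
      by (simp add: complex_eq_iff power2_eq_square)
    have "G (of_real x) = N (of_real x) / (of_real t + \<i> * of_real x)"
    proof -
      have "G (of_real x) = N (of_real x) / (of_real x - \<i> * of_real t) / \<i>"
        using ne unfolding G_def N0 by (simp only: if_False diff_zero)
      then show ?thesis unfolding a[symmetric] by (simp only: divide_divide_eq_left mult.commute)
    qed
    also have "\<dots> = line_kernel t T 1 q x - K * 2 * of_real t / ((of_real t + \<i> * of_real x) * (of_real t - \<i> * of_real x))"
      unfolding N_def line_kernel_def by (simp only: divide_inverse inverse_mult_distrib power_one_right) (simp add: algebra_simps)
    finally show ?thesis unfolding b K_def by (simp add: divide_inverse mult_ac)
  qed
  have i1: "integrable lborel (line_kernel t T 1 q)" using q by (intro line_kernel_integrable t T) auto
  have i2: "integrable lborel (\<lambda>x. complex_of_real (2 * t * (t + T) powr (- q)) * of_real (inverse (t\<^sup>2 + x\<^sup>2)))"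
    by (intro integrable_mult_right integrable_of_real integral_poisson_kernel t)
  have int: "integrable lborel (\<lambda>x. G (of_real x))" unfolding Gx using i1 i2 by (rule Bochner_Integration.integrable_diff)
  \<comment> \<open>The subtracted term decays only like \<open>1 / norm u\<close>, which caps the
    decay of \<open>N\<close> at \<open>min q 1\<close>. The factor 2 in \<open>C\<close> comes from
    \<open>norm (u - \<i> * t) \<ge> norm u / 2\<close> for
    \<open>norm u \<ge> 2 * t\<close>.\<close>
  define p where "p = 1 + min q 1"
  define C where "C = 2 * (1 + (t + T) powr (- q) * 2 * t)"
  have "(LINT x|lborel. G (of_real x)) = 0"
  proof (rule lebesgue_integral_upper_half_plane[OF hol[unfolded S_def], of p "max 1 (2 * t)" C])
    fix u :: complex assume u: "Im u \<ge> 0" "norm u \<ge> max 1 (2 * t)"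
    note n = half_plane_norms[OF u(1) t] half_plane_norms[OF u(1) T]
    have u1: "norm u \<ge> 1" "norm u \<ge> 2 * t" using u by auto
    have ne: "of_real T - \<i> * u \<noteq> 0" using Re_pos_slit[OF n(4)] by simp
    have d: "norm (u - \<i> * of_real t) \<ge> norm u / 2"
      using norm_triangle_ineq2[of u "\<i> * of_real t"] u1 t by (simp add: norm_mult)
    have neu: "u \<noteq> \<i> * of_real t" using d u1 by auto
    have "norm ((of_real T - \<i> * u) powr (- of_real q)) \<le> norm u powr (- q)"
      unfolding e norm_powr_of_real_exponent[OF ne] using n u1 q by (intro powr_mono2') auto
    also have "\<dots> \<le> norm u powr (- min q 1)" using u1 by (intro powr_mono) auto
    finally have b1: "norm ((of_real T - \<i> * u) powr (- of_real q)) \<le> norm u powr (- min q 1)" .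
    have "norm (K * (2 * of_real t / (of_real t - \<i> * u))) = (t + T) powr (- q) * 2 * t / norm (of_real t - \<i> * u)"
      using t by (simp add: K_def norm_mult norm_divide)
    also have "\<dots> \<le> (t + T) powr (- q) * 2 * t / norm u"
      using n u1 t by (intro divide_left_mono mult_nonneg_nonneg mult_pos_pos) auto
    also have "\<dots> = (t + T) powr (- q) * 2 * t * norm u powr (- 1)"
      using u1 by (simp add: powr_minus divide_inverse)
    also have "\<dots> \<le> (t + T) powr (- q) * 2 * t * norm u powr (- min q 1)"
      using u1 t by (intro mult_left_mono powr_mono) auto
    finally have b2: "norm (K * (2 * of_real t / (of_real t - \<i> * u))) \<le> (t + T) powr (- q) * 2 * t * norm u powr (- min q 1)" .
    have "norm (N u) \<le> (1 + (t + T) powr (- q) * 2 * t) * norm u powr (- min q 1)"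
      unfolding N_def using norm_triangle_le_diff[OF add_mono[OF b1 b2]] by (simp add: algebra_simps)
    then have "norm (N u) / norm (u - \<i> * of_real t) \<le> ((1 + (t + T) powr (- q) * 2 * t) * norm u powr (- min q 1)) / (norm u / 2)"
      using d u1 t less_le_trans[OF zero_less_one u1(1)] by (intro frac_le mult_nonneg_nonneg add_nonneg_nonneg) auto
    moreover have "norm (G u) = norm (N u) / norm (u - \<i> * of_real t)"
      unfolding G_def N0 using neu by (simp add: norm_divide norm_mult)
    ultimately have "norm (G u) \<le> ((1 + (t + T) powr (- q) * 2 * t) * norm u powr (- min q 1)) / (norm u / 2)"
      by (simp only:)
    also have "\<dots> = C * norm u powr (- p)"
      using u1 by (simp add: C_def p_def powr_diff powr_minus field_simps)
    finally show "norm (G u) \<le> C * norm u powr (- p)" .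
  qed (use t T q int in \<open>auto simp: p_def\<close>)
  then have "(LINT x|lborel. line_kernel t T 1 q x) = of_real (2 * t * (t + T) powr (- q)) * (LINT x|lborel. complex_of_real (inverse (t\<^sup>2 + x\<^sup>2)))"
    unfolding Gx Bochner_Integration.integral_diff[OF i1 i2] integral_mult_right_zero by (simp only: right_minus_eq)
  also have "(LINT x|lborel. complex_of_real (inverse (t\<^sup>2 + x\<^sup>2))) = of_real (pi / t)"
    by (simp only: integral_complex_of_real integral_poisson_kernel(2)[OF t])
  finally show ?thesis using t by (simp add: mult_ac)
qed

text \<open>Integrating the derivative of the kernel with exponents \<open>Suc k\<close> and
  \<open>q\<close> to 0 relates the exponents \<open>(Suc (Suc k), q)\<close> and
  \<open>(Suc k, q + 1)\<close>. The induction therefore runs over all \<open>q\<close> at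
  once.\<close>

lemma integral_line_kernel:
  assumes t: "t > 0" and T: "T > 0" and q: "q > 0"
  shows "(LINT x|lborel. line_kernel t T (Suc k) q x) = of_real (pochhammer q k / fact k * (2 * pi) * (t + T) powr (- q - real k))"
  using q
proof (induction k arbitrary: q)
  case 0
  then show ?case using integral_line_kernel_1[OF t T] by simp
next
  case (Suc k)
  have ne: "of_real t + \<i> * of_real x \<noteq> 0" "of_real T - \<i> * of_real x \<notin> \<real>\<^sub>\<le>\<^sub>0" "of_real T - \<i> * of_real x \<noteq> 0" for x
    using Re_pos_slit[of "of_real t + \<i> * of_real x"] Re_pos_slit[of "of_real T - \<i> * of_real x"] t T by auto
  \<comment> \<open>This is the derivative of \<open>line_kernel t T (Suc k) q\<close>, which tends
    to 0 at both ends of the line.\<close>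
  define f where "f x = \<i> * of_real q * line_kernel t T (Suc k) (q + 1) x - \<i> * of_nat (Suc k) * line_kernel t T (Suc (Suc k)) q x" for x
  have i1: "integrable lborel (line_kernel t T (Suc k) (q + 1))" and i2: "integrable lborel (line_kernel t T (Suc (Suc k)) q)"
    using Suc.prems by (auto intro!: line_kernel_integrable t T)
  have "(LINT x|lborel. f x) = 0"
  proof (rule lebesgue_integral_real_line_FTC[where F = "line_kernel t T (Suc k) q"])
    fix x :: real
    have d1: "((\<lambda>u. inverse ((of_real t + \<i> * u) ^ Suc k)) has_field_derivative
        - \<i> * of_nat (Suc k) * inverse ((of_real t + \<i> * of_real x) ^ Suc (Suc k))) (at (of_real x))"
    proof -
      define X where "X = of_real t + \<i> * complex_of_real x"
      have X: "X \<noteq> 0" using ne(1) by (simp add: X_def)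
      have "((\<lambda>u. of_real t + \<i> * u) has_field_derivative \<i>) (at (of_real x))"
        by (auto intro!: derivative_eq_intros)
      from DERIV_inverse_fun[OF DERIV_power[OF this, of "Suc k"]] X
      have "((\<lambda>u. inverse ((of_real t + \<i> * u) ^ Suc k)) has_field_derivative
        - (of_nat (Suc k) * (\<i> * X ^ k) * inverse ((X ^ Suc k) ^ Suc (Suc 0)))) (at (of_real x))"
        by (simp add: X_def)
      moreover have pw: "(X ^ Suc k) ^ Suc (Suc 0) = X ^ k * X ^ Suc (Suc k)" by (simp add: mult_ac)
      have "- (of_nat (Suc k) * (\<i> * X ^ k) * inverse ((X ^ Suc k) ^ Suc (Suc 0))) = - \<i> * of_nat (Suc k) * inverse (X ^ Suc (Suc k))"
        unfolding pw inverse_mult_distrib using X by (simp add: field_simps del: of_nat_Suc power_Suc)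
      ultimately show ?thesis unfolding X_def[symmetric] by (simp only:)
    qed
    have d2: "((\<lambda>u. (of_real T - \<i> * u) powr (- of_real q)) has_field_derivative
        \<i> * of_real q * (of_real T - \<i> * of_real x) powr (- of_real (q + 1))) (at (of_real x))"
    proof -
      have d: "((\<lambda>u. of_real T - \<i> * u) has_field_derivative - \<i>) (at (of_real x))"
        by (auto intro!: derivative_eq_intros)
      have "- complex_of_real (q + 1) = - of_real q - 1" by simp
      then show ?thesis
        using DERIV_chain2[OF has_field_derivative_powr[OF ne(2)[of x], of "- of_real q"] d] by (simp add: mult_ac)
    qed
    have "((\<lambda>u. inverse ((of_real t + \<i> * u) ^ Suc k) * (of_real T - \<i> * u) powr (- of_real q)) has_field_derivative f x) (at (of_real x))"
      by (rule DERIV_cong[OF DERIV_mult[OF d1 d2]]) (simp add: f_def line_kernel_def algebra_simps)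
    from has_vector_derivative_real_field[OF this]
    show "(line_kernel t T (Suc k) q has_vector_derivative f x) (at x)" by (simp add: line_kernel_def[abs_def])
    have "continuous_on UNIV f" unfolding f_def by (intro continuous_intros line_kernel_continuous[OF t T])
    then show "isCont f x" by (simp add: continuous_on_eq_continuous_at)
  next
    show "integrable lborel f" unfolding f_def
      by (intro Bochner_Integration.integrable_diff integrable_mult_right i1 i2)
    have c: "real (Suc k) + q > 0" using Suc.prems by (simp add: add_pos_pos)
    define M where "M = min 1 (min t T) powr (- (real (Suc k) + q))"
    have bd: "norm (line_kernel t T (Suc k) q x) \<le> M * (1 + x\<^sup>2) powr (- (real (Suc k) + q) / 2)" for x
      unfolding M_def using Suc.prems by (intro line_kernel_bound t T) auto
    have "((\<lambda>x::real. M * (1 + x\<^sup>2) powr (- (real (Suc k) + q) / 2)) \<longlongrightarrow> 0) at_top"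
      using c by real_asymp
    then show "(line_kernel t T (Suc k) q \<longlongrightarrow> 0) at_top"
      by (rule Lim_null_comparison[rotated]) (use bd in auto)
    have "((\<lambda>x::real. M * (1 + x\<^sup>2) powr (- (real (Suc k) + q) / 2)) \<longlongrightarrow> 0) at_bot"
      using c by real_asymp
    then show "(line_kernel t T (Suc k) q \<longlongrightarrow> 0) at_bot"
      by (rule Lim_null_comparison[rotated]) (use bd in auto)
  qed
  then have "\<i> * of_real q * (LINT x|lborel. line_kernel t T (Suc k) (q + 1) x) = \<i> * of_nat (Suc k) * (LINT x|lborel. line_kernel t T (Suc (Suc k)) q x)"
    unfolding f_def using i1 i2 by (simp add: Bochner_Integration.integral_diff)
  then have "of_nat (Suc k) * (LINT x|lborel. line_kernel t T (Suc (Suc k)) q x) = of_real q * (LINT x|lborel. line_kernel t T (Suc k) (q + 1) x)"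
    by (simp add: mult.assoc del: of_nat_Suc)
  also have "\<dots> = of_real q * of_real (pochhammer (q + 1) k / fact k * (2 * pi) * (t + T) powr (- (q + 1) - real k))"
    using Suc.IH[of "q + 1"] Suc.prems by simp
  also have "\<dots> = of_real (pochhammer q (Suc k) / fact k * (2 * pi) * (t + T) powr (- q - real (Suc k)))"
  proof -
    have "- (q + 1) - real k = - q - real (Suc k)" by simp
    then show ?thesis by (simp only: pochhammer_rec of_real_mult[symmetric]) (simp add: mult_ac)
  qed
  finally have "(LINT x|lborel. line_kernel t T (Suc (Suc k)) q x) = of_real (pochhammer q (Suc k) / fact k * (2 * pi) * (t + T) powr (- q - real (Suc k))) / of_nat (Suc k)"
    by (simp add: nonzero_eq_divide_eq mult_ac del: of_nat_Suc)
  also have "\<dots> = of_real (pochhammer q (Suc k) / fact k * (2 * pi) * (t + T) powr (- q - real (Suc k)) / real (Suc k))"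
    by simp
  finally show ?case by (simp only: fact_Suc) (simp add: mult_ac)
qed

section \<open>An integral over hyperbolic cosines\<close>

lemma cosh_ge_exp_half: "cosh x \<ge> exp \<bar>x\<bar> / 2" for x :: real
  by (simp add: cosh_def abs_if)

lemma cosh_integrand_bound:
  fixes \<zeta> :: complex and \<tau> \<kappa> q :: real
  assumes "\<kappa> \<ge> 0" "q \<ge> 0" "\<bar>Re \<zeta>\<bar> \<le> r"
  shows "norm (exp (\<zeta> * of_real \<tau>)) * (\<kappa> + cosh \<tau>) powr (- q) \<le> 2 powr q * exp (- (q - r) * \<bar>\<tau>\<bar>)"
proof -
  have "(\<kappa> + cosh \<tau>) powr (- q) \<le> (exp \<bar>\<tau>\<bar> / 2) powr (- q)"
    using assms cosh_ge_exp_half[of \<tau>] by (intro powr_mono2') auto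
  also have "\<dots> = 2 powr q * exp (- q * \<bar>\<tau>\<bar>)"
    by (simp add: powr_divide powr_minus powr_def[of "exp \<bar>\<tau>\<bar>"] exp_minus field_simps)
  finally have 1: "(\<kappa> + cosh \<tau>) powr (- q) \<le> 2 powr q * exp (- q * \<bar>\<tau>\<bar>)" .
  have "Re \<zeta> * \<tau> \<le> r * \<bar>\<tau>\<bar>"
  proof -
    have "Re \<zeta> * \<tau> \<le> \<bar>Re \<zeta>\<bar> * \<bar>\<tau>\<bar>" by (metis abs_ge_self abs_mult)
    also have "\<dots> \<le> r * \<bar>\<tau>\<bar>" using assms by (intro mult_right_mono) auto
    finally show ?thesis .
  qed
  then have 2: "norm (exp (\<zeta> * of_real \<tau>)) \<le> exp (r * \<bar>\<tau>\<bar>)" by simp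
  have "norm (exp (\<zeta> * of_real \<tau>)) * (\<kappa> + cosh \<tau>) powr (- q) \<le> exp (r * \<bar>\<tau>\<bar>) * (2 powr q * exp (- q * \<bar>\<tau>\<bar>))"
    using 1 2 by (intro mult_mono) auto
  also have "\<dots> = 2 powr q * exp (- (q - r) * \<bar>\<tau>\<bar>)"
    by (simp add: mult_exp_exp[symmetric] left_diff_distrib exp_diff exp_minus field_simps)
  finally show ?thesis .
qed

text \<open>Up to elementary factors an associated Legendre function of \<open>s\<close>. Exponent
  1/2 at \<open>s = \<i> * x\<close> and \<open>s = - \<i> * x\<close> represents the spherical
  function, and exponent \<open>1/2 + l\<close> at \<open>s = t\<close> is the value of the orbital
  integral.\<close>

definition cosh_int :: "real \<Rightarrow> complex \<Rightarrow> complex \<Rightarrow> complex" where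
  "cosh_int q \<zeta> s = (LINT \<tau>|lborel. exp (\<zeta> * of_real \<tau>) * (s + of_real (cosh \<tau>)) powr (- of_real q))"

lemma cosh_int_measurable:
  assumes "\<And>\<tau>. s + of_real (cosh \<tau>) \<noteq> (0::complex)"
  shows "(\<lambda>\<tau>. exp (\<zeta> * of_real \<tau>) * (s + of_real (cosh \<tau>)) powr (- of_real q)) \<in> borel_measurable lborel"
proof -
  have [measurable]: "(cosh :: real \<Rightarrow> real) \<in> borel_measurable borel"
    by (intro borel_measurable_continuous_onI continuous_intros)
  have "(\<lambda>\<tau>. exp (\<zeta> * of_real \<tau>) * exp (- of_real q * Ln (s + of_real (cosh \<tau>)))) \<in> borel_measurable lborel"
    by measurable
  then show ?thesis using assms by (simp add: powr_def)
qed

lemma closed_of_real_atMost: "closed (complex_of_real ` {..x})"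
proof -
  have "complex_of_real ` {..x} = {z. Re z \<le> x} \<inter> {z. Im z = 0}"
    by (auto simp: complex_eq_iff image_iff intro!: bexI[of _ "Re z" for z])
  then show ?thesis by (simp add: closed_Int closed_halfspace_Re_le closed_halfspace_Im_eq)
qed

text \<open>The source of all majorants in \<open>s\<close>. For large \<open>k\<close> the triangle
  inequality gives a linear lower bound, and for the remaining \<open>k\<close> the distance of
  \<open>s0\<close> from the cut does.\<close>

lemma cosh_shift_lower_bound:
  assumes s0: "s0 \<notin> complex_of_real ` {..-1}"
  shows "\<exists>r>0. \<exists>c>0. c \<le> 1 \<and> (\<forall>s\<in>ball s0 r. \<forall>k\<ge>1. norm (s + of_real k) \<ge> c * k \<and> s + of_real k \<notin> \<real>\<^sub>\<le>\<^sub>0)"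
proof -
  have cl: "closed (complex_of_real ` {..-1})" by (rule closed_of_real_atMost)
  then have "open (- (complex_of_real ` {..-1}))" by (simp add: open_Compl)
  then obtain e where e: "e > 0" "ball s0 e \<subseteq> - (complex_of_real ` {..-1})"
    using s0 by (meson ComplI open_contains_ball)
  define r where "r = min (e / 2) 1"
  \<comment> \<open>From \<open>M\<close> on, \<open>k\<close> is at least twice
    \<open>norm s\<close>; below \<open>M\<close> the distance \<open>r\<close> to the cut is at
    least \<open>r / M * k\<close>.\<close>
  define M where "M = 2 * (norm s0 + 1)"
  define c where "c = min (1/2) (r / M)"
  have r: "r > 0" "r \<le> e / 2" "r \<le> 1" using e by (auto simp: r_def)
  have M: "M \<ge> 2" by (simp add: M_def)
  have c: "c > 0" "c \<le> 1/2" "c \<le> r / M" using r M by (auto simp: c_def)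
  have "norm (s + of_real k) \<ge> c * k \<and> s + of_real k \<notin> \<real>\<^sub>\<le>\<^sub>0" if s: "s \<in> ball s0 r" and k: "k \<ge> 1" for s k
  proof
    have ns: "norm s \<le> norm s0 + 1"
      using s r norm_triangle_ineq2[of s s0] by (simp add: dist_norm norm_minus_commute)
    show "norm (s + of_real k) \<ge> c * k"
    proof (cases "k \<ge> M")
      case True
      have "norm (s + of_real k) \<ge> k - norm s" using norm_diff_ineq[of "of_real k" s] k by (simp add: add.commute)
      moreover have "norm s \<le> k / 2" using ns True by (simp add: M_def)
      moreover have "c * k \<le> 1/2 * k" using c k by (intro mult_right_mono) auto
      ultimately show ?thesis by linarith
    next
      case False
      have "- complex_of_real k \<in> complex_of_real ` {..-1}" using k by (auto intro!: image_eqI[of _ _ "- k"])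
      then have "- complex_of_real k \<notin> ball s0 e" using e by blast
      then have "dist s0 (- of_real k) \<ge> e" by simp
      also have "dist s0 (- of_real k) \<le> dist s0 s + dist s (- of_real k)" by (rule dist_triangle)
      finally have "dist s (- of_real k) \<ge> r" using s r by simp
      then have "norm (s + of_real k) \<ge> r" by (simp add: dist_norm)
      moreover have "c * k \<le> r / M * M" using c k False M r by (intro mult_mono) auto
      ultimately show ?thesis using M by simp
    qed
    show "s + of_real k \<notin> \<real>\<^sub>\<le>\<^sub>0"
    proof
      assume "s + of_real k \<in> \<real>\<^sub>\<le>\<^sub>0"
      then obtain y where "s + of_real k = complex_of_real y" "y \<le> 0" by (auto elim: nonpos_Reals_cases)
      then have "s = complex_of_real (y - k)" "y - k \<le> -1" using k by (auto simp: algebra_simps)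
      then have "s \<in> complex_of_real ` {..-1}" by (auto intro!: image_eqI[of _ _ "y - k"])
      moreover have "s \<in> ball s0 e" using s r by auto
      ultimately show False using e by blast
    qed
  qed
  moreover have "c \<le> 1" using c by simp
  ultimately show ?thesis using r(1) c(1) by blast
qed

lemma cosh_int_bound:
  assumes c: "c > 0" "c \<le> 1" and b: "\<And>k. k \<ge> 1 \<Longrightarrow> norm (s + of_real k) \<ge> c * k" and q: "q \<ge> 0" and r: "\<bar>Re \<zeta>\<bar> \<le> r"
  shows "norm (exp (\<zeta> * of_real \<tau>) * (s + of_real (cosh \<tau>)) powr (- of_real q)) \<le> (c / 2) powr (- q) * exp (- (q - r) * \<bar>\<tau>\<bar>)"
proof -
  have n: "norm (s + of_real (cosh \<tau>)) \<ge> c * cosh \<tau>" using b[of "cosh \<tau>"] cosh_real_ge_1 by simp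
  have ck: "c * cosh \<tau> > 0" using c by simp
  have ne: "s + of_real (cosh \<tau>) \<noteq> 0" using n ck by auto
  have e: "- complex_of_real q = of_real (- q)" by simp
  have "norm (exp (\<zeta> * of_real \<tau>) * (s + of_real (cosh \<tau>)) powr (- of_real q))
      = norm (exp (\<zeta> * of_real \<tau>)) * norm (s + of_real (cosh \<tau>)) powr (- q)"
    unfolding norm_mult e norm_powr_of_real_exponent[OF ne] ..
  also have "\<dots> \<le> norm (exp (\<zeta> * of_real \<tau>)) * (c * cosh \<tau>) powr (- q)"
    using n ck q by (intro mult_left_mono powr_mono2') auto
  also have "\<dots> = c powr (- q) * (norm (exp (\<zeta> * of_real \<tau>)) * (0 + cosh \<tau>) powr (- q))"
    using c by (simp add: powr_mult)
  also have "\<dots> \<le> c powr (- q) * (2 powr q * exp (- (q - r) * \<bar>\<tau>\<bar>))"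
    using q r by (intro mult_left_mono cosh_integrand_bound) auto
  also have "\<dots> = (c / 2) powr (- q) * exp (- (q - r) * \<bar>\<tau>\<bar>)"
    using c by (simp add: powr_divide powr_minus field_simps)
  finally show ?thesis .
qed

lemma cosh_int_integrable:
  assumes s: "s \<notin> complex_of_real ` {..-1}" and z: "\<bar>Re \<zeta>\<bar> < q"
  shows "integrable lborel (\<lambda>\<tau>. exp (\<zeta> * of_real \<tau>) * (s + of_real (cosh \<tau>)) powr (- of_real q))"
proof -
  obtain r c where r: "r > 0" and c: "c > 0" "c \<le> 1"
    and b: "\<And>s' k. s' \<in> ball s r \<Longrightarrow> k \<ge> 1 \<Longrightarrow> norm (s' + of_real k) \<ge> c * k \<and> s' + of_real k \<notin> \<real>\<^sub>\<le>\<^sub>0"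
    using cosh_shift_lower_bound[OF s] by blast
  have q: "q \<ge> 0" using z by linarith
  have bs: "\<And>k. k \<ge> 1 \<Longrightarrow> norm (s + of_real k) \<ge> c * k \<and> s + of_real k \<notin> \<real>\<^sub>\<le>\<^sub>0" using b[of s] r by simp
  show ?thesis
  proof (rule Bochner_Integration.integrable_bound[OF _ _ AE_I2])
    show "integrable lborel (\<lambda>\<tau>. (c / 2) powr (- q) * exp (- (q - \<bar>Re \<zeta>\<bar>) * \<bar>\<tau>\<bar>))"
      using z by (intro integrable_mult_right integrable_exp_abs) auto
    show "(\<lambda>\<tau>. exp (\<zeta> * of_real \<tau>) * (s + of_real (cosh \<tau>)) powr (- of_real q)) \<in> borel_measurable lborel"
      using bs[OF cosh_real_ge_1] by (intro cosh_int_measurable) (metis nonpos_Reals_zero_I)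
    show "norm (exp (\<zeta> * of_real \<tau>) * (s + of_real (cosh \<tau>)) powr (- of_real q)) \<le> norm ((c / 2) powr (- q) * exp (- (q - \<bar>Re \<zeta>\<bar>) * \<bar>\<tau>\<bar>))" for \<tau>
      using cosh_int_bound[OF c, of s q \<zeta> "\<bar>Re \<zeta>\<bar>" \<tau>] bs q by simp
  qed
qed

lemma cosh_int_holomorphic_s:
  assumes z: "\<bar>Re \<zeta>\<bar> < q"
  shows "cosh_int q \<zeta> holomorphic_on - (complex_of_real ` {..-1})"
  unfolding cosh_int_def[abs_def]
proof (rule holomorphic_on_lebesgue_integral)
  have q: "q \<ge> 0" using z by linarith
  show "open (- (complex_of_real ` {..-1}))" by (simp add: open_Compl closed_of_real_atMost)
  show "(\<lambda>s. exp (\<zeta> * of_real \<tau>) * (s + of_real (cosh \<tau>)) powr (- of_real q)) holomorphic_on - (complex_of_real ` {..-1})" for \<tau>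
  proof (intro holomorphic_intros)
    fix s assume "s \<in> - (complex_of_real ` {..-1})"
    then obtain r c where "r > 0" "\<And>s' k. s' \<in> ball s r \<Longrightarrow> k \<ge> 1 \<Longrightarrow> s' + of_real k \<notin> \<real>\<^sub>\<le>\<^sub>0"
      using cosh_shift_lower_bound[of s] by blast
    then show "s + of_real (cosh \<tau>) \<notin> \<real>\<^sub>\<le>\<^sub>0" using cosh_real_ge_1 by (meson centre_in_ball)
  qed
  show "(\<lambda>\<tau>. exp (\<zeta> * of_real \<tau>) * (s + of_real (cosh \<tau>)) powr (- of_real q)) \<in> borel_measurable lborel"
    if "s \<in> - (complex_of_real ` {..-1})" for s
    using cosh_int_integrable[OF _ z, of s] that by (intro borel_measurable_integrable) auto
  fix s0 assume "s0 \<in> - (complex_of_real ` {..-1})"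
  then obtain r c where r: "r > 0" and c: "c > 0" "c \<le> 1"
    and b: "\<And>s k. s \<in> ball s0 r \<Longrightarrow> k \<ge> 1 \<Longrightarrow> norm (s + of_real k) \<ge> c * k \<and> s + of_real k \<notin> \<real>\<^sub>\<le>\<^sub>0"
    using cosh_shift_lower_bound[of s0] by blast
  show "\<exists>r>0. \<exists>g. integrable lborel g \<and> (\<forall>s\<in>ball s0 r. \<forall>\<tau>\<in>space lborel.
      norm (exp (\<zeta> * of_real \<tau>) * (s + of_real (cosh \<tau>)) powr (- of_real q)) \<le> g \<tau>)"
  proof (intro exI[of _ r] conjI exI[of _ "\<lambda>\<tau>. (c / 2) powr (- q) * exp (- (q - \<bar>Re \<zeta>\<bar>) * \<bar>\<tau>\<bar>)"] ballI r)
    show "integrable lborel (\<lambda>\<tau>. (c / 2) powr (- q) * exp (- (q - \<bar>Re \<zeta>\<bar>) * \<bar>\<tau>\<bar>))"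
      using z by (intro integrable_mult_right integrable_exp_abs) auto
    show "norm (exp (\<zeta> * of_real \<tau>) * (s + of_real (cosh \<tau>)) powr (- of_real q)) \<le> (c / 2) powr (- q) * exp (- (q - \<bar>Re \<zeta>\<bar>) * \<bar>\<tau>\<bar>)"
      if "s \<in> ball s0 r" for s \<tau>
      using b[OF that] q by (intro cosh_int_bound c) auto
  qed
qed

lemma cosh_int_holomorphic_\<zeta>:
  assumes s: "s \<notin> complex_of_real ` {..-1}"
  shows "(\<lambda>\<zeta>. cosh_int q \<zeta> s) holomorphic_on {\<zeta>. \<bar>Re \<zeta>\<bar> < q}"
  unfolding cosh_int_def
proof (rule holomorphic_on_lebesgue_integral)
  show "open {\<zeta>. \<bar>Re \<zeta>\<bar> < q}" by (intro open_Collect_less continuous_intros)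
  show "(\<lambda>\<zeta>. exp (\<zeta> * of_real \<tau>) * (s + of_real (cosh \<tau>)) powr (- of_real q)) holomorphic_on {\<zeta>. \<bar>Re \<zeta>\<bar> < q}" for \<tau>
    by (intro holomorphic_intros)
  show "(\<lambda>\<tau>. exp (\<zeta> * of_real \<tau>) * (s + of_real (cosh \<tau>)) powr (- of_real q)) \<in> borel_measurable lborel"
    if "\<zeta> \<in> {\<zeta>. \<bar>Re \<zeta>\<bar> < q}" for \<zeta>
    using cosh_int_integrable[OF s, of \<zeta> q] that by (intro borel_measurable_integrable) auto
  fix \<zeta>0 assume z0: "\<zeta>0 \<in> {\<zeta>. \<bar>Re \<zeta>\<bar> < q}"
  define r where "r = (q - \<bar>Re \<zeta>0\<bar>) / 2"
  have r: "r > 0" "\<bar>Re \<zeta>0\<bar> + r < q" and q: "q \<ge> 0" using z0 by (auto simp: r_def field_simps)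
  obtain e c where c: "e > 0" "c > 0" "c \<le> 1"
    and b: "\<And>s' k. s' \<in> ball s e \<Longrightarrow> k \<ge> 1 \<Longrightarrow> norm (s' + of_real k) \<ge> c * k"
    using cosh_shift_lower_bound[OF s] by blast
  have bs: "\<And>k. k \<ge> 1 \<Longrightarrow> norm (s + of_real k) \<ge> c * k" using b[of s] c by simp
  show "\<exists>r>0. \<exists>g. integrable lborel g \<and> (\<forall>\<zeta>\<in>ball \<zeta>0 r. \<forall>\<tau>\<in>space lborel.
      norm (exp (\<zeta> * of_real \<tau>) * (s + of_real (cosh \<tau>)) powr (- of_real q)) \<le> g \<tau>)"
  proof (intro exI[of _ r] conjI exI[of _ "\<lambda>\<tau>. (c / 2) powr (- q) * exp (- (q - (\<bar>Re \<zeta>0\<bar> + r)) * \<bar>\<tau>\<bar>)"] ballI r)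
    show "integrable lborel (\<lambda>\<tau>. (c / 2) powr (- q) * exp (- (q - (\<bar>Re \<zeta>0\<bar> + r)) * \<bar>\<tau>\<bar>))"
      using r by (intro integrable_mult_right integrable_exp_abs) auto
    fix \<zeta> \<tau> assume "\<zeta> \<in> ball \<zeta>0 r"
    then have "\<bar>Re \<zeta>\<bar> \<le> \<bar>Re \<zeta>0\<bar> + r"
      using abs_Re_le_cmod[of "\<zeta>0 - \<zeta>"] by (simp add: dist_norm)
    then show "norm (exp (\<zeta> * of_real \<tau>) * (s + of_real (cosh \<tau>)) powr (- of_real q)) \<le> (c / 2) powr (- q) * exp (- (q - (\<bar>Re \<zeta>0\<bar> + r)) * \<bar>\<tau>\<bar>)"
      by (intro cosh_int_bound c bs q)
  qed
qed

lemma nonneg_not_cut: "x \<ge> 0 \<Longrightarrow> complex_of_real x \<notin> complex_of_real ` {..-1}"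
  by auto

lemma powr_times_of_real:
  assumes "k > 0" "W \<noteq> 0"
  shows "(of_real k * W) powr a = of_real k powr a * W powr (a::complex)"
  using assms by (simp add: powr_def Ln_times_of_real Ln_of_real exp_add distrib_left)

text \<open>The binomial series of the shifted power. As
  \<open>\<kappa> + cosh \<tau> \<ge> \<kappa> + 1 > norm v\<close>, it is dominated by one
  convergent series uniformly in \<open>\<tau>\<close>, and the \<open>n\<close>-th term raises the
  exponent \<open>q\<close> by \<open>n\<close>.\<close>

lemma cosh_int_expansion:
  fixes \<kappa> q :: real and v \<zeta> :: complex
  assumes \<kappa>: "\<kappa> \<ge> 0" and v: "norm v < \<kappa> + 1" and z: "\<bar>Re \<zeta>\<bar> < q"
  shows "(\<lambda>n. ((- of_real q) gchoose n) * v ^ n * cosh_int (q + real n) \<zeta> (of_real \<kappa>)) sums cosh_int q \<zeta> (of_real \<kappa> + v)"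
proof -
  have q: "q > 0" using z by linarith
  define \<rho> where "\<rho> = norm v / (\<kappa> + 1)"
  have \<rho>: "0 \<le> \<rho>" "\<rho> < 1" using v \<kappa> by (auto simp: \<rho>_def divide_less_eq_1)
  define B where "B n = (- complex_of_real q) gchoose n" for n
  have nB: "norm (B n) = pochhammer q n / fact n" for n
  proof -
    have "B n = of_real ((- q) gchoose n)" unfolding B_def by (simp add: gbinomial_prod_rev)
    then have "norm (B n) = \<bar>(- q) gchoose n\<bar>" by (simp only: norm_of_real)
    also have "\<dots> = pochhammer q n / fact n" using q by (simp add: gbinomial_pochhammer abs_mult pochhammer_nonneg)
    finally show ?thesis .
  qed
  define f where "f n \<tau> = B n * v ^ n * (exp (\<zeta> * of_real \<tau>) * (of_real \<kappa> + of_real (cosh \<tau>)) powr (- of_real (q + real n)))" for n \<tau>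
  have K: "\<kappa> + cosh \<tau> \<ge> \<kappa> + 1" for \<tau> using cosh_real_ge_1[of \<tau>] by simp
  have nf: "norm (f n \<tau>) \<le> (pochhammer q n / fact n * \<rho> ^ n) * norm (exp (\<zeta> * of_real \<tau>) * (of_real \<kappa> + of_real (cosh \<tau>)) powr (- of_real q))" for n \<tau>
  proof -
    define k where "k = \<kappa> + cosh \<tau>"
    have k: "k \<ge> \<kappa> + 1" "k > 0" using K[of \<tau>] \<kappa> by (auto simp: k_def)
    have nk: "norm (complex_of_real k powr (- of_real y)) = k powr (- y)" for y
    proof -
      have "norm (complex_of_real k powr (of_real (- y))) = k powr (- y)"
        using norm_powr_of_real_exponent[of "of_real k" "- y"] k by simp
      then show ?thesis by simp
    qed
    have "norm v ^ n * k powr (- real n) = (norm v / k) ^ n"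
      using k by (simp add: powr_minus powr_realpow divide_inverse power_mult_distrib power_inverse)
    also have "\<dots> \<le> \<rho> ^ n"
      unfolding \<rho>_def using k \<kappa> by (intro power_mono divide_left_mono) auto
    finally have le: "norm v ^ n * k powr (- real n) \<le> \<rho> ^ n" .
    have "norm (f n \<tau>) = pochhammer q n / fact n * (norm v ^ n * k powr (- real n)) * (norm (exp (\<zeta> * of_real \<tau>)) * k powr (- q))"
      unfolding f_def of_real_add[symmetric] k_def[symmetric] norm_mult norm_power nk nB
      by (simp only: minus_add_distrib powr_add) (simp add: mult_ac)
    also have "\<dots> \<le> pochhammer q n / fact n * \<rho> ^ n * (norm (exp (\<zeta> * of_real \<tau>)) * k powr (- q))"
      using le q by (intro mult_right_mono mult_left_mono) (auto simp: pochhammer_nonneg)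
    finally show ?thesis unfolding of_real_add[symmetric] k_def[symmetric] norm_mult nk .
  qed
  have pw: "f n \<tau> = exp (\<zeta> * of_real \<tau>) * of_real (\<kappa> + cosh \<tau>) powr (- of_real q) * (B n * (v / of_real (\<kappa> + cosh \<tau>)) ^ n)" for n \<tau>
  proof -
    define k where "k = complex_of_real (\<kappa> + cosh \<tau>)"
    have k: "k \<noteq> 0" using K[of \<tau>] \<kappa> by (simp add: k_def del: of_real_add)
    have "- complex_of_real (q + real n) = - of_real q - of_nat n" by simp
    then have "k powr (- of_real (q + real n)) = k powr (- of_real q) / k ^ n"
      using k by (simp add: powr_diff powr_nat' )
    then show ?thesis unfolding f_def of_real_add[symmetric] k_def[symmetric] by (simp add: power_divide mult_ac)
  qed
  have ps: "(\<lambda>n. f n \<tau>) sums (exp (\<zeta> * of_real \<tau>) * (of_real \<kappa> + v + of_real (cosh \<tau>)) powr (- of_real q))" for \<tau>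
  proof -
    define k where "k = \<kappa> + cosh \<tau>"
    have k: "k \<ge> \<kappa> + 1" "k > 0" using K[of \<tau>] \<kappa> by (auto simp: k_def)
    have n1: "norm (v / of_real k) < 1" using v k by (simp add: norm_divide divide_less_eq_1)
    have ne: "1 + v / of_real k \<noteq> 0" using n1 by (metis add_eq_0_iff norm_minus_cancel norm_one less_irrefl)
    have "complex_of_real k * (1 + v / of_real k) = of_real \<kappa> + v + of_real (cosh \<tau>)"
    proof -
      have "complex_of_real k * (1 + v / of_real k) = of_real k + v" using k by (simp add: distrib_left)
      then show ?thesis by (simp add: k_def)
    qed
    then have "(of_real \<kappa> + v + of_real (cosh \<tau>)) powr (- of_real q) = (of_real k * (1 + v / of_real k)) powr (- of_real q)" by simp
    also have "\<dots> = of_real k powr (- of_real q) * (1 + v / of_real k) powr (- of_real q)"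
      using ne k by (intro powr_times_of_real) auto
    finally have e: "(of_real \<kappa> + v + of_real (cosh \<tau>)) powr (- of_real q) = of_real k powr (- of_real q) * (1 + v / of_real k) powr (- of_real q)" .
    show ?thesis unfolding pw e k_def[symmetric] B_def
      using sums_mult[OF gen_binomial_complex[OF n1, of "- of_real q"], of "exp (\<zeta> * of_real \<tau>) * of_real k powr (- of_real q)"]
      by (simp only: mult.assoc)
  qed
  have intf: "integrable lborel (f n)" for n
    unfolding f_def using z nonneg_not_cut[OF \<kappa>] by (intro integrable_mult_right cosh_int_integrable) auto
  have sm: "summable (\<lambda>n. pochhammer q n / fact n * \<rho> ^ n)"
    using pochhammer_fact_sums[of \<rho> q] \<rho> by (auto simp: sums_iff)
  have int0: "integrable lborel (\<lambda>\<tau>. exp (\<zeta> * of_real \<tau>) * (of_real \<kappa> + of_real (cosh \<tau>)) powr (- of_real q))"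
    using z nonneg_not_cut[OF \<kappa>] by (intro cosh_int_integrable) auto
  have "(\<lambda>n. integral\<^sup>L lborel (f n)) sums (LINT \<tau>|lborel. (\<Sum>n. f n \<tau>))"
  proof (rule sums_integral[OF intf])
    show "AE \<tau> in lborel. summable (\<lambda>n. norm (f n \<tau>))"
      using nf by (intro AE_I2 summable_comparison_test'[OF summable_mult2[OF sm], of 0]) auto
    show "summable (\<lambda>n. LINT \<tau>|lborel. norm (f n \<tau>))"
    proof (rule summable_comparison_test'[OF summable_mult2[OF sm], of 0])
      fix n
      have "(LINT \<tau>|lborel. norm (f n \<tau>)) \<le> (LINT \<tau>|lborel. (pochhammer q n / fact n * \<rho> ^ n) * norm (exp (\<zeta> * of_real \<tau>) * (of_real \<kappa> + of_real (cosh \<tau>)) powr (- of_real q)))"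
        using nf by (intro integral_mono integrable_norm intf integrable_mult_right int0) auto
      then show "norm (LINT \<tau>|lborel. norm (f n \<tau>)) \<le> pochhammer q n / fact n * \<rho> ^ n * (LINT \<tau>|lborel. norm (exp (\<zeta> * of_real \<tau>) * (of_real \<kappa> + of_real (cosh \<tau>)) powr (- of_real q)))"
        by simp
    qed
  qed
  moreover have "(\<Sum>n. f n \<tau>) = exp (\<zeta> * of_real \<tau>) * (of_real \<kappa> + v + of_real (cosh \<tau>)) powr (- of_real q)" for \<tau>
    using ps[of \<tau>] by (simp add: sums_iff)
  moreover have "integral\<^sup>L lborel (f n) = B n * v ^ n * cosh_int (q + real n) \<zeta> (of_real \<kappa>)" for n
    unfolding f_def cosh_int_def by simp
  ultimately show ?thesis unfolding B_def cosh_int_def by simp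
qed

section \<open>Values of the cosh integral at the shifts 1 and 0\<close>

text \<open>The logistic substitution \<open>g\<close> maps the line to the unit interval and turns
  \<open>1 + cosh \<tau>\<close> into the reciprocal of
  \<open>2 * g \<tau> * (1 - g \<tau>)\<close>, so a Beta integral with parameters
  \<open>p + r\<close> and \<open>p - r\<close> results.\<close>

lemma cosh_int_1_real:
  fixes p r :: real
  assumes r: "\<bar>r\<bar> < p"
  shows "cosh_int p (of_real r) 1 = of_real (2 powr p * (Gamma (p + r) * Gamma (p - r) / Gamma (2 * p)))"
proof -
  define f where "f s = s powr (p + r - 1) * (1 - s) powr (p - r - 1)" for s :: real
  define g where "g \<tau> = 1 / (1 + exp (- \<tau>))" for \<tau> :: real
  define g' where "g' \<tau> = exp (- \<tau>) / (1 + exp (- \<tau>))\<^sup>2" for \<tau> :: real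
  define h where "h \<tau> = exp (r * \<tau>) * (1 + cosh \<tau>) powr (- p)" for \<tau> :: real
  have E: "1 + exp (- \<tau>) > 0" for \<tau> :: real by (simp add: add_pos_pos)
  have g01: "0 < g \<tau>" "g \<tau> < 1" for \<tau> using E[of \<tau>] by (auto simp: g_def)
  have hh: "f (g \<tau>) * g' \<tau> = 2 powr (- p) * h \<tau>" for \<tau>
  proof -
    define e where "e = exp (- \<tau>)"
    have e: "e > 0" "1 + e > 0" by (auto simp: e_def add_pos_pos)
    have 1: "1 - g \<tau> = e / (1 + e)" using e by (simp add: g_def e_def[symmetric] field_simps)
    have ch: "1 + cosh \<tau> = (1 + e)\<^sup>2 / (2 * e)"
      using e by (simp add: cosh_def e_def exp_minus field_simps power2_eq_square)
    have lg: "ln (g \<tau>) = - ln (1 + e)" using e by (simp add: g_def e_def[symmetric] ln_div)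
    have lg1: "ln (1 - g \<tau>) = ln e - ln (1 + e)" unfolding 1 using e by (simp add: ln_div)
    have "exp (2 * ln (1 + e)) = (1 + e)\<^sup>2" using e by (simp add: exp_double)
    then have eg': "g' \<tau> = exp (ln e - 2 * ln (1 + e))" using e by (simp add: g'_def e_def[symmetric] exp_diff)
    have "f (g \<tau>) * g' \<tau> = exp ((p + r - 1) * (- ln (1 + e)) + (p - r - 1) * (ln e - ln (1 + e)) + (ln e - 2 * ln (1 + e)))"
      unfolding f_def exp_add eg' powr_def lg lg1 using g01[of \<tau>] by simp
    also have "(p + r - 1) * (- ln (1 + e)) + (p - r - 1) * (ln e - ln (1 + e)) + (ln e - 2 * ln (1 + e))
       = - p * ln 2 + (r * \<tau> + (- p) * (2 * ln (1 + e) - (ln 2 + ln e)))"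
      by (simp add: e_def algebra_simps)
    also have "exp \<dots> = 2 powr (- p) * h \<tau>"
    proof -
      have "ln (1 + cosh \<tau>) = 2 * ln (1 + e) - (ln 2 + ln e)"
        unfolding ch using e by (simp add: ln_div ln_mult ln_realpow power2_eq_square)
      moreover have "1 + cosh \<tau> > 0" using cosh_real_ge_1[of \<tau>] by linarith
      ultimately have "h \<tau> = exp (r * \<tau>) * exp (- p * (2 * ln (1 + e) - (ln 2 + ln e)))"
        by (simp add: h_def powr_def)
      moreover have "(2::real) powr (- p) = exp (- p * ln 2)" by (simp add: powr_def)
      ultimately show ?thesis by (simp only: exp_add)
    qed
    finally show ?thesis .
  qed
  have hc: "complex_of_real (h \<tau>) = exp (of_real r * of_real \<tau>) * (1 + of_real (cosh \<tau>)) powr (- of_real p)" for \<tau>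
  proof -
    have "complex_of_real ((1 + cosh \<tau>) powr (- p)) = of_real (1 + cosh \<tau>) powr (of_real (- p))"
      using cosh_real_ge_1[of \<tau>] by (intro powr_of_real[symmetric]) auto
    then show ?thesis by (simp add: h_def exp_of_real[symmetric])
  qed
  have inth: "integrable lborel h"
  proof -
    have "integrable lborel (\<lambda>\<tau>. exp (complex_of_real r * of_real \<tau>) * (1 + of_real (cosh \<tau>)) powr (- of_real p))"
      using r nonneg_not_cut[of 1] by (intro cosh_int_integrable) auto
    then have "integrable lborel (\<lambda>\<tau>. complex_of_real (h \<tau>))" unfolding hc .
    then show ?thesis by (simp only: complex_of_real_integrable_eq)
  qed
  have der: "DERIV g \<tau> :> g' \<tau>" for \<tau>
    unfolding g_def[abs_def] g'_def using E[of \<tau>] by (auto intro!: derivative_eq_intros simp: field_simps power2_eq_square)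
  have "(LBINT x=0..1. f x) = (LBINT x=-\<infinity>..\<infinity>. f (g x) * g' x)"
  proof (rule interval_integral_substitution_nonneg(2)[OF _ der])
    show "isCont f (g x)" for x
      unfolding f_def using g01[of x] by (intro continuous_intros) auto
    show "isCont g' x" for x unfolding g'_def[abs_def] using E[of x] by (intro continuous_intros) auto
    show "0 \<le> f (g x)" for x by (simp add: f_def)
    show "0 \<le> g' x" for x by (simp add: g'_def)
    have "(g \<longlongrightarrow> 0) at_bot" unfolding g_def[abs_def] by real_asymp
    then show "((ereal \<circ> g \<circ> real_of_ereal) \<longlongrightarrow> 0) (at_right (- \<infinity>))"
      unfolding zero_ereal_def ereal_tendsto_simps1 unfolding comp_def by (rule tendsto_ereal)
    have "(g \<longlongrightarrow> 1) at_top" unfolding g_def[abs_def] by real_asymp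
    then show "((ereal \<circ> g \<circ> real_of_ereal) \<longlongrightarrow> 1) (at_left \<infinity>)"
      unfolding one_ereal_def ereal_tendsto_simps1 unfolding comp_def by (rule tendsto_ereal)
    show "set_integrable lborel (einterval (- \<infinity>) \<infinity>) (\<lambda>x. f (g x) * g' x)"
      unfolding hh using inth by (simp add: set_integrable_def)
  qed auto
  also have "\<dots> = 2 powr (- p) * (LINT \<tau>|lborel. h \<tau>)"
    unfolding hh by (simp add: interval_lebesgue_integral_def set_lebesgue_integral_def)
  finally have I: "(LINT \<tau>|lborel. h \<tau>) = 2 powr p * (LBINT x=0..1. f x)" by (simp add: powr_minus)
  have "(LBINT x=ereal 0..ereal 1. f x) = integral {0..1} f"
    unfolding f_def using r by (intro interval_integral_eq_integral integrable_Beta) auto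
  also have "\<dots> = Beta (p + r) (p - r)"
    unfolding f_def using r by (intro integral_unique has_integral_Beta_real) auto
  finally have "(LBINT x=0..1. f x) = Gamma (p + r) * Gamma (p - r) / Gamma (2 * p)"
    by (simp add: zero_ereal_def one_ereal_def Beta_def)
  then show ?thesis using I unfolding cosh_int_def hc[symmetric] integral_complex_of_real by simp
qed

text \<open>The real interval determines the value on the whole strip; the Gamma factors have no
  poles there because both arguments have positive real part.\<close>

lemma cosh_int_1:
  assumes z: "\<bar>Re \<zeta>\<bar> < p"
  shows "cosh_int p \<zeta> 1 = of_real (2 powr p) * (Gamma (of_real p + \<zeta>) * Gamma (of_real p - \<zeta>) / Gamma (2 * of_real p))"
proof -
  define U where "U = {\<zeta>. \<bar>Re \<zeta>\<bar> < p}"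
  have p: "p > 0" using z by linarith
  have op: "open U" unfolding U_def by (intro open_Collect_less continuous_intros)
  have "U = {\<zeta>. Re \<zeta> < p} \<inter> {\<zeta>. Re \<zeta> > - p}" by (auto simp: U_def)
  then have con: "connected U"
    by (auto intro!: convex_connected convex_Int convex_halfspace_Re_lt convex_halfspace_Re_gt)
  have np: "w \<notin> \<int>\<^sub>\<le>\<^sub>0" if "Re w > 0" for w :: complex using that by (auto elim!: nonpos_Ints_cases)
  have "cosh_int p \<zeta> 1 - of_real (2 powr p) * (Gamma (of_real p + \<zeta>) * Gamma (of_real p - \<zeta>) / Gamma (2 * of_real p)) = 0"
  proof (rule analytic_continuation[of "\<lambda>\<zeta>. cosh_int p \<zeta> 1 - of_real (2 powr p) * (Gamma (of_real p + \<zeta>) * Gamma (of_real p - \<zeta>) / Gamma (2 * of_real p))" U "complex_of_real ` {-p<..<p}" 0])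
    show "(\<lambda>\<zeta>. cosh_int p \<zeta> 1 - of_real (2 powr p) * (Gamma (of_real p + \<zeta>) * Gamma (of_real p - \<zeta>) / Gamma (2 * of_real p))) holomorphic_on U"
    proof (intro holomorphic_on_diff holomorphic_intros)
      show "(\<lambda>\<zeta>. cosh_int p \<zeta> 1) holomorphic_on U"
        unfolding U_def using cosh_int_holomorphic_\<zeta>[of 1 p] nonneg_not_cut[of 1] by simp
    qed (use p in \<open>auto intro!: np simp: U_def Gamma_eq_zero_iff\<close>)
    show "0 islimpt complex_of_real ` {-p<..<p}"
    proof -
      have "(0::real) islimpt {-p<..<p}" using p by (intro open_imp_islimpt) auto
      then have "complex_of_real 0 islimpt complex_of_real ` {-p<..<p}"
        unfolding islimpt_approachable by (metis (no_types, lifting) dist_of_real imageI of_real_eq_iff)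
      then show ?thesis by simp
    qed
    fix w assume "w \<in> complex_of_real ` {-p<..<p}"
    then obtain r where r: "w = of_real r" "\<bar>r\<bar> < p" by auto
    have "Gamma (of_real p + w) = of_real (Gamma (p + r))" "Gamma (of_real p - w) = of_real (Gamma (p - r))" "Gamma (2 * of_real p) = complex_of_real (Gamma (2 * p))"
      unfolding r(1) by (simp_all flip: Gamma_complex_of_real)
    then show "cosh_int p w 1 - of_real (2 powr p) * (Gamma (of_real p + w) * Gamma (of_real p - w) / Gamma (2 * of_real p)) = 0"
      using cosh_int_1_real[OF r(2)] r(1) by simp
  qed (use op con z p in \<open>auto simp: U_def\<close>)
  then show ?thesis by simp
qed

text \<open>The half-angle identity \<open>1 + cosh \<sigma> = 2 * (cosh (\<sigma> / 2))^2\<close>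
  reduces the shift 0 to the shift 1 with \<open>q\<close> and \<open>\<zeta>\<close>
  halved.\<close>

lemma cosh_int_0:
  assumes z: "\<bar>Re \<zeta>\<bar> < q"
  shows "cosh_int q \<zeta> 0 = of_real (2 powr q) / 2 * (Gamma ((of_real q + \<zeta>) / 2) * Gamma ((of_real q - \<zeta>) / 2) / Gamma (of_real q))"
proof -
  have "cosh_int q \<zeta> 0 = (1/2) *\<^sub>R (LINT \<sigma>|lborel. exp (\<zeta> * of_real (0 + 1/2 * \<sigma>)) * (0 + of_real (cosh (0 + 1/2 * \<sigma>))) powr (- of_real q))"
    unfolding cosh_int_def by (subst lborel_integral_real_affine[of "1/2" _ 0]) auto
  also have "(LINT \<sigma>|lborel. exp (\<zeta> * of_real (0 + 1/2 * \<sigma>)) * (0 + of_real (cosh (0 + 1/2 * \<sigma>))) powr (- of_real q))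
     = (LINT \<sigma>|lborel. of_real (2 powr (q / 2)) * (exp (\<zeta> / 2 * of_real \<sigma>) * (1 + of_real (cosh \<sigma>)) powr (- of_real (q / 2))))"
  proof (rule Bochner_Integration.integral_cong[OF refl])
    fix \<sigma> :: real
    define c where "c = cosh (\<sigma> / 2)"
    have c: "c \<ge> 1" unfolding c_def by (rule cosh_real_ge_1)
    have ch: "1 + cosh \<sigma> = 2 * c\<^sup>2"
      using cosh_double_cosh[of "\<sigma> / 2"] by (simp add: c_def)
    have "complex_of_real c powr (of_real (- q)) = of_real (c powr (- q))"
      using c by (intro powr_of_real) auto
    moreover have "complex_of_real (1 + cosh \<sigma>) powr (of_real (- (q / 2))) = of_real ((1 + cosh \<sigma>) powr (- (q / 2)))"
      unfolding ch using c by (intro powr_of_real) auto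
    moreover have "(1 + cosh \<sigma>) powr (- (q / 2)) = 2 powr (- (q / 2)) * c powr (- q)"
    proof -
      have e: "c\<^sup>2 = c powr 2" using c by (simp add: powr_numeral)
      have "(c\<^sup>2) powr (- (q / 2)) = c powr (- q)" unfolding e powr_powr by simp
      then show ?thesis unfolding ch using c by (simp add: powr_mult)
    qed
    then have "c powr (- q) = 2 powr (q / 2) * (1 + cosh \<sigma>) powr (- (q / 2))" by (simp add: powr_minus)
    ultimately have "complex_of_real c powr (of_real (- q)) = of_real (2 powr (q / 2)) * of_real (1 + cosh \<sigma>) powr (of_real (- (q / 2)))"
      by (simp only: of_real_mult)
    then have "complex_of_real c powr (- of_real q) = of_real (2 powr (q / 2)) * (1 + of_real (cosh \<sigma>)) powr (- of_real (q / 2))"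
      by simp
    then show "exp (\<zeta> * of_real (0 + 1/2 * \<sigma>)) * (0 + of_real (cosh (0 + 1/2 * \<sigma>))) powr (- of_real q)
       = of_real (2 powr (q / 2)) * (exp (\<zeta> / 2 * of_real \<sigma>) * (1 + of_real (cosh \<sigma>)) powr (- of_real (q / 2)))"
      by (simp add: c_def mult_ac)
  qed
  also have "\<dots> = of_real (2 powr (q / 2)) * cosh_int (q / 2) (\<zeta> / 2) 1"
    by (simp add: cosh_int_def)
  also have "cosh_int (q / 2) (\<zeta> / 2) 1 = of_real (2 powr (q / 2)) * (Gamma (of_real (q / 2) + \<zeta> / 2) * Gamma (of_real (q / 2) - \<zeta> / 2) / Gamma (2 * of_real (q / 2)))"
    using z by (intro cosh_int_1) auto
  also have "of_real (2 powr (q / 2)) * (of_real (2 powr (q / 2)) * X) = of_real (2 powr q) * X" for X :: complex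
    by (simp flip: mult.assoc of_real_mult powr_add)
  finally show ?thesis by (simp add: scaleR_conv_of_real add_divide_distrib diff_divide_distrib)
qed

section \<open>The spherical function as a cosh integral\<close>

text \<open>Averaging the expansion at shift 0 over both signs leaves the even powers. The values
  \<open>cosh_int_0\<close> and the duplication of the factorial identify the coefficients with
  those of a Gauss series.\<close>

lemma cosh_int_even_part:
  assumes z: "\<bar>Re z\<bar> < 1" and u: "norm u < 1"
  defines "a \<equiv> (1 + z) / 4" and "b \<equiv> (1 - z) / 4"
  shows "(cosh_int (1/2) (z / 2) (\<i> * u) + cosh_int (1/2) (z / 2) (- (\<i> * u))) / 2
     = Gamma a * Gamma b / of_real (sqrt (2 * pi)) * gauss_F a b (1/2) (- (u\<^sup>2))"
proof -
  define B where "B n = (- complex_of_real (1/2)) gchoose n" for n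
  define C where "C n = cosh_int (1/2 + real n) (z / 2) 0" for n
  define s where "s = complex_of_real (sqrt 2)"
  define p where "p = complex_of_real (sqrt pi)"
  have sp: "s \<noteq> 0" "p \<noteq> 0" "s * p = of_real (sqrt (2 * pi))" by (auto simp: s_def p_def real_sqrt_mult)
  have np: "w \<notin> \<int>\<^sub>\<le>\<^sub>0" if "Re w > 0" for w :: complex using that by (auto elim!: nonpos_Ints_cases)
  have ab: "Re a > 0" "Re b > 0" using z by (auto simp: a_def b_def)
  have ex: "(\<lambda>n. B n * v ^ n * C n) sums cosh_int (1/2) (z / 2) v" if "norm v < 1" for v
    using cosh_int_expansion[of 0 v "z / 2" "1/2"] that z by (simp add: B_def C_def)
  have "(\<lambda>n. (B n * (\<i> * u) ^ n * C n + B n * (- (\<i> * u)) ^ n * C n) / 2) sums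
     ((cosh_int (1/2) (z / 2) (\<i> * u) + cosh_int (1/2) (z / 2) (- (\<i> * u))) / 2)"
    using u by (intro sums_divide sums_add ex) (auto simp: norm_mult)
  moreover have "(B n * (\<i> * u) ^ n * C n + B n * (- (\<i> * u)) ^ n * C n) / 2 = 0" if "n \<notin> range (\<lambda>m. 2 * m)" for n
  proof -
    have "odd n" using that by (auto elim!: evenE)
    then have "(- (\<i> * u)) ^ n = - ((\<i> * u) ^ n)" by (rule power_minus_odd)
    then show ?thesis by simp
  qed
  \<comment> \<open>The odd terms are 0, so the series is reindexed along the even numbers.\<close>
  ultimately have "(\<lambda>m. (B (2 * m) * (\<i> * u) ^ (2 * m) * C (2 * m) + B (2 * m) * (- (\<i> * u)) ^ (2 * m) * C (2 * m)) / 2) sums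
     ((cosh_int (1/2) (z / 2) (\<i> * u) + cosh_int (1/2) (z / 2) (- (\<i> * u))) / 2)"
    by (subst sums_mono_reindex) (auto simp: strict_mono_def)
  moreover have "(B (2 * m) * (\<i> * u) ^ (2 * m) * C (2 * m) + B (2 * m) * (- (\<i> * u)) ^ (2 * m) * C (2 * m)) / 2
      = Gamma a * Gamma b / of_real (sqrt (2 * pi)) * (hyp_coeff a b (1/2) m * (- (u\<^sup>2)) ^ m)" for m
  proof -
    have pw: "(\<i> * u) ^ (2 * m) = (- (u\<^sup>2)) ^ m" "(- (\<i> * u)) ^ (2 * m) = (- (u\<^sup>2)) ^ m"
      by (simp_all add: power_mult power_mult_distrib)
    have Bm: "B (2 * m) = pochhammer (1/2) (2 * m) / fact (2 * m)"
      by (simp add: B_def gbinomial_pochhammer)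
    have h: "(1/2 :: complex) \<notin> \<int>\<^sub>\<le>\<^sub>0" by (rule half_not_nonpos_Int)
    have g1: "Gamma (1/2 + of_nat (2 * m)) = pochhammer (1/2) (2 * m) * p"
      using pochhammer_Gamma[OF h, of "2 * m"] sp by (simp add: p_def Gamma_one_half_complex field_simps)
    have g2: "Gamma (a + of_nat m) = pochhammer a m * Gamma a" "Gamma (b + of_nat m) = pochhammer b m * Gamma b"
      using pochhammer_Gamma[OF np[OF ab(1)], of m] pochhammer_Gamma[OF np[OF ab(2)], of m] np[OF ab(1)] np[OF ab(2)]
      by (simp_all add: Gamma_eq_zero_iff)
    have pne: "pochhammer (1/2 :: complex) k \<noteq> 0" for k
      using h by (metis pochhammer_eq_0_iff minus_of_nat_in_nonpos_Ints)
    have pow2: "complex_of_real (2 powr (1/2 + real (2 * m))) / 2 = 4 ^ m / s"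
    proof -
      have "2 powr (1/2 + real (2 * m)) / 2 = 4 ^ m * (sqrt 2 / 2)"
        by (simp add: powr_add powr_half_sqrt powr_realpow[of 2 "2 * m", simplified] power_mult)
      also have "sqrt 2 / 2 = 1 / sqrt 2" by (simp add: field_simps)
      finally have "2 powr (1/2 + real (2 * m)) / 2 = 4 ^ m / sqrt 2" by simp
      then have "complex_of_real (2 powr (1/2 + real (2 * m)) / 2) = of_real (4 ^ m / sqrt 2)" by simp
      then show ?thesis by (simp add: s_def)
    qed
    have zz: "(of_real (1/2 + real (2 * m)) + z / 2) / 2 = a + of_nat m" "(of_real (1/2 + real (2 * m)) - z / 2) / 2 = b + of_nat m"
      "complex_of_real (1/2 + real (2 * m)) = 1/2 + of_nat (2 * m)"
      by (simp_all add: a_def b_def field_simps)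
    have "C (2 * m) = of_real (2 powr (1/2 + real (2 * m))) / 2 * (Gamma ((of_real (1/2 + real (2 * m)) + z / 2) / 2) * Gamma ((of_real (1/2 + real (2 * m)) - z / 2) / 2) / Gamma (of_real (1/2 + real (2 * m))))"
      unfolding C_def using z by (intro cosh_int_0) auto
    then have Cm: "C (2 * m) = 4 ^ m / s * ((pochhammer a m * Gamma a) * (pochhammer b m * Gamma b) / (pochhammer (1/2) (2 * m) * p))"
      unfolding zz(1,2) pow2 unfolding zz(3) g1 g2 .
    have fd: "(fact (2 * m) :: complex) = 4 ^ m * pochhammer (1/2) m * fact m"
      using fact_double[of m, where 'a = complex] by (simp add: power_mult)
    have "B (2 * m) * C (2 * m) = Gamma a * Gamma b / (s * p) * hyp_coeff a b (1/2) m"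
      unfolding Bm Cm fd hyp_coeff_def using sp pne[of m] pne[of "2 * m"] by (simp add: field_simps)
    moreover have "(B (2 * m) * X * C (2 * m) + B (2 * m) * X * C (2 * m)) / 2 = (B (2 * m) * C (2 * m)) * X" for X by simp
    ultimately show ?thesis unfolding pw sp(3) by (simp only: mult.assoc)
  qed
  ultimately have S: "(\<lambda>m. Gamma a * Gamma b / of_real (sqrt (2 * pi)) * (hyp_coeff a b (1/2) m * (- (u\<^sup>2)) ^ m)) sums
     ((cosh_int (1/2) (z / 2) (\<i> * u) + cosh_int (1/2) (z / 2) (- (\<i> * u))) / 2)" by simp
  have "norm (- (u\<^sup>2)) < 1" using u by (simp add: norm_power power_less_one_iff)
  then have "(\<lambda>m. hyp_coeff a b (1/2) m * (- (u\<^sup>2)) ^ m) sums gauss_F a b (1/2) (- (u\<^sup>2))"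
    unfolding gauss_F_def using summable_norm_cancel[OF summable_gauss_F] by (intro summable_sums) auto
  from sums_unique2[OF S sums_mult[OF this]] show ?thesis .
qed

text \<open>Near 0 the two sides are Gauss series in \<open>- (x^2)\<close> and in
  \<open>x^2 / (1 + x^2)\<close>, related by Pfaff's transformation; the identity theorem on a strip
  around the real axis reaches all \<open>x\<close>. The bound on \<open>Re z\<close> makes the
  integral with exponent 1/2 converge.\<close>

lemma sph_eq_cosh_int:
  assumes z: "\<bar>Re z\<bar> < 1"
  shows "sph z x = of_real (sqrt (2 * pi)) * rGamma ((1 + z) / 4) * rGamma ((1 - z) / 4) *
     ((cosh_int (1/2) (z / 2) (\<i> * of_real x) + cosh_int (1/2) (z / 2) (- (\<i> * of_real x))) / 2)"
proof -
  define a b where "a = (1 + z) / 4" and "b = (1 - z) / 4"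
  define c where "c = of_real (sqrt (2 * pi)) * rGamma a * rGamma b"
  have np: "w \<notin> \<int>\<^sub>\<le>\<^sub>0" if "Re w > 0" for w :: complex using that by (auto elim!: nonpos_Ints_cases)
  have ab: "Gamma a \<noteq> 0" "Gamma b \<noteq> 0" using z np[of a] np[of b] by (auto simp: a_def b_def Gamma_eq_zero_iff)
  define P where "P u = (1 + u\<^sup>2) powr (- a) * gauss_F a a (1/2) (u\<^sup>2 / (1 + u\<^sup>2))" for u :: complex
  define Q where "Q u = c * ((cosh_int (1/2) (z / 2) (\<i> * u) + cosh_int (1/2) (z / 2) (- (\<i> * u))) / 2)" for u
  \<comment> \<open>On this strip \<open>Re (u^2) > - 1/2\<close>. This is equivalent to
    \<open>norm (u^2) < norm (1 + u^2)\<close>, keeps \<open>1 + u^2\<close> off the cut of the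
    power, and keeps both shifts off the cut of \<open>cosh_int\<close>.\<close>
  define S where "S = {u::complex. \<bar>Im u\<bar> < 1/2}"
  have S: "open S" unfolding S_def by (intro open_Collect_less continuous_intros)
  have "S = {u. Im u < 1/2} \<inter> {u. Im u > - (1/2)}" by (auto simp: S_def)
  then have con: "connected S"
    by (metis convex_connected convex_Int convex_halfspace_Im_lt convex_halfspace_Im_gt)
  have re: "Re (u\<^sup>2) > - (1/2)" if "u \<in> S" for u
  proof -
    have "(Im u)\<^sup>2 < (1/2)\<^sup>2" using that by (intro power2_strict_mono) (auto simp: S_def)
    moreover have "(1/2 :: real)\<^sup>2 = 1/4" by (simp add: power2_eq_square)
    moreover have "Re (u\<^sup>2) = (Re u)\<^sup>2 - (Im u)\<^sup>2" by (rule Re_power2)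
    ultimately show ?thesis using zero_le_power2[of "Re u"] by linarith
  qed
  have holP: "P holomorphic_on S"
    unfolding P_def
  proof (intro holomorphic_on_mult holomorphic_on_powr_right)
    have nr: "1 + u\<^sup>2 \<notin> \<real>\<^sub>\<le>\<^sub>0" if "u \<in> S" for u using re[OF that] by (auto simp: complex_nonpos_Reals_iff)
    then have n0: "1 + u\<^sup>2 \<noteq> 0" if "u \<in> S" for u using that by force
    show "(\<lambda>u. (1 + u\<^sup>2) powr (- a)) holomorphic_on S" using nr by (intro holomorphic_intros) auto
    have "(\<lambda>u. u\<^sup>2 / (1 + u\<^sup>2)) ` S \<subseteq> ball 0 1"
    proof safe
      fix u assume u: "u \<in> S"
      have "(norm (u\<^sup>2))\<^sup>2 < (norm (1 + u\<^sup>2))\<^sup>2"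
        unfolding cmod_power2 using re[OF u] by (simp add: power2_eq_square algebra_simps)
      then have "norm (u\<^sup>2) < norm (1 + u\<^sup>2)" by (rule power2_less_imp_less) simp
      then show "u\<^sup>2 / (1 + u\<^sup>2) \<in> ball 0 1" using n0[OF u] by (simp add: norm_divide divide_less_eq_1)
    qed
    moreover have "(\<lambda>u. u\<^sup>2 / (1 + u\<^sup>2)) holomorphic_on S" using n0 by (intro holomorphic_intros) auto
    ultimately show "(\<lambda>u. gauss_F a a (1/2) (u\<^sup>2 / (1 + u\<^sup>2))) holomorphic_on S"
      using holomorphic_on_compose_gen[OF _ gauss_F_holomorphic] by (fastforce simp: o_def)
  qed
  have holQ: "Q holomorphic_on S"
  proof -
    have hc: "cosh_int (1/2) (z / 2) holomorphic_on - (complex_of_real ` {..-1})"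
      using z by (intro cosh_int_holomorphic_s) auto
    have *: "\<i> * u \<notin> complex_of_real ` {..-1} \<and> - (\<i> * u) \<notin> complex_of_real ` {..-1}" if "u \<in> S" for u
      using that by (auto simp: S_def complex_eq_iff)
    have 1: "(\<lambda>u. cosh_int (1/2) (z / 2) (\<i> * u)) holomorphic_on S"
    proof -
      have "(\<lambda>u. \<i> * u) ` S \<subseteq> - (complex_of_real ` {..-1})" using * by (simp only: image_subset_iff Compl_iff) simp
      moreover have "(\<lambda>u. \<i> * u) holomorphic_on S" by (intro holomorphic_intros)
      ultimately show ?thesis using holomorphic_on_compose_gen[OF _ hc] by (simp add: o_def)
    qed
    have 2: "(\<lambda>u. cosh_int (1/2) (z / 2) (- (\<i> * u))) holomorphic_on S"
    proof -
      have "(\<lambda>u. - (\<i> * u)) ` S \<subseteq> - (complex_of_real ` {..-1})" using * by (simp only: image_subset_iff Compl_iff) simp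
      moreover have "(\<lambda>u. - (\<i> * u)) holomorphic_on S" by (intro holomorphic_intros)
      ultimately show ?thesis using holomorphic_on_compose_gen[OF _ hc] by (simp add: o_def)
    qed
    show ?thesis unfolding Q_def by (intro holomorphic_intros 1 2) auto
  qed
  have PQ: "P u = Q u" if u: "u \<in> ball 0 (1/2)" for u
  proof -
    have nu: "norm (- (u\<^sup>2)) < 1/2"
    proof -
      have "norm u * norm u \<le> 1/2 * norm u" using u by (intro mult_right_mono) auto
      then show ?thesis using u by (simp add: norm_power power2_eq_square norm_mult)
    qed
    have ba: "1/2 - b = a" by (simp add: a_def b_def field_simps)
    have "Q u = c * (Gamma a * Gamma b / of_real (sqrt (2 * pi)) * gauss_F a b (1/2) (- (u\<^sup>2)))"
      unfolding Q_def using cosh_int_even_part[OF z, of u] u by (simp add: a_def b_def)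
    also have "\<dots> = gauss_F a b (1/2) (- (u\<^sup>2))"
      unfolding c_def rGamma_inverse_Gamma using ab by (simp add: field_simps)
    also have "\<dots> = (1 - - (u\<^sup>2)) powr (- a) * gauss_F a (1/2 - b) (1/2) (- (u\<^sup>2) / (- (u\<^sup>2) - 1))"
      by (rule gauss_F_pfaff[OF half_not_nonpos_Int nu])
    also have "- (u\<^sup>2) / (- (u\<^sup>2) - 1) = u\<^sup>2 / (1 + u\<^sup>2)"
    proof -
      have "- (u\<^sup>2) - 1 = - (1 + u\<^sup>2)" by simp
      then show ?thesis by (simp only: minus_divide_divide)
    qed
    finally show ?thesis by (simp add: P_def ba)
  qed
  have "P (of_real x) = Q (of_real x)"
  proof (rule analytic_continuation_open[of "ball 0 (1/2)" S P Q])
    show "ball 0 (1/2) \<subseteq> S"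
    proof
      fix u :: complex assume "u \<in> ball 0 (1/2)"
      then show "u \<in> S" using abs_Im_le_cmod[of u] by (auto simp: S_def)
    qed
    show "ball 0 (1/2) \<noteq> ({} :: complex set)" by simp
  qed (use S con holP holQ PQ in \<open>auto simp: S_def\<close>)
  moreover have "sph z x = P (of_real x)"
  proof -
    have 1: "(z + 1) / 4 = a" by (simp add: a_def add.commute)
    have "- (z + 1) / 4 = - ((z + 1) / 4)" by (rule minus_divide_left[symmetric])
    then have "- (z + 1) / 4 = - a" unfolding 1 .
    with 1 show ?thesis unfolding sph_def P_def by simp
  qed
  ultimately show ?thesis by (simp add: Q_def c_def a_def b_def)
qed

section \<open>The real orbital integral\<close>

lemma integral_conj_line_kernel':
  assumes t: "t > 0" and T: "T > 0" and q: "q \<ge> 0" "real k + q > 1"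
  shows "(LINT x|lborel. inverse ((of_real t + \<i> * of_real x) ^ k) * (of_real T + \<i> * of_real x) powr (- of_real q)) = 0"
proof -
  have "(LINT x|lborel. inverse ((of_real t + \<i> * of_real x) ^ k) * (of_real T + \<i> * of_real x) powr (- of_real q))
    = \<bar>- 1\<bar> *\<^sub>R (LINT x|lborel. inverse ((of_real t + \<i> * of_real (0 + - 1 * x)) ^ k) * (of_real T + \<i> * of_real (0 + - 1 * x)) powr (- of_real q))"
    by (rule lborel_integral_real_affine) simp
  then show ?thesis using integral_conj_line_kernel(2)[OF assms] by simp
qed

text \<open>Fubini, with the integral in \<open>x\<close> evaluated first. The condition
  \<open>l \<ge> 1\<close> makes the power \<open>Suc l\<close> integrable on the line by
  itself.\<close>

lemma integral_sph_narrow: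
  assumes t: "t > 0" and l: "l \<ge> 1" and z: "\<bar>Re z\<bar> < 1"
  shows "(LINT x|lborel. inverse ((of_real t + \<i> * of_real x) ^ Suc l) * sph z x)
     = of_real (sqrt (2 * pi)) * rGamma ((1 + z) / 4) * rGamma ((1 - z) / 4) * of_real (pi * (pochhammer (1/2) l / fact l)) *
       cosh_int (1/2 + real l) (z / 2) (of_real t)"
proof -
  define c where "c = of_real (sqrt (2 * pi)) * rGamma ((1 + z) / 4) * rGamma ((1 - z) / 4)"
  define \<zeta> where "\<zeta> = z / 2"
  have z2: "\<bar>Re \<zeta>\<bar> < 1/2" using z by (simp add: \<zeta>_def)
  define k where "k x = inverse ((of_real t + \<i> * complex_of_real x) ^ Suc l)" for x
  define f where "f x \<tau> = k x * (exp (\<zeta> * of_real \<tau>) * (((\<i> * of_real x + of_real (cosh \<tau>)) powr (- of_real (1/2)) + (- (\<i> * of_real x) + of_real (cosh \<tau>)) powr (- of_real (1/2))) / 2))" for x \<tau>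
  have ne: "\<i> * of_real x + complex_of_real (cosh \<tau>) \<noteq> 0" "- (\<i> * of_real x) + complex_of_real (cosh \<tau>) \<noteq> 0" for x \<tau>
    using cosh_real_pos[of \<tau>] by (auto simp: complex_eq_iff)
  have ncut: "\<i> * of_real x \<notin> complex_of_real ` {..-1}" "- (\<i> * of_real x) \<notin> complex_of_real ` {..-1}" for x
    by (auto simp: complex_eq_iff)
  have [measurable]: "(cosh :: real \<Rightarrow> real) \<in> borel_measurable borel"
    by (intro borel_measurable_continuous_onI continuous_intros)
  have meas: "(\<lambda>(x, \<tau>). f x \<tau>) \<in> borel_measurable (lborel \<Otimes>\<^sub>M lborel)"
  proof -
    have "(\<lambda>(x, \<tau>). inverse ((of_real t + \<i> * complex_of_real x) ^ Suc l) * (exp (\<zeta> * of_real \<tau>) * ((exp (- of_real (1/2) * Ln (\<i> * of_real x + of_real (cosh \<tau>))) + exp (- of_real (1/2) * Ln (- (\<i> * of_real x) + of_real (cosh \<tau>)))) / 2))) \<in> borel_measurable (lborel \<Otimes>\<^sub>M lborel)"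
      by measurable
    then show ?thesis using ne by (simp add: f_def[abs_def] k_def[abs_def] powr_def)
  qed
  \<comment> \<open>The majorant splits as a product:
    \<open>norm (\<i> * x + cosh \<tau>) \<ge> cosh \<tau>\<close> for both signs, so the dependence
    on \<open>x\<close> disappears from the second factor.\<close>
  define g where "g x = norm (k x)" for x
  define h where "h \<tau> = norm (exp (\<zeta> * of_real \<tau>)) * (0 + cosh \<tau>) powr (- (1/2))" for \<tau>
  have bnd: "norm (f x \<tau>) \<le> g x * h \<tau>" for x \<tau>
  proof -
    have e: "- complex_of_real (1/2) = of_real (- (1/2))" by simp
    have "norm (\<i> * of_real x + complex_of_real (cosh \<tau>)) \<ge> cosh \<tau>" "norm (- (\<i> * of_real x) + complex_of_real (cosh \<tau>)) \<ge> cosh \<tau>"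
      using complex_Re_le_cmod[of "\<i> * of_real x + complex_of_real (cosh \<tau>)"] complex_Re_le_cmod[of "- (\<i> * of_real x) + complex_of_real (cosh \<tau>)"] by simp_all
    then have p: "norm ((\<i> * of_real x + complex_of_real (cosh \<tau>)) powr (- of_real (1/2))) \<le> cosh \<tau> powr (- (1/2))"
      "norm ((- (\<i> * of_real x) + complex_of_real (cosh \<tau>)) powr (- of_real (1/2))) \<le> cosh \<tau> powr (- (1/2))"
      unfolding e norm_powr_of_real_exponent[OF ne(1)] norm_powr_of_real_exponent[OF ne(2)]
      by (auto intro!: powr_mono2' cosh_real_pos)
    have "norm (((\<i> * of_real x + complex_of_real (cosh \<tau>)) powr (- of_real (1/2)) + (- (\<i> * of_real x) + of_real (cosh \<tau>)) powr (- of_real (1/2))) / 2) \<le> cosh \<tau> powr (- (1/2))"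
      using norm_triangle_le[OF add_mono[OF p]] by (simp add: norm_divide)
    then have av: "norm (((\<i> * of_real x + complex_of_real (cosh \<tau>)) powr (- of_real (1/2)) + (- (\<i> * of_real x) + of_real (cosh \<tau>)) powr (- of_real (1/2))) / 2) \<le> (0 + cosh \<tau>) powr (- (1/2))"
      by (simp only: add_0_left)
    show ?thesis unfolding f_def norm_mult g_def h_def by (intro mult_left_mono av norm_ge_zero)
  qed
  have intk: "integrable lborel (\<lambda>x. k x)"
  proof -
    have "integrable lborel (line_kernel t 1 (Suc l) 0)" using t l by (intro line_kernel_integrable) auto
    moreover have "1 - \<i> * of_real x \<noteq> 0" for x by (auto simp: complex_eq_iff)
    ultimately show ?thesis by (simp add: line_kernel_def[abs_def] k_def[abs_def])
  qed
  then have intg: "integrable lborel g" unfolding g_def by (rule integrable_norm)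
  have inth: "integrable lborel h"
  proof (rule Bochner_Integration.integrable_bound[OF _ _ AE_I2])
    show "integrable lborel (\<lambda>\<tau>. 2 powr (1/2) * exp (- (1/2 - \<bar>Re \<zeta>\<bar>) * \<bar>\<tau>\<bar>))"
      using z2 by (intro integrable_mult_right integrable_exp_abs) auto
    show "h \<in> borel_measurable lborel" unfolding h_def[abs_def] by measurable
    show "norm (h \<tau>) \<le> norm (2 powr (1/2) * exp (- (1/2 - \<bar>Re \<zeta>\<bar>) * \<bar>\<tau>\<bar>))" for \<tau>
      using cosh_integrand_bound[of 0 "1/2" \<zeta> "\<bar>Re \<zeta>\<bar>" \<tau>] by (simp add: h_def)
  qed
  have intgh: "integrable (lborel \<Otimes>\<^sub>M lborel) (\<lambda>(x, \<tau>). g x * h \<tau>)"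
  proof (rule lborel_pair.Fubini_integrable)
    show "(\<lambda>(x, \<tau>). g x * h \<tau>) \<in> borel_measurable (lborel \<Otimes>\<^sub>M lborel)"
      using intg inth by measurable
    show "integrable lborel (\<lambda>x. LINT \<tau>|lborel. norm (case (x, \<tau>) of (x, \<tau>) \<Rightarrow> g x * h \<tau>))"
      using intg by (simp add: abs_mult)
    show "AE x in lborel. integrable lborel (\<lambda>\<tau>. case (x, \<tau>) of (x, \<tau>) \<Rightarrow> g x * h \<tau>)"
      using inth by simp
  qed
  have intf: "integrable (lborel \<Otimes>\<^sub>M lborel) (\<lambda>(x, \<tau>). f x \<tau>)"
    by (rule Bochner_Integration.integrable_bound[OF intgh meas]) (auto intro!: AE_I2 order_trans[OF bnd])
  have i1: "integrable lborel (\<lambda>\<tau>. exp (\<zeta> * of_real \<tau>) * (s + of_real (cosh \<tau>)) powr (- of_real (1/2)))"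
    if "s \<notin> complex_of_real ` {..-1}" for s using z2 that by (intro cosh_int_integrable) auto
  have L: "k x * sph z x = c * (LINT \<tau>|lborel. f x \<tau>)" for x
  proof -
    have "(LINT \<tau>|lborel. f x \<tau>) = k x * (LINT \<tau>|lborel. (exp (\<zeta> * of_real \<tau>) * (\<i> * of_real x + of_real (cosh \<tau>)) powr (- of_real (1/2)) + exp (\<zeta> * of_real \<tau>) * (- (\<i> * of_real x) + of_real (cosh \<tau>)) powr (- of_real (1/2))) / 2)"
      unfolding f_def integral_mult_right_zero by (simp only: distrib_left add_divide_distrib times_divide_eq_right)
    also have "\<dots> = k x * ((cosh_int (1/2) \<zeta> (\<i> * of_real x) + cosh_int (1/2) \<zeta> (- (\<i> * of_real x))) / 2)"
      unfolding cosh_int_def integral_divide_zero Bochner_Integration.integral_add[OF i1[OF ncut(1)] i1[OF ncut(2)]] ..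
    finally show ?thesis unfolding sph_eq_cosh_int[OF z] c_def \<zeta>_def by (simp only: mult_ac)
  qed
  \<comment> \<open>Of the two signs, the one whose singularity lies on the same side as that of
    \<open>k\<close> integrates to 0. The other gives \<open>2 * pi\<close>, and the averaging
    halves it to \<open>pi\<close>.\<close>
  have R: "(LINT x|lborel. f x \<tau>) = of_real (pi * (pochhammer (1/2) l / fact l)) * (exp (\<zeta> * of_real \<tau>) * (of_real t + of_real (cosh \<tau>)) powr (- of_real (1/2 + real l)))" for \<tau>
  proof -
    have T: "cosh \<tau> > 0" by (rule cosh_real_pos)
    have j1: "integrable lborel (\<lambda>x. k x * (of_real (cosh \<tau>) - \<i> * of_real x) powr (- of_real (1/2)))"
      using line_kernel_integrable[OF t T, of "1/2" "Suc l"] l by (simp add: line_kernel_def[abs_def] k_def)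
    have j2: "integrable lborel (\<lambda>x. k x * (of_real (cosh \<tau>) + \<i> * of_real x) powr (- of_real (1/2)))"
    proof -
      have "integrable lborel (\<lambda>x. inverse ((of_real t - \<i> * of_real (0 + - 1 * x)) ^ Suc l) * (of_real (cosh \<tau>) - \<i> * of_real (0 + - 1 * x)) powr (- of_real (1/2)))"
        using integral_conj_line_kernel(1)[OF t T, of "1/2" "Suc l"] l by (intro lborel_integrable_real_affine) auto
      then show ?thesis by (simp add: k_def)
    qed
    have v1: "(LINT x|lborel. k x * (of_real (cosh \<tau>) - \<i> * of_real x) powr (- of_real (1/2))) = of_real (pochhammer (1/2) l / fact l * (2 * pi) * (t + cosh \<tau>) powr (- (1/2) - real l))"
      using integral_line_kernel[OF t T, of "1/2" l] by (simp add: line_kernel_def k_def)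
    have v2: "(LINT x|lborel. k x * (of_real (cosh \<tau>) + \<i> * of_real x) powr (- of_real (1/2))) = 0"
      using integral_conj_line_kernel'[OF t T, of "1/2" "Suc l"] l by (simp add: k_def)
    have "f x \<tau> = exp (\<zeta> * of_real \<tau>) / 2 * (k x * (of_real (cosh \<tau>) + \<i> * of_real x) powr (- of_real (1/2)) + k x * (of_real (cosh \<tau>) - \<i> * of_real x) powr (- of_real (1/2)))" for x
    proof -
      have "\<i> * of_real x + complex_of_real (cosh \<tau>) = of_real (cosh \<tau>) + \<i> * of_real x" "- (\<i> * of_real x) + complex_of_real (cosh \<tau>) = of_real (cosh \<tau>) - \<i> * of_real x" by simp_all
      then show ?thesis unfolding f_def by (simp only: distrib_left) (simp add: algebra_simps add_divide_distrib)
    qed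
    then have "(LINT x|lborel. f x \<tau>) = exp (\<zeta> * of_real \<tau>) / 2 * (0 + of_real (pochhammer (1/2) l / fact l * (2 * pi) * (t + cosh \<tau>) powr (- (1/2) - real l)))"
      by (simp only: integral_mult_right_zero Bochner_Integration.integral_add[OF j2 j1] v1 v2)
    also have "(t + cosh \<tau>) powr (- (1/2) - real l) = (t + cosh \<tau>) powr (- (1/2 + real l))" by simp
    also have "complex_of_real (pochhammer (1/2) l / fact l * (2 * pi) * (t + cosh \<tau>) powr (- (1/2 + real l)))
       = of_real (pochhammer (1/2) l / fact l * (2 * pi)) * (of_real t + of_real (cosh \<tau>)) powr (- of_real (1/2 + real l))"
    proof -
      have "complex_of_real ((t + cosh \<tau>) powr (- (1/2 + real l))) = of_real (t + cosh \<tau>) powr of_real (- (1/2 + real l))"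
        using t T by (intro powr_of_real[symmetric]) auto
      then show ?thesis by (simp only: of_real_mult of_real_minus of_real_add)
    qed
    finally show ?thesis by (simp add: mult_ac)
  qed
  have "(LINT x|lborel. k x * sph z x) = c * (LINT x|lborel. LINT \<tau>|lborel. f x \<tau>)"
    unfolding L by (rule integral_mult_right_zero)
  also have "(LINT x|lborel. LINT \<tau>|lborel. f x \<tau>) = (LINT \<tau>|lborel. LINT x|lborel. f x \<tau>)"
    by (rule lborel_pair.Fubini_integral[OF intf, symmetric])
  also have "\<dots> = of_real (pi * (pochhammer (1/2) l / fact l)) * cosh_int (1/2 + real l) \<zeta> (of_real t)"
    unfolding R cosh_int_def by (rule integral_mult_right_zero)
  finally show ?thesis unfolding k_def c_def \<zeta>_def by (simp only: mult.assoc)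
qed

text \<open>The decay of the first factor is the power \<open>- (l + 1) / 2\<close> of
  \<open>1 + x^2\<close>, and \<open>sph_bound_local\<close> with \<open>L = Suc l\<close> leaves a
  power below \<open>- 1/2\<close>, locally uniformly in \<open>z\<close>.\<close>

lemma integrable_sph:
  assumes t: "t > 0" and z: "\<bar>Re z\<bar> < 2 * real (Suc l) - 1"
  shows "integrable lborel (\<lambda>x. inverse ((of_real t + \<i> * of_real x) ^ Suc l) * sph z x)"
    and "(\<lambda>z. LINT x|lborel. inverse ((of_real t + \<i> * of_real x) ^ Suc l) * sph z x) holomorphic_on {z. \<bar>Re z\<bar> < 2 * real (Suc l) - 1}"
proof -
  define k where "k x = inverse ((of_real t + \<i> * complex_of_real x) ^ Suc l)" for x
  have contk: "continuous_on UNIV k"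
  proof -
    have "of_real t + \<i> * of_real x \<noteq> 0" for x using t by (auto simp: complex_eq_iff)
    then show ?thesis unfolding k_def by (intro continuous_intros) auto
  qed
  have nk: "norm (k x) \<le> min 1 (min t 1) powr (- real (Suc l)) * (1 + x\<^sup>2) powr (- real (Suc l) / 2)" for x
  proof -
    have "1 - \<i> * of_real x \<noteq> 0" by (auto simp: complex_eq_iff)
    then show ?thesis using line_kernel_bound[OF t zero_less_one, of 0 "Suc l" x] by (simp add: line_kernel_def k_def)
  qed
  have meas: "(\<lambda>x. k x * sph z x) \<in> borel_measurable lborel" for z
    using contk sph_continuous[of z] by (simp add: borel_measurable_continuous_onI continuous_on_mult)
  have dom: "\<exists>r>0. \<exists>g. integrable lborel g \<and> (\<forall>z\<in>ball z0 r. \<forall>x\<in>space lborel. norm (k x * sph z x) \<le> g x)"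
    if "z0 \<in> {z. \<bar>Re z\<bar> < 2 * real (Suc l) - 1}" for z0
  proof -
    have "\<bar>Re z0\<bar> < 2 * real (Suc l) - 1" using that by simp
    from sph_bound_local[OF this] obtain r C \<sigma> where r: "r > 0" "C \<ge> 0" "\<sigma> > 1/2"
      and b: "\<And>z x. z \<in> ball z0 r \<Longrightarrow> norm (sph z x) \<le> C * (1 + x\<^sup>2) powr (real (Suc l) / 2 - \<sigma>)"
      by blast
    define M where "M = min 1 (min t 1) powr (- real (Suc l))"
    show ?thesis
    proof (intro exI[of _ r] conjI exI[of _ "\<lambda>x. M * C * (1 + x\<^sup>2) powr (- \<sigma>)"] ballI r)
      show "integrable lborel (\<lambda>x. M * C * (1 + x\<^sup>2) powr (- \<sigma>))"
        using r by (intro integrable_mult_right integrable_one_plus_sq_powr)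
      fix z x assume z: "z \<in> ball z0 r"
      have "norm (k x * sph z x) \<le> (M * (1 + x\<^sup>2) powr (- real (Suc l) / 2)) * (C * (1 + x\<^sup>2) powr (real (Suc l) / 2 - \<sigma>))"
        unfolding norm_mult M_def by (intro mult_mono nk b[OF z]) auto
      also have "\<dots> = M * C * ((1 + x\<^sup>2) powr (- real (Suc l) / 2) * (1 + x\<^sup>2) powr (real (Suc l) / 2 - \<sigma>))" by (simp only: mult_ac)
      also have "(1 + x\<^sup>2) powr (- real (Suc l) / 2) * (1 + x\<^sup>2) powr (real (Suc l) / 2 - \<sigma>) = (1 + x\<^sup>2) powr (- \<sigma>)"
      proof -
        have "- real (Suc l) / 2 + (real (Suc l) / 2 - \<sigma>) = - \<sigma>" by (simp add: field_simps)
        then show ?thesis unfolding powr_add[symmetric] by (simp only:)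
      qed
      finally show "norm (k x * sph z x) \<le> M * C * (1 + x\<^sup>2) powr (- \<sigma>)" .
    qed
  qed
  show "integrable lborel (\<lambda>x. inverse ((of_real t + \<i> * of_real x) ^ Suc l) * sph z x)"
  proof -
    obtain r g where r: "r > 0" and g: "integrable lborel g" "\<And>z' x. z' \<in> ball z r \<Longrightarrow> norm (k x * sph z' x) \<le> g x"
      using dom[of z] z by auto
    have "integrable lborel (\<lambda>x. k x * sph z x)"
      by (rule Bochner_Integration.integrable_bound[OF g(1) meas AE_I2]) (use g(2)[of z] r in \<open>auto intro: order_trans[OF _ abs_ge_self]\<close>)
    then show ?thesis by (simp only: k_def)
  qed
  have "(\<lambda>z. LINT x|lborel. k x * sph z x) holomorphic_on {z. \<bar>Re z\<bar> < 2 * real (Suc l) - 1}"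
  proof (rule holomorphic_on_lebesgue_integral[OF _ _ meas dom])
    show "open {z. \<bar>Re z\<bar> < 2 * real (Suc l) - 1}" by (intro open_Collect_less continuous_intros)
    show "(\<lambda>z. k x * sph z x) holomorphic_on {z. \<bar>Re z\<bar> < 2 * real (Suc l) - 1}" for x
      by (intro holomorphic_intros sph_holomorphic)
  qed
  then show "(\<lambda>z. LINT x|lborel. inverse ((of_real t + \<i> * of_real x) ^ Suc l) * sph z x) holomorphic_on {z. \<bar>Re z\<bar> < 2 * real (Suc l) - 1}"
    by (simp only: k_def)
qed

text \<open>The right-hand side makes sense for \<open>\<bar>Re (z / 2)\<bar> < 1/2 + l\<close>,
  which is the same strip as for the left-hand side; so the identity extends from
  \<open>\<bar>Re z\<bar> < 1\<close>.\<close>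

lemma integral_sph:
  assumes t: "t > 0" and l: "l \<ge> 1" and z: "\<bar>Re z\<bar> < 2 * real (Suc l) - 1"
  shows "(LINT x|lborel. inverse ((of_real t + \<i> * of_real x) ^ Suc l) * sph z x)
     = of_real (sqrt (2 * pi)) * rGamma ((1 + z) / 4) * rGamma ((1 - z) / 4) * of_real (pi * (pochhammer (1/2) l / fact l)) *
       cosh_int (1/2 + real l) (z / 2) (of_real t)"
proof -
  define U where "U = {z. \<bar>Re z\<bar> < 2 * real (Suc l) - 1}"
  have "U = {z. Re z < 2 * real (Suc l) - 1} \<inter> {z. Re z > - (2 * real (Suc l) - 1)}" by (auto simp: U_def)
  then have con: "connected U"
    by (metis convex_connected convex_Int convex_halfspace_Re_lt convex_halfspace_Re_gt)
  have op: "open U" unfolding U_def by (intro open_Collect_less continuous_intros)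
  show ?thesis
  proof (rule analytic_continuation_open[of "{z. \<bar>Re z\<bar> < 1}" U "\<lambda>z. LINT x|lborel. inverse ((of_real t + \<i> * of_real x) ^ Suc l) * sph z x"
      "\<lambda>z. of_real (sqrt (2 * pi)) * rGamma ((1 + z) / 4) * rGamma ((1 - z) / 4) * of_real (pi * (pochhammer (1/2) l / fact l)) *
       cosh_int (1/2 + real l) (z / 2) (of_real t)"])
    show "open {z. \<bar>Re z\<bar> < 1}" by (intro open_Collect_less continuous_intros)
    show "{z. \<bar>Re z\<bar> < 1} \<noteq> {}" by (auto intro!: exI[of _ 0])
    show "{z. \<bar>Re z\<bar> < 1} \<subseteq> U" using l by (auto simp: U_def)
    show "(\<lambda>z. LINT x|lborel. inverse ((of_real t + \<i> * of_real x) ^ Suc l) * sph z x) holomorphic_on U"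
      unfolding U_def using integrable_sph(2)[OF t z] .
    have "(\<lambda>\<zeta>. cosh_int (1/2 + real l) \<zeta> (of_real t)) holomorphic_on {\<zeta>. \<bar>Re \<zeta>\<bar> < 1/2 + real l}"
      using t by (intro cosh_int_holomorphic_\<zeta> nonneg_not_cut) auto
    moreover have "(\<lambda>z. z / 2) ` U \<subseteq> {\<zeta>. \<bar>Re \<zeta>\<bar> < 1/2 + real l}" by (auto simp: U_def)
    moreover have "(\<lambda>z. z / 2) holomorphic_on U" by (intro holomorphic_intros) auto
    ultimately have "(\<lambda>z. cosh_int (1/2 + real l) (z / 2) (of_real t)) holomorphic_on U"
      using holomorphic_on_compose_gen[of "\<lambda>z. z / 2" U "\<lambda>\<zeta>. cosh_int (1/2 + real l) \<zeta> (of_real t)"] by (simp add: o_def)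
    then show "(\<lambda>z. of_real (sqrt (2 * pi)) * rGamma ((1 + z) / 4) * rGamma ((1 - z) / 4) * of_real (pi * (pochhammer (1/2) l / fact l)) *
       cosh_int (1/2 + real l) (z / 2) (of_real t)) holomorphic_on U"
      by (intro holomorphic_intros) auto
    show "(LINT x|lborel. inverse ((of_real t + \<i> * of_real x) ^ Suc l) * sph z x)
     = of_real (sqrt (2 * pi)) * rGamma ((1 + z) / 4) * rGamma ((1 - z) / 4) * of_real (pi * (pochhammer (1/2) l / fact l)) *
       cosh_int (1/2 + real l) (z / 2) (of_real t)" if "z \<in> {z. \<bar>Re z\<bar> < 1}" for z
      using integral_sph_narrow[OF t l] that by simp
  qed (use op con z in \<open>auto simp: U_def\<close>)
qed

section \<open>Continuation of the hypergeometric series to the cut plane\<close>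

text \<open>Abel's theorem along a radius. Summation by parts writes the error as
  \<open>1 - r\<close> times the power series of the errors \<open>d n\<close> of the partial sums,
  which tend to 0.\<close>

lemma abel_limit:
  fixes a :: "nat \<Rightarrow> complex"
  assumes a: "summable a"
  shows "((\<lambda>r::real. \<Sum>n. a n * of_real r ^ n) \<longlongrightarrow> suminf a) (at_left 1)"
proof -
  define s where "s = suminf a"
  define d where "d n = (\<Sum>i\<le>n. a i) - s" for n
  have "(\<lambda>n. \<Sum>i\<le>n. a i) \<longlonglongrightarrow> s" unfolding s_def using a by (rule summable_LIMSEQ')
  then have d0: "d \<longlonglongrightarrow> 0" unfolding d_def by (rule LIM_zero)
  then obtain D where D: "\<And>n. norm (d n) \<le> D" by (metis BseqE convergentI convergent_imp_Bseq)
  have D0: "D \<ge> 0" using D[of 0] norm_ge_zero order_trans by blast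
  have key: "(\<Sum>n. a n * of_real r ^ n) - s = of_real (1 - r) * (\<Sum>n. d n * of_real r ^ n)" and
    sd: "summable (\<lambda>n. norm (d n * of_real r ^ n))" if r: "0 < r" "r < 1" for r :: real
  proof -
    define \<rho> where "\<rho> = complex_of_real r"
    have n\<rho>: "norm \<rho> < 1" "norm \<rho> = r" using r by (auto simp: \<rho>_def)
    have sg: "summable (\<lambda>n. D * r ^ n)" using r by (intro summable_mult summable_geometric) auto
    show sd: "summable (\<lambda>n. norm (d n * of_real r ^ n))"
      by (rule summable_comparison_test'[OF sg, of 0]) (use D r in \<open>auto simp: norm_mult norm_power intro!: mult_right_mono\<close>)
    then have s1: "summable (\<lambda>n. d n * \<rho> ^ n)" unfolding \<rho>_def by (rule summable_norm_cancel)
    have s2: "summable (\<lambda>n. s * \<rho> ^ n)" using n\<rho> by (intro summable_mult summable_geometric) auto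
    define S where "S n = (\<Sum>i\<le>n. a i)" for n
    have sS: "summable (\<lambda>n. S n * \<rho> ^ n)" using summable_add[OF s1 s2] by (simp add: S_def d_def algebra_simps)
    then have sS': "summable (\<lambda>n. S (Suc n) * \<rho> ^ Suc n)" by (subst summable_Suc_iff)
    have h1: "(1 - \<rho>) * (\<Sum>n. S n * \<rho> ^ n) = (\<Sum>n. S n * \<rho> ^ n) - (\<Sum>n. S n * \<rho> ^ Suc n)"
      using suminf_mult[OF sS, of \<rho>] by (simp add: algebra_simps)
    have h2: "(\<Sum>n. S n * \<rho> ^ n) = S 0 + (\<Sum>n. S (Suc n) * \<rho> ^ Suc n)"
      using suminf_split_head[OF sS] by simp
    have h3: "S 0 + (\<Sum>n. S (Suc n) * \<rho> ^ Suc n) - (\<Sum>n. S n * \<rho> ^ Suc n) = S 0 + (\<Sum>n. a (Suc n) * \<rho> ^ Suc n)"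
    proof -
      have "summable (\<lambda>n. S n * \<rho> ^ Suc n)" using summable_mult2[OF sS, of \<rho>] by (simp add: mult_ac)
      from suminf_diff[OF sS' this] show ?thesis by (simp add: S_def algebra_simps)
    qed
    have h4: "S 0 + (\<Sum>n. a (Suc n) * \<rho> ^ Suc n) = (\<Sum>n. a n * \<rho> ^ n)"
    proof -
      have "summable (\<lambda>n. a n * \<rho> ^ n)"
        using powser_inside[of a 1 \<rho>] a n\<rho> by simp
      then show ?thesis using suminf_split_head[of "\<lambda>n. a n * \<rho> ^ n"] by (simp add: S_def)
    qed
    have e1: "(\<Sum>n. a n * \<rho> ^ n) = (1 - \<rho>) * (\<Sum>n. S n * \<rho> ^ n)"
      by (metis h1 h2 h3 h4)
    have g1: "(1 - \<rho>) * (\<Sum>n. s * \<rho> ^ n) = s"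
    proof -
      have "1 - \<rho> \<noteq> 0" using n\<rho> by auto
      then show ?thesis using suminf_geometric[OF n\<rho>(1)] suminf_mult[OF summable_geometric[OF n\<rho>(1)], of s] by simp
    qed
    have g2: "(\<Sum>n. S n * \<rho> ^ n) - (\<Sum>n. s * \<rho> ^ n) = (\<Sum>n. d n * \<rho> ^ n)"
      using suminf_diff[OF sS s2] by (simp add: S_def d_def algebra_simps)
    have "(\<Sum>n. a n * \<rho> ^ n) - s = (1 - \<rho>) * ((\<Sum>n. S n * \<rho> ^ n) - (\<Sum>n. s * \<rho> ^ n))"
      unfolding right_diff_distrib[of "1 - \<rho>"] e1 g1 ..
    then show "(\<Sum>n. a n * of_real r ^ n) - s = of_real (1 - r) * (\<Sum>n. d n * of_real r ^ n)"
      unfolding g2 by (simp add: \<rho>_def)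
  qed
  show ?thesis
    unfolding s_def[symmetric] tendsto_iff
  proof safe
    fix e :: real assume e: "e > 0"
    obtain N where N: "\<And>n. n \<ge> N \<Longrightarrow> norm (d n) < e / 2"
      using LIMSEQ_D[OF d0, of "e / 2"] e by auto
    have ev1: "eventually (\<lambda>r::real. 0 < r \<and> r < 1) (at_left 1)"
      unfolding eventually_at_left_field by (intro exI[of _ 0]) auto
    have "((\<lambda>r::real. (1 - r) * (real N * D)) \<longlongrightarrow> (1 - 1) * (real N * D)) (at_left 1)"
      by (intro tendsto_intros)
    then have "eventually (\<lambda>r::real. (1 - r) * (real N * D) < e / 2) (at_left 1)"
      using e by (intro order_tendstoD(2)) auto
    with ev1 show "eventually (\<lambda>r::real. dist (\<Sum>n. a n * of_real r ^ n) s < e) (at_left 1)"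
    proof eventually_elim
      case (elim r)
      then have r: "0 < r" "r < 1" by auto
      have "norm (\<Sum>n. d n * of_real r ^ n) \<le> (\<Sum>n. norm (d n * of_real r ^ n))" by (rule summable_norm[OF sd[OF r]])
      also have "\<dots> = (\<Sum>n. norm (d (n + N) * of_real r ^ (n + N))) + (\<Sum>n<N. norm (d n * of_real r ^ n))"
        by (rule suminf_split_initial_segment[OF sd[OF r]])
      also have "\<dots> \<le> (\<Sum>n. e / 2 * r ^ n) + (\<Sum>n<N. D)"
      proof (intro add_mono suminf_le sum_mono)
        show "norm (d (n + N) * of_real r ^ (n + N)) \<le> e / 2 * r ^ n" for n
        proof -
          have "norm (d (n + N)) * r ^ (n + N) \<le> e / 2 * r ^ n"
            using N[of "n + N"] r e by (intro mult_mono power_decreasing) (auto intro: less_imp_le)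
          then show ?thesis using r by (simp add: norm_mult norm_power)
        qed
        show "norm (d n * of_real r ^ n) \<le> D" for n
        proof -
          have "norm (d n) * r ^ n \<le> D * 1" using D r D0 by (intro mult_mono power_le_one) auto
          then show ?thesis using r by (simp add: norm_mult norm_power)
        qed
        show "summable (\<lambda>n. norm (d (n + N) * of_real r ^ (n + N)))"
          using sd[OF r] by (subst summable_iff_shift)
        show "summable (\<lambda>n. e / 2 * r ^ n)" using r by (intro summable_mult summable_geometric) auto
      qed
      also have "\<dots> = e / 2 / (1 - r) + real N * D"
        using r suminf_geometric[of r] suminf_mult[OF summable_geometric[of r], of "e / 2"] by simp
      finally have "(1 - r) * norm (\<Sum>n. d n * of_real r ^ n) \<le> (1 - r) * (e / 2 / (1 - r) + real N * D)"
        using r by (intro mult_left_mono) auto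
      also have "\<dots> = e / 2 + (1 - r) * (real N * D)"
      proof -
        have "1 - r \<noteq> 0" using r by simp
        then have "(1 - r) * (e / 2 / (1 - r)) = e / 2" by (metis nonzero_mult_div_cancel_left times_divide_eq_right)
        then show ?thesis by (simp only: distrib_left)
      qed
      also have "\<dots> < e" using elim by simp
      finally have "(1 - r) * norm (\<Sum>n. d n * of_real r ^ n) < e" .
      moreover have "norm (of_real (1 - r) * (\<Sum>n. d n * complex_of_real r ^ n)) = (1 - r) * norm (\<Sum>n. d n * complex_of_real r ^ n)"
        using r unfolding norm_mult norm_of_real by simp
      ultimately show ?case unfolding dist_norm key[OF r] by simp
    qed
  qed
qed

lemma closed_of_real_atLeast: "closed (complex_of_real ` {x..})"
proof -
  have "complex_of_real ` {x..} = {z. Re z \<ge> x} \<inter> {z. Im z = 0}"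
    by (auto simp: complex_eq_iff image_iff intro!: bexI[of _ "Re z" for z])
  then show ?thesis by (simp add: closed_Int closed_halfspace_Re_ge closed_halfspace_Im_eq)
qed

lemma scaled_not_cut:
  assumes w: "w \<notin> complex_of_real ` {1..}" and r: "0 \<le> r" "r \<le> 1"
  shows "of_real r * w \<notin> complex_of_real ` {1..}"
proof
  assume "of_real r * w \<in> complex_of_real ` {1..}"
  then obtain x where x: "of_real r * w = complex_of_real x" "x \<ge> 1" by auto
  then have "r \<noteq> 0" by auto
  then have "w = complex_of_real (x / r)" using x by (simp add: field_simps)
  moreover have "x / r \<ge> 1" using x r \<open>r \<noteq> 0\<close> by (simp add: field_simps)
  ultimately show False using w by (metis atLeast_iff imageI)
qed

text \<open>The set is starlike about 0, because scaling towards 0 never meets the cut. An infinite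
  \<open>R\<close> covers the whole cut plane.\<close>

lemma connected_cut_ball: "connected (eball 0 R - complex_of_real ` {1..})"
proof (cases "R > 0")
  case True
  have "starlike (eball 0 R - complex_of_real ` {1..})"
    unfolding starlike_def
  proof (intro bexI[of _ 0] ballI subsetI)
    fix x y assume x: "x \<in> eball 0 R - complex_of_real ` {1..}" and "y \<in> closed_segment 0 x"
    then obtain r where r: "0 \<le> r" "r \<le> 1" "y = of_real r * x"
      by (auto simp: in_segment scaleR_conv_of_real)
    have "norm y \<le> norm x" using r by (simp add: norm_mult mult_left_le_one_le)
    then have "ereal (norm y) < R" using x by (auto intro: le_less_trans[of _ "ereal (norm x)"])
    then show "y \<in> eball 0 R - complex_of_real ` {1..}" using scaled_not_cut[of x r] r x by auto
  qed (use True in \<open>auto simp: zero_ereal_def[symmetric]\<close>)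
  then show ?thesis by (rule starlike_imp_connected)
next
  case False
  then have "eball 0 R = ({} :: complex set)" by simp
  then show ?thesis by simp
qed

text \<open>By the identity theorem any two continuations to the cut plane agree, so the choice in
  \<open>hyp2F1\<close> is immaterial. The definition prefers the series wherever it converges, and
  this may happen on the unit circle or for a terminating series; there Abel's theorem identifies
  the sum with the continuation.\<close>

lemma hyp2F1_continuation:
  assumes G: "G holomorphic_on - (complex_of_real ` {1..})" and eq: "\<And>u. u \<in> ball 0 1 \<Longrightarrow> G u = gauss_F a b c u"
    and w: "w \<notin> complex_of_real ` {1..}"
  shows "hyp2F1 a b c w = G w"
proof (cases "summable (hyp2F1_series a b c w)")
  case False
  define P where "P f \<longleftrightarrow> f holomorphic_on - (complex_of_real ` {1..}) \<and> (\<forall>u\<in>ball 0 1. f u = (\<Sum>n. hyp2F1_series a b c u n))" for f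
  have "P G" unfolding P_def using G eq by (simp add: gauss_F_def hyp2F1_series_eq[abs_def])
  then have S: "P (SOME f. P f)" by (rule someI[of P])
  define f where "f = (SOME f. P f)"
  have Pf: "P f" using S by (simp only: f_def)
  have "f w = G w"
  proof (rule analytic_continuation_open[of "ball 0 1" "- (complex_of_real ` {1..})" f G])
    show "open (- (complex_of_real ` {1..}))" by (simp add: open_Compl closed_of_real_atLeast)
    show "connected (- (complex_of_real ` {1..}))" using connected_cut_ball[of \<infinity>] by (simp add: Compl_eq_Diff_UNIV)
    show "ball 0 1 \<subseteq> - (complex_of_real ` {1..})" by auto
    show "f z = G z" if "z \<in> ball 0 1" for z
      using Pf that eq unfolding P_def by (simp add: gauss_F_def hyp2F1_series_eq[abs_def])
  qed (use G w Pf in \<open>auto simp: P_def\<close>)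
  moreover have "hyp2F1 a b c w = f w" unfolding hyp2F1_def f_def P_def[abs_def] using False by simp
  ultimately show ?thesis by simp
next
  case True
  show ?thesis
  proof (cases "norm w < 1")
    case True
    then show ?thesis using eq[of w] by (simp add: hyp2F1_eq_gauss_F)
  next
    case w1: False
    have sm: "summable (\<lambda>n. hyp_coeff a b c n * w ^ n)" using True by (simp add: hyp2F1_series_eq[abs_def])
    define f where "f = eval_fps (hyp_fps a b c)"
    \<comment> \<open>Convergence at \<open>w\<close> makes the series holomorphic on
      \<open>ball 0 (norm w)\<close>, where it equals \<open>G\<close> off the cut; both are then
      followed radially to \<open>w\<close>.\<close>
    have "fps_conv_radius (hyp_fps a b c) \<ge> norm w"
      unfolding fps_conv_radius_def using sm by (intro conv_radius_geI) (simp add: hyp_fps_def)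
    then have "ball 0 (norm w) \<subseteq> eball (0::complex) (fps_conv_radius (hyp_fps a b c))"
      by (auto simp: less_le_trans[of _ "ereal (norm w)"])
    then have holf: "f holomorphic_on ball 0 (norm w)" unfolding f_def by (intro holomorphic_on_eval_fps)
    have fG: "f u = G u" if u: "u \<in> ball 0 (norm w)" "u \<notin> complex_of_real ` {1..}" for u
    proof (rule analytic_continuation_open[of "ball 0 1" "eball 0 (ereal (norm w)) - complex_of_real ` {1..}" f G])
      show "open (eball 0 (ereal (norm w)) - complex_of_real ` {1..})" by (intro open_Diff closed_of_real_atLeast) auto
      show "ball 0 1 \<subseteq> eball 0 (ereal (norm w)) - complex_of_real ` {1..}" using w1 by auto
      show "f z = G z" if "z \<in> ball 0 1" for z using eq[OF that] by (simp add: f_def gauss_F_eq_eval_fps)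
      show "G holomorphic_on eball 0 (ereal (norm w)) - complex_of_real ` {1..}" using G by (rule holomorphic_on_subset) auto
      show "f holomorphic_on eball 0 (ereal (norm w)) - complex_of_real ` {1..}" using holf by (rule holomorphic_on_subset) auto
      show "connected (eball 0 (ereal (norm w)) - complex_of_real ` {1..})" by (rule connected_cut_ball)
    qed (use u in auto)
    have ev1: "eventually (\<lambda>r::real. 0 < r \<and> r < 1) (at_left 1)"
      unfolding eventually_at_left_field by (intro exI[of _ 0]) auto
    have "((\<lambda>r::real. \<Sum>n. hyp_coeff a b c n * w ^ n * of_real r ^ n) \<longlongrightarrow> (\<Sum>n. hyp_coeff a b c n * w ^ n)) (at_left 1)"
      by (rule abel_limit[OF sm])
    moreover have "eventually (\<lambda>r::real. (\<Sum>n. hyp_coeff a b c n * w ^ n * of_real r ^ n) = G (of_real r * w)) (at_left 1)"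
      using ev1
    proof eventually_elim
      case (elim r)
      have "f (of_real r * w) = G (of_real r * w)"
      proof (rule fG)
        have "r * norm w < 1 * norm w" using elim w1 by (intro mult_strict_right_mono) linarith+
        then show "of_real r * w \<in> ball 0 (norm w)" using elim by (simp add: norm_mult)
        show "of_real r * w \<notin> complex_of_real ` {1..}" using scaled_not_cut[OF w] elim by simp
      qed
      then show ?case by (simp add: f_def eval_fps_def hyp_fps_def power_mult_distrib mult_ac)
    qed
    ultimately have "((\<lambda>r::real. G (of_real r * w)) \<longlongrightarrow> (\<Sum>n. hyp_coeff a b c n * w ^ n)) (at_left 1)"
      by (rule Lim_transform_eventually)
    moreover have "((\<lambda>r::real. G (of_real r * w)) \<longlongrightarrow> G w) (at_left 1)"
    proof (rule isCont_tendsto_compose[of w G])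
      show "isCont G w" using holomorphic_on_imp_continuous_on[OF G] w
        by (simp add: continuous_on_eq_continuous_at open_Compl closed_of_real_atLeast)
    qed (auto intro!: tendsto_eq_intros)
    ultimately have "(\<Sum>n. hyp_coeff a b c n * w ^ n) = G w"
      using tendsto_unique[OF trivial_limit_at_left_real] by blast
    then show ?thesis using True by (simp add: hyp2F1_def hyp2F1_series_eq[abs_def])
  qed
qed

text \<open>The expansion about shift 1 with \<open>v = - 2 * w\<close>: its condition
  \<open>norm v < 2\<close> is \<open>norm w < 1\<close>, and \<open>cosh_int_1\<close> evaluates
  each term.\<close>

lemma cosh_int_gauss_F:
  assumes z: "\<bar>Re \<zeta>\<bar> < q" and w: "norm w < 1"
  shows "cosh_int q \<zeta> (1 - 2 * w) = cosh_int q \<zeta> 1 * gauss_F (of_real q + \<zeta>) (of_real q - \<zeta>) (of_real q + 1/2) w"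
proof -
  define Q where "Q = complex_of_real q"
  have q: "q > 0" using z by linarith
  have np: "x \<notin> \<int>\<^sub>\<le>\<^sub>0" if "Re x > 0" for x :: complex using that by (auto elim!: nonpos_Ints_cases)
  have npQ: "Q + \<zeta> \<notin> \<int>\<^sub>\<le>\<^sub>0" "Q - \<zeta> \<notin> \<int>\<^sub>\<le>\<^sub>0" "2 * Q \<notin> \<int>\<^sub>\<le>\<^sub>0" "Q \<notin> \<int>\<^sub>\<le>\<^sub>0" "Q + 1/2 \<notin> \<int>\<^sub>\<le>\<^sub>0"
    using z q by (auto intro!: np simp: Q_def)
  have poch: "Gamma (x + of_nat n) = pochhammer x n * Gamma x" if "x \<notin> \<int>\<^sub>\<le>\<^sub>0" for x :: complex and n
    using pochhammer_Gamma[OF that, of n] that by (simp add: Gamma_eq_zero_iff)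
  have pne: "pochhammer x n \<noteq> 0" if "x \<notin> \<int>\<^sub>\<le>\<^sub>0" for x :: complex and n
    using that by (metis pochhammer_eq_0_iff minus_of_nat_in_nonpos_Ints)
  have S: "(\<lambda>n. ((- of_real q) gchoose n) * (- 2 * w) ^ n * cosh_int (q + real n) \<zeta> (of_real 1)) sums cosh_int q \<zeta> (of_real 1 + - 2 * w)"
    using w z by (intro cosh_int_expansion) (auto simp: norm_mult)
  have "((- of_real q) gchoose n) * (- 2 * w) ^ n * cosh_int (q + real n) \<zeta> (of_real 1)
      = cosh_int q \<zeta> 1 * (hyp_coeff (Q + \<zeta>) (Q - \<zeta>) (Q + 1/2) n * w ^ n)" for n
  proof -
    define X where "X = complex_of_real (2 powr q)"
    have a1: "cosh_int q \<zeta> 1 = X * (Gamma (Q + \<zeta>) * Gamma (Q - \<zeta>) / Gamma (2 * Q))"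
      using cosh_int_1[OF z] by (simp add: X_def Q_def)
    have e: "of_real (q + real n) + \<zeta> = Q + \<zeta> + of_nat n" "of_real (q + real n) - \<zeta> = Q - \<zeta> + of_nat n"
      "2 * complex_of_real (q + real n) = 2 * Q + of_nat (2 * n)" by (simp_all add: Q_def)
    have "(2::real) powr (q + real n) = 2 powr q * 2 ^ n" by (simp add: powr_add powr_realpow)
    then have "complex_of_real (2 powr (q + real n)) = X * 2 ^ n" by (simp add: X_def)
    moreover have "cosh_int (q + real n) \<zeta> 1 = of_real (2 powr (q + real n)) * (Gamma (of_real (q + real n) + \<zeta>) * Gamma (of_real (q + real n) - \<zeta>) / Gamma (2 * of_real (q + real n)))"
      using z by (intro cosh_int_1) auto
    ultimately have a2: "cosh_int (q + real n) \<zeta> 1 = X * 2 ^ n * ((pochhammer (Q + \<zeta>) n * Gamma (Q + \<zeta>)) * (pochhammer (Q - \<zeta>) n * Gamma (Q - \<zeta>)) / (pochhammer (2 * Q) (2 * n) * Gamma (2 * Q)))"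
      unfolding e poch[OF npQ(1)] poch[OF npQ(2)] poch[OF npQ(3)] by (simp only:)
    \<comment> \<open>Duplication produces the third parameter \<open>Q + 1/2\<close> and cancels
      the factor \<open>pochhammer Q n\<close> of the binomial coefficient.\<close>
    have p2: "pochhammer (2 * Q) (2 * n) = 2 ^ n * 2 ^ n * pochhammer Q n * pochhammer (Q + 1/2) n"
      using pochhammer_double[of Q n] by (simp only: of_nat_power of_nat_numeral power_even_eq power2_eq_square of_nat_mult)
    have g: "((- of_real q) gchoose n) = (- 1) ^ n * pochhammer Q n / fact n" by (simp add: gbinomial_pochhammer Q_def)
    have m: "(- 2 * w) ^ n = (- 1) ^ n * 2 ^ n * w ^ n" 
    proof -
      have "(- 2 * w) ^ n = ((- 1) * 2 * w) ^ n" by simp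
      then show ?thesis by (simp only: power_mult_distrib)
    qed
    have sg: "(- 1) ^ n * (- 1) ^ n = (1 :: complex)" by (simp flip: power_mult_distrib)
    have "((- of_real q) gchoose n) * (- 2 * w) ^ n * cosh_int (q + real n) \<zeta> (of_real 1)
      = ((- 1) ^ n * (- 1) ^ n) * (pochhammer Q n / fact n * 2 ^ n * w ^ n * cosh_int (q + real n) \<zeta> 1)"
      unfolding g m by (simp add: mult_ac)
    also have "\<dots> = pochhammer Q n / fact n * 2 ^ n * w ^ n * cosh_int (q + real n) \<zeta> 1" unfolding sg by simp
    also have "\<dots> = cosh_int q \<zeta> 1 * (hyp_coeff (Q + \<zeta>) (Q - \<zeta>) (Q + 1/2) n * w ^ n)"
      unfolding a1 a2 p2 hyp_coeff_def using pne[OF npQ(4)] pne[OF npQ(5)] npQ(3) by (simp add: field_simps Gamma_eq_zero_iff)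
    finally show ?thesis .
  qed
  then have S': "(\<lambda>n. cosh_int q \<zeta> 1 * (hyp_coeff (Q + \<zeta>) (Q - \<zeta>) (Q + 1/2) n * w ^ n)) sums cosh_int q \<zeta> (1 - 2 * w)"
    using S by simp
  have "(\<lambda>n. hyp_coeff (Q + \<zeta>) (Q - \<zeta>) (Q + 1/2) n * w ^ n) sums gauss_F (Q + \<zeta>) (Q - \<zeta>) (Q + 1/2) w"
    unfolding gauss_F_def using summable_norm_cancel[OF summable_gauss_F[OF w]] by (rule summable_sums)
  from sums_unique2[OF S' sums_mult[OF this]] show ?thesis by (simp add: Q_def)
qed

text \<open>The map \<open>1 - 2 * w\<close> sends the complement of the cut of
  \<open>hyp2F1\<close> into the domain of \<open>cosh_int\<close>, so the integral continues the
  series.\<close>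

lemma hyp2F1_eq_cosh_int:
  assumes z: "\<bar>Re z\<bar> < 2 * real (Suc m) - 1" and t: "t > 1"
  shows "cosh_int (1/2 + real m) (z / 2) 1 * hyp2F1 ((1 - z) / 2) ((1 + z) / 2) (of_nat (Suc m)) (of_real ((1 - t) / 2))
     = of_real (((1 + t) / 2) ^ m) * cosh_int (1/2 + real m) (z / 2) (of_real t)"
proof -
  define q where "q = 1/2 + real m"
  define \<zeta> where "\<zeta> = z / 2"
  have zz: "\<bar>Re \<zeta>\<bar> < q" using z by (simp add: q_def \<zeta>_def)
  have np: "x \<notin> \<int>\<^sub>\<le>\<^sub>0" if "Re x > 0" for x :: complex using that by (auto elim!: nonpos_Ints_cases)
  have c1: "cosh_int q \<zeta> 1 \<noteq> 0"
    unfolding cosh_int_1[OF zz] using zz np[of "of_real q + \<zeta>"] np[of "of_real q - \<zeta>"] np[of "2 * of_real q"]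
    by (auto simp: Gamma_eq_zero_iff)
  \<comment> \<open>The factor \<open>(1 - w) ^ m\<close> is Euler's: it changes the parameters
    \<open>q + \<zeta>\<close> and \<open>q - \<zeta>\<close> of the integral into those of the
    Legendre function.\<close>
  define G where "G w = (1 - w) ^ m * cosh_int q \<zeta> (1 - 2 * w) / cosh_int q \<zeta> 1" for w
  have ar: "of_nat (Suc m) - (1 - z) / 2 = of_real q + \<zeta>" "of_nat (Suc m) - (1 + z) / 2 = of_real q - \<zeta>"
    "of_nat (Suc m) = of_real q + (1/2 :: complex)" "of_nat (Suc m) - (1 - z) / 2 - (1 + z) / 2 = (of_nat m :: complex)"
    by (simp_all add: q_def \<zeta>_def field_simps)
  have "hyp2F1 ((1 - z) / 2) ((1 + z) / 2) (of_nat (Suc m)) (of_real ((1 - t) / 2)) = G (of_real ((1 - t) / 2))"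
  proof (rule hyp2F1_continuation)
    have hc: "cosh_int q \<zeta> holomorphic_on - (complex_of_real ` {..-1})" by (rule cosh_int_holomorphic_s[OF zz])
    have im: "(\<lambda>w. 1 - 2 * w) ` (- (complex_of_real ` {1..})) \<subseteq> - (complex_of_real ` {..-1})"
    proof (rule image_subsetI, rule ComplI)
      fix w assume w: "w \<in> - (complex_of_real ` {1..})" and "1 - 2 * w \<in> complex_of_real ` {..-1}"
      then obtain x where x: "1 - 2 * w = of_real x" "x \<le> -1" by auto
      then have "w = of_real ((1 - x) / 2)" by (simp add: field_simps)
      moreover have "(1 - x) / 2 \<ge> 1" using x by simp
      ultimately show False using w by (metis ComplD atLeast_iff imageI)
    qed
    have "(\<lambda>w. cosh_int q \<zeta> (1 - 2 * w)) holomorphic_on - (complex_of_real ` {1..})"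
      using holomorphic_on_compose_gen[OF _ hc im] by (simp add: o_def holomorphic_intros)
    then show "G holomorphic_on - (complex_of_real ` {1..})"
      unfolding G_def using c1 by (intro holomorphic_intros) auto
    show "G u = gauss_F ((1 - z) / 2) ((1 + z) / 2) (of_nat (Suc m)) u" if u: "u \<in> ball 0 1" for u
    proof -
      have nu: "norm u < 1" using u by simp
      have "1 - u \<noteq> 0" using nu by auto
      then have "(1 - u) powr (of_nat m) = (1 - u) ^ m" by (simp add: powr_nat')
      moreover have "gauss_F ((1 - z) / 2) ((1 + z) / 2) (of_nat (Suc m)) u = (1 - u) powr (of_nat (Suc m) - (1 - z) / 2 - (1 + z) / 2) * gauss_F (of_nat (Suc m) - (1 - z) / 2) (of_nat (Suc m) - (1 + z) / 2) (of_nat (Suc m)) u"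
        by (rule gauss_F_euler[OF _ nu]) (rule np, simp)
      moreover have "cosh_int q \<zeta> (1 - 2 * u) = cosh_int q \<zeta> 1 * gauss_F (of_real q + \<zeta>) (of_real q - \<zeta>) (of_real q + 1/2) u"
        by (rule cosh_int_gauss_F[OF zz nu])
      moreover have "of_real q + \<zeta> - (1 + z) / 2 = of_nat m" by (simp add: q_def \<zeta>_def field_simps)
      ultimately show ?thesis unfolding G_def ar(1,2) unfolding ar(3) using c1 by simp
    qed
    show "complex_of_real ((1 - t) / 2) \<notin> complex_of_real ` {1..}" using t by (auto simp del: of_real_divide of_real_diff)
  qed
  also have "G (of_real ((1 - t) / 2)) = of_real (((1 + t) / 2) ^ m) * cosh_int q \<zeta> (of_real t) / cosh_int q \<zeta> 1"
  proof -
    have "1 - complex_of_real ((1 - t) / 2) = of_real ((1 + t) / 2)" "1 - 2 * complex_of_real ((1 - t) / 2) = of_real t"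
      by (simp_all add: field_simps)
    then show ?thesis unfolding G_def by (simp only: of_real_power)
  qed
  finally show ?thesis using c1 by (simp add: q_def \<zeta>_def)
qed

section \<open>Averaging over the compact group at a real place\<close>

unbundle no fps_syntax

lemma mat2_sel [simp]:
  "mat2 a b c d $ 1 $ 1 = a" "mat2 a b c d $ 1 $ 2 = b" "mat2 a b c d $ 2 $ 1 = c" "mat2 a b c d $ 2 $ 2 = d"
  by (simp_all add: mat2_def)

lemma mat2_eqI:
  fixes M N :: "'a^2^2"
  assumes "M $ 1 $ 1 = N $ 1 $ 1" "M $ 1 $ 2 = N $ 1 $ 2" "M $ 2 $ 1 = N $ 2 $ 1" "M $ 2 $ 2 = N $ 2 $ 2"
  shows "M = N"
  using assms by (simp add: vec_eq_iff forall_2)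

lemma mat2_mult_sel:
  fixes M N :: "'a::semiring_1^2^2"
  shows "(M ** N) $ 1 $ 1 = M $ 1 $ 1 * N $ 1 $ 1 + M $ 1 $ 2 * N $ 2 $ 1"
    "(M ** N) $ 1 $ 2 = M $ 1 $ 1 * N $ 1 $ 2 + M $ 1 $ 2 * N $ 2 $ 2"
    "(M ** N) $ 2 $ 1 = M $ 2 $ 1 * N $ 1 $ 1 + M $ 2 $ 2 * N $ 2 $ 1"
    "(M ** N) $ 2 $ 2 = M $ 2 $ 1 * N $ 1 $ 2 + M $ 2 $ 2 * N $ 2 $ 2"
  by (simp_all add: matrix_matrix_mult_def sum_2)

lemma mat_1_sel [simp]:
  "(mat 1 :: 'a::zero_neq_one^2^2) $ 1 $ 1 = 1" "(mat 1 :: 'a::zero_neq_one^2^2) $ 1 $ 2 = 0" "(mat 1 :: 'a::zero_neq_one^2^2) $ 2 $ 1 = 0" "(mat 1 :: 'a::zero_neq_one^2^2) $ 2 $ 2 = 1"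
  by (simp_all add: mat_def)

lemma matrix_inv_eqI:
  fixes A B :: "'a::semiring_1^'n^'n"
  assumes "A ** B = mat 1" "B ** A = mat 1"
  shows "matrix_inv A = B"
proof -
  have "A ** matrix_inv A = mat 1 \<and> matrix_inv A ** A = mat 1"
    unfolding matrix_inv_def by (rule someI[of _ B]) (use assms in simp)
  then have "matrix_inv A = matrix_inv A ** (A ** B)" "matrix_inv A ** A = mat 1" using assms by simp_all
  then show ?thesis by (simp add: matrix_mul_assoc)
qed

lemma borel_measurable_det2: "{g :: real^2^2. det g > 0} \<in> sets borel"
proof -
  have "continuous_on UNIV (\<lambda>g :: real^2^2. det g)" unfolding det_2 by (intro continuous_intros)
  then show ?thesis by (intro borel_open open_Collect_less) (auto intro: continuous_intros)
qed

lemma O2_det: "k \<in> O2 \<Longrightarrow> det k = 1 \<or> det k = - 1"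
  unfolding O2_def using det_orthogonal_matrix by blast

text \<open>Left translation by the reflection \<open>mat2 1 0 0 (- 1)\<close> exchanges the two
  components of \<open>O2\<close>, so each has mass 1/2.\<close>

lemma haar_O2_average:
  fixes f :: "real^2^2 \<Rightarrow> complex"
  assumes dk: "is_haar_prob O2 dk" and f: "\<And>k. k \<in> O2 \<Longrightarrow> f k = (if det k > 0 then A else B)"
  shows "integrable dk f" "(LINT k|dk. f k) = (A + B) / 2"
proof -
  have sets: "sets dk = sets (restrict_space borel O2)" and one: "emeasure dk O2 = 1"
    and inv: "\<And>k A. k \<in> O2 \<Longrightarrow> A \<in> sets dk \<Longrightarrow> emeasure dk ((\<lambda>g. k ** g) ` A) = emeasure dk A"
    using dk by (auto simp: is_haar_prob_def)
  have sp: "space dk = O2" using sets_eq_imp_space_eq[OF sets] by (simp add: space_restrict_space)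
  define P where "P = {k \<in> O2. det k > 0}"
  define N where "N = O2 - P"
  have Ps: "P \<in> sets dk"
  proof -
    have "P = O2 \<inter> {g. det g > 0}" by (auto simp: P_def)
    then show ?thesis unfolding sets sets_restrict_space using borel_measurable_det2 by auto
  qed
  have Ns: "N \<in> sets dk" unfolding N_def sp[symmetric] using Ps by auto
  define r :: "real^2^2" where "r = mat2 1 0 0 (- 1)"
  have r: "r \<in> O2" "det r = - 1" "r ** r = mat 1"
  proof -
    have t: "transpose r = r" by (rule mat2_eqI) (simp_all add: r_def transpose_def)
    show rr: "r ** r = mat 1" by (rule mat2_eqI) (simp_all add: mat2_mult_sel r_def)
    show "r \<in> O2" using t rr by (simp add: O2_def orthogonal_matrix)
    show "det r = - 1" by (simp add: det_2 r_def)
  qed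
  have "(\<lambda>g. r ** g) ` P = N"
  proof
    show "(\<lambda>g. r ** g) ` P \<subseteq> N"
      using r by (auto simp: P_def N_def det_mul O2_def orthogonal_matrix_mul)
    show "N \<subseteq> (\<lambda>g. r ** g) ` P"
    proof
      fix k assume k: "k \<in> N"
      then have "det k = - 1" "k \<in> O2" using O2_det[of k] by (auto simp: N_def P_def)
      then have "r ** k \<in> P" using r by (auto simp: P_def det_mul O2_def orthogonal_matrix_mul)
      moreover have "k = r ** (r ** k)" using r by (simp add: matrix_mul_assoc)
      ultimately show "k \<in> (\<lambda>g. r ** g) ` P" by blast
    qed
  qed
  then have eq: "emeasure dk N = emeasure dk P" using inv[OF r(1) Ps] by simp
  interpret finite_measure dk by standard (simp add: sp one)
  have "P \<union> N = O2" "P \<inter> N = {}" by (auto simp: P_def N_def)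
  then have "measure dk P + measure dk N = 1"
    using finite_measure_Union[OF Ps Ns] one by (simp add: measure_def)
  moreover have "measure dk N = measure dk P" using eq by (simp add: measure_def)
  ultimately have half: "measure dk P = 1/2" "measure dk N = 1/2" by auto
  have fe: "f k = indicator P k *\<^sub>R A + indicator N k *\<^sub>R B" if "k \<in> space dk" for k
    using f[of k] that by (auto simp: sp P_def N_def indicator_def)
  have ii: "integrable dk (indicator P :: _ \<Rightarrow> real)" "integrable dk (indicator N :: _ \<Rightarrow> real)"
    using Ps Ns by (auto intro!: integrable_real_indicator simp: emeasure_eq_measure)
  have i: "integrable dk (\<lambda>k. indicator P k *\<^sub>R A)" "integrable dk (\<lambda>k. indicator N k *\<^sub>R B)"
    using ii by (auto intro!: integrable_scaleR_left)
  show "integrable dk f"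
    using Bochner_Integration.integrable_add[OF i] by (subst Bochner_Integration.integrable_cong[OF refl fe]) auto
  have "(LINT k|dk. f k) = (LINT k|dk. indicator P k *\<^sub>R A + indicator N k *\<^sub>R B)"
    by (rule Bochner_Integration.integral_cong[OF refl fe])
  also have "\<dots> = measure dk P *\<^sub>R A + measure dk N *\<^sub>R B"
    using ii sets.sets_into_space[OF Ps] sets.sets_into_space[OF Ns]
    by (subst Bochner_Integration.integral_add[OF i]) (simp add: Int_absorb2)
  finally show "(LINT k|dk. f k) = (A + B) / 2" by (simp add: half scaleR_conv_of_real add_divide_distrib)
qed

text \<open>The test function sees the determinant, the trace and the antisymmetric part. Orthogonal
  conjugation preserves the first two and multiplies the third by \<open>det k\<close>.\<close>

lemma Phi_real_conj:
  assumes k: "k \<in> O2"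
  shows "Phi_real l (conj_unip a x k) =
    (if a > 0 then of_real ((4 * a) ^ (l div 2)) * inverse (Complex (a + 1) (- (det k * ((a - 1) * x))) ^ l) else 0)"
proof -
  have t: "transpose k ** k = mat 1" "k ** transpose k = mat 1"
    using k by (auto simp: O2_def orthogonal_matrix_def)
  then have inv: "matrix_inv k = transpose k" by (intro matrix_inv_eqI)
  define g where "g = mat2 a ((a - 1) * x) 0 1"
  define M where "M = transpose k ** g ** k"
  define p q r s where "p = k $ 1 $ 1" and "q = k $ 1 $ 2" and "r = k $ 2 $ 1" and "s = k $ 2 $ 2"
  have kk: "p * p + q * q = 1" "p * r + q * s = 0" "r * r + s * s = 1"
    using arg_cong[OF t(2), of "\<lambda>M :: real^2^2. M $ 1 $ 1"] arg_cong[OF t(2), of "\<lambda>M :: real^2^2. M $ 1 $ 2"] arg_cong[OF t(2), of "\<lambda>M :: real^2^2. M $ 2 $ 2"]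
    by (simp_all add: mat2_mult_sel transpose_def p_def q_def r_def s_def)
  have d: "det k = p * s - q * r" by (simp add: det_2 p_def q_def r_def s_def)
  have "det k * det k = 1" using O2_det[OF k] by auto
  then have detM: "det M = a" unfolding M_def det_mul det_transpose by (simp add: g_def det_2 mult_ac)
  have M1: "M $ 1 $ 1 + M $ 2 $ 2 = a + 1"
  proof -
    have "M $ 1 $ 1 + M $ 2 $ 2 = a * (p * p + q * q) + ((a - 1) * x) * (p * r + q * s) + (r * r + s * s)"
      by (simp add: M_def mat2_mult_sel transpose_def g_def p_def q_def r_def s_def algebra_simps)
    then show ?thesis using kk by simp
  qed
  have M2: "M $ 1 $ 2 - M $ 2 $ 1 = det k * ((a - 1) * x)"
    unfolding d by (simp add: M_def mat2_mult_sel transpose_def g_def p_def q_def r_def s_def algebra_simps)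
  have "conj_unip a x k = M" by (simp add: conj_unip_def inv M_def g_def)
  then show ?thesis unfolding Phi_real_def by (simp only: detM M1 M2)
qed

lemma frakF_real_neg:
  assumes dk: "is_haar_prob O2 dk" and a: "\<not> a > 0"
  shows "frakF_converges dk lborel (Phi_real l) \<phi> a" "frakF dk lborel (Phi_real l) \<phi> a = 0"
proof -
  have "Phi_real l (conj_unip a x k) = (if det k > 0 then 0 else 0)" if "k \<in> O2" for k x
    using Phi_real_conj[OF that] a by simp
  note A = haar_O2_average[OF dk this]
  show "frakF_converges dk lborel (Phi_real l) \<phi> a" "frakF dk lborel (Phi_real l) \<phi> a = 0"
    using A by (simp_all add: frakF_converges_def frakF_def)
qed

lemma sph_even: "sph z (- x) = sph z x"
  by (simp add: sph_def)

text \<open>The two components of \<open>O2\<close> contribute the integrand at \<open>x\<close> and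
  at \<open>- x\<close>, which agree after integration because \<open>sph\<close> is even. Dividing
  out \<open>\<bar>a - 1\<bar>\<close> leaves the base \<open>t + \<i> * x\<close>.\<close>

lemma frakF_real_pos:
  assumes dk: "is_haar_prob O2 dk" and a: "a > 0" "a \<noteq> 1" and m: "m \<ge> 1" and z: "\<bar>Re z\<bar> < 2 * real (Suc m) - 1"
  defines "t \<equiv> (a + 1) / \<bar>a - 1\<bar>"
  shows "frakF_converges dk lborel (Phi_real (Suc m)) (phi_real z) a"
    and "frakF dk lborel (Phi_real (Suc m)) (phi_real z) a =
      of_real ((4 * a) ^ (Suc m div 2) / \<bar>a - 1\<bar> ^ Suc m) * (LINT x|lborel. inverse ((of_real t + \<i> * of_real x) ^ Suc m) * sph z x)"
proof -
  define D where "D = (4 * a) ^ (Suc m div 2) / \<bar>a - 1\<bar> ^ Suc m"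
  define A where "A \<sigma> x = complex_of_real ((4 * a) ^ (Suc m div 2)) * inverse (Complex (a + 1) (- (\<sigma> * ((a - 1) * x))) ^ Suc m)" for \<sigma> x :: real
  have t: "t > 0" using a by (simp add: t_def)
  define Kp where "Kp x = inverse ((of_real t + \<i> * complex_of_real x) ^ Suc m)" for x
  \<comment> \<open>The signs of \<open>a - 1\<close> and of \<open>det k\<close> are moved into the
    variable; averaging over both values of \<open>\<sigma>\<close> then removes the sign of
    \<open>a - 1\<close>.\<close>
  have Acomp: "A \<sigma> x = of_real D * Kp (- (sgn (a - 1) * \<sigma>) * x)" for \<sigma> x
  proof -
    have "Complex (a + 1) (- (\<sigma> * ((a - 1) * x))) = of_real \<bar>a - 1\<bar> * (of_real t + \<i> * complex_of_real (- (sgn (a - 1) * \<sigma>) * x))"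
    proof -
      have re: "a + 1 = \<bar>a - 1\<bar> * t" using a by (simp add: t_def)
      have im: "- (\<sigma> * ((a - 1) * x)) = \<bar>a - 1\<bar> * (- (sgn (a - 1) * \<sigma>) * x)"
        using a by (cases "a > 1") (simp_all add: abs_if sgn_if algebra_simps)
      show ?thesis unfolding Complex_eq im re of_real_mult distrib_left mult.left_commute[of "of_real \<bar>a - 1\<bar>" \<i>] ..
    qed
    then show ?thesis unfolding A_def D_def Kp_def by (simp add: power_mult_distrib divide_inverse mult_ac)
  qed
  have f: "Phi_real (Suc m) (conj_unip a x k) = (if det k > 0 then A 1 x else A (- 1) x)" if "k \<in> O2" for k x
    using Phi_real_conj[OF that, of "Suc m" a x] O2_det[OF that] a by (auto simp: A_def)
  have av: "integrable dk (\<lambda>k. Phi_real (Suc m) (conj_unip a x k))"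
    "(LINT k|dk. Phi_real (Suc m) (conj_unip a x k)) = (A 1 x + A (- 1) x) / 2" for x
    using haar_O2_average[where f = "\<lambda>k. Phi_real (Suc m) (conj_unip a x k)", OF dk f] by auto
  have avg: "(LINT k|dk. Phi_real (Suc m) (conj_unip a x k)) = of_real (D / 2) * (Kp x + Kp (- x))" for x
    unfolding av(2) Acomp using a by (auto simp: sgn_if field_simps)
  have i1: "integrable lborel (\<lambda>x. Kp x * sph z x)" unfolding Kp_def by (rule integrable_sph(1)[OF t z])
  have i2: "integrable lborel (\<lambda>x. Kp (- x) * sph z x)"
    using lborel_integrable_real_affine[OF i1, of "- 1" 0] by (simp add: sph_even)
  have v2: "(LINT x|lborel. Kp (- x) * sph z x) = (LINT x|lborel. Kp x * sph z x)"
    using lborel_integral_real_affine[of "- 1" "\<lambda>x. Kp x * sph z x" 0] by (simp add: sph_even)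
  define h where "h x = of_real (D / 2) * (Kp x * sph z x + Kp (- x) * sph z x)" for x
  have ih: "integrable lborel h" unfolding h_def by (intro integrable_mult_right Bochner_Integration.integrable_add i1 i2)
  have ae: "AE x in lborel. (LINT k|dk. Phi_real (Suc m) (conj_unip a x k)) * phi_real z x = h x"
    using AE_lborel_singleton[of 0]
  proof eventually_elim
    case (elim x)
    then show ?case unfolding avg h_def phi_real_eq_sph[OF elim] by (simp add: algebra_simps)
  qed
  \<comment> \<open>\<open>phi_real\<close> is identified with \<open>sph\<close> only for
    \<open>x \<noteq> 0\<close>; changing a measurable function at one point keeps it
    measurable.\<close>
  have meas: "(\<lambda>x. (LINT k|dk. Phi_real (Suc m) (conj_unip a x k)) * phi_real z x) \<in> borel_measurable lborel"
  proof (rule measurable_discrete_difference[where X = "{0}"])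
    show "h \<in> borel_measurable lborel" using ih by simp
    show "h x = (LINT k|dk. Phi_real (Suc m) (conj_unip a x k)) * phi_real z x" if "x \<notin> {0}" for x
      unfolding avg h_def using phi_real_eq_sph[of x z] that by (simp add: algebra_simps)
  qed auto
  show "frakF_converges dk lborel (Phi_real (Suc m)) (phi_real z) a"
    unfolding frakF_converges_def using av(1) integrable_cong_AE[OF meas borel_measurable_integrable[OF ih] ae] ih by blast
  have "frakF dk lborel (Phi_real (Suc m)) (phi_real z) a = (LINT x|lborel. h x)"
    unfolding frakF_def by (rule integral_cong_AE[OF meas borel_measurable_integrable[OF ih] ae])
  also have "\<dots> = of_real (D / 2) * ((LINT x|lborel. Kp x * sph z x) + (LINT x|lborel. Kp x * sph z x))"
    unfolding h_def integral_mult_right_zero Bochner_Integration.integral_add[OF i1 i2] v2 ..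
  also have "\<dots> = of_real D * (LINT x|lborel. Kp x * sph z x)" by simp
  finally show "frakF dk lborel (Phi_real (Suc m)) (phi_real z) a =
      of_real ((4 * a) ^ (Suc m div 2) / \<bar>a - 1\<bar> ^ Suc m) * (LINT x|lborel. inverse ((of_real t + \<i> * of_real x) ^ Suc m) * sph z x)"
    by (simp only: D_def Kp_def)
qed

section \<open>The Legendre form of the real orbital integral\<close>

text \<open>Both sides are real constants times the Gamma product \<open>G\<close>, the reciprocal
  Gammas \<open>R\<close> and the hypergeometric value \<open>H\<close>. Since \<open>m\<close> is
  odd, the power of \<open>t^2 - 1\<close> has a natural exponent and only real constants remain to
  be compared.\<close>

lemma legendre_form:
  assumes z: "\<bar>Re z\<bar> < 2 * real (Suc m) - 1" and t: "t > 1" and odd: "odd m"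
  shows "of_real ((t\<^sup>2 - 1) ^ (Suc m div 2)) *
      (of_real (sqrt (2 * pi)) * rGamma ((1 + z) / 4) * rGamma ((1 - z) / 4) * of_real (pi * (pochhammer (1/2) m / fact m)) *
       cosh_int (1/2 + real m) (z / 2) (of_real t))
    = of_real (4 * pi) / Gamma (of_nat (Suc m)) *
          (Gamma (of_nat (Suc m) + (z - 1) / 2) * Gamma (of_nat (Suc m) + (- z - 1) / 2) /
            (Gamma_R ((1 + z) / 2) * Gamma_R ((1 - z) / 2))) * of_real (sqrt (t\<^sup>2 - 1) / 2) *
          Legendre_P (1 - of_nat (Suc m)) ((z - 1) / 2) (of_real t)"
proof -
  define H where "H = hyp2F1 ((1 - z) / 2) ((1 + z) / 2) (of_nat (Suc m)) (of_real ((1 - t) / 2))"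
  define V where "V = cosh_int (1/2 + real m) (z / 2) (of_real t)"
  define G where "G = Gamma (of_nat (Suc m) + (z - 1) / 2) * Gamma (of_nat (Suc m) + (- z - 1) / 2)"
  define R where "R = rGamma ((1 + z) / 4) * rGamma ((1 - z) / 4)"
  have fm: "(fact m :: real) > 0" "(fact (2 * m) :: real) > 0" by simp_all
  have V1: "cosh_int (1/2 + real m) (z / 2) 1 = of_real (2 powr (1/2 + real m) / fact (2 * m)) * G"
  proof -
    have "cosh_int (1/2 + real m) (z / 2) 1 = of_real (2 powr (1/2 + real m)) * (Gamma (of_real (1/2 + real m) + z / 2) * Gamma (of_real (1/2 + real m) - z / 2) / Gamma (2 * of_real (1/2 + real m)))"
      using z by (intro cosh_int_1) auto
    moreover have e: "complex_of_real (1/2 + real m) + z / 2 = of_nat (Suc m) + (z - 1) / 2" "complex_of_real (1/2 + real m) - z / 2 = of_nat (Suc m) + (- z - 1) / 2"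
      "2 * complex_of_real (1/2 + real m) = of_nat (Suc (2 * m))" by (simp_all add: field_simps)
    moreover have "Gamma (of_nat (Suc (2 * m))) = (fact (2 * m) :: complex)" using Gamma_fact[of "2 * m", where 'a = complex] by (simp add: add.commute)
    ultimately show ?thesis unfolding G_def by (simp only: of_real_divide of_real_fact times_divide_eq_right times_divide_eq_left)
  qed
  have V: "V = of_real ((2 / (1 + t)) ^ m * 2 powr (1/2 + real m) / fact (2 * m)) * G * H"
  proof -
    have "of_real (((1 + t) / 2) ^ m) * V = of_real (2 powr (1/2 + real m) / fact (2 * m)) * G * H"
      using hyp2F1_eq_cosh_int[OF z t] unfolding V1 H_def V_def by simp
    then have "of_real ((2 / (1 + t)) ^ m) * (of_real (((1 + t) / 2) ^ m) * V) = of_real ((2 / (1 + t)) ^ m) * (of_real (2 powr (1/2 + real m) / fact (2 * m)) * G * H)" by simp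
    moreover have "of_real ((2 / (1 + t)) ^ m) * (of_real (((1 + t) / 2) ^ m) * V) = V"
    proof -
      have "(2 / (1 + t)) ^ m * ((1 + t) / 2) ^ m = 1" 
      proof -
        have "2 / (1 + t) * ((1 + t) / 2) = 1" using t by (simp add: field_simps)
        then show ?thesis by (simp only: power_mult_distrib[symmetric] power_one)
      qed
      then show ?thesis by (simp only: mult.assoc[symmetric] of_real_mult[symmetric] of_real_1 mult_1)
    qed
    ultimately show ?thesis by (simp only: of_real_mult times_divide_eq_right[symmetric] mult.assoc)
  qed
  have GR: "G / (Gamma_R ((1 + z) / 2) * Gamma_R ((1 - z) / 2)) = of_real (sqrt pi) * G * R"
  proof -
    define p where "p = complex_of_real pi"
    have p: "p \<noteq> 0" by (simp add: p_def)
    have sq: "p powr (1/2) = of_real (sqrt pi)"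
      using powr_of_real[of pi "1/2"] by (simp add: p_def powr_half_sqrt)
    have "p powr (- ((1 + z) / 2) / 2) * p powr (- ((1 - z) / 2) / 2) = p powr (- (1/2))"

    proof -
      have "- ((1 + z) / 2) / 2 + - ((1 - z) / 2) / 2 = - (1/2)" by (simp add: field_simps)
      then show ?thesis by (simp only: powr_add[symmetric])
    qed
    also have "\<dots> = inverse (of_real (sqrt pi))" by (simp only: powr_minus sq)
    finally have pp: "p powr (- ((1 + z) / 2) / 2) * p powr (- ((1 - z) / 2) / 2) = inverse (of_real (sqrt pi))" .
    have "Gamma_R ((1 + z) / 2) * Gamma_R ((1 - z) / 2) = (p powr (- ((1 + z) / 2) / 2) * p powr (- ((1 - z) / 2) / 2)) * (Gamma ((1 + z) / 4) * Gamma ((1 - z) / 4))"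
      unfolding Gamma_R_def p_def[symmetric] by (simp add: ac_simps)
    then show ?thesis unfolding pp R_def rGamma_inverse_Gamma by (simp only: divide_inverse inverse_mult_distrib inverse_inverse_eq mult_ac)
  qed
  have L: "Legendre_P (1 - of_nat (Suc m)) ((z - 1) / 2) (of_real t) = of_real (1 / fact m * ((t + 1) / (t - 1)) powr (- real m / 2)) * H"
  proof -
    have g: "Gamma (of_nat (Suc m)) = (fact m :: complex)" using Gamma_fact[of m, where 'a = complex] by (simp add: add.commute)
    have e: "- ((z - 1) / 2) = (1 - z) / 2" "(z - 1) / 2 + 1 = (1 + z) / 2" "1 - (1 - of_nat (Suc m)) = (of_nat (Suc m) :: complex)"
      "(1 - complex_of_real t) / 2 = of_real ((1 - t) / 2)" "(1 - of_nat (Suc m)) / 2 = complex_of_real (- real m / 2)"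
      "(complex_of_real t + 1) / (complex_of_real t - 1) = of_real ((t + 1) / (t - 1))"
      by (simp_all add: field_simps)
    have "complex_of_real ((t + 1) / (t - 1)) powr (of_real (- real m / 2)) = of_real (((t + 1) / (t - 1)) powr (- real m / 2))"
      using t by (intro powr_of_real) auto
    then show ?thesis unfolding Legendre_P_def e g H_def by (simp only: of_real_mult of_real_divide of_real_fact of_real_1)
  qed
  have "((t\<^sup>2 - 1) ^ (Suc m div 2)) * (sqrt (2 * pi) * (pi * (pochhammer (1/2) m / fact m)) * ((2 / (1 + t)) ^ m * 2 powr (1/2 + real m) / fact (2 * m)))
     = 4 * pi / fact m * sqrt pi * (sqrt (t\<^sup>2 - 1) / 2) * (1 / fact m * ((t + 1) / (t - 1)) powr (- real m / 2))"
  proof -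
    have pos: "t - 1 > 0" "t + 1 > 0" using t by auto
    have t2: "t\<^sup>2 - 1 = (t - 1) * (t + 1)" by (simp add: power2_eq_square algebra_simps)
    have t2p: "t\<^sup>2 - 1 > 0" unfolding t2 using pos by simp
    obtain j where j: "m = 2 * j + 1" using odd by (elim oddE)
    \<comment> \<open>In terms of \<open>S\<close> all powers become natural:
      \<open>(t^2 - 1) ^ (Suc m div 2)\<close> is \<open>S ^ Suc m\<close>, and the Legendre
      prefactor is \<open>(S / (t + 1)) ^ m\<close>.\<close>
    define S where "S = sqrt (t\<^sup>2 - 1)"
    have S: "S > 0" "S * S = (t - 1) * (t + 1)" using t2p t2 by (auto simp: S_def)
    have pw1: "(t\<^sup>2 - 1) ^ (Suc m div 2) = S ^ Suc m"
    proof -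
      have "Suc m div 2 = j + 1" "Suc m = 2 * (j + 1)" using j by auto
      then show ?thesis using S t2 by (simp only: power_mult power2_eq_square)
    qed
    have "((t + 1) / (t - 1)) powr (- real m / 2) = (((t + 1) / (t - 1)) powr (1/2)) powr (- real m)"
      by (simp add: powr_powr)
    also have "((t + 1) / (t - 1)) powr (1/2) = (t + 1) / S"
    proof -
      have "((t + 1) / S)\<^sup>2 = (t + 1) / (t - 1)" 
      proof -
        have "((t + 1) / S)\<^sup>2 = (t + 1) * (t + 1) / (S * S)" by (simp only: power2_eq_square times_divide_times_eq)
        also have "\<dots> = (t + 1) * (t + 1) / ((t - 1) * (t + 1))" by (simp only: S(2))
        also have "\<dots> = (t + 1) / (t - 1)" using pos by simp
        finally show ?thesis .
      qed
      then have "sqrt ((t + 1) / (t - 1)) = (t + 1) / S" using S pos by (intro real_sqrt_unique) auto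
      then show ?thesis using pos by (simp add: powr_half_sqrt)
    qed
    also have "((t + 1) / S) powr (- real m) = (S / (t + 1)) ^ m"
      using S pos by (simp add: powr_minus powr_realpow power_divide divide_simps)
    finally have pw2: "((t + 1) / (t - 1)) powr (- real m / 2) = (S / (t + 1)) ^ m" .
    have pw3: "2 powr (1/2 + real m) = sqrt 2 * 2 ^ m" by (simp add: powr_add powr_half_sqrt powr_realpow)
    \<comment> \<open>This cancels \<open>pochhammer (1/2) m\<close> from the kernel integral
      against \<open>fact (2 * m)\<close> from \<open>cosh_int_1\<close>.\<close>
    have fd: "(fact (2 * m) :: real) = 2 ^ m * 2 ^ m * pochhammer (1/2) m * fact m"
      using fact_double[of m, where 'a = real] by (simp only: power_even_eq power2_eq_square)
    have pp: "pochhammer (1/2 :: real) m > 0" by (simp add: pochhammer_pos)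
    have s2: "sqrt (2 * pi) * sqrt 2 = 2 * sqrt pi" by (simp add: real_sqrt_mult)
    have "(S ^ Suc m) * (sqrt (2 * pi) * (pi * (pochhammer (1/2) m / fact m)) * ((2 / (1 + t)) ^ m * (sqrt 2 * 2 ^ m) / (2 ^ m * 2 ^ m * pochhammer (1/2) m * fact m)))
      = (sqrt (2 * pi) * sqrt 2) * pi * S * (S / (1 + t)) ^ m / (fact m * fact m)"
      using pp by (simp add: power_divide field_simps)
    then show ?thesis unfolding pw1 pw2 pw3 fd S_def[symmetric] s2 by (simp add: add.commute)
  qed
  then have C: "complex_of_real ((t\<^sup>2 - 1) ^ (Suc m div 2)) * (of_real (sqrt (2 * pi)) * of_real (pi * (pochhammer (1/2) m / fact m)) * of_real ((2 / (1 + t)) ^ m * 2 powr (1/2 + real m) / fact (2 * m)))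
     = of_real (4 * pi / fact m) * of_real (sqrt pi) * of_real (sqrt (t\<^sup>2 - 1) / 2) * of_real (1 / fact m * ((t + 1) / (t - 1)) powr (- real m / 2))"
    by (simp only: of_real_mult[symmetric])
  have Gm: "Gamma (of_nat (Suc m)) = (of_real (fact m) :: complex)" using Gamma_fact[of m, where 'a = complex] by (simp add: add.commute)
  have "of_real ((t\<^sup>2 - 1) ^ (Suc m div 2)) * (of_real (sqrt (2 * pi)) * rGamma ((1 + z) / 4) * rGamma ((1 - z) / 4) * of_real (pi * (pochhammer (1/2) m / fact m)) * V)
    = (complex_of_real ((t\<^sup>2 - 1) ^ (Suc m div 2)) * (of_real (sqrt (2 * pi)) * of_real (pi * (pochhammer (1/2) m / fact m)) * of_real ((2 / (1 + t)) ^ m * 2 powr (1/2 + real m) / fact (2 * m)))) * (G * R * H)"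
    unfolding V R_def by (simp only: mult_ac)
  also have "\<dots> = of_real (4 * pi / fact m) * (of_real (sqrt pi) * G * R) * of_real (sqrt (t\<^sup>2 - 1) / 2) * (of_real (1 / fact m * ((t + 1) / (t - 1)) powr (- real m / 2)) * H)"
    unfolding C by (simp only: mult_ac)
  also have "complex_of_real (4 * pi / fact m) = of_real (4 * pi) / Gamma (of_nat (Suc m))" unfolding Gm by (rule of_real_divide)
  finally show ?thesis unfolding GR[symmetric] L[symmetric] V_def[symmetric] G_def[symmetric] .
qed

lemma frakF_real:
  assumes dk: "is_haar_prob O2 dk" and a: "a \<noteq> 0" "a \<noteq> 1" and l: "even l" "l \<ge> 4" and z: "\<bar>Re z\<bar> < 2 * real l - 1"
  shows "frakF_converges dk lborel (Phi_real l) (phi_real z) a"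
    and "frakF dk lborel (Phi_real l) (phi_real z) a =
          complex_of_real (4 * pi) / Gamma (of_nat l) *
          (Gamma (of_nat l + (z - 1) / 2) * Gamma (of_nat l + (- z - 1) / 2) /
            (Gamma_R ((1 + z) / 2) * Gamma_R ((1 - z) / 2))) *
          (if a > 0 then 1 else 0) *
          complex_of_real (\<bar>a\<bar> powr (1 / 2) * inverse \<bar>a - 1\<bar>) *
          Legendre_P (1 - of_nat l) ((z - 1) / 2)
            (complex_of_real ((\<bar>(a - 1) / (a + 1)\<bar> ^ 2) powr (- 1 / 2)))"
proof -
  obtain m where m: "l = Suc m" "m \<ge> 1" "odd m" using l by (cases l) auto
  have z': "\<bar>Re z\<bar> < 2 * real (Suc m) - 1" using z m by simp
  show "frakF_converges dk lborel (Phi_real l) (phi_real z) a"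
    using frakF_real_neg(1)[OF dk] frakF_real_pos(1)[OF dk _ a(2) m(2) z'] m(1) by blast
  show "frakF dk lborel (Phi_real l) (phi_real z) a =
          complex_of_real (4 * pi) / Gamma (of_nat l) *
          (Gamma (of_nat l + (z - 1) / 2) * Gamma (of_nat l + (- z - 1) / 2) /
            (Gamma_R ((1 + z) / 2) * Gamma_R ((1 - z) / 2))) *
          (if a > 0 then 1 else 0) *
          complex_of_real (\<bar>a\<bar> powr (1 / 2) * inverse \<bar>a - 1\<bar>) *
          Legendre_P (1 - of_nat l) ((z - 1) / 2)
            (complex_of_real ((\<bar>(a - 1) / (a + 1)\<bar> ^ 2) powr (- 1 / 2)))"
  proof (cases "a > 0")
    case False
    then show ?thesis using frakF_real_neg(2)[OF dk False] by simp
  next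
    case True
    define t where "t = (a + 1) / \<bar>a - 1\<bar>"
    have ne: "\<bar>a - 1\<bar> > 0" using a by simp
    have t: "t > 1" using True ne by (simp add: t_def less_divide_eq abs_if)
    have t0: "t > 0" using t by simp
    have arg: "(\<bar>(a - 1) / (a + 1)\<bar> ^ 2) powr (- 1 / 2) = t"
    proof -
      have "\<bar>(a - 1) / (a + 1)\<bar> = inverse t" using True by (simp add: t_def abs_divide)
      then have "(\<bar>(a - 1) / (a + 1)\<bar> ^ 2) powr (- 1 / 2) = inverse (sqrt ((inverse t)\<^sup>2))"
        by (simp add: powr_minus powr_half_sqrt)
      then show ?thesis using t by simp
    qed
    \<comment> \<open>This absorbs the normalising powers of \<open>4 * a\<close> and
      \<open>\<bar>a - 1\<bar>\<close> of the test function into \<open>t\<close> and produces the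
      factor \<open>\<bar>a\<bar> powr (1 / 2) * inverse \<bar>a - 1\<bar>\<close>.\<close>
    have t2: "t\<^sup>2 - 1 = 4 * a / \<bar>a - 1\<bar>\<^sup>2"
    proof -
      have "t\<^sup>2 - 1 = ((a + 1)\<^sup>2 - \<bar>a - 1\<bar>\<^sup>2) / \<bar>a - 1\<bar>\<^sup>2" using ne by (simp add: t_def power_divide diff_divide_distrib)
      also have "(a + 1)\<^sup>2 - \<bar>a - 1\<bar>\<^sup>2 = 4 * a" by (simp add: power2_eq_square algebra_simps)
      finally show ?thesis .
    qed
    have D: "(4 * a) ^ (Suc m div 2) / \<bar>a - 1\<bar> ^ Suc m = (t\<^sup>2 - 1) ^ (Suc m div 2)"
    proof -
      have "\<bar>a - 1\<bar> ^ Suc m = (\<bar>a - 1\<bar>\<^sup>2) ^ (Suc m div 2)"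
        unfolding power_mult[symmetric] using m(3) by simp
      then show ?thesis unfolding t2 power_divide by simp
    qed
    have S: "sqrt (t\<^sup>2 - 1) / 2 = \<bar>a\<bar> powr (1 / 2) * inverse \<bar>a - 1\<bar>"
      
    proof -
      have "sqrt (4 * a / \<bar>a - 1\<bar>\<^sup>2) = 2 * sqrt a / \<bar>a - 1\<bar>"
        unfolding real_sqrt_divide real_sqrt_abs abs_abs real_sqrt_mult by simp
      moreover have "\<bar>a\<bar> powr (1 / 2) = sqrt a" using True by (simp add: powr_half_sqrt)
      ultimately show ?thesis unfolding t2 by (simp only: divide_inverse) simp
    qed
    have "frakF dk lborel (Phi_real l) (phi_real z) a = of_real ((t\<^sup>2 - 1) ^ (Suc m div 2)) *
       (of_real (sqrt (2 * pi)) * rGamma ((1 + z) / 4) * rGamma ((1 - z) / 4) * of_real (pi * (pochhammer (1/2) m / fact m)) *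
       cosh_int (1/2 + real m) (z / 2) (of_real t))"
      unfolding m(1) frakF_real_pos(2)[OF dk True a(2) m(2) z'] t_def[symmetric] D integral_sph[OF t0 m(2) z'] ..
    then show ?thesis unfolding legendre_form[OF z' t m(3)] arg m(1) S using True by (simp only: if_True mult_1_right)
  qed
qed

section \<open>Radial integrals over a non-archimedean local field\<close>

text \<open>\<open>qv\<close> is a cardinality and would be 0 for an infinite quotient, so
  \<open>qv_ge2\<close> records both that the residue field is finite and that
  \<open>q > 1\<close>.\<close>

locale local_field =
  fixes \<pi> :: "'k::{field_char_0,metric_space}" and q :: real
  assumes q_def: "q = real (qv TYPE('k))"
    and dist_vabs: "dist x y = vabs (x - y :: 'k)"
    and vabs_mult: "vabs (x * y :: 'k) = vabs x * vabs y"
    and vabs_add_le: "vabs (x + y :: 'k) \<le> max (vabs x) (vabs y)"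
    and val_ideal_eq: "val_ideal = {\<pi> * y | y. y \<in> val_ring}"
    and vabs_pi: "vabs \<pi> = 1 / q"
    and qv_ge2: "qv TYPE('k) \<ge> 2"
begin

lemma q_gt_1: "q > 1" using qv_ge2 by (simp add: q_def)

lemma vabs_nonneg [simp]: "vabs (x :: 'k) \<ge> 0" by (simp add: vabs_def)

lemma vabs_eq_0 [simp]: "vabs (x :: 'k) = 0 \<longleftrightarrow> x = 0" by (simp add: vabs_def)

lemma vabs_pos: "x \<noteq> 0 \<Longrightarrow> vabs (x :: 'k) > 0" by (simp add: vabs_def)

lemma vabs_0 [simp]: "vabs (0 :: 'k) = 0" by simp

lemma vabs_1 [simp]: "vabs (1 :: 'k) = 1"
  using vabs_mult[of 1 1] vabs_pos[of 1] by simp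

lemma vabs_minus [simp]: "vabs (- x :: 'k) = vabs x"
proof -
  have "vabs (- 1 :: 'k) * vabs (- 1 :: 'k) = 1" using vabs_mult[of "- 1" "- 1"] by simp
  then have "vabs (- 1 :: 'k) = 1" using vabs_nonneg[of "- 1"] by (metis abs_of_nonneg abs_square_eq_1 power2_eq_square)
  then show ?thesis using vabs_mult[of "- 1" x] by simp
qed

lemma vabs_diff_le: "vabs (x - y :: 'k) \<le> max (vabs x) (vabs y)"
  using vabs_add_le[of x "- y"] by simp

lemma vabs_minus_commute: "vabs (x - y :: 'k) = vabs (y - x)"
  using vabs_minus[of "x - y"] by simp

lemma vabs_inverse: "vabs (inverse x :: 'k) = inverse (vabs x)"
proof (cases "x = 0")
  case False
  then have "vabs (inverse x) * vabs x = 1" using vabs_mult[of "inverse x" x] by simp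
  then show ?thesis by (metis inverse_unique mult.commute)
qed simp

lemma vabs_divide: "vabs (x / y :: 'k) = vabs x / vabs y"
  by (simp add: divide_inverse vabs_mult vabs_inverse)

lemma vabs_power: "vabs (x ^ n :: 'k) = vabs x ^ n"
  by (induction n) (simp_all add: vabs_mult)

lemma vabs_add_eq: "vabs x < vabs y \<Longrightarrow> vabs (x + y :: 'k) = vabs y"
  using vabs_add_le[of x y] vabs_diff_le[of "x + y" x] by (simp add: max_def split: if_splits)

lemma vabs_lt_1: "vabs (x :: 'k) < 1 \<Longrightarrow> vabs x \<le> 1 / q"
proof -
  assume "vabs x < 1"
  then obtain y where "x = \<pi> * y" "vabs y \<le> 1" using val_ideal_eq by (auto simp: val_ideal_def val_ring_def)
  then show ?thesis using q_gt_1 by (simp add: vabs_mult vabs_pi divide_right_mono)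
qed

text \<open>Dividing by a power of \<open>\<pi>\<close> brings the absolute value into the interval
  from \<open>1 / q\<close> (excluded) to 1, where \<open>vabs_lt_1\<close> leaves only the value
  1.\<close>

lemma vabs_le_1_cases:
  assumes "vabs (x :: 'k) \<le> 1" "x \<noteq> 0"
  obtains n where "vabs x = 1 / q ^ n"
proof -
  have x0: "vabs x > 0" using assms vabs_pos by simp
  have "\<exists>n. (1 / q) ^ n < vabs x" using q_gt_1 x0 by (intro real_arch_pow_inv) auto
  define n where "n = (LEAST n. (1 / q) ^ n < vabs x)"
  have n: "(1 / q) ^ n < vabs x" unfolding n_def by (rule LeastI_ex) fact
  then have "n \<noteq> 0" using assms by (intro notI) simp
  then obtain m where m: "n = Suc m" by (cases n) auto
  have m2: "vabs x \<le> (1 / q) ^ m" using not_less_Least[of m "\<lambda>n. (1 / q) ^ n < vabs x"] m n_def by auto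
  define y where "y = x / \<pi> ^ m"
  have y: "vabs y = vabs x * q ^ m" by (simp add: y_def vabs_divide vabs_power vabs_pi power_divide)
  have qm: "q ^ m > 0" using q_gt_1 by simp
  have "vabs y \<le> 1" unfolding y using m2 qm by (simp add: power_divide field_simps)
  moreover have "vabs y > 1 / q" unfolding y using n qm q_gt_1 by (simp add: m power_divide field_simps)
  ultimately have "vabs y = 1" using vabs_lt_1[of y] by linarith
  then have "vabs x = 1 / q ^ m" unfolding y using qm by (metis nonzero_eq_divide_eq less_irrefl)
  then show thesis using that by blast
qed

definition lvl :: "'k \<Rightarrow> nat" where "lvl x = (THE n. max 1 (vabs x) = q ^ n)"

lemma lvl: "max 1 (vabs x) = q ^ lvl x"
proof -
  have "\<exists>n. max 1 (vabs x) = q ^ n"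
  proof (cases "vabs x \<le> 1")
    case True
    then show ?thesis by (intro exI[of _ 0]) simp
  next
    case False
    then have "vabs (inverse x) \<le> 1" "inverse x \<noteq> 0" by (auto simp: vabs_inverse inverse_le_1_iff)
    then obtain n where "vabs (inverse x) = 1 / q ^ n" using vabs_le_1_cases by blast
    then have "vabs x = q ^ n" by (metis vabs_inverse inverse_eq_divide inverse_inverse_eq)
    then show ?thesis using False by (intro exI[of _ n]) simp
  qed
  then obtain n where n: "max 1 (vabs x) = q ^ n" by blast
  show ?thesis unfolding lvl_def by (rule theI[of _ n]) (use n q_gt_1 in auto)
qed

lemma lvl_le_iff: "lvl x \<le> n \<longleftrightarrow> vabs x \<le> q ^ n"
proof -
  have "lvl x \<le> n \<longleftrightarrow> q ^ lvl x \<le> q ^ n" using q_gt_1 by simp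
  also have "\<dots> \<longleftrightarrow> vabs x \<le> q ^ n" unfolding lvl[symmetric] using q_gt_1 by (simp add: one_le_power)
  finally show ?thesis .
qed

definition resid :: "('k \<times> 'k) set" where
  "resid = {(x, y). x \<in> val_ring \<and> y \<in> val_ring \<and> x - y \<in> val_ideal}"

lemma equiv_resid: "equiv val_ring resid"
proof (intro equivI refl_onI symI transI)
  fix x y z assume "(x, y) \<in> resid" "(y, z) \<in> resid"
  then show "(x, z) \<in> resid" using vabs_add_le[of "x - y" "y - z"] by (auto simp: resid_def val_ideal_def)
qed (auto simp: resid_def val_ideal_def val_ring_def vabs_minus_commute)

lemma card_resid: "card (val_ring // resid) = qv TYPE('k)" "finite (val_ring // resid)"
proof -
  show "card (val_ring // resid) = qv TYPE('k)" by (simp add: qv_def resid_def)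
  then show "finite (val_ring // resid)" using qv_ge2 by (intro card_ge_0_finite) simp
qed

definition rep :: "'k set \<Rightarrow> 'k" where "rep c = (SOME x. x \<in> c)"

lemma rep: "c \<in> val_ring // resid \<Longrightarrow> rep c \<in> c" "c \<in> val_ring // resid \<Longrightarrow> vabs (rep c) \<le> 1"
proof -
  assume c: "c \<in> val_ring // resid"
  then obtain x where x: "x \<in> val_ring" "c = resid `` {x}" by (auto elim!: quotientE)
  then have "x \<in> c" using equiv_class_self[OF equiv_resid] by blast
  then show "rep c \<in> c" unfolding rep_def by (rule someI)
  then show "vabs (rep c) \<le> 1" using x by (auto simp: resid_def val_ring_def)
qed

lemma ex_rep: "vabs y \<le> 1 \<Longrightarrow> \<exists>c\<in>val_ring // resid. vabs (y - rep c) < 1"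
proof -
  assume "vabs y \<le> 1"
  then have c: "resid `` {y} \<in> val_ring // resid" by (auto simp: val_ring_def intro: quotientI)
  moreover have "(y, rep (resid `` {y})) \<in> resid" using rep(1)[OF c] by simp
  ultimately show ?thesis by (intro bexI[of _ "resid `` {y}"]) (auto simp: resid_def val_ideal_def)
qed

lemma rep_inj:
  assumes "c \<in> val_ring // resid" "d \<in> val_ring // resid" "vabs (rep c - rep d) < 1"
  shows "c = d"
proof -
  have "(rep c, rep d) \<in> resid" using assms rep(2)[of c] rep(2)[of d] by (auto simp: resid_def val_ideal_def val_ring_def)
  then show ?thesis using quotient_eq_iff[OF equiv_resid assms(1,2) rep(1)[OF assms(1)] rep(1)[OF assms(2)]] by simp
qed

text \<open>The volume of the level set of \<open>lvl\<close> at \<open>n\<close> relative to the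
  valuation ring: \<open>q ^ n\<close> less \<open>q ^ (n - 1)\<close> for positive
  \<open>n\<close>.\<close>

definition mass :: "nat \<Rightarrow> real" where "mass n = (if n = 0 then 1 else (1 - 1 / q) * q ^ n)"

lemma ball_eq: "{x :: 'k. vabs x \<le> r} = cball 0 r"
  by (auto simp: dist_vabs)

end

section \<open>Volumes of balls and levels\<close>

locale local_field_haar = local_field \<pi> q for \<pi> :: "'k::{field_char_0,metric_space}" and q +
  fixes dx :: "'k measure"
  assumes haar: "is_haar_field dx"
begin

definition vol :: real where "vol = measure dx {x. vabs x \<le> 1}"

lemma sets_dx: "sets dx = sets borel" and
  transl: "A \<in> sets dx \<Longrightarrow> emeasure dx ((+) t ` A) = emeasure dx A" and
  vol0: "emeasure dx {x. vabs x \<le> 1} = ennreal vol" and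
  vol_eq: "vol = q powr (- real (dv TYPE('k)) / 2)"
  using haar by (auto simp: is_haar_field_def vol_def val_ring_def measure_def q_def)

lemma vol_pos: "vol > 0" using q_gt_1 by (simp add: vol_eq)

lemma space_dx [simp]: "space dx = UNIV" using sets_eq_imp_space_eq[OF sets_dx] by simp

lemma ball_sets: "{x. vabs x \<le> r} \<in> sets dx"
  unfolding sets_dx ball_eq by simp

lemma transl_ball: "(+) t ` {x :: 'k. vabs x \<le> r} = {x. vabs (x - t) \<le> r}"
  by (auto simp: image_iff) (metis add.commute diff_add_cancel)

lemma transl_ball_sets: "{x. vabs (x - t) \<le> r} \<in> sets dx"
proof -
  have "{x. vabs (x - t) \<le> r} = cball t r" by (auto simp: dist_vabs vabs_minus_commute)
  then show ?thesis unfolding sets_dx by simp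
qed

text \<open>A ball of radius \<open>q ^ Suc n\<close> is the disjoint union of \<open>q\<close>
  translates of the ball of radius \<open>q ^ n\<close>, one for each residue class.\<close>

lemma emeasure_ball: "emeasure dx {x. vabs x \<le> q ^ n} = ennreal (q ^ n * vol)"
proof (induction n)
  case 0
  then show ?case using vol0 by simp
next
  case (Suc n)
  define C where "C = val_ring // resid"
  \<comment> \<open>The centres are residue representatives scaled by \<open>\<pi> ^ Suc n\<close>;
    membership in a translate becomes a congruence between \<open>x * \<pi> ^ Suc n\<close> and the
    representative.\<close>
  define t where "t c = rep c / \<pi> ^ Suc n" for c
  define T where "T c = {x. vabs (x - t c) \<le> q ^ n}" for c
  have q0: "q > 0" using q_gt_1 by simp
  have pi0: "\<pi> \<noteq> 0" using vabs_pi q0 by (metis divide_eq_0_iff less_numeral_extra(3) vabs_0 zero_neq_one)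
  have vt: "vabs (x - t c) = vabs (x * \<pi> ^ Suc n - rep c) * q ^ Suc n" for x c
  proof -
    have "x - t c = (x * \<pi> ^ Suc n - rep c) / \<pi> ^ Suc n" using pi0 by (simp add: t_def diff_divide_distrib)
    then show ?thesis by (simp only: vabs_divide vabs_power vabs_pi power_divide power_one divide_divide_eq_right div_by_1)
  qed
  have U: "{x :: 'k. vabs x \<le> q ^ Suc n} = (\<Union>c\<in>C. T c)"
  proof (intro equalityI subsetI)
    fix x :: 'k assume "x \<in> {x. vabs x \<le> q ^ Suc n}"
    then have "vabs (x * \<pi> ^ Suc n) \<le> 1"
      using q0 by (simp add: vabs_mult vabs_power vabs_pi power_divide field_simps)
    then obtain c where c: "c \<in> C" "vabs (x * \<pi> ^ Suc n - rep c) < 1" using ex_rep unfolding C_def by blast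
    have "vabs (x * \<pi> ^ Suc n - rep c) * q ^ Suc n \<le> 1 / q * q ^ Suc n"
      using vabs_lt_1[OF c(2)] q0 by (intro mult_right_mono) auto
    then have "x \<in> T c" unfolding T_def using q0 by (simp add: vt)
    then show "x \<in> (\<Union>c\<in>C. T c)" using c by blast
  next
    fix x assume "x \<in> (\<Union>c\<in>C. T c)"
    then obtain c where c: "c \<in> C" "vabs (x - t c) \<le> q ^ n" by (auto simp: T_def)
    have "vabs (t c) \<le> q ^ Suc n"
      using rep(2)[of c] c q0 unfolding C_def t_def vabs_divide vabs_power vabs_pi by (simp add: power_divide field_simps mult_left_le_one_le)
    moreover have "q ^ n \<le> q ^ Suc n" using q_gt_1 by (intro power_increasing) auto
    ultimately show "x \<in> {x. vabs x \<le> q ^ Suc n}" using c(2) vabs_add_le[of "x - t c" "t c"] by (simp add: max_def split: if_splits)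
  qed
  have D: "disjoint_family_on T C"
  proof (unfold disjoint_family_on_def, intro ballI impI, rule ccontr)
    fix c d assume c: "c \<in> C" and d: "d \<in> C" and ne: "c \<noteq> d" and "T c \<inter> T d \<noteq> {}"
    then obtain x where x: "vabs (x - t c) \<le> q ^ n" "vabs (x - t d) \<le> q ^ n" by (auto simp: T_def)
    define y where "y = x * \<pi> ^ Suc n"
    have qn: "q ^ n < q ^ Suc n" using q_gt_1 by simp
    have "vabs (y - rep c) < 1" "vabs (y - rep d) < 1"
    proof -
      have l: "Z < 1" if "Z * q ^ Suc n \<le> q ^ n" for Z
      proof (rule mult_right_less_imp_less)
        show "Z * q ^ Suc n < 1 * q ^ Suc n" using that qn by linarith
      qed (use q0 in simp)
      show "vabs (y - rep c) < 1" "vabs (y - rep d) < 1" using x unfolding vt y_def[symmetric] by (auto intro: l)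
    qed
    then have "vabs (rep c - rep d) < 1" using vabs_diff_le[of "y - rep d" "y - rep c"] by simp
    then show False using rep_inj c d ne by (auto simp: C_def)
  qed
  have Ts: "T c \<in> sets dx" for c unfolding T_def by (rule transl_ball_sets)
  have Te: "emeasure dx (T c) = ennreal (q ^ n * vol)" for c
    using transl[OF ball_sets[of "q ^ n"], of "t c"] Suc.IH unfolding transl_ball T_def by simp
  have "emeasure dx {x :: 'k. vabs x \<le> q ^ Suc n} = (\<Sum>c\<in>C. emeasure dx (T c))"
    unfolding U using D Ts card_resid(2) by (subst sum_emeasure[symmetric]) (auto simp: C_def)
  also have "\<dots> = ennreal (real (card C)) * ennreal (q ^ n * vol)" unfolding Te by (simp add: ennreal_of_nat_eq_real_of_nat)
  also have "\<dots> = ennreal (q ^ Suc n * vol)" unfolding C_def card_resid(1) q_def[symmetric]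
    using q0 vol_pos by (subst ennreal_mult[symmetric]) (simp_all add: mult_ac)
  finally show ?case .
qed

lemma shell_sets: "{x. lvl x = n} \<in> sets dx"
proof (cases n)
  case 0
  have "{x. lvl x = 0} = {x. vabs x \<le> q ^ 0}" using lvl_le_iff[of _ 0] by simp
  then show ?thesis unfolding 0 using ball_sets by simp
next
  case (Suc m)
  have "{x. lvl x = Suc m} = {x. vabs x \<le> q ^ Suc m} - {x. vabs x \<le> q ^ m}"
    unfolding lvl_le_iff[symmetric] by auto
  then show ?thesis unfolding Suc using ball_sets by simp
qed

lemma emeasure_shell: "emeasure dx {x. lvl x = n} = ennreal (mass n * vol)"
proof (cases n)
  case 0
  have "{x. lvl x = 0} = {x. vabs x \<le> q ^ 0}" using lvl_le_iff[of _ 0] by simp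
  then show ?thesis unfolding 0 using emeasure_ball[of 0] by (simp add: mass_def)
next
  case (Suc m)
  have sub: "{x :: 'k. vabs x \<le> q ^ m} \<subseteq> {x. vabs x \<le> q ^ Suc m}"
    using q_gt_1 unfolding lvl_le_iff[symmetric] by auto
  have "{x. lvl x = Suc m} = {x. vabs x \<le> q ^ Suc m} - {x. vabs x \<le> q ^ m}"
    unfolding lvl_le_iff[symmetric] by auto
  then have "emeasure dx {x. lvl x = Suc m} = ennreal (q ^ Suc m * vol) - ennreal (q ^ m * vol)"
    using emeasure_Diff[OF _ ball_sets ball_sets sub] by (simp only: emeasure_ball) simp
  also have "\<dots> = ennreal (q ^ Suc m * vol - q ^ m * vol)" using q_gt_1 vol_pos by (intro ennreal_minus) auto
  also have "q ^ Suc m * vol - q ^ m * vol = mass (Suc m) * vol" using q_gt_1 by (simp add: mass_def field_simps)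
  finally show ?thesis unfolding Suc .
qed

lemma mass_pos: "mass n > 0" using q_gt_1 by (simp add: mass_def)

text \<open>The integrand is split over the disjoint levels; summability of the norms permits
  termwise integration.\<close>

lemma radial_integral:
  fixes c :: "nat \<Rightarrow> complex"
  assumes sm: "summable (\<lambda>n. norm (of_real (mass n) * c n))"
  shows "integrable dx (\<lambda>x. c (lvl x))"
    and "(LINT x|dx. c (lvl x)) = of_real vol * (\<Sum>n. of_real (mass n) * c n)"
proof -
  define f where "f n x = indicator {x. lvl x = n} x *\<^sub>R c n" for n x
  have meas: "measure dx {x. lvl x = n} = mass n * vol" for n
    using emeasure_shell[of n] mass_pos[of n] vol_pos by (simp add: measure_def)
  have ind: "integrable dx (indicator {x. lvl x = n} :: _ \<Rightarrow> real)" for n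
    using shell_sets[of n] emeasure_shell[of n] by (intro integrable_real_indicator) auto
  have fi: "integrable dx (f n)" for n unfolding f_def using ind by (intro integrable_scaleR_left) auto
  have fin: "(LINT x|dx. f n x) = of_real vol * (of_real (mass n) * c n)" for n
  proof -
    have "(LINT x|dx. f n x) = (LINT x|dx. indicator {x. lvl x = n} x) *\<^sub>R c n"
      unfolding f_def using ind by (intro integral_scaleR_left) auto
    then show ?thesis by (simp add: meas scaleR_conv_of_real)
  qed
  have fnorm: "(LINT x|dx. norm (f n x)) = vol * norm (of_real (mass n) * c n)" for n
  proof -
    have "(LINT x|dx. norm (f n x)) = (LINT x|dx. indicator {x. lvl x = n} x * norm (c n))"
      by (intro Bochner_Integration.integral_cong) (auto simp: f_def)
    then show ?thesis using mass_pos[of n] by (simp add: meas norm_mult)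
  qed
  have sums: "(\<lambda>n. f n x) sums c (lvl x)" for x
  proof -
    have "(\<lambda>n. if n = lvl x then c n else 0) sums c (lvl x)" by (rule sums_single)
    moreover have "(\<lambda>n. if n = lvl x then c n else 0) = (\<lambda>n. f n x)" by (auto simp: f_def)
    ultimately show ?thesis by simp
  qed
  have ae: "AE x in dx. summable (\<lambda>n. norm (f n x))"
  proof (intro AE_I2)
    fix x
    show "summable (\<lambda>n. norm (f n x))" by (rule summable_finite[of "{lvl x}"]) (auto simp: f_def)
  qed
  have sn: "summable (\<lambda>n. LINT x|dx. norm (f n x))" unfolding fnorm by (intro summable_mult sm)
  have e: "(\<Sum>n. f n x) = c (lvl x)" for x using sums[of x] by (simp add: sums_iff)
  show "integrable dx (\<lambda>x. c (lvl x))" using integrable_suminf[OF fi ae sn] by (simp only: e)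
  have "(\<lambda>n. LINT x|dx. f n x) sums (LINT x|dx. c (lvl x))" using sums_integral[OF fi ae sn] by (simp only: e)
  moreover have "(\<lambda>n. of_real vol * (of_real (mass n) * c n)) sums (of_real vol * (\<Sum>n. of_real (mass n) * c n))"
    by (intro sums_mult summable_sums summable_norm_cancel[OF sm])
  ultimately show "(LINT x|dx. c (lvl x)) = of_real vol * (\<Sum>n. of_real (mass n) * c n)" unfolding fin by (rule sums_unique2)
qed

end

text \<open>The point is that the residue field is finite with at least two elements. A nonzero
  element of the prime ideal shows \<open>\<pi> \<noteq> 0\<close>, hence \<open>q\<close> is
  positive and the quotient finite, and the classes of 0 and 1 differ.\<close>

lemma completion_local_field:
  fixes \<iota> :: "'f::field_char_0 \<Rightarrow> 'k::{field_char_0,complete_space}"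
  assumes v: "v \<in> finite_places" and c: "is_completion_at v \<iota>"
  shows "\<exists>\<pi> :: 'k. local_field \<pi> (real (qv TYPE('k)))"
proof -
  have hom: "is_ring_hom \<iota>" and d: "\<And>x y::'k. dist x y = vabs (x - y)"
    and m: "\<And>x y::'k. vabs (x * y) = vabs x * vabs y" and u: "\<And>x y::'k. vabs (x + y) \<le> max (vabs x) (vabs y)"
    and alg: "\<And>a. algebraic_int a \<Longrightarrow> vabs (\<iota> a) < 1 \<longleftrightarrow> a \<in> v"
    using c by (auto simp: is_completion_at_def)
  obtain \<pi> :: 'k where pi: "val_ideal = {\<pi> * y | y. y \<in> val_ring}" "vabs \<pi> = 1 / real (qv TYPE('k))"
    using c by (auto simp: is_completion_at_def)
  have v': "primeideal v int_ring" "v \<noteq> {0}" using v by (auto simp: finite_places_def)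
  interpret primeideal v int_ring by (rule v')
  have "0 \<in> v" using additive_subgroup.zero_closed[OF additive_subgroup_axioms] by (simp add: int_ring_def)
  then obtain \<alpha> where al: "\<alpha> \<in> v" "\<alpha> \<noteq> 0" using v'(2) by blast
  then have "algebraic_int \<alpha>" using a_subset by (auto simp: int_ring_def)
  then have i1: "\<iota> \<alpha> \<in> val_ideal" using alg al by (simp add: val_ideal_def)
  have h: "\<iota> 1 = 1" "\<And>x y. \<iota> (x * y) = \<iota> x * \<iota> y" using hom by (auto simp: is_ring_hom_def)
  have "\<iota> \<alpha> * \<iota> (inverse \<alpha>) = 1" using h(2)[of \<alpha> "inverse \<alpha>"] al h(1) by simp
  then have "\<iota> \<alpha> \<noteq> 0" by auto
  then have "\<pi> \<noteq> 0" using i1 pi(1) by auto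
  then have "vabs \<pi> > 0" by (simp add: vabs_def)
  \<comment> \<open>If \<open>qv\<close> were 0, the division \<open>1 / 0 = 0\<close> would force
    \<open>\<pi>\<close> to vanish.\<close>
  then have q0: "qv TYPE('k) > 0" using pi(2) by (metis div_by_0 gr0I less_irrefl of_nat_0)
  define R where "R = {(x :: 'k, y). x \<in> val_ring \<and> y \<in> val_ring \<and> x - y \<in> val_ideal}"
  have cR: "card (val_ring // R) = qv TYPE('k)" by (simp add: qv_def R_def)
  have one: "vabs (1 :: 'k) = 1"
  proof -
    have "vabs (1 :: 'k) > 0" by (simp add: vabs_def)
    then show ?thesis using m[of 1 1] by simp
  qed
  have mone: "vabs (- 1 :: 'k) = 1"
  proof -
    have "vabs (- 1 :: 'k) * vabs (- 1 :: 'k) = 1" using m[of "- 1" "- 1"] one by simp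
    moreover have "vabs (- 1 :: 'k) \<ge> 0" by (simp add: vabs_def)
    ultimately show ?thesis by (metis abs_of_nonneg abs_square_eq_1 power2_eq_square)
  qed
  have 01: "(0 :: 'k) \<in> val_ring" "(1 :: 'k) \<in> val_ring" using one by (auto simp: val_ring_def vabs_def)
  have "R `` {0} \<noteq> R `` {1}"
  proof
    assume "R `` {0} = R `` {1}"
    moreover have "1 \<in> R `` {1}" using 01 by (auto simp: R_def val_ideal_def vabs_def)
    ultimately have "(0, 1) \<in> R" by blast
    then show False using mone by (auto simp: R_def val_ideal_def)
  qed
  moreover have "R `` {0} \<in> val_ring // R" "R `` {1} \<in> val_ring // R" using 01 by (auto intro: quotientI)
  ultimately have "card {R `` {0}, R `` {1}} = 2" "{R `` {0}, R `` {1}} \<subseteq> val_ring // R" by auto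
  moreover have "finite (val_ring // R)" using q0 cR by (intro card_ge_0_finite) simp
  ultimately have "2 \<le> card (val_ring // R)" by (metis card_mono)
  then have "local_field \<pi> (real (qv TYPE('k)))" using d m u pi cR by unfold_locales auto
  then show ?thesis by blast
qed

section \<open>The Macdonald recursion\<close>

text \<open>Macdonald's formula for the spherical function at level \<open>n\<close>, with the
  denominator \<open>a - b\<close> divided out: the value at level 1 is what remains after this
  cancellation, and both \<open>a\<close> and \<open>b\<close> satisfy the characteristic equation
  of the recursion.\<close>

fun macd :: "complex \<Rightarrow> complex \<Rightarrow> nat \<Rightarrow> complex" where
  "macd a b 0 = 1"
| "macd a b (Suc 0) = (a + b - 2 * a * b) / (1 - a * b)"
| "macd a b (Suc (Suc n)) = (a + b) * macd a b (Suc n) - a * b * macd a b n"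

text \<open>The relative level volume \<open>mass\<close> with \<open>c\<close> for
  \<open>1 / q\<close>; \<open>c\<close> will be the product of the two roots.\<close>

definition shell_mass :: "complex \<Rightarrow> nat \<Rightarrow> complex" where
  "shell_mass c n = (if n = 0 then 1 else (1 - c) / c ^ n)"

text \<open>The numerator obeys the same recursion and has, up to the denominator, the same two
  initial values.\<close>

lemma macd_closed:
  assumes "a \<noteq> b" "a * b \<noteq> 1"
  shows "macd a b n = ((1 - b)\<^sup>2 * a ^ Suc n - (1 - a)\<^sup>2 * b ^ Suc n) / ((a - b) * (1 - a * b))"
proof -
  have ab: "1 - a * b \<noteq> 0" using assms by simp
  define D where "D = (a - b) * (1 - a * b)"
  define h where "h n = (1 - b)\<^sup>2 * a ^ Suc n - (1 - a)\<^sup>2 * b ^ Suc n" for n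
  have h: "h 0 = D" "h (Suc 0) = (a - b) * (a + b - 2 * a * b)" "h (Suc (Suc n)) = (a + b) * h (Suc n) - a * b * h n" for n
    by (simp_all add: h_def D_def power2_eq_square algebra_simps)
  have "D * macd a b n = h n \<and> D * macd a b (Suc n) = h (Suc n)"
  proof (induction n)
    case 0
    show ?case using ab by (simp add: h) (simp add: D_def)
  next
    case (Suc n)
    have "D * macd a b (Suc (Suc n)) = (a + b) * (D * macd a b (Suc n)) - a * b * (D * macd a b n)"
      by (simp add: algebra_simps)
    then show ?case using Suc h(3)[of n] by simp
  qed
  then have "D * macd a b n = h n" by simp
  moreover have "D \<noteq> 0" using assms ab by (simp add: D_def)
  ultimately show ?thesis unfolding h_def D_def[symmetric] by (simp add: eq_divide_eq mult.commute)
qed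

text \<open>The level volume \<open>1 / (a * b) ^ k\<close> turns \<open>a ^ k\<close> into
  \<open>inverse b ^ k\<close> and conversely, so the sums telescope to a combination of
  \<open>inverse a ^ N\<close> and \<open>inverse b ^ N\<close>. These are the two powers of the
  absolute value in \<open>O1\<close>.\<close>

lemma sum_macd:
  assumes a: "a \<noteq> 0" and b: "b \<noteq> 0" and ab: "a \<noteq> b" "a * b \<noteq> 1"
  shows "(\<Sum>k\<le>N. shell_mass (a * b) k * macd a b k)
    = b * (1 - a) / (b - a) * inverse a ^ N + a * (1 - b) / (a - b) * inverse b ^ N"
proof -
  define D where "D = a - b"
  have D: "D \<noteq> 0" "b - a = - D" using ab by (auto simp: D_def)
  have one: "1 - a * b \<noteq> 0" using ab by simp
  have t: "(1 - a * b) / (a * b) ^ k * macd a b k = (a * (1 - b)\<^sup>2 * inverse b ^ k - b * (1 - a)\<^sup>2 * inverse a ^ k) / D" for k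
    unfolding macd_closed[OF ab] D_def[symmetric] using a b D one
    by (simp add: power_mult_distrib power_inverse field_simps)
  have "(\<Sum>k\<le>N. shell_mass (a * b) k * macd a b k) * D = a * (1 - b) * inverse b ^ N - b * (1 - a) * inverse a ^ N"
  proof (induction N)
    case 0
    then show ?case by (simp add: shell_mass_def D_def algebra_simps)
  next
    case (Suc N)
    have "(\<Sum>k\<le>Suc N. shell_mass (a * b) k * macd a b k) * D
      = (\<Sum>k\<le>N. shell_mass (a * b) k * macd a b k) * D + (1 - a * b) / (a * b) ^ Suc N * macd a b (Suc N) * D"
      by (simp add: shell_mass_def distrib_right)
    also have "\<dots> = (a * (1 - b) * inverse b ^ N - b * (1 - a) * inverse a ^ N) + (a * (1 - b)\<^sup>2 * inverse b ^ Suc N - b * (1 - a)\<^sup>2 * inverse a ^ Suc N)"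
      unfolding Suc t using D by simp
    also have "inverse b ^ N = b * inverse b ^ Suc N" using b by simp
    also have "inverse a ^ N = a * inverse a ^ Suc N" using a by simp
    also have "a * (1 - b) * (b * inverse b ^ Suc N) - b * (1 - a) * (a * inverse a ^ Suc N) + (a * (1 - b)\<^sup>2 * inverse b ^ Suc N - b * (1 - a)\<^sup>2 * inverse a ^ Suc N)
       = a * (1 - b) * inverse b ^ Suc N - b * (1 - a) * inverse a ^ Suc N"
      by (simp only: power2_eq_square) (simp only: algebra_simps mult_1 mult_1_right)
    finally show ?case .
  qed
  then have "(\<Sum>k\<le>N. shell_mass (a * b) k * macd a b k) = (a * (1 - b) * inverse b ^ N - b * (1 - a) * inverse a ^ N) / D"
    using D by (simp add: eq_divide_eq)
  then show ?thesis unfolding D(2) D_def[symmetric] by (simp add: diff_divide_distrib)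
qed

text \<open>For \<open>a * b = 1 / q\<close> the weight of the last level is
  \<open>1 / (q + 1)\<close>, the mass of \<open>K0\<close>. The left-hand side is a weighted mean
  of the sums up to \<open>N - 1\<close> and up to \<open>N\<close>.\<close>

lemma sum_macd_boundary:
  assumes a: "a \<noteq> 0" and b: "b \<noteq> 0" and ab: "a \<noteq> b" "a * b \<noteq> 1" "a * b \<noteq> - 1" and N: "N \<ge> 1"
  shows "(\<Sum>k<N. shell_mass (a * b) k * macd a b k) + a * b / (1 + a * b) * (shell_mass (a * b) N * macd a b N)
    = b * (1 - a) / (b - a) * (a * (1 + b) / (1 + a * b)) * inverse a ^ N
    + a * (1 - b) / (a - b) * (b * (1 + a) / (1 + a * b)) * inverse b ^ N"
proof -
  obtain M where M: "N = Suc M" using N by (cases N) auto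
  define D where "D = a - b"
  define V where "V = 1 + a * b"
  have V: "V \<noteq> 0" using ab(3) by (auto simp: V_def add_eq_0_iff)
  have D: "D \<noteq> 0" "b - a = - D" using ab by (auto simp: D_def)
  define S where "S k = (\<Sum>i\<le>k. shell_mass (a * b) i * macd a b i)" for k
  have S: "S k = (a * (1 - b) * inverse b ^ k - b * (1 - a) * inverse a ^ k) / D" for k
    unfolding S_def sum_macd[OF a b ab(1,2)] D(2) D_def[symmetric] by (simp add: diff_divide_distrib)
  have "shell_mass (a * b) N * macd a b N = S N - S M" unfolding M S_def by simp
  moreover have "(\<Sum>k<N. shell_mass (a * b) k * macd a b k) = S M" unfolding M S_def lessThan_Suc_atMost ..
  ultimately have "(\<Sum>k<N. shell_mass (a * b) k * macd a b k) + a * b / (1 + a * b) * (shell_mass (a * b) N * macd a b N)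
    = (S M * V + a * b * (S N - S M)) / V" using V by (simp add: V_def[symmetric] add_divide_distrib)
  also have "S M * V + a * b * (S N - S M) = S M + a * b * S N" by (simp add: V_def algebra_simps)
  also have "S M = (a * (1 - b) * b * inverse b ^ N - b * (1 - a) * a * inverse a ^ N) / D"
  proof -
    have "inverse b ^ M = b * inverse b ^ N" "inverse a ^ M = a * inverse a ^ N" using a b by (simp_all add: M)
    then show ?thesis unfolding S by (simp only: mult.assoc)
  qed
  also have "S N = (a * (1 - b) * inverse b ^ N - b * (1 - a) * inverse a ^ N) / D" by (rule S)
  also have "((a * (1 - b) * b * inverse b ^ N - b * (1 - a) * a * inverse a ^ N) / D + a * b * ((a * (1 - b) * inverse b ^ N - b * (1 - a) * inverse a ^ N) / D)) / V
    = ((a * (1 - b) * b * inverse b ^ N - b * (1 - a) * a * inverse a ^ N) + a * b * (a * (1 - b) * inverse b ^ N - b * (1 - a) * inverse a ^ N)) / (D * V)"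
    by (simp only: times_divide_eq_right add_divide_distrib[symmetric] divide_divide_eq_left)
  also have "(a * (1 - b) * b * inverse b ^ N - b * (1 - a) * a * inverse a ^ N) + a * b * (a * (1 - b) * inverse b ^ N - b * (1 - a) * inverse a ^ N)
    = a * (1 - b) * (b * (1 + a)) * inverse b ^ N - b * (1 - a) * (a * (1 + b)) * inverse a ^ N"
    by (simp only: algebra_simps mult_1 mult_1_right)
  finally have lhs: "(\<Sum>k<N. shell_mass (a * b) k * macd a b k) + a * b / (1 + a * b) * (shell_mass (a * b) N * macd a b N)
    = (a * (1 - b) * (b * (1 + a)) * inverse b ^ N - b * (1 - a) * (a * (1 + b)) * inverse a ^ N) / (D * V)" .
  show ?thesis unfolding lhs unfolding D(2) D_def[symmetric] V_def[symmetric] by (simp add: diff_divide_distrib)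
qed

text \<open>Equal roots are allowed, so no closed form is used: \<open>F (Suc j) - A * F j\<close>
  is geometric with ratio \<open>B\<close>, which gives summability, and summing the recursion gives
  the value.\<close>

lemma linear_recurrence_sums:
  fixes F :: "nat \<Rightarrow> complex"
  assumes A: "norm A < 1" and B: "norm B < 1" and rec: "\<And>j. F (Suc (Suc j)) = (A + B) * F (Suc j) - A * B * F j"
  shows "summable (\<lambda>j. norm (F j))" and "(\<lambda>j. F (Suc j)) sums ((F 1 - A * B * F 0) / ((1 - A) * (1 - B)))"
proof -
  define d where "d = F 1 - A * F 0"
  have D: "F (Suc j) - A * F j = B ^ j * d" for j
  proof (induction j)
    case (Suc j)
    have "F (Suc (Suc j)) - A * F (Suc j) = B * (F (Suc j) - A * F j)" unfolding rec by (simp add: algebra_simps)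
    then show ?case using Suc by simp
  qed (simp add: d_def)
  have step: "norm (F (Suc j)) \<le> norm A * norm (F j) + norm d * norm B ^ j" for j
  proof -
    have "F (Suc j) = A * F j + B ^ j * d" using D[of j] by (simp add: algebra_simps)
    then have "norm (F (Suc j)) \<le> norm (A * F j) + norm (B ^ j * d)" using norm_triangle_ineq by metis
    then show ?thesis by (simp add: norm_mult norm_power mult.commute)
  qed
  define K where "K = norm (F 0) + norm d * (1 / (1 - norm B))"
  \<comment> \<open>A partial sum \<open>S\<close> satisfies \<open>S \<le> norm A * S + K\<close>,
    and \<open>norm A < 1\<close> turns this into a bound.\<close>
  have "(\<Sum>j<N. norm (F j)) \<le> K / (1 - norm A)" for N
  proof -
    have "(\<Sum>j<N. norm (F j)) \<le> (\<Sum>j<Suc N. norm (F j))" by simp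
    also have "\<dots> = norm (F 0) + (\<Sum>j<N. norm (F (Suc j)))" by (rule sum.lessThan_Suc_shift)
    also have "(\<Sum>j<N. norm (F (Suc j))) \<le> (\<Sum>j<N. norm A * norm (F j) + norm d * norm B ^ j)" by (intro sum_mono step)
    also have "\<dots> = norm A * (\<Sum>j<N. norm (F j)) + norm d * (\<Sum>j<N. norm B ^ j)" by (simp add: sum.distrib sum_distrib_left)
    also have "(\<Sum>j<N. norm B ^ j) \<le> (\<Sum>j. norm B ^ j)" using B by (intro sum_le_suminf summable_geometric) auto
    also have "(\<Sum>j. norm B ^ j) = 1 / (1 - norm B)" using B by (intro suminf_geometric) auto
    finally have "(\<Sum>j<N. norm (F j)) \<le> norm A * (\<Sum>j<N. norm (F j)) + K"
      unfolding K_def by (simp add: mult_left_mono)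
    then have "(\<Sum>j<N. norm (F j)) * (1 - norm A) \<le> K" by (simp add: algebra_simps)
    then show ?thesis using A by (simp add: pos_le_divide_eq)
  qed
  then show sn: "summable (\<lambda>j. norm (F j))" by (intro summableI_nonneg_bounded) auto
  have s0: "summable F" by (rule summable_norm_cancel[OF sn])
  then have s1: "summable (\<lambda>j. F (Suc j))" by (subst summable_Suc_iff)
  define S where "S = (\<Sum>j. F (Suc j))"
  have e1: "suminf F = F 0 + S" unfolding S_def using suminf_split_head[OF s0] by simp
  have "(\<Sum>j. F (Suc (Suc j))) = S - F 1" unfolding S_def using suminf_split_head[OF s1] by simp
  moreover have "(\<Sum>j. F (Suc (Suc j))) = (A + B) * S - A * B * (F 0 + S)"
    unfolding rec S_def using s0 s1 e1[unfolded S_def] by (subst suminf_diff[symmetric]) (simp_all add: suminf_mult summable_mult)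
  ultimately have "S * ((1 - A) * (1 - B)) = F 1 - A * B * F 0" by (simp add: algebra_simps)
  moreover have "(1 - A) * (1 - B) \<noteq> 0" using A B by auto
  ultimately have "S = (F 1 - A * B * F 0) / ((1 - A) * (1 - B))" by (simp add: eq_divide_eq)
  then show "(\<lambda>j. F (Suc j)) sums ((F 1 - A * B * F 0) / ((1 - A) * (1 - B)))" using summable_sums[OF s1] S_def by simp
qed

text \<open>The rational form of the sum over all levels with weight 1 up to level \<open>N\<close>
  and the ratio \<open>a * b * X\<close> beyond it. It has no denominator \<open>a - b\<close>, so
  it is continuous where the roots coincide.\<close>

definition macd_total :: "nat \<Rightarrow> complex \<Rightarrow> complex \<Rightarrow> complex \<Rightarrow> complex" where
  "macd_total N X a b = (\<Sum>k\<le>N. shell_mass (a * b) k * macd a b k)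
     + (1 - a * b) / (a * b) ^ N * ((macd a b (Suc N) * X - a * b * X\<^sup>2 * macd a b N) / ((1 - a * X) * (1 - b * X)))"

lemma macd_total_series:
  fixes a b X :: complex and N :: nat
  assumes A: "norm (a * X) < 1" and B: "norm (b * X) < 1" and ab: "a * b \<noteq> 0"
  defines "s \<equiv> \<lambda>k. shell_mass (a * b) k * ((a * b * X) ^ (k - N) * macd a b k)"
  shows "summable (\<lambda>k. norm (s k))" "suminf s = macd_total N X a b"
proof -
  define F where "F j = macd a b (N + j) * X ^ j" for j
  define c where "c = (1 - a * b) / (a * b) ^ N"
  have rec: "F (Suc (Suc j)) = (a * X + b * X) * F (Suc j) - (a * X) * (b * X) * F j" for j
    by (simp add: F_def algebra_simps)
  note L = linear_recurrence_sums[where F = F, OF A B rec]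
  \<comment> \<open>Beyond level \<open>N\<close> the weight cancels the growth of the level
    volumes, and \<open>macd\<close> times a power of \<open>X\<close> remains. Up to
    \<open>N\<close> the truncated difference \<open>k - N\<close> makes the weight 1.\<close>
  have tail: "s (j + Suc N) = c * F (Suc j)" for j
    using ab by (simp add: s_def shell_mass_def c_def F_def power_add power_mult_distrib field_simps)
  have "summable (\<lambda>j. norm (c * F (Suc j)))" unfolding norm_mult
    using iffD2[OF summable_Suc_iff L(1)] by (rule summable_mult)
  then have "summable (\<lambda>j. norm (s (j + Suc N)))" unfolding tail .
  then show sn: "summable (\<lambda>k. norm (s k))" using summable_iff_shift[of "\<lambda>k. norm (s k)" "Suc N"] by blast
  have "suminf s = (\<Sum>j. s (j + Suc N)) + (\<Sum>k<Suc N. s k)"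
    by (rule suminf_split_initial_segment[OF summable_norm_cancel[OF sn]])
  also have "(\<Sum>j. s (j + Suc N)) = c * ((F 1 - a * X * (b * X) * F 0) / ((1 - a * X) * (1 - b * X)))"
    unfolding tail by (rule sums_unique[symmetric, OF sums_mult[OF L(2)]])
  also have "(\<Sum>k<Suc N. s k) = (\<Sum>k\<le>N. shell_mass (a * b) k * macd a b k)"
    unfolding lessThan_Suc_atMost by (intro sum.cong) (auto simp: s_def)
  finally show "suminf s = macd_total N X a b"
    by (simp add: macd_total_def c_def F_def power2_eq_square mult_ac add.commute)
qed

text \<open>The shape of \<open>S1\<close> for \<open>vabs b > 1\<close>: each term carries one of
  the two factors \<open>1 - a * X\<close> and \<open>1 - b * X\<close>.\<close>

lemma macd_total_closed:
  assumes a: "a \<noteq> 0" and b: "b \<noteq> 0" and ab: "a \<noteq> b" "a * b \<noteq> 1" and X: "a * X \<noteq> 1" "b * X \<noteq> 1"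
  shows "macd_total N X a b = (1 - a * b * X) * (b * (1 - a) / ((b - a) * (1 - b * X)) * inverse a ^ N
    + a * (1 - b) / ((a - b) * (1 - a * X)) * inverse b ^ N)"
proof -
  define D U V where "D = a - b" and "U = 1 - a * X" and "V = 1 - b * X"
  have nz: "D \<noteq> 0" "b - a = - D" "U \<noteq> 0" "V \<noteq> 0" "1 - a * b \<noteq> 0" using ab X by (auto simp: D_def U_def V_def)
  define W where "W = 1 - a * b"
  define p r where "p = inverse a ^ N" and "r = inverse b ^ N"
  have e: "macd a b (Suc N) * X - a * b * X\<^sup>2 * macd a b N
    = ((1 - b)\<^sup>2 * a\<^sup>2 * X * V * a ^ N - (1 - a)\<^sup>2 * b\<^sup>2 * X * U * b ^ N) / (D * W)"
    unfolding macd_closed[OF ab] D_def[symmetric] W_def[symmetric] times_divide_eq_left times_divide_eq_right diff_divide_distrib[symmetric]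
    by (simp add: U_def V_def power2_eq_square algebra_simps)
  have pr: "a ^ N / (a * b) ^ N = r" "b ^ N / (a * b) ^ N = p" using a b by (simp_all add: p_def r_def power_mult_distrib power_inverse field_simps)
  have "W / (a * b) ^ N * (((1 - b)\<^sup>2 * a\<^sup>2 * X * V * a ^ N - (1 - a)\<^sup>2 * b\<^sup>2 * X * U * b ^ N) / (D * W) / (U * V))
    = ((1 - b)\<^sup>2 * a\<^sup>2 * X * V * (a ^ N / (a * b) ^ N) - (1 - a)\<^sup>2 * b\<^sup>2 * X * U * (b ^ N / (a * b) ^ N)) / (D * (U * V))"
    using nz(5) unfolding W_def[symmetric] by (simp add: diff_divide_distrib right_diff_distrib mult_ac)
  then have "macd_total N X a b = (a * (1 - b) * r - b * (1 - a) * p) / D + ((1 - b)\<^sup>2 * a\<^sup>2 * X * V * r - (1 - a)\<^sup>2 * b\<^sup>2 * X * U * p) / (D * (U * V))"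
    unfolding macd_total_def sum_macd[OF a b ab] e U_def[symmetric] V_def[symmetric] W_def[symmetric] pr nz(2) D_def[symmetric] p_def[symmetric] r_def[symmetric]
    by (simp add: diff_divide_distrib)
  also have "\<dots> = ((a * (1 - b) * r - b * (1 - a) * p) * (U * V) + ((1 - b)\<^sup>2 * a\<^sup>2 * X * V * r - (1 - a)\<^sup>2 * b\<^sup>2 * X * U * p)) / (D * (U * V))"
    using nz by (simp add: add_divide_distrib)
  also have "(a * (1 - b) * r - b * (1 - a) * p) * (U * V) + ((1 - b)\<^sup>2 * a\<^sup>2 * X * V * r - (1 - a)\<^sup>2 * b\<^sup>2 * X * U * p)
     = (1 - a * b * X) * (a * (1 - b) * r * V - b * (1 - a) * p * U)"
    by (simp only: U_def V_def power2_eq_square) (simp only: algebra_simps mult_1 mult_1_right)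
  also have "(1 - a * b * X) * (a * (1 - b) * r * V - b * (1 - a) * p * U) / (D * (U * V)) = (1 - a * b * X) * (a * (1 - b) * r / (D * U) - b * (1 - a) * p / (D * V))"
    using nz by (simp add: field_simps)
  finally show ?thesis unfolding nz(2) D_def[symmetric] U_def[symmetric] V_def[symmetric] p_def[symmetric] r_def[symmetric] by simp
qed

text \<open>At \<open>N = 0\<close> the two terms combine into one product, which is the shape of
  \<open>S1\<close> for \<open>vabs b \<le> 1\<close>.\<close>

lemma macd_total_0:
  assumes ab: "a * b \<noteq> 1" and X: "a * X \<noteq> 1" "b * X \<noteq> 1"
  shows "macd_total 0 X a b = (1 - a * b * X)\<^sup>2 / ((1 - a * X) * (1 - b * X))"
proof -
  have "(1 - a * b) * (macd a b (Suc 0) * X - a * b * X\<^sup>2) = (a + b - 2 * a * b) * X - (1 - a * b) * a * b * X\<^sup>2"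
  proof -
    have e: "(1 - a * b) * macd a b (Suc 0) = a + b - 2 * a * b" using ab by simp
    show ?thesis unfolding e[symmetric] by (simp only: algebra_simps)
  qed
  moreover have nz: "(1 - a * X) * (1 - b * X) \<noteq> 0" using X by simp
  ultimately have "macd_total 0 X a b = ((1 - a * X) * (1 - b * X) + ((a + b - 2 * a * b) * X - (1 - a * b) * a * b * X\<^sup>2)) / ((1 - a * X) * (1 - b * X))"
    by (simp only: macd_total_def add_divide_distrib divide_self) (simp add: shell_mass_def)
  then show ?thesis by (simp add: power2_eq_square algebra_simps)
qed

lemma isCont_macd:
  assumes "isCont f z" "isCont g z" "f z * g z \<noteq> 1"
  shows "isCont (\<lambda>w. macd (f w) (g w) n) z"
proof -
  have "isCont (\<lambda>w. macd (f w) (g w) n) z \<and> isCont (\<lambda>w. macd (f w) (g w) (Suc n)) z"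
    by (induction n) (use assms in \<open>auto intro!: continuous_intros\<close>)
  then show ?thesis ..
qed

lemma isCont_shell_mass:
  assumes "isCont f z" "f z \<noteq> 0"
  shows "isCont (\<lambda>w. shell_mass (f w) n) z"
  using assms by (cases "n = 0") (auto simp: shell_mass_def intro!: continuous_intros)

section \<open>Conjugation and volumes in the maximal compact subgroup\<close>

context local_field begin

lemma vabs_diff_lt: "vabs x < r \<Longrightarrow> vabs y < r \<Longrightarrow> vabs (x - y :: 'k) < r"
  using vabs_diff_le[of x y] by simp

lemma vabs_add_lt: "vabs x < r \<Longrightarrow> vabs y < r \<Longrightarrow> vabs (x + y :: 'k) < r"
  using vabs_add_le[of x y] by simp

lemma vabs_mult_lt: "vabs x \<le> 1 \<Longrightarrow> vabs y < 1 \<Longrightarrow> vabs (x * y :: 'k) < 1"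
  using mult_right_mono[of "vabs x" 1 "vabs y"] by (simp add: vabs_mult)

definition mx :: "'k^2^2 \<Rightarrow> real" where
  "mx g = max (max (vabs (g $ 1 $ 1)) (vabs (g $ 1 $ 2))) (max (vabs (g $ 2 $ 1)) (vabs (g $ 2 $ 2)))"

lemma mx_le_iff: "mx g \<le> r \<longleftrightarrow> (\<forall>i j. vabs (g $ i $ j) \<le> r)"
  by (auto simp: mx_def forall_2)

lemma mx_ge: "vabs (g $ i $ j) \<le> mx g" using mx_le_iff[of g "mx g"] by simp

lemma mx_nonneg: "mx g \<ge> 0" using mx_ge[of g 1 1] vabs_nonneg order_trans by blast

lemma mx_attained: "\<exists>i j. mx g = vabs (g $ i $ j)"
proof -
  have m: "max x y = x \<or> max x y = y" for x y :: real by (simp add: max_def)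
  show ?thesis unfolding mx_def using m by metis
qed

lemma GL2_iff: "k \<in> GL2_val_ring \<longleftrightarrow> mx k \<le> 1 \<and> vabs (det k) = 1"
  by (simp add: GL2_val_ring_def mx_le_iff val_ring_def)

lemma mx_mult_le: "mx (M ** N) \<le> mx M * mx N"
proof -
  have t: "vabs (M $ i $ l * N $ l $ j) \<le> mx M * mx N" for i j l
    unfolding vabs_mult by (intro mult_mono mx_ge mx_nonneg vabs_nonneg)
  have "vabs ((M ** N) $ i $ j) \<le> mx M * mx N" for i j
  proof -
    have "(M ** N) $ i $ j = M $ i $ 1 * N $ 1 $ j + M $ i $ 2 * N $ 2 $ j"
      by (simp add: matrix_matrix_mult_def sum_2)
    then have "vabs ((M ** N) $ i $ j) \<le> max (vabs (M $ i $ 1 * N $ 1 $ j)) (vabs (M $ i $ 2 * N $ 2 $ j))"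
      by (simp add: vabs_add_le)
    also have "\<dots> \<le> mx M * mx N" by (intro max.boundedI t)
    finally show ?thesis .
  qed
  then show ?thesis unfolding mx_le_iff by blast
qed

definition adj2 :: "'k^2^2 \<Rightarrow> 'k^2^2" where
  "adj2 k = mat2 (k $ 2 $ 2 / det k) (- (k $ 1 $ 2) / det k) (- (k $ 2 $ 1) / det k) (k $ 1 $ 1 / det k)"

lemma det_mat2 [simp]: "det (mat2 p r s t) = p * t - r * (s :: 'k)"
  by (simp add: det_2)

lemma adj2_inverse:
  assumes "det k \<noteq> 0"
  shows "k ** adj2 k = mat 1" "adj2 k ** k = mat 1"
proof -
  have d: "k $ 1 $ 1 * k $ 2 $ 2 - k $ 1 $ 2 * k $ 2 $ 1 = det k" by (simp add: det_2)
  have e: "det k / det k = 1" using assms by simp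
  have s: "k $ 1 $ 1 * k $ 2 $ 2 / det k - k $ 1 $ 2 * k $ 2 $ 1 / det k = 1"
    unfolding diff_divide_distrib[symmetric] d by (rule e)
  show "k ** adj2 k = mat 1" by (rule mat2_eqI) (use s in \<open>simp_all add: mat2_mult_sel adj2_def mult.commute\<close>)
  show "adj2 k ** k = mat 1" by (rule mat2_eqI) (use s in \<open>simp_all add: mat2_mult_sel adj2_def mult.commute\<close>)
qed

lemma GL2_inv:
  assumes k: "k \<in> GL2_val_ring"
  shows "matrix_inv k = adj2 k" "k ** adj2 k = mat 1" "adj2 k ** k = mat 1" "adj2 k \<in> GL2_val_ring"
proof -
  have d: "vabs (det k) = 1" and m: "mx k \<le> 1" using k by (auto simp: GL2_iff)
  then have d0: "det k \<noteq> 0" by auto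
  show 1: "k ** adj2 k = mat 1" and 2: "adj2 k ** k = mat 1" using adj2_inverse[OF d0] by auto
  show "matrix_inv k = adj2 k" by (rule matrix_inv_eqI[OF 1 2])
  have "det (adj2 k) * det k = 1" using arg_cong[OF 2, of det] by (simp add: det_mul)
  then have "vabs (det (adj2 k)) = 1" using vabs_mult[of "det (adj2 k)" "det k"] d by simp
  moreover have "mx (adj2 k) \<le> 1"
    using m unfolding mx_le_iff adj2_def by (simp add: forall_2 vabs_divide d)
  ultimately show "adj2 k \<in> GL2_val_ring" by (simp add: GL2_iff)
qed

lemma GL2_mult: "(k :: 'k^2^2) \<in> GL2_val_ring \<Longrightarrow> h \<in> GL2_val_ring \<Longrightarrow> k ** h \<in> GL2_val_ring"
  using order_trans[OF mx_mult_le[of k h] mult_le_one[OF _ mx_nonneg[of h]]] by (simp add: GL2_iff det_mul vabs_mult)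

text \<open>An integral matrix does not increase the maximum norm, and its inverse is integral
  too.\<close>

lemma mx_GL2_mult:
  assumes k: "k \<in> GL2_val_ring"
  shows "mx (k ** M) = mx M" "mx (M ** k) = mx M"
proof -
  have le: "mx (h ** N) \<le> mx N" "mx (N ** h) \<le> mx N" if "h \<in> GL2_val_ring" for h N
    using mx_mult_le[of h N] mx_mult_le[of N h] that mx_nonneg[of N] mult_left_le_one_le[of "mx N" "mx h"] mult_left_le[of "mx h" "mx N"] mx_nonneg[of h]
    by (auto simp: GL2_iff)
  have "adj2 k ** (k ** M) = M" "(M ** k) ** adj2 k = M"
    using GL2_inv[OF k] by (simp_all add: matrix_mul_assoc) (simp add: matrix_mul_assoc[symmetric])
  then show "mx (k ** M) = mx M" "mx (M ** k) = mx M"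
    using le[OF k, of M] le(1)[OF GL2_inv(4)[OF k], of "k ** M"] le(2)[OF GL2_inv(4)[OF k], of "M ** k"] by auto
qed

text \<open>The maximum norm and the determinant do not depend on \<open>k\<close>, so the test
  functions outside the level are constant on the compact group. Only the lower left entry, which
  \<open>K0\<close> tests, involves the first column of \<open>k\<close>.\<close>

lemma conj_unip_props:
  assumes k: "k \<in> GL2_val_ring"
  shows "mx (conj_unip a x k) = max (max (vabs a) (vabs ((a - 1) * x))) 1"
    and "det (conj_unip a x k) = a"
    and "vabs (conj_unip a x k $ 2 $ 1) = vabs (k $ 2 $ 1) * vabs (a - 1) * vabs (k $ 1 $ 1 + x * k $ 2 $ 1)"
proof -
  define g where "g = mat2 a ((a - 1) * x) 0 1"
  have c: "conj_unip a x k = adj2 k ** g ** k" by (simp add: conj_unip_def GL2_inv(1)[OF k] g_def)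
  show "mx (conj_unip a x k) = max (max (vabs a) (vabs ((a - 1) * x))) 1"
    unfolding c mx_GL2_mult(2)[OF k] mx_GL2_mult(1)[OF GL2_inv(4)[OF k]] by (simp add: g_def mx_def)
  have "det (adj2 k) * det k = 1" using arg_cong[OF GL2_inv(3)[OF k], of det] by (simp add: det_mul)
  then show "det (conj_unip a x k) = a" unfolding c det_mul by (simp add: g_def mult.left_commute mult.commute)
  have "conj_unip a x k $ 2 $ 1 = - (k $ 2 $ 1 * (a - 1) * (k $ 1 $ 1 + x * k $ 2 $ 1)) / det k"
    unfolding c by (simp add: mat2_mult_sel adj2_def g_def) (simp add: add_divide_distrib diff_divide_distrib algebra_simps)
  then show "vabs (conj_unip a x k $ 2 $ 1) = vabs (k $ 2 $ 1) * vabs (a - 1) * vabs (k $ 1 $ 1 + x * k $ 2 $ 1)"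
    using k by (simp add: vabs_divide vabs_mult GL2_iff)
qed

lemma center_GL2_iff: "t \<in> center_GL2 \<longleftrightarrow> (\<exists>c. c \<noteq> 0 \<and> t = mat2 c 0 0 (c :: 'k))"
proof
  assume t: "t \<in> center_GL2"
  have inv: "invertible (mat2 1 1 0 (1 :: 'k))" "invertible (mat2 1 0 1 (1 :: 'k))" "invertible t"
    using t by (simp_all add: invertible_det_nz center_GL2_def)
  then have 1: "t ** mat2 1 1 0 1 = mat2 1 1 0 1 ** t" and 2: "t ** mat2 1 0 1 1 = mat2 1 0 1 1 ** t"
    using t by (auto simp: center_GL2_def)
  have "t $ 2 $ 1 = 0" "t $ 1 $ 1 = t $ 2 $ 2" "t $ 1 $ 2 = 0"
    using arg_cong[OF 1, of "\<lambda>M :: 'k^2^2. M $ 1 $ 1"] arg_cong[OF 1, of "\<lambda>M :: 'k^2^2. M $ 1 $ 2"] arg_cong[OF 2, of "\<lambda>M :: 'k^2^2. M $ 1 $ 1"]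
    by (simp_all add: mat2_mult_sel)
  then have e: "t = mat2 (t $ 1 $ 1) 0 0 (t $ 1 $ 1)" by (intro mat2_eqI) simp_all
  have "det t \<noteq> 0" using inv(3) by (simp add: invertible_det_nz)
  then have "t $ 1 $ 1 \<noteq> 0" by (subst (asm) e) simp
  then show "\<exists>c. c \<noteq> 0 \<and> t = mat2 c 0 0 c" using e by blast
next
  assume "\<exists>c. c \<noteq> 0 \<and> t = mat2 c 0 0 c"
  then obtain c where c: "c \<noteq> 0" "t = mat2 c 0 0 c" by blast
  have "t ** g = g ** t" for g by (rule mat2_eqI) (simp_all add: c mat2_mult_sel mult.commute)
  then show "t \<in> center_GL2" using c by (simp add: center_GL2_def invertible_det_nz)
qed

lemma scalar_mult_sel:
  fixes k :: "'k^2^2"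
  shows "(mat2 c 0 0 c ** k) $ i $ j = c * k $ i $ j"
  using exhaust_2[of i] exhaust_2[of j] by (auto simp: mat2_mult_sel)

lemma mx_scalar: "mx (mat2 c 0 0 c ** k) = vabs c * mx k"
  unfolding mx_def scalar_mult_sel vabs_mult by (simp add: max_mult_distrib_left)

lemma mx_GL2: "k \<in> GL2_val_ring \<Longrightarrow> mx k = 1"
proof (rule antisym)
  assume k: "k \<in> GL2_val_ring"
  then show "mx k \<le> 1" by (simp add: GL2_iff)
  have "1 = mx (adj2 k ** k)" unfolding GL2_inv(3)[OF k] by (simp add: mx_def)
  also have "\<dots> = mx k" by (rule mx_GL2_mult(1)[OF GL2_inv(4)[OF k]])
  finally show "1 \<le> mx k" by simp
qed

text \<open>Membership modulo the centre becomes a scale-invariant equality of norm and determinant,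
  to which \<open>conj_unip_props\<close> applies directly.\<close>

lemma center_times_GL2_iff:
  "M \<in> center_times GL2_val_ring \<longleftrightarrow> det M \<noteq> 0 \<and> (mx M)\<^sup>2 = vabs (det M)"
  "M \<in> center_times K0 \<longleftrightarrow> det M \<noteq> 0 \<and> (mx M)\<^sup>2 = vabs (det M) \<and> vabs (M $ 2 $ 1) < mx M"
proof -
  have fwd: "det M \<noteq> 0 \<and> (mx M)\<^sup>2 = vabs (det M) \<and> (k \<in> K0 \<longrightarrow> vabs (M $ 2 $ 1) < mx M)"
    if t: "t \<in> center_GL2" and k: "k \<in> GL2_val_ring" and M: "M = t ** k" for t k
  proof -
    obtain c where c: "c \<noteq> 0" "t = mat2 c 0 0 c" using t center_GL2_iff by blast
    have m: "mx M = vabs c" unfolding M c(2) mx_scalar mx_GL2[OF k] by simp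
    have "det M = c * c * det k" unfolding M c(2) det_mul by simp
    moreover have "vabs (det k) = 1" using k by (simp add: GL2_iff)
    moreover have "M $ 2 $ 1 = c * k $ 2 $ 1" unfolding M c(2) scalar_mult_sel ..
    ultimately show ?thesis using c(1) vabs_pos[OF c(1)] unfolding m by (auto simp: vabs_mult power2_eq_square K0_def val_ideal_def)
  qed
  have bwd: "\<exists>t k. M = t ** k \<and> t \<in> center_GL2 \<and> k \<in> GL2_val_ring \<and> (vabs (M $ 2 $ 1) < mx M \<longrightarrow> k \<in> K0)"
    if d: "det M \<noteq> 0" and m: "(mx M)\<^sup>2 = vabs (det M)"
  proof -
    \<comment> \<open>An entry of maximal absolute value is the central factor to divide by.\<close>
    obtain i j where ij: "mx M = vabs (M $ i $ j)" using mx_attained by blast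
    define c where "c = M $ i $ j"
    have c0: "c \<noteq> 0" using d m ij by (auto simp: c_def)
    define k where "k = mat2 (inverse c) 0 0 (inverse c) ** M"
    have Mk: "M = mat2 c 0 0 c ** k"
      by (rule mat2_eqI) (use c0 in \<open>simp_all add: k_def scalar_mult_sel\<close>)
    have mk: "mx k = 1" unfolding k_def mx_scalar ij using c0 by (simp add: vabs_inverse c_def)
    have "vabs (det k) = inverse (vabs c) * inverse (vabs c) * vabs (det M)"
      unfolding k_def det_mul by (simp only: det_mat2 mult_zero_left diff_0_right vabs_mult vabs_inverse)
    also have "vabs (det M) = vabs c * vabs c" using m unfolding ij c_def[symmetric] power2_eq_square by simp
    finally have "vabs (det k) = 1" using c0 by (simp add: field_simps)
    then have k: "k \<in> GL2_val_ring" using mk by (simp add: GL2_iff)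
    have "vabs (k $ 2 $ 1) < 1" if "vabs (M $ 2 $ 1) < mx M"
      using that vabs_pos[OF c0] unfolding k_def scalar_mult_sel vabs_mult vabs_inverse ij c_def[symmetric] by (simp add: field_simps)
    then show ?thesis using Mk k c0 center_GL2_iff by (intro exI[of _ "mat2 c 0 0 c"] exI[of _ k]) (auto simp: K0_def val_ideal_def)
  qed
  show "M \<in> center_times GL2_val_ring \<longleftrightarrow> det M \<noteq> 0 \<and> (mx M)\<^sup>2 = vabs (det M)"
    using fwd bwd unfolding center_times_def by blast
  have sub: "k \<in> K0 \<Longrightarrow> k \<in> GL2_val_ring" for k :: "'k^2^2" by (simp add: K0_def)
  show "M \<in> center_times K0 \<longleftrightarrow> det M \<noteq> 0 \<and> (mx M)\<^sup>2 = vabs (det M) \<and> vabs (M $ 2 $ 1) < mx M"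
    using fwd bwd sub unfolding center_times_def by blast
qed

lemma max_sq_eq_iff:
  fixes t u :: real
  assumes "t \<ge> 0"
  shows "(max (max t u) 1)\<^sup>2 = t \<longleftrightarrow> t = 1 \<and> u \<le> 1"
proof
  assume e: "(max (max t u) 1)\<^sup>2 = t"
  define m where "m = max (max t u) 1"
  have m: "m \<ge> 1" "t \<le> m" "u \<le> m" by (auto simp: m_def)
  have "m * m \<le> m * 1" using e m by (simp add: m_def[symmetric] power2_eq_square)
  then have "m = 1" using m by (metis antisym less_le_trans mult_le_cancel_left_pos zero_less_one)
  then show "t = 1 \<and> u \<le> 1" using e m by (simp add: m_def[symmetric])
qed (simp add: max_def)

lemma Phi_unram_conj:
  fixes a x :: 'k
  assumes "k \<in> GL2_val_ring" "a \<noteq> 0"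
  shows "Phi_unram (conj_unip a x k) = (if vabs a = 1 \<and> vabs ((a - 1) * x) \<le> 1 then 1 else 0)"
  unfolding Phi_unram_def indicator_def center_times_GL2_iff conj_unip_props[OF assms(1)] using assms(2) max_sq_eq_iff[of "vabs a"] by simp

lemma Phi_n_conj:
  fixes a x :: 'k
  assumes "k \<in> GL2_val_ring" "a \<noteq> 0"
  shows "Phi_n (conj_unip a x k) = (if vabs a = 1 \<and> vabs ((a - 1) * x) \<le> 1 \<and>
    vabs (k $ 2 $ 1) * vabs (a - 1) * vabs (k $ 1 $ 1 + x * k $ 2 $ 1) < 1 then 1 else 0)"
proof -
  have "max (max (vabs a) (vabs ((a - 1) * x))) 1 = 1" if "vabs a = 1" "vabs ((a - 1) * x) \<le> 1" using that by simp
  then show ?thesis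
    unfolding Phi_n_def indicator_def center_times_GL2_iff conj_unip_props[OF assms(1)] using assms(2) max_sq_eq_iff[of "vabs a"] by auto
qed

lemma Phi_S_conj:
  fixes a x :: 'k
  assumes "k \<in> GL2_val_ring"
  shows "Phi_S s (conj_unip a x k) = inverse (of_real q powr (- (s + 1) / 2) - of_real q powr ((s + 1) / 2)) *
    of_real (inverse (vabs a) * (max (max (vabs a) (vabs ((a - 1) * x))) 1)\<^sup>2) powr (- (s + 1) / 2)"
  unfolding Phi_S_def Let_def mx_def[symmetric] unfolding conj_unip_props[OF assms] q_def by simp

end

section \<open>Haar measure of the level subgroup and averages of the test functions\<close>

locale local_field_group = local_field \<pi> q for \<pi> :: "'k::{field_char_0,metric_space}" and q +
  fixes dk :: "('k^2^2) measure"
  assumes haar_group: "is_haar_prob GL2_val_ring dk"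
begin

lemma sets_dk: "sets dk = sets (restrict_space borel GL2_val_ring)" and
  total: "emeasure dk GL2_val_ring = 1" and
  invariant: "k \<in> GL2_val_ring \<Longrightarrow> A \<in> sets dk \<Longrightarrow> emeasure dk ((\<lambda>g. k ** g) ` A) = emeasure dk A"
  using haar_group by (auto simp: is_haar_prob_def)

lemma space_dk: "space dk = GL2_val_ring"
  using sets_eq_imp_space_eq[OF sets_dk] by (simp add: space_restrict_space)

sublocale finite_measure dk by standard (simp add: space_dk total)

lemma prob_one: "measure dk GL2_val_ring = 1"
  by (simp add: measure_def total)

lemma integral_const_on:
  assumes "\<And>k. k \<in> GL2_val_ring \<Longrightarrow> f k = (c :: complex)"
  shows "integrable dk f" "(LINT k|dk. f k) = c"
proof -
  have "integrable dk f \<longleftrightarrow> integrable dk (\<lambda>_. c)"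
    by (rule Bochner_Integration.integrable_cong) (auto simp: space_dk assms)
  then show "integrable dk f" by simp
  have "(LINT k|dk. f k) = (LINT k|dk. c)"
    by (rule Bochner_Integration.integral_cong) (auto simp: space_dk assms)
  then show "(LINT k|dk. f k) = c" by (simp add: space_dk prob_one)
qed

text \<open>The matrices whose first column reduces to the point \<open>j : 1\<close> of the
  projective line over the residue field; \<open>K0\<close> is the fibre over the point at
  infinity.\<close>

definition cell :: "'k \<Rightarrow> ('k^2^2) set" where
  "cell j = {k \<in> GL2_val_ring. vabs (k $ 1 $ 1 - j * k $ 2 $ 1) < 1}"

text \<open>The condition is open: changing the entries of the first column by less than 1 changes
  an integral combination of them by less than 1.\<close>

lemma column_sets:
  assumes i: "vabs i \<le> 1" and j: "vabs j \<le> 1"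
  shows "{k \<in> GL2_val_ring. vabs (i * k $ 1 $ 1 - j * k $ 2 $ 1) < 1} \<in> sets dk"
proof -
  define S where "S = {k :: 'k^2^2. vabs (i * k $ 1 $ 1 - j * k $ 2 $ 1) < 1}"
  have "open S"
  proof (subst open_subopen, intro ballI)
    fix g assume g: "g \<in> S"
    define V where "V = (\<lambda>k :: 'k^2^2. k $ 1) -` ((\<lambda>r. r $ 1) -` ball (g $ 1 $ 1) 1) \<inter> (\<lambda>k :: 'k^2^2. k $ 2) -` ((\<lambda>r. r $ 1) -` ball (g $ 2 $ 1) 1)"
    have "open V" unfolding V_def by (rule open_Int; rule open_vimage_vec_nth; rule open_vimage_vec_nth; rule open_ball)
    moreover have "g \<in> V" by (simp add: V_def)
    moreover have "V \<subseteq> S"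
    proof
      fix k assume "k \<in> V"
      then have d: "vabs (k $ 1 $ 1 - g $ 1 $ 1) < 1" "vabs (k $ 2 $ 1 - g $ 2 $ 1) < 1"
        by (auto simp: V_def dist_vabs vabs_minus_commute)
      have "vabs (i * (k $ 1 $ 1 - g $ 1 $ 1) - j * (k $ 2 $ 1 - g $ 2 $ 1)) < 1"
        by (intro vabs_diff_lt vabs_mult_lt d i j)
      moreover have "vabs (i * g $ 1 $ 1 - j * g $ 2 $ 1) < 1" using g by (simp add: S_def)
      ultimately have "vabs ((i * (k $ 1 $ 1 - g $ 1 $ 1) - j * (k $ 2 $ 1 - g $ 2 $ 1)) + (i * g $ 1 $ 1 - j * g $ 2 $ 1)) < 1"
        by (rule vabs_add_lt)
      moreover have "(i * (k $ 1 $ 1 - g $ 1 $ 1) - j * (k $ 2 $ 1 - g $ 2 $ 1)) + (i * g $ 1 $ 1 - j * g $ 2 $ 1) = i * k $ 1 $ 1 - j * k $ 2 $ 1"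
        by (simp only: right_diff_distrib) simp
      ultimately show "k \<in> S" by (simp only: S_def mem_Collect_eq)
    qed
    ultimately show "\<exists>T. open T \<and> g \<in> T \<and> T \<subseteq> S" by (intro exI[of _ V] conjI)
  qed
  then have "S \<in> sets borel" by (rule borel_open)
  then have "GL2_val_ring \<inter> S \<in> sets dk" unfolding sets_dk sets_restrict_space by (rule imageI)
  moreover have "GL2_val_ring \<inter> S = {k \<in> GL2_val_ring. vabs (i * k $ 1 $ 1 - j * k $ 2 $ 1) < 1}" by (auto simp: S_def)
  ultimately show ?thesis by simp
qed

lemma K0_sets: "K0 \<in> sets dk"
proof -
  have "K0 = {k \<in> GL2_val_ring. vabs (0 * k $ 1 $ 1 - 1 * k $ 2 $ 1 :: 'k) < 1}" by (auto simp: K0_def val_ideal_def)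
  then show ?thesis using column_sets[of 0 1] by simp
qed

lemma cell_sets: "vabs j \<le> 1 \<Longrightarrow> cell j \<in> sets dk"
  using column_sets[of 1 j] by (simp add: cell_def)

text \<open>A common element would have its whole first column in the maximal ideal, and its
  determinant could not be a unit.\<close>

lemma K0_cell_disjoint: "vabs j \<le> 1 \<Longrightarrow> K0 \<inter> cell j = {}"
proof (rule ccontr)
  assume j: "vabs j \<le> 1" and "K0 \<inter> cell j \<noteq> {}"
  then obtain k :: "'k^2^2" where k: "k \<in> GL2_val_ring" "vabs (k $ 2 $ 1) < 1" "vabs (k $ 1 $ 1 - j * k $ 2 $ 1) < 1"
    by (auto simp: cell_def K0_def val_ideal_def)
  have lt: "vabs (x * y) < 1" if "vabs x \<le> 1" "vabs y < 1" for x y :: 'k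
    using that mult_left_le_one_le[of "vabs y" "vabs x"] unfolding vabs_mult by (meson le_less_trans vabs_nonneg)
  have "vabs ((k $ 1 $ 1 - j * k $ 2 $ 1) + j * k $ 2 $ 1) < 1"
    using k(3) lt[OF j k(2)] by (meson le_less_trans max_less_iff_conj vabs_add_le)
  then have a: "vabs (k $ 1 $ 1) < 1" by simp
  have o: "vabs (k $ 2 $ 2) \<le> 1" "vabs (k $ 1 $ 2) \<le> 1" using k(1) by (simp_all add: GL2_iff mx_le_iff)
  have "vabs (k $ 2 $ 2 * k $ 1 $ 1 - k $ 1 $ 2 * k $ 2 $ 1) < 1"
    using lt[OF o(1) a] lt[OF o(2) k(2)] by (meson le_less_trans max_less_iff_conj vabs_diff_le)
  moreover have "det k = k $ 2 $ 2 * k $ 1 $ 1 - k $ 1 $ 2 * k $ 2 $ 1" by (simp add: det_2 mult.commute)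
  ultimately show False using k(1) by (simp add: GL2_iff)
qed

text \<open>Left multiplication by the integral matrix \<open>mat2 j 1 1 0\<close> moves the point
  at infinity to \<open>j : 1\<close>.\<close>

lemma emeasure_cell:
  assumes j: "vabs j \<le> 1"
  shows "emeasure dk (cell j) = emeasure dk K0"
proof -
  define m where "m = mat2 j 1 1 0"
  have m: "m \<in> GL2_val_ring" using j by (simp add: m_def GL2_iff mx_def)
  have "cell j = (\<lambda>g. m ** g) ` K0"
  proof (intro equalityI subsetI)
    fix k assume k: "k \<in> cell j"
    define h where "h = adj2 m ** k"
    have "h $ 2 $ 1 = k $ 1 $ 1 - j * k $ 2 $ 1" by (simp add: h_def adj2_def m_def mat2_mult_sel)
    moreover have "h \<in> GL2_val_ring" using k GL2_mult[OF GL2_inv(4)[OF m]] by (simp add: h_def cell_def)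
    ultimately have "h \<in> K0" using k by (simp add: K0_def val_ideal_def cell_def)
    moreover have "k = m ** h" using GL2_inv(2)[OF m] by (simp add: h_def matrix_mul_assoc)
    ultimately show "k \<in> (\<lambda>g. m ** g) ` K0" by blast
  next
    fix k assume "k \<in> (\<lambda>g. m ** g) ` K0"
    then obtain h where h: "h \<in> K0" "k = m ** h" by blast
    have "k $ 1 $ 1 - j * k $ 2 $ 1 = h $ 2 $ 1" by (simp add: h(2) m_def mat2_mult_sel)
    then show "k \<in> cell j" using h GL2_mult[OF m] by (simp add: cell_def K0_def val_ideal_def)
  qed
  then show ?thesis using invariant[OF m K0_sets] by simp
qed

lemma measure_cell: "vabs j \<le> 1 \<Longrightarrow> measure dk (cell j) = measure dk K0"
  by (simp add: measure_def emeasure_cell)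

text \<open>The group is the disjoint union of \<open>K0\<close> and one cell for each of the
  \<open>q\<close> residue classes, all of the same mass.\<close>

lemma measure_K0: "measure dk K0 = 1 / (q + 1)"
proof -
  define C where "C = val_ring // (resid :: ('k \<times> 'k) set)"
  have r: "vabs (rep c) \<le> 1" if "c \<in> C" for c using rep(2) that by (simp add: C_def)
  have col: "vabs (k $ 2 $ 1) \<le> 1" "vabs (k $ 1 $ 1) \<le> 1" if "k \<in> GL2_val_ring" for k :: "'k^2^2"
    using that by (simp_all add: GL2_iff mx_le_iff)
  have cover: "GL2_val_ring = K0 \<union> (\<Union>c\<in>C. cell (rep c))"
  proof (intro equalityI subsetI)
    fix k :: "'k^2^2" assume k: "k \<in> GL2_val_ring"
    show "k \<in> K0 \<union> (\<Union>c\<in>C. cell (rep c))"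
    proof (cases "vabs (k $ 2 $ 1) < 1")
      case True
      then show ?thesis using k by (simp add: K0_def val_ideal_def)
    next
      case False
      then have g1: "vabs (k $ 2 $ 1) = 1" using col[OF k] by simp
      then have "vabs (k $ 1 $ 1 / k $ 2 $ 1) \<le> 1" using col[OF k] by (simp add: vabs_divide)
      then obtain c where c: "c \<in> C" "vabs (k $ 1 $ 1 / k $ 2 $ 1 - rep c) < 1" using ex_rep unfolding C_def by blast
      have "k $ 2 $ 1 \<noteq> 0" using g1 by auto
      then have "k $ 1 $ 1 - rep c * k $ 2 $ 1 = (k $ 1 $ 1 / k $ 2 $ 1 - rep c) * k $ 2 $ 1" by (simp add: left_diff_distrib)
      then have "vabs (k $ 1 $ 1 - rep c * k $ 2 $ 1) < 1" using c(2) g1 by (simp add: vabs_mult)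
      then show ?thesis using k c(1) by (auto simp: cell_def)
    qed
  qed (auto simp: K0_def cell_def)
  have disj: "disjoint_family_on (\<lambda>c. cell (rep c)) C"
  proof (unfold disjoint_family_on_def, intro ballI impI, rule ccontr)
    fix c d assume c: "c \<in> C" and d: "d \<in> C" and ne: "c \<noteq> d" and "cell (rep c) \<inter> cell (rep d) \<noteq> {}"
    then obtain k where k: "k \<in> cell (rep c)" "k \<in> cell (rep d)" by blast
    have kG: "k \<in> GL2_val_ring" using k by (simp add: cell_def)
    have "k \<notin> K0" using k(1) K0_cell_disjoint[OF r[OF c]] by blast
    then have g1: "vabs (k $ 2 $ 1) = 1" using kG col(1)[OF kG] by (simp add: K0_def val_ideal_def)
    have "vabs ((k $ 1 $ 1 - rep d * k $ 2 $ 1) - (k $ 1 $ 1 - rep c * k $ 2 $ 1)) < 1"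
      using k by (intro le_less_trans[OF vabs_diff_le]) (simp add: cell_def)
    also have "(k $ 1 $ 1 - rep d * k $ 2 $ 1) - (k $ 1 $ 1 - rep c * k $ 2 $ 1) = (rep c - rep d) * k $ 2 $ 1" by (simp add: algebra_simps)
    finally have "vabs (rep c - rep d) < 1" using g1 by (simp add: vabs_mult)
    then show False using rep_inj c d ne by (auto simp: C_def)
  qed
  have fin: "finite C" using card_resid(2) by (simp add: C_def)
  have U: "(\<Union>c\<in>C. cell (rep c)) \<in> sets dk" using fin r cell_sets by (intro sets.finite_UN) auto
  have "1 = measure dk (K0 \<union> (\<Union>c\<in>C. cell (rep c)))" unfolding cover[symmetric] using prob_one by simp
  also have "\<dots> = measure dk K0 + measure dk (\<Union>c\<in>C. cell (rep c))"
    using K0_cell_disjoint r by (intro finite_measure_Union K0_sets U) blast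
  also have "measure dk (\<Union>c\<in>C. cell (rep c)) = (\<Sum>c\<in>C. measure dk (cell (rep c)))"
    using cell_sets r by (intro finite_measure_finite_Union fin disj) auto
  also have "\<dots> = (\<Sum>c\<in>C. measure dk K0)" using measure_cell r by (intro sum.cong) auto
  also have "\<dots> = q * measure dk K0" using card_resid(1) by (simp add: C_def q_def)
  finally have "measure dk K0 * (q + 1) = 1" by (simp add: algebra_simps)
  then show ?thesis using q_gt_1 by (simp add: eq_divide_eq)
qed

text \<open>If \<open>vabs (a - 1) = 1\<close>, the condition on \<open>k\<close> splits into
  membership in \<open>K0\<close> or in \<open>cell (- x)\<close>, whence the weight 2. If
  \<open>vabs (a - 1) < 1\<close>, the part \<open>(a - 1) * k $ 1 $ 1\<close> is negligible: every
  \<open>k\<close> qualifies when \<open>vabs ((a - 1) * x) < 1\<close>, and exactly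
  \<open>K0\<close> does on the boundary.\<close>

lemma Phi_n_average:
  assumes a: "a \<noteq> 0"
  shows "integrable dk (\<lambda>k. Phi_n (conj_unip a x k))"
    and "(LINT k|dk. Phi_n (conj_unip a x k)) = of_real (if vabs a = 1 \<and> vabs ((a - 1) * x) \<le> 1 then
      (if vabs (a - 1) = 1 then 2 / (q + 1) else if vabs ((a - 1) * x) < 1 then 1 else 1 / (q + 1)) else 0)"
proof -
  have goal: "integrable dk (\<lambda>k. Phi_n (conj_unip a x k)) \<and> (LINT k|dk. Phi_n (conj_unip a x k)) = of_real (measure dk E)"
    if E: "E \<in> sets dk" and e: "\<And>k. k \<in> GL2_val_ring \<Longrightarrow> Phi_n (conj_unip a x k) = (if k \<in> E then 1 else 0)" for E
  proof -
    have c: "Phi_n (conj_unip a x k) = of_real (indicator E k)" if "k \<in> space dk" for k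
      using e that by (auto simp: space_dk indicator_def)
    have i: "integrable dk (indicator E :: _ \<Rightarrow> real)" using E by (intro integrable_real_indicator) (auto simp: emeasure_eq_measure)
    have "integrable dk (\<lambda>k. complex_of_real (indicator E k))" using i by (rule integrable_of_real)
    moreover have "(LINT k|dk. complex_of_real (indicator E k)) = of_real (measure dk E)"
      using sets.sets_into_space[OF E] by (simp add: integral_complex_of_real Int_absorb2)
    ultimately show ?thesis
      using Bochner_Integration.integrable_cong[OF refl c, of dk] Bochner_Integration.integral_cong[OF refl c, of dk] by simp
  qed
  define I where "I = (if vabs a = 1 \<and> vabs ((a - 1) * x) \<le> 1 then
      (if vabs (a - 1) = 1 then 2 / (q + 1) else if vabs ((a - 1) * x) < 1 then 1 else 1 / (q + 1)) else 0)"
  have col: "vabs (k $ 2 $ 1) \<le> 1" "vabs (k $ 1 $ 1) \<le> 1" if "k \<in> GL2_val_ring" for k :: "'k^2^2"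
    using that by (simp_all add: GL2_iff mx_le_iff)
  have "\<exists>E. E \<in> sets dk \<and> measure dk E = I \<and> (\<forall>k\<in>GL2_val_ring. Phi_n (conj_unip a x k) = (if k \<in> E then 1 else 0))"
  proof (cases "vabs a = 1 \<and> vabs ((a - 1) * x) \<le> 1")
    case False
    then show ?thesis using Phi_n_conj[OF _ a] unfolding I_def by (intro exI[of _ "{}"]) auto
  next
    case True
    have P: "Phi_n (conj_unip a x k) = (if vabs (k $ 2 $ 1) * vabs (a - 1) * vabs (k $ 1 $ 1 + x * k $ 2 $ 1) < 1 then 1 else 0)"
      if "k \<in> GL2_val_ring" for k using Phi_n_conj[OF that a] True by simp
    have a1: "vabs (a - 1) \<le> 1" using vabs_diff_le[of a 1] True by simp
    show ?thesis
    proof (cases "vabs (a - 1) = 1")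
      case u: True
      have x: "vabs (- x) \<le> 1" using True u by (simp add: vabs_mult)
      have "measure dk (K0 \<union> cell (- x)) = measure dk K0 + measure dk (cell (- x))"
        using K0_cell_disjoint[OF x] by (intro finite_measure_Union K0_sets cell_sets x)
      then have "measure dk (K0 \<union> cell (- x)) = I" unfolding I_def measure_cell[OF x] measure_K0 using True u by simp
      moreover have "Phi_n (conj_unip a x k) = (if k \<in> K0 \<union> cell (- x) then 1 else 0)" if k: "k \<in> GL2_val_ring" for k
      proof -
        have le: "vabs (k $ 1 $ 1 + x * k $ 2 $ 1) \<le> 1"
          using vabs_add_le[of "k $ 1 $ 1" "x * k $ 2 $ 1"] col[OF k] x mult_le_one[of "vabs x" "vabs (k $ 2 $ 1)"] by (simp add: vabs_mult)
        have "g * h < 1 \<longleftrightarrow> g < 1 \<or> h < 1" if "0 \<le> g" "g \<le> 1" "0 \<le> h" "h \<le> 1" for g h :: real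
          using that mult_left_le_one_le[of h g] mult_left_le[of h g] by (cases "g = 1") auto
        then show ?thesis unfolding P[OF k] u using col(1)[OF k] le k by (simp add: K0_def val_ideal_def cell_def)
      qed
      ultimately show ?thesis using K0_sets cell_sets[OF x] by (intro exI[of _ "K0 \<union> cell (- x)"]) auto
    next
      case u: False
      then have lt: "vabs (a - 1) < 1" using a1 by simp
      have prod: "vabs (a - 1) * vabs (k $ 1 $ 1 + x * k $ 2 $ 1) = vabs ((a - 1) * k $ 1 $ 1 + (a - 1) * x * k $ 2 $ 1)" for k :: "'k^2^2"
        by (simp add: vabs_mult[symmetric] algebra_simps)
      have f1: "vabs ((a - 1) * k $ 1 $ 1) < 1" if "k \<in> GL2_val_ring" for k :: "'k^2^2"
        using lt col(2)[OF that] mult_left_le[of "vabs (k $ 1 $ 1)" "vabs (a - 1)"] unfolding vabs_mult by (meson le_less_trans vabs_nonneg)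
      show ?thesis
      proof (cases "vabs ((a - 1) * x) < 1")
        case s: True
        have "vabs (k $ 2 $ 1) * vabs (a - 1) * vabs (k $ 1 $ 1 + x * k $ 2 $ 1) < 1" if k: "k \<in> GL2_val_ring" for k :: "'k^2^2"
        proof -
          have "vabs ((a - 1) * x * k $ 2 $ 1) < 1"
            using s col(1)[OF k] mult_left_le[of "vabs (k $ 2 $ 1)" "vabs ((a - 1) * x)"] unfolding vabs_mult[of "(a - 1) * x"] by (meson le_less_trans vabs_nonneg)
          then have "vabs (a - 1) * vabs (k $ 1 $ 1 + x * k $ 2 $ 1) < 1"
            unfolding prod using f1[OF k] by (meson le_less_trans max_less_iff_conj vabs_add_le)
          then show ?thesis using col(1)[OF k] mult_left_le_one_le[of "vabs (a - 1) * vabs (k $ 1 $ 1 + x * k $ 2 $ 1)" "vabs (k $ 2 $ 1)"]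
            by (simp add: mult.assoc)
        qed
        then show ?thesis using P True u s prob_one sets.top[of dk] unfolding I_def by (intro exI[of _ "GL2_val_ring"]) (simp add: space_dk)
      next
        case s: False
        then have x1: "vabs ((a - 1) * x) = 1" using True by simp
        have "vabs (k $ 2 $ 1) * vabs (a - 1) * vabs (k $ 1 $ 1 + x * k $ 2 $ 1) < 1 \<longleftrightarrow> k \<in> K0" if k: "k \<in> GL2_val_ring" for k :: "'k^2^2"
        proof (cases "vabs (k $ 2 $ 1) < 1")
          case g: True
          have "vabs ((a - 1) * x * k $ 2 $ 1) < 1" using g by (simp add: vabs_mult[of "(a - 1) * x"] x1)
          then have "vabs (a - 1) * vabs (k $ 1 $ 1 + x * k $ 2 $ 1) < 1"
            unfolding prod using f1[OF k] by (meson le_less_trans max_less_iff_conj vabs_add_le)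
          then show ?thesis using g col(1)[OF k] k mult_left_le_one_le[of "vabs (a - 1) * vabs (k $ 1 $ 1 + x * k $ 2 $ 1)" "vabs (k $ 2 $ 1)"]
            by (simp add: mult.assoc K0_def val_ideal_def)
        next
          case g: False
          then have g1: "vabs (k $ 2 $ 1) = 1" using col(1)[OF k] by simp
          have "vabs ((a - 1) * x * k $ 2 $ 1) = 1" using g1 by (simp add: vabs_mult[of "(a - 1) * x"] x1)
          then have "vabs (a - 1) * vabs (k $ 1 $ 1 + x * k $ 2 $ 1) = 1" unfolding prod using f1[OF k] vabs_add_eq by metis
          then show ?thesis using g1 by (simp add: mult.assoc K0_def val_ideal_def)
        qed
        then show ?thesis using P True u s measure_K0 K0_sets unfolding I_def by (intro exI[of _ K0]) simp
      qed
    qed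
  qed
  then obtain E where "E \<in> sets dk" "measure dk E = I" "\<And>k. k \<in> GL2_val_ring \<Longrightarrow> Phi_n (conj_unip a x k) = (if k \<in> E then 1 else 0)" by blast
  then show "integrable dk (\<lambda>k. Phi_n (conj_unip a x k))" "(LINT k|dk. Phi_n (conj_unip a x k)) = of_real (if vabs a = 1 \<and> vabs ((a - 1) * x) \<le> 1 then
      (if vabs (a - 1) = 1 then 2 / (q + 1) else if vabs ((a - 1) * x) < 1 then 1 else 1 / (q + 1)) else 0)"
    using goal[of E] unfolding I_def by auto
qed

end

section \<open>Spherical functions and special functions at finite places\<close>

context local_field begin

text \<open>The roots of the recursion are \<open>alf z\<close> and \<open>alf (- z)\<close>, entire
  functions of \<open>z\<close> without zeros.\<close>

definition alf :: "complex \<Rightarrow> complex" where "alf w = of_real q powr ((w - 1) / 2)"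

lemma q_powr_ne0 [simp]: "complex_of_real q powr s \<noteq> 0" using q_gt_1 by simp

lemma alf_ne0 [simp]: "alf w \<noteq> 0" by (simp only: alf_def q_powr_ne0 not_False_eq_True)

lemma alf_mult: "alf w * alf (- w) = of_real (1 / q)"
proof -
  have "alf w * alf (- w) = of_real q powr (- 1)" unfolding alf_def powr_add[symmetric] by (simp add: field_simps)
  then show ?thesis using q_gt_1 by (simp add: powr_minus divide_inverse)
qed

lemma alf_mult_ne: "alf w * alf (- w) \<noteq> 0" "alf w * alf (- w) \<noteq> 1" "alf w * alf (- w) \<noteq> - 1"
proof -
  have "1 / q \<noteq> 0" "1 / q \<noteq> 1" "1 / q \<noteq> - 1" using q_gt_1 by (auto simp: field_simps)
  then show "alf w * alf (- w) \<noteq> 0" "alf w * alf (- w) \<noteq> 1" "alf w * alf (- w) \<noteq> - 1"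
    unfolding alf_mult by (metis of_real_0 of_real_1 of_real_minus of_real_eq_iff)+
qed

lemma isCont_alf: "isCont alf z" "isCont (\<lambda>w. alf (- w)) z"
  using q_gt_1 unfolding alf_def by (auto intro!: continuous_intros)

text \<open>The difference of the roots is entire and nonzero at 1, where it equals
  \<open>1 - 1 / q\<close>; so coincidences of the roots are isolated.\<close>

lemma eventually_alf: "\<forall>\<^sub>F w in at z. alf w \<noteq> alf (- w)"
proof -
  have h: "(\<lambda>w. alf w - alf (- w)) holomorphic_on UNIV"
    using q_gt_1 unfolding alf_def by (intro holomorphic_intros) auto
  have "alf 1 - alf (- 1) = 1 - of_real (1 / q)"
    using alf_mult[of 1] q_gt_1 by (simp add: alf_def)
  moreover have "1 / q \<noteq> 1" using q_gt_1 by simp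
  ultimately have "alf 1 - alf (- 1) \<noteq> 0" by (metis of_real_1 of_real_eq_iff right_minus_eq)
  then have "\<forall>\<^sub>F w in at z. alf w - alf (- w) \<noteq> 0 \<and> w \<in> UNIV"
    by (intro non_zero_neighbour_alt[OF h]) auto
  then show ?thesis by eventually_elim auto
qed

text \<open>A continuous expression that agrees with the given formula for distinct roots near
  \<open>z\<close> is its value with singularities removed.\<close>

lemma remove_sings_alf:
  assumes "isCont E z" "\<forall>\<^sub>F w in at z. alf w \<noteq> alf (- w) \<longrightarrow> R w = E w"
  shows "remove_sings R z = E z"
proof (rule remove_sings_eqI)
  have "\<forall>\<^sub>F w in at z. R w = E w" using eventually_alf assms(2) by eventually_elim auto
  then show "(R \<longlongrightarrow> E z) (at z)" using assms(1) by (simp add: isCont_def tendsto_cong)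
qed

lemma real_powr_mult:
  assumes "u > 0" "v > 0"
  shows "complex_of_real (u * v) powr t = of_real u powr t * of_real v powr t"
  using assms by (simp add: powr_def Ln_of_real ln_mult distrib_left exp_add flip: of_real_mult)

lemma real_powr_power:
  assumes "u > 0"
  shows "complex_of_real (u ^ n) powr t = (of_real u powr t) ^ n"
  using assms by (induction n) (auto simp: real_powr_mult simp del: of_real_mult of_real_power)

lemma zeta_eq: "zeta_fin (qv TYPE('k)) s = 1 / (1 - of_real q powr (- s))"
  by (simp add: zeta_fin_def q_def)

text \<open>The local zeta factors become rational functions of the roots and of
  \<open>of_real q powr (- s)\<close>. Writing \<open>1 / q\<close> as the product of the roots
  matches the coefficients of the recursion.\<close>

lemma zeta_alf:
  defines "\<zeta> \<equiv> zeta_fin (qv TYPE('k))"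
  shows "\<zeta> 1 = 1 / (1 - alf w * alf (- w))"
    and "\<zeta> (- w) = alf (- w) / (alf (- w) - alf w)" and "\<zeta> w = alf w / (alf w - alf (- w))"
    and "\<zeta> ((1 - w) / 2) = 1 / (1 - alf w)" and "\<zeta> ((1 + w) / 2) = 1 / (1 - alf (- w))"
    and "\<zeta> (s + (w + 1) / 2) = 1 / (1 - alf (- w) * of_real q powr (- s))"
    and "\<zeta> (s + (- w + 1) / 2) = 1 / (1 - alf w * of_real q powr (- s))"
    and "\<zeta> (s + 1) = 1 / (1 - alf w * alf (- w) * of_real q powr (- s))"
proof -
  have q1: "complex_of_real q powr (- 1) = of_real (1 / q)" using q_gt_1 by (simp add: powr_minus divide_inverse)
  show "\<zeta> 1 = 1 / (1 - alf w * alf (- w))" unfolding \<zeta>_def zeta_eq alf_mult q1 ..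
  have r: "of_real q powr w = alf w / alf (- w)" for w
  proof -
    have "of_real q powr w = of_real q powr ((w - 1) / 2 - (- w - 1) / 2)" by (simp add: field_simps)
    then show ?thesis by (simp only: powr_diff alf_def)
  qed
  have z: "\<zeta> (- w) = alf (- w) / (alf (- w) - alf w)" for w
  proof -
    have "1 - of_real q powr w = (alf (- w) - alf w) / alf (- w)" unfolding r by (simp add: diff_divide_distrib)
    then show ?thesis unfolding \<zeta>_def zeta_eq by simp
  qed
  show "\<zeta> (- w) = alf (- w) / (alf (- w) - alf w)" by (rule z)
  show "\<zeta> w = alf w / (alf w - alf (- w))" using z[of "- w"] by simp
  have e: "- ((1 - w) / 2) = (w - 1) / 2" "- ((1 + w) / 2) = (- w - 1) / 2" "- (s + (w + 1) / 2) = (- w - 1) / 2 + - s"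
    "- (s + (- w + 1) / 2) = (w - 1) / 2 + - s" "- (s + 1) = - 1 + - s" by (simp_all add: field_simps)
  show "\<zeta> ((1 - w) / 2) = 1 / (1 - alf w)" "\<zeta> ((1 + w) / 2) = 1 / (1 - alf (- w))"
    "\<zeta> (s + (w + 1) / 2) = 1 / (1 - alf (- w) * of_real q powr (- s))"
    "\<zeta> (s + (- w + 1) / 2) = 1 / (1 - alf w * of_real q powr (- s))"
    "\<zeta> (s + 1) = 1 / (1 - alf w * alf (- w) * of_real q powr (- s))"
    unfolding \<zeta>_def zeta_eq e powr_add alf_mult q1 by (simp_all only: alf_def)
qed

abbreviation mac :: "complex \<Rightarrow> nat \<Rightarrow> complex" where "mac z \<equiv> macd (alf z) (alf (- z))"

lemma isCont_mac: "isCont (\<lambda>w. mac w n) z"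
  by (rule isCont_macd[OF isCont_alf alf_mult_ne(2)])

text \<open>At level \<open>n\<close> the factor \<open>h_fin w\<close> is the \<open>n\<close>-th
  power of \<open>alf (- w)\<close>, and the zeta factors supply the coefficients of
  \<open>macd_closed\<close>.\<close>

lemma phi_fin_eq: "phi_fin z x = mac z (lvl x)"
proof -
  define n where "n = lvl x"
  have h: "h_fin w x = alf (- w) ^ n" "h_fin (- w) x = alf w ^ n" for w
  proof -
    have hh: "h_fin w x = alf (- w) ^ n" for w
    proof -
      have "- (w + 1) / 2 = (- w - 1) / 2" by (simp add: field_simps)
      then show ?thesis using q_gt_1 unfolding h_fin_def lvl n_def[symmetric] alf_def by (simp only: real_powr_power)
    qed
    show "h_fin w x = alf (- w) ^ n" "h_fin (- w) x = alf w ^ n" using hh[of w] hh[of "- w"] by simp_all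
  qed
  show ?thesis unfolding phi_fin_def n_def[symmetric]
  proof (rule remove_sings_alf[OF isCont_mac], intro always_eventually allI impI)
    fix w assume ne: "alf w \<noteq> alf (- w)"
    define a b where "a = alf w" and "b = alf (- w)"
    define D W where "D = a - b" and "W = 1 - a * b"
    have D: "D \<noteq> 0" "b - a = - D" using ne by (auto simp: a_def b_def D_def)
    have A: "A_coeff (zeta_fin (qv TYPE('k))) w = 1 / W * (b / (b - a)) * (1 - a)\<^sup>2"
      unfolding A_coeff_def zeta_alf(1)[of w] zeta_alf(2,4)[of w] a_def b_def W_def by (simp add: power_divide)
    have B: "A_coeff (zeta_fin (qv TYPE('k))) (- w) = 1 / W * (a / (a - b)) * (1 - b)\<^sup>2"
      using zeta_alf(1)[of w] zeta_alf(3,5)[of w] unfolding A_coeff_def a_def b_def W_def by (simp add: power_divide)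
    have "mac w n = ((1 - b)\<^sup>2 * a ^ Suc n - (1 - a)\<^sup>2 * b ^ Suc n) / (D * W)"
      unfolding a_def b_def D_def W_def by (rule macd_closed[OF ne alf_mult_ne(2)])
    also have "\<dots> = 1 / W * (b / (b - a)) * (1 - a)\<^sup>2 * b ^ n + 1 / W * (a / (a - b)) * (1 - b)\<^sup>2 * a ^ n"
      unfolding D(2) D_def[symmetric] by (simp add: diff_divide_distrib mult_ac)
    finally show "A_coeff (zeta_fin (qv TYPE('k))) w * h_fin w x + A_coeff (zeta_fin (qv TYPE('k))) (- w) * h_fin (- w) x = mac w n"
      unfolding A B h by (simp flip: a_def b_def)
  qed
qed

text \<open>The even power \<open>q ^ (2 * N)\<close> compensates half of the denominator 4, so
  whole powers of the inverse roots appear.\<close>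

lemma powr_quarter:
  "complex_of_real (q ^ (2 * N)) powr ((- w + 1) / 4) = inverse (alf w) ^ N"
  "complex_of_real (q ^ (2 * N)) powr ((w + 1) / 4) = inverse (alf (- w)) ^ N"
proof -
  have p: "complex_of_real (q ^ (2 * N)) powr ((- w + 1) / 4) = inverse (alf w) ^ N" for w
  proof -
    have "(of_real q powr ((- w + 1) / 4)) ^ 2 = of_real q powr ((- w + 1) / 4 + (- w + 1) / 4)"
      by (simp only: power2_eq_square powr_add)
    also have "(- w + 1) / 4 + (- w + 1) / 4 = - ((w - 1) / 2)" by (simp add: field_simps)
    finally have "(of_real q powr ((- w + 1) / 4)) ^ 2 = inverse (alf w)" by (simp only: powr_minus alf_def)
    moreover have "complex_of_real (q ^ (2 * N)) powr ((- w + 1) / 4) = (of_real q powr ((- w + 1) / 4)) ^ (2 * N)"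
      using q_gt_1 by (intro real_powr_power) simp
    ultimately show ?thesis by (simp only: power_mult)
  qed
  show "complex_of_real (q ^ (2 * N)) powr ((- w + 1) / 4) = inverse (alf w) ^ N" by (rule p)
  show "complex_of_real (q ^ (2 * N)) powr ((w + 1) / 4) = inverse (alf (- w)) ^ N" using p[of "- w"] by simp
qed

lemma isCont_shell_sum:
  assumes "finite A"
  shows "isCont (\<lambda>w. \<Sum>k\<in>A. shell_mass (alf w * alf (- w)) k * mac w k) z"
  by (intro continuous_intros isCont_mac isCont_shell_mass isCont_alf alf_mult_ne)

text \<open>For distinct roots the two terms of \<open>O1\<close> are those of
  \<open>sum_macd\<close> and, with the extra factor, of \<open>sum_macd_boundary\<close>; the level
  sums extend them continuously.\<close>

lemma O1_eq:
  fixes b :: 'k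
  assumes b: "vabs b = q ^ (2 * N)"
  shows "O1 0 z b = (\<Sum>k\<le>N. shell_mass (alf z * alf (- z)) k * mac z k)"
    and "O1 1 z b = (if N = 0 then of_real (2 / (q + 1)) else (\<Sum>k<N. shell_mass (alf z * alf (- z)) k * mac z k)
       + alf z * alf (- z) / (1 + alf z * alf (- z)) * (shell_mass (alf z * alf (- z)) N * mac z N))"
proof -
  have e: "(- w + 1) / 2 = (1 - w) / 2" "(w + 1) / 2 = (1 + w) / 2" for w :: complex by simp_all
  have R: "zeta_fin (qv TYPE('k)) (- w) / zeta_fin (qv TYPE('k)) ((- w + 1) / 2) * F * complex_of_real (vabs b) powr ((- w + 1) / 4)
    + zeta_fin (qv TYPE('k)) w / zeta_fin (qv TYPE('k)) ((w + 1) / 2) * G * complex_of_real (vabs b) powr ((w + 1) / 4)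
    = alf (- w) * (1 - alf w) / (alf (- w) - alf w) * F * inverse (alf w) ^ N + alf w * (1 - alf (- w)) / (alf w - alf (- w)) * G * inverse (alf (- w)) ^ N" for w F G
    unfolding b powr_quarter unfolding e(1)[of w] e(2)[of w] zeta_alf(4,5)[of w] zeta_alf(2,3)[of w] by simp
  show "O1 0 z b = (\<Sum>k\<le>N. shell_mass (alf z * alf (- z)) k * mac z k)"
    unfolding O1_def Let_def R
    by (rule remove_sings_alf[OF isCont_shell_sum]) (auto intro!: always_eventually simp: sum_macd alf_mult_ne)
  \<comment> \<open>At \<open>N = 0\<close> the boundary sum would be \<open>1 / (q + 1)\<close>,
    half the required value. This is the case in which both \<open>K0\<close> and one more cell
    contribute, and it is verified separately.\<close>
  define E where "E w = (if N = 0 then of_real (2 / (q + 1)) else (\<Sum>k<N. shell_mass (alf w * alf (- w)) k * mac w k)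
       + alf w * alf (- w) / (1 + alf w * alf (- w)) * (shell_mass (alf w * alf (- w)) N * mac w N))" for w
  have nz: "1 + alf w * alf (- w) \<noteq> 0" for w using alf_mult_ne(3)[of w] by (metis add_eq_0_iff minus_minus)
  have "isCont E z"
    unfolding E_def using isCont_shell_sum[of "{..<N}" z] nz[of z] alf_mult_ne[of z]
    by (cases "N = 0") (auto intro!: continuous_intros isCont_mac isCont_shell_mass isCont_alf)
  moreover have "alf (- w) * (1 - alf w) / (alf (- w) - alf w) * ((1 + of_real q powr ((w + 1) / 2)) / (1 + of_real q)) ^ 1 * inverse (alf w) ^ N
      + alf w * (1 - alf (- w)) / (alf w - alf (- w)) * ((1 + of_real q powr ((- w + 1) / 2)) / (1 + of_real q)) ^ 1 * inverse (alf (- w)) ^ N = E w"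
    if ne: "alf w \<noteq> alf (- w)" for w
  proof -
    define a b where "a = alf w" and "b = alf (- w)"
    have a0: "a \<noteq> 0" "b \<noteq> 0" by (simp_all add: a_def b_def)
    have ab: "a \<noteq> b" "a * b \<noteq> 1" "a * b \<noteq> - 1" "1 + a * b \<noteq> 0" using ne alf_mult_ne nz unfolding a_def b_def by auto
    have "a * b = of_real (1 / q)" unfolding a_def b_def by (rule alf_mult)
    then have Q: "complex_of_real q = inverse (a * b)" by (simp add: divide_inverse)
    have e1: "(w + 1) / 2 = - ((- w - 1) / 2)" "(- w + 1) / 2 = - ((w - 1) / 2)" by (simp_all add: field_simps)
    have f1: "of_real q powr ((w + 1) / 2) = inverse b" unfolding e1 powr_minus b_def alf_def ..
    have f2: "of_real q powr ((- w + 1) / 2) = inverse a" unfolding e1 powr_minus a_def alf_def ..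
    have V: "1 + inverse (a * b) = (1 + a * b) / (a * b)" using a0 by (simp add: field_simps)
    \<comment> \<open>With \<open>q = 1 / (a * b)\<close> the extra factor of \<open>O1 1\<close>
      becomes the boundary factor of \<open>sum_macd_boundary\<close>.\<close>
    have g: "(1 + inverse b) / (1 + of_real q) = a * (1 + b) / (1 + a * b)" "(1 + inverse a) / (1 + of_real q) = b * (1 + a) / (1 + a * b)"
    proof -
      have i: "1 + inverse b = (1 + b) / b" "1 + inverse a = (1 + a) / a" using a0 by (simp_all add: field_simps)
      have c: "(1 + u) / u / (V / (t * u)) = t * (1 + u) / V" if "u \<noteq> 0" for t u V :: complex
      proof -
        have "(1 + u) / u / (V / (t * u)) = ((1 + u) * (t * u / u)) / V"
          by (simp only: divide_divide_eq_right times_divide_eq_left times_divide_eq_right)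
        also have "t * u / u = t" using that by simp
        finally show ?thesis by (simp only: mult.commute)
      qed
      show "(1 + inverse b) / (1 + of_real q) = a * (1 + b) / (1 + a * b)" unfolding Q V i by (rule c[OF a0(2)])
      show "(1 + inverse a) / (1 + of_real q) = b * (1 + a) / (1 + a * b)" unfolding Q V i(2) unfolding mult.commute[of a b] by (rule c[OF a0(1)])
    qed
    show ?thesis
    proof (cases "N = 0")
      case True
      have "E w = 2 / (1 + of_real q)" using True by (simp add: E_def add.commute)
      also have "\<dots> = 2 * (a * b) / (1 + a * b)" unfolding Q V by (simp only: divide_divide_eq_right)
      also have "\<dots> = (2 * (a * b)) * (a - b) / ((a - b) * (1 + a * b))" using ab by simp
      also have "(2 * (a * b)) * (a - b) = a * (1 - b) * (b * (1 + a)) - b * (1 - a) * (a * (1 + b))" by (simp add: algebra_simps)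
      also have "(a * (1 - b) * (b * (1 + a)) - b * (1 - a) * (a * (1 + b))) / ((a - b) * (1 + a * b))
        = b * (1 - a) / (- (a - b)) * (a * (1 + b) / (1 + a * b)) + a * (1 - b) / (a - b) * (b * (1 + a) / (1 + a * b))"
        by (simp only: diff_divide_distrib times_divide_times_eq) (simp add: minus_divide_left[symmetric] minus_divide_right[symmetric] del: minus_diff_eq)
      finally show ?thesis unfolding a_def[symmetric] b_def[symmetric] f1 f2 power_one_right g using True by simp
    next
      case False
      then have "E w = b * (1 - a) / (b - a) * (a * (1 + b) / (1 + a * b)) * inverse a ^ N + a * (1 - b) / (a - b) * (b * (1 + a) / (1 + a * b)) * inverse b ^ N"
        using sum_macd_boundary[OF a0 ab(1-3), of N] by (simp add: E_def a_def b_def)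
      then show ?thesis unfolding a_def[symmetric] b_def[symmetric] f1 f2 power_one_right g by simp
    qed
  qed
  ultimately have "O1 1 z b = E z"
    unfolding O1_def Let_def R q_def[symmetric] by (intro remove_sings_alf) (auto intro!: always_eventually)
  then show "O1 1 z b = (if N = 0 then of_real (2 / (q + 1)) else (\<Sum>k<N. shell_mass (alf z * alf (- z)) k * mac z k)
       + alf z * alf (- z) / (1 + alf z * alf (- z)) * (shell_mass (alf z * alf (- z)) N * mac z N))" unfolding E_def .
qed

text \<open>Both tail ratios have real exponents \<open>(Re z - 1) / 2 - Re s\<close> and
  \<open>(- Re z - 1) / 2 - Re s\<close>; the hypothesis says that both are negative.\<close>

lemma norm_alf_lt_1:
  assumes "2 * Re s + 1 > \<bar>Re z\<bar>"
  shows "norm (alf z * of_real q powr (- s)) < 1" "norm (alf (- z) * of_real q powr (- s)) < 1" "norm (of_real q powr (- (s + 1))) < 1"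
proof -
  have n: "norm (complex_of_real q powr t) < 1" if "Re t < 0" for t
  proof -
    have "norm (complex_of_real q powr t) = exp (Re t * ln q)" using q_gt_1 by (subst norm_powr_real) auto
    then show ?thesis using that q_gt_1 by (simp add: mult_neg_pos)
  qed
  show "norm (alf z * of_real q powr (- s)) < 1" "norm (alf (- z) * of_real q powr (- s)) < 1" "norm (of_real q powr (- (s + 1))) < 1"
    unfolding alf_def powr_add[symmetric] using assms by (auto intro!: n)
qed

text \<open>The two branches of \<open>S1\<close> are the total sum over all levels with
  \<open>N = 0\<close> and with positive \<open>N\<close>, times the normalising constant
  \<open>c\<close> of \<open>Phi_S\<close>.\<close>

lemma S1_eq:
  fixes b :: 'k
  assumes s: "2 * Re s + 1 > \<bar>Re z\<bar>"
  defines "X \<equiv> of_real q powr (- s)"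
  defines "c \<equiv> inverse (of_real q powr (- (s + 1) / 2) - of_real q powr ((s + 1) / 2))"
  shows "vabs b \<le> 1 \<Longrightarrow> S1 z s b = c * of_real (vabs b) powr ((s + 1) / 2) * macd_total 0 X (alf z) (alf (- z))"
    and "vabs b = q ^ (2 * N) \<Longrightarrow> N \<ge> 1 \<Longrightarrow> S1 z s b = c * macd_total N X (alf z) (alf (- z))"
proof -
  note lt = norm_alf_lt_1[OF s, folded X_def]
  have nz: "alf z * X \<noteq> 1" "alf (- z) * X \<noteq> 1" using lt by auto
  define h where "h = complex_of_real q powr ((s + 1) / 2)"
  have h0: "h \<noteq> 0" by (simp only: h_def q_powr_ne0 not_False_eq_True)
  have hm: "complex_of_real q powr (- (s + 1) / 2) = inverse h" unfolding h_def by (simp only: minus_divide_left[symmetric] powr_minus)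
  have s2: "(s + 1) / 2 + (s + 1) / 2 = s + 1" by simp
  \<comment> \<open>The decay ratio of the test function from one level to the next, since
    \<open>alf w * alf (- w)\<close> is \<open>1 / q\<close> and \<open>h * h\<close> is
    \<open>q\<close> to the power \<open>s + 1\<close>.\<close>
  have y: "alf w * alf (- w) * X = inverse (h * h)" for w
  proof -
    have "h * h = of_real q powr (s + 1)" unfolding h_def powr_add[symmetric] by (simp only: s2)
    moreover have "- 1 + - s = - (s + 1)" by simp
    ultimately have "inverse (h * h) = of_real q powr (- 1 + - s)" by (simp only: powr_minus)
    also have "\<dots> = alf w * alf (- w) * X" unfolding powr_add X_def alf_mult using q_gt_1 by (simp add: powr_minus divide_inverse)
    finally show ?thesis ..
  qed
  have "h * h \<noteq> 1"
  proof
    assume "h * h = 1"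
    moreover have "of_real q powr (- (s + 1)) = inverse (h * h)" unfolding h_def powr_add[symmetric] powr_minus s2 ..
    ultimately show False using lt(3) by simp
  qed
  \<comment> \<open>One factor \<open>1 - inverse (h * h)\<close> of the total cancels against the
    normalisation and leaves the sign and the power in front of \<open>S1\<close>.\<close>
  then have ch: "c * (1 - inverse (h * h)) = - inverse h"
  proof -
    assume 1: "h * h \<noteq> 1"
    have "inverse h - h = (1 - h * h) / h" "1 - inverse (h * h) = - (1 - h * h) / (h * h)" using h0 by (simp_all add: field_simps)
    then show ?thesis unfolding c_def hm h_def[symmetric] using 1 h0 by (simp add: field_simps)
  qed
  show "S1 z s b = c * of_real (vabs b) powr ((s + 1) / 2) * macd_total 0 X (alf z) (alf (- z))" if b: "vabs b \<le> 1"
  proof -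
    define P where "P = (1 - alf z * X) * (1 - alf (- z) * X)"
    have "c * macd_total 0 X (alf z) (alf (- z)) = (c * (1 - inverse (h * h))) * ((1 - inverse (h * h)) / P)"
      unfolding macd_total_0[OF alf_mult_ne(2) nz] y P_def power2_eq_square by simp
    then have t: "c * macd_total 0 X (alf z) (alf (- z)) = - inverse h * ((1 - inverse (h * h)) / P)" unfolding ch .
    have "S1 z s b = - inverse h * ((1 - inverse (h * h)) / P) * of_real (vabs b) powr ((s + 1) / 2)"
      unfolding S1_def Let_def zeta_alf(6,7)[of s z] zeta_alf(8)[of s z] X_def[symmetric] y q_def[symmetric] hm P_def using b by (simp add: mult.commute)
    then show ?thesis unfolding t[symmetric] by (simp only: mult_ac)
  qed
  show "S1 z s b = c * macd_total N X (alf z) (alf (- z))" if b: "vabs b = q ^ (2 * N)" and N: "N \<ge> 1"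
  proof -
    define E where "E w = macd_total N X (alf w) (alf (- w)) / (1 - inverse (h * h))" for w
    have h1: "1 - inverse (h * h) \<noteq> 0" using \<open>h * h \<noteq> 1\<close> by (metis inverse_1 inverse_inverse_eq right_minus_eq)
    have cont: "isCont E z" unfolding E_def macd_total_def
      using isCont_shell_sum[of "{..N}" z] nz h1 alf_mult_ne[of z] by (auto intro!: continuous_intros isCont_mac isCont_alf)
    have ev: "\<forall>\<^sub>F w in at z. alf w * X \<noteq> 1 \<and> alf (- w) * X \<noteq> 1"
    proof (intro eventually_conj)
      have "((\<lambda>w. alf w * X) \<longlongrightarrow> alf z * X) (at z)" "((\<lambda>w. alf (- w) * X) \<longlongrightarrow> alf (- z) * X) (at z)"
        using isCont_alf[of z] unfolding isCont_def by (auto intro!: tendsto_intros)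
      then show "\<forall>\<^sub>F w in at z. alf w * X \<noteq> 1" "\<forall>\<^sub>F w in at z. alf (- w) * X \<noteq> 1"
        using nz tendsto_imp_eventually_ne by blast+
    qed
    have e: "(- w + 1) / 2 = (1 - w) / 2" "(w + 1) / 2 = (1 + w) / 2" for w :: complex by simp_all
    have ev2: "\<forall>\<^sub>F w in at z. alf w \<noteq> alf (- w) \<longrightarrow>
       zeta_fin (qv TYPE('k)) (- w) * zeta_fin (qv TYPE('k)) (s + (w + 1) / 2) / zeta_fin (qv TYPE('k)) ((- w + 1) / 2) * complex_of_real (vabs b) powr ((- w + 1) / 4)
     + zeta_fin (qv TYPE('k)) w * zeta_fin (qv TYPE('k)) (s + (- w + 1) / 2) / zeta_fin (qv TYPE('k)) ((w + 1) / 2) * complex_of_real (vabs b) powr ((w + 1) / 4) = E w"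
      using ev
    proof eventually_elim
      case (elim w)
      show ?case
      proof
        assume ne: "alf w \<noteq> alf (- w)"
        have "E w = alf (- w) * (1 - alf w) / ((alf (- w) - alf w) * (1 - alf (- w) * X)) * inverse (alf w) ^ N
          + alf w * (1 - alf (- w)) / ((alf w - alf (- w)) * (1 - alf w * X)) * inverse (alf (- w)) ^ N"
          unfolding E_def using macd_total_closed[OF alf_ne0 alf_ne0 ne alf_mult_ne(2), of X N] elim h1 unfolding y by simp
        then show "zeta_fin (qv TYPE('k)) (- w) * zeta_fin (qv TYPE('k)) (s + (w + 1) / 2) / zeta_fin (qv TYPE('k)) ((- w + 1) / 2) * complex_of_real (vabs b) powr ((- w + 1) / 4)
     + zeta_fin (qv TYPE('k)) w * zeta_fin (qv TYPE('k)) (s + (- w + 1) / 2) / zeta_fin (qv TYPE('k)) ((w + 1) / 2) * complex_of_real (vabs b) powr ((w + 1) / 4) = E w"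
          unfolding b powr_quarter zeta_alf(6,7)[of s w] X_def[symmetric] unfolding e(1)[of w] e(2)[of w] zeta_alf(4,5)[of w] zeta_alf(2,3)[of w] by simp
      qed
    qed
    have "vabs b > 1" unfolding b using q_gt_1 N by (intro one_less_power) auto
    then have "S1 z s b = - inverse h * E z"
      unfolding S1_def Let_def remove_sings_alf[OF cont ev2] using hm by (simp add: q_def)
    also have "\<dots> = c * macd_total N X (alf z) (alf (- z))" unfolding ch[symmetric] E_def using h1 by simp
    finally show ?thesis .
  qed
qed

end

section \<open>The orbital integrals at finite places\<close>

locale local_place = local_field_haar \<pi> q dx + local_field_group \<pi> q dk
  for \<pi> :: "'k::{field_char_0,metric_space}" and q and dx and dk
begin

lemma mass_eq: "of_real (mass n) = shell_mass (alf z * alf (- z)) n"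
proof -
  have "mass n = (if n = 0 then 1 else (1 - 1 / q) / (1 / q) ^ n)" by (simp add: mass_def power_divide)
  then show ?thesis unfolding alf_mult shell_mass_def by (simp only: if_distrib[of of_real] of_real_divide of_real_diff of_real_power of_real_1)
qed

lemma frakF_radial:
  assumes av: "\<And>x. integrable dk (\<lambda>k. \<Phi> (conj_unip a x k))" "\<And>x. (LINT k|dk. \<Phi> (conj_unip a x k)) = g (lvl x)"
    and sm: "summable (\<lambda>n. norm (shell_mass (alf z * alf (- z)) n * (g n * mac z n)))"
  shows "frakF_converges dk dx \<Phi> (phi_fin z) a"
    and "frakF dk dx \<Phi> (phi_fin z) a = of_real vol * (\<Sum>n. shell_mass (alf z * alf (- z)) n * (g n * mac z n))"
  using radial_integral[of "\<lambda>n. g n * mac z n", unfolded mass_eq[of _ z], OF sm] av(1)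
  unfolding frakF_converges_def frakF_def av(2) phi_fin_eq by auto

lemma frakF_radial_finite:
  assumes av: "\<And>x. integrable dk (\<lambda>k. \<Phi> (conj_unip a x k))" "\<And>x. (LINT k|dk. \<Phi> (conj_unip a x k)) = (if lvl x \<le> N then g (lvl x) else 0)"
  shows "frakF_converges dk dx \<Phi> (phi_fin z) a"
    and "frakF dk dx \<Phi> (phi_fin z) a = of_real vol * (\<Sum>n\<le>N. shell_mass (alf z * alf (- z)) n * (g n * mac z n))"
proof -
  define G where "G n = (if n \<le> N then g n else 0)" for n
  have av2: "(LINT k|dk. \<Phi> (conj_unip a x k)) = G (lvl x)" for x by (simp add: av(2) G_def)
  have sm: "summable (\<lambda>n. norm (shell_mass (alf z * alf (- z)) n * (G n * mac z n)))"
    by (rule summable_finite[of "{..N}"]) (auto simp: G_def)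
  show "frakF_converges dk dx \<Phi> (phi_fin z) a" by (rule frakF_radial(1)[OF av(1) av2 sm])
  have "(\<Sum>n. shell_mass (alf z * alf (- z)) n * (G n * mac z n)) = (\<Sum>n\<le>N. shell_mass (alf z * alf (- z)) n * (G n * mac z n))"
    by (rule suminf_finite) (auto simp: G_def)
  also have "\<dots> = (\<Sum>n\<le>N. shell_mass (alf z * alf (- z)) n * (g n * mac z n))"
    by (rule sum.cong) (auto simp: G_def)
  finally show "frakF dk dx \<Phi> (phi_fin z) a = of_real vol * (\<Sum>n\<le>N. shell_mass (alf z * alf (- z)) n * (g n * mac z n))"
    unfolding frakF_radial(2)[OF av(1) av2 sm] by simp
qed

lemma lvl_lt_iff: "N \<ge> 1 \<Longrightarrow> lvl x < N \<longleftrightarrow> vabs x < q ^ N"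
proof -
  assume "N \<ge> 1"
  then have "q ^ N > 1" using q_gt_1 by (intro one_less_power) auto
  moreover have "lvl x < N \<longleftrightarrow> q ^ lvl x < q ^ N" using q_gt_1 by simp
  ultimately show ?thesis unfolding lvl[symmetric] by simp
qed

text \<open>For a unit \<open>a\<close> one number \<open>N\<close> controls everything: it is the
  last level in the support of the averaged test function and half the exponent of the absolute
  value of \<open>a / (a - 1)^2\<close>.\<close>

lemma unit_level:
  assumes "vabs a = 1" "a \<noteq> 1"
  obtains N where "vabs (a - 1) = 1 / q ^ N" "vabs (inverse ((a - 1) ^ 2) * a) = q ^ (2 * N)"
    "\<And>x. vabs ((a - 1) * x) \<le> 1 \<longleftrightarrow> lvl x \<le> N" "\<And>x. N \<ge> 1 \<Longrightarrow> vabs ((a - 1) * x) < 1 \<longleftrightarrow> lvl x < N"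
    "vabs (a - 1) = 1 \<longleftrightarrow> N = 0"
proof -
  have "vabs (a - 1) \<le> 1" using vabs_diff_le[of a 1] assms by simp
  then obtain N where N: "vabs (a - 1) = 1 / q ^ N" using vabs_le_1_cases[of "a - 1"] assms by auto
  have qN: "q ^ N > 0" using q_gt_1 by simp
  have "vabs (inverse ((a - 1) ^ 2) * a) = q ^ (2 * N)"
    using assms qN by (simp add: vabs_mult vabs_inverse vabs_power N power_divide power_mult mult.commute[of 2])
  moreover have "vabs ((a - 1) * x) \<le> 1 \<longleftrightarrow> lvl x \<le> N" for x using qN by (simp add: vabs_mult N lvl_le_iff)
  moreover have "vabs ((a - 1) * x) < 1 \<longleftrightarrow> lvl x < N" if "N \<ge> 1" for x using qN by (simp add: vabs_mult N lvl_lt_iff[OF that])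
  moreover have "vabs (a - 1) = 1 \<longleftrightarrow> N = 0"
  proof (cases "N = 0")
    case False
    then have "q ^ N > 1" using q_gt_1 by (intro one_less_power) auto
    then show ?thesis using False by (simp add: N)
  qed (simp add: N)
  ultimately show thesis using that[of N] N by blast
qed

lemma frakF_unram:
  assumes a: "a \<noteq> 0" "a \<noteq> 1"
  shows "frakF_converges dk dx Phi_unram (phi_fin z) a"
    and "frakF dk dx Phi_unram (phi_fin z) a = (if vabs a = 1 then 1 else 0) * of_real vol * O1 0 z (inverse ((a - 1) ^ 2) * a)"
    and "vabs a = 1 \<Longrightarrow> vabs (a - 1) = 1 \<Longrightarrow> frakF dk dx Phi_unram (phi_fin z) a = of_real vol"
proof -
  have av: "integrable dk (\<lambda>k. Phi_unram (conj_unip a x k))"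
    "(LINT k|dk. Phi_unram (conj_unip a x k)) = (if vabs a = 1 \<and> vabs ((a - 1) * x) \<le> 1 then 1 else 0)" for x
    using integral_const_on[OF Phi_unram_conj[OF _ a(1)]] by auto
  have "frakF_converges dk dx Phi_unram (phi_fin z) a \<and>
    frakF dk dx Phi_unram (phi_fin z) a = (if vabs a = 1 then 1 else 0) * of_real vol * O1 0 z (inverse ((a - 1) ^ 2) * a) \<and>
    (vabs a = 1 \<and> vabs (a - 1) = 1 \<longrightarrow> frakF dk dx Phi_unram (phi_fin z) a = of_real vol)"
  proof (cases "vabs a = 1")
    case False
    then show ?thesis using av by (simp add: frakF_converges_def frakF_def)
  next
    case True
    obtain N where N: "vabs (inverse ((a - 1) ^ 2) * a) = q ^ (2 * N)" "\<And>x. vabs ((a - 1) * x) \<le> 1 \<longleftrightarrow> lvl x \<le> N" "vabs (a - 1) = 1 \<longleftrightarrow> N = 0"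
      using unit_level[OF True a(2)] by metis
    have av2: "(LINT k|dk. Phi_unram (conj_unip a x k)) = (if lvl x \<le> N then 1 else 0)" for x using av(2) True N(2) by simp
    show ?thesis using frakF_radial_finite[where g = "\<lambda>_. 1", OF av(1) av2, of z] O1_eq(1)[OF N(1), of z] True N(3)
      by (auto simp: shell_mass_def)
  qed
  then show "frakF_converges dk dx Phi_unram (phi_fin z) a"
    "frakF dk dx Phi_unram (phi_fin z) a = (if vabs a = 1 then 1 else 0) * of_real vol * O1 0 z (inverse ((a - 1) ^ 2) * a)"
    "vabs a = 1 \<Longrightarrow> vabs (a - 1) = 1 \<Longrightarrow> frakF dk dx Phi_unram (phi_fin z) a = of_real vol" by blast+
qed

text \<open>The averages of \<open>Phi_n_average\<close> are the weights 1 below level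
  \<open>N\<close> and \<open>1 / (q + 1)\<close> at level \<open>N\<close>, as in the boundary form
  of \<open>O1_eq\<close>.\<close>

lemma frakF_n:
  assumes a: "a \<noteq> 0" "a \<noteq> 1"
  shows "frakF_converges dk dx Phi_n (phi_fin z) a"
    and "frakF dk dx Phi_n (phi_fin z) a = (if vabs a = 1 then 1 else 0) * of_real vol * O1 1 z (inverse ((a - 1) ^ 2) * a)"
proof -
  note av = Phi_n_average[OF a(1)]
  have "frakF_converges dk dx Phi_n (phi_fin z) a \<and>
    frakF dk dx Phi_n (phi_fin z) a = (if vabs a = 1 then 1 else 0) * of_real vol * O1 1 z (inverse ((a - 1) ^ 2) * a)"
  proof (cases "vabs a = 1")
    case False
    then show ?thesis using av by (simp add: frakF_converges_def frakF_def)
  next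
    case True
    obtain N where N: "vabs (inverse ((a - 1) ^ 2) * a) = q ^ (2 * N)" "\<And>x. vabs ((a - 1) * x) \<le> 1 \<longleftrightarrow> lvl x \<le> N"
      "vabs (a - 1) = 1 \<longleftrightarrow> N = 0" "\<And>x. N \<ge> 1 \<Longrightarrow> vabs ((a - 1) * x) < 1 \<longleftrightarrow> lvl x < N"
      using unit_level[OF True a(2)] by metis
    \<comment> \<open>At \<open>N = 0\<close> the only level is the valuation ring itself, and there
      the average is \<open>2 / (q + 1)\<close>.\<close>
    define g :: "nat \<Rightarrow> complex" where "g n = of_real (if N = 0 then 2 / (q + 1) else if n < N then 1 else 1 / (q + 1))" for n
    have av2: "(LINT k|dk. Phi_n (conj_unip a x k)) = (if lvl x \<le> N then g (lvl x) else 0)" for x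
      using True N(4)[of x] unfolding av(2) N(2,3) g_def by (cases "N = 0") auto
    have "(\<Sum>n\<le>N. shell_mass (alf z * alf (- z)) n * (g n * mac z n)) = O1 1 z (inverse ((a - 1) ^ 2) * a)"
    proof (cases "N = 0")
      case True
      then show ?thesis unfolding O1_eq(2)[OF N(1)] by (simp add: g_def shell_mass_def)
    next
      case False
      \<comment> \<open>The boundary weight of \<open>O1_eq\<close>, written in the roots, is the
        mass of \<open>K0\<close>.\<close>
      have "(1 / q) / (1 + 1 / q) = 1 / (q + 1)" using q_gt_1 by (simp add: field_simps)
      then have c: "alf z * alf (- z) / (1 + alf z * alf (- z)) = of_real (1 / (q + 1))"
        unfolding alf_mult by (metis of_real_1 of_real_add of_real_divide)
      have "(\<Sum>n\<le>N. shell_mass (alf z * alf (- z)) n * (g n * mac z n))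
        = (\<Sum>n<N. shell_mass (alf z * alf (- z)) n * (g n * mac z n)) + shell_mass (alf z * alf (- z)) N * (g N * mac z N)"
        unfolding lessThan_Suc_atMost[symmetric] by simp
      also have "(\<Sum>n<N. shell_mass (alf z * alf (- z)) n * (g n * mac z n)) = (\<Sum>n<N. shell_mass (alf z * alf (- z)) n * mac z n)"
        using False by (intro sum.cong) (auto simp: g_def)
      also have "shell_mass (alf z * alf (- z)) N * (g N * mac z N) = of_real (1 / (q + 1)) * (shell_mass (alf z * alf (- z)) N * mac z N)"
        using False by (simp add: g_def)
      finally show ?thesis unfolding O1_eq(2)[OF N(1)] c using False by simp
    qed
    then show ?thesis using frakF_radial_finite[where g = g, OF av(1) av2, of z] True by simp
  qed
  then show "frakF_converges dk dx Phi_n (phi_fin z) a"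
    "frakF dk dx Phi_n (phi_fin z) a = (if vabs a = 1 then 1 else 0) * of_real vol * O1 1 z (inverse ((a - 1) ^ 2) * a)" by blast+
qed

lemma powr_level: "complex_of_real ((q ^ m)\<^sup>2) powr (- (s + 1) / 2) = (alf z * alf (- z) * of_real q powr (- s)) ^ m"
proof -
  have "complex_of_real ((q ^ m)\<^sup>2) powr (- (s + 1) / 2) = ((of_real q powr (- (s + 1) / 2))\<^sup>2) ^ m"
    using q_gt_1 unfolding power_mult[symmetric] mult.commute[of 2] by (intro real_powr_power) simp
  also have "(of_real q powr (- (s + 1) / 2))\<^sup>2 = of_real q powr (- (s + 1) / 2 + - (s + 1) / 2)"
    by (simp only: power2_eq_square powr_add)
  also have "- (s + 1) / 2 + - (s + 1) / 2 = - 1 + - s" by (simp add: field_simps)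
  also have "of_real q powr (- 1 + - s) = alf z * alf (- z) * of_real q powr (- s)"
    unfolding powr_add alf_mult using q_gt_1 by (simp add: powr_minus divide_inverse)
  finally show ?thesis .
qed

text \<open>The maximum norm of the conjugate is constant up to a level \<open>N\<close> and then
  grows with \<open>q ^ lvl x\<close>. Either \<open>vabs (a - 1) = max (vabs a) 1\<close> and
  \<open>N = 0\<close>, or \<open>a\<close> is a unit close to 1 and \<open>N\<close> is the
  exponent of \<open>a - 1\<close>.\<close>

lemma frakF_S:
  assumes a: "a \<noteq> 0" "a \<noteq> 1" and s: "2 * Re s + 1 > \<bar>Re z\<bar>"
  shows "frakF_converges dk dx (Phi_S s) (phi_fin z) a"
    and "frakF dk dx (Phi_S s) (phi_fin z) a = of_real vol * S1 z s (inverse ((a - 1) ^ 2) * a)"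
proof -
  define b where "b = inverse ((a - 1) ^ 2) * a"
  define X where "X = complex_of_real q powr (- s)"
  define c where "c = inverse (complex_of_real q powr (- (s + 1) / 2) - of_real q powr ((s + 1) / 2))"
  have va: "vabs a > 0" "vabs (a - 1) > 0" using a vabs_pos[of a] vabs_pos[of "a - 1"] by auto
  have vb: "vabs b = vabs a / (vabs (a - 1))\<^sup>2" by (simp add: b_def vabs_mult vabs_inverse vabs_power divide_inverse mult.commute)
  define f where "f x = c * of_real (inverse (vabs a) * (max (max (vabs a) (vabs ((a - 1) * x))) 1)\<^sup>2) powr (- (s + 1) / 2)" for x
  have av: "integrable dk (\<lambda>k. Phi_S s (conj_unip a x k))" "(LINT k|dk. Phi_S s (conj_unip a x k)) = f x" for x
    using integral_const_on[OF Phi_S_conj] by (auto simp: f_def c_def)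
  \<comment> \<open>Both cases have this shape, with truncated subtraction in the exponent; they
    differ in \<open>K\<close> and \<open>N\<close> only.\<close>
  have main: "frakF_converges dk dx (Phi_S s) (phi_fin z) a \<and> frakF dk dx (Phi_S s) (phi_fin z) a = of_real vol * S1 z s b"
    if f: "\<And>x. f x = K * (alf z * alf (- z) * X) ^ (lvl x - N)" and S: "S1 z s b = K * macd_total N X (alf z) (alf (- z))" for K N
  proof -
    note T = macd_total_series[OF norm_alf_lt_1(1,2)[OF s, folded X_def] alf_mult_ne(1), of N]
    define t where "t n = shell_mass (alf z * alf (- z)) n * ((alf z * alf (- z) * X) ^ (n - N) * mac z n)" for n
    have e: "shell_mass (alf z * alf (- z)) n * (K * (alf z * alf (- z) * X) ^ (n - N) * mac z n) = K * t n" for n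
      by (simp add: t_def)
    have t: "summable (\<lambda>n. norm (t n))" "suminf t = macd_total N X (alf z) (alf (- z))" using T unfolding t_def by auto
    have sm: "summable (\<lambda>n. norm (shell_mass (alf z * alf (- z)) n * (K * (alf z * alf (- z) * X) ^ (n - N) * mac z n)))"
      unfolding e norm_mult by (intro summable_mult t(1))
    have av2: "(LINT k|dk. Phi_S s (conj_unip a x k)) = K * (alf z * alf (- z) * X) ^ (lvl x - N)" for x unfolding av(2) f ..
    note R = frakF_radial[where g = "\<lambda>n. K * (alf z * alf (- z) * X) ^ (n - N)", OF av(1) av2 sm]
    have "(\<Sum>n. K * t n) = S1 z s b" unfolding S t(2)[symmetric] by (rule suminf_mult[OF summable_norm_cancel[OF t(1)]])
    then show ?thesis using R unfolding e by simp
  qed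
  have "frakF_converges dk dx (Phi_S s) (phi_fin z) a \<and> frakF dk dx (Phi_S s) (phi_fin z) a = of_real vol * S1 z s b"
  proof (cases "vabs (a - 1) = max (vabs a) 1")
    case True
    define M where "M = vabs (a - 1)"
    have M: "M \<ge> 1" "M \<ge> vabs a" "M = max (vabs a) 1" using True by (auto simp: M_def)
    have "vabs a \<le> M\<^sup>2" using M mult_mono[of 1 M "vabs a" M] by (simp add: power2_eq_square)
    then have b1: "vabs b \<le> 1" unfolding vb M_def[symmetric] using M by (simp add: divide_le_eq)
    have bpos: "vabs b > 0" unfolding vb using va by (intro divide_pos_pos zero_less_power)
    have "f x = c * of_real (vabs b) powr ((s + 1) / 2) * (alf z * alf (- z) * X) ^ (lvl x - 0)" for x
    proof -
      \<comment> \<open>The entries 1 and \<open>a\<close> together have norm \<open>M\<close>, so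
        \<open>M\<close> factors out and \<open>max 1 (vabs x)\<close> remains.\<close>
      have "max (max (vabs a) (vabs ((a - 1) * x))) 1 = max (M * 1) (M * vabs x)"
        unfolding vabs_mult M_def[symmetric] using M(3) by (simp add: max.commute max.left_commute max.assoc)
      also have "\<dots> = M * q ^ lvl x" using M(1) by (simp add: lvl[symmetric] max_mult_distrib_left)
      finally have "inverse (vabs a) * (max (max (vabs a) (vabs ((a - 1) * x))) 1)\<^sup>2 = inverse (vabs b) * (q ^ lvl x)\<^sup>2"
        unfolding vb M_def[symmetric] by (simp add: power_mult_distrib divide_inverse)
      moreover have "complex_of_real (inverse (vabs b) * (q ^ lvl x)\<^sup>2) powr (- (s + 1) / 2)
        = of_real (inverse (vabs b)) powr (- (s + 1) / 2) * of_real ((q ^ lvl x)\<^sup>2) powr (- (s + 1) / 2)"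
        using bpos q_gt_1 by (intro real_powr_mult) auto
      moreover have "complex_of_real (inverse (vabs b)) powr (- (s + 1) / 2) = of_real (vabs b) powr ((s + 1) / 2)"
        using bpos by (simp add: powr_def Ln_of_real ln_inverse minus_divide_left[symmetric] del: of_real_inverse minus_add_distrib)
      ultimately show ?thesis unfolding f_def powr_level[of _ s z] X_def by simp
    qed
    then show ?thesis using S1_eq(1)[OF s b1] unfolding c_def[symmetric] X_def[symmetric] by (intro main)
  next
    case False
    \<comment> \<open>If \<open>vabs a\<close> differed from 1, the ultrametric inequality would be
      an equality for \<open>a - 1\<close>, which is the case already treated.\<close>
    have "vabs a = 1"
    proof (rule ccontr)
      assume "vabs a \<noteq> 1"
      then have "vabs (a - 1) = max (vabs a) 1"
        using vabs_add_eq[of a "- 1"] vabs_add_eq[of "- 1" a] by (cases "vabs a < 1") auto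
      then show False using False by simp
    qed
    note a1 = this
    obtain N where N: "vabs (a - 1) = 1 / q ^ N" "vabs b = q ^ (2 * N)" "vabs (a - 1) = 1 \<longleftrightarrow> N = 0"
      using unit_level[OF a1 a(2)] unfolding b_def by metis
    have N1: "N \<ge> 1" using False a1 N(3) by (cases N) auto
    have qN: "q ^ N > 0" using q_gt_1 by simp
    have "f x = c * (alf z * alf (- z) * X) ^ (lvl x - N)" for x
    proof -
      have "max (max (vabs a) (vabs ((a - 1) * x))) 1 = q ^ (lvl x - N)"
      proof (cases "lvl x \<le> N")
        case True
        then have "vabs x \<le> q ^ N" by (simp add: lvl_le_iff)
        then have "vabs ((a - 1) * x) \<le> 1" using qN by (simp add: vabs_mult N(1))
        then show ?thesis using True a1 by simp
      next
        case False
        then have "q ^ lvl x > 1" using q_gt_1 by (intro one_less_power) auto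
        then have "vabs x = q ^ lvl x" using lvl[of x] by (auto simp: max_def split: if_splits)
        then have "vabs ((a - 1) * x) = q ^ (lvl x - N)" using False q_gt_1 by (simp add: vabs_mult N(1) power_diff)
        moreover have "q ^ (lvl x - N) \<ge> 1" using q_gt_1 by (intro one_le_power) simp
        ultimately show ?thesis using a1 by simp
      qed
      then show ?thesis unfolding f_def a1 X_def powr_level[of _ s z, symmetric] by simp
    qed
    then show ?thesis using S1_eq(2)[OF s N(2) N1] unfolding c_def[symmetric] X_def[symmetric] by (intro main)
  qed
  then show "frakF_converges dk dx (Phi_S s) (phi_fin z) a" "frakF dk dx (Phi_S s) (phi_fin z) a = of_real vol * S1 z s (inverse ((a - 1) ^ 2) * a)"
    unfolding b_def by auto
qed

end

section \<open>Assembly over the places\<close>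

lemma completion_local_place:
  fixes \<iota> :: "'f::field_char_0 \<Rightarrow> 'k::{field_char_0,complete_space}"
  assumes "v \<in> finite_places" "is_completion_at v \<iota>" "is_haar_prob GL2_val_ring dk" "is_haar_field (dx :: 'k measure)"
  shows "\<exists>\<pi> :: 'k. local_place \<pi> (real (qv TYPE('k))) dx dk"
proof -
  obtain \<pi> :: 'k where "local_field \<pi> (real (qv TYPE('k)))" using completion_local_field[OF assms(1,2)] by blast
  then have "local_place \<pi> (real (qv TYPE('k))) dx dk"
    using assms(3,4) by (simp add: local_place_def local_field_haar_def local_field_haar_axioms_def local_field_group_def local_field_group_axioms_def)
  then show ?thesis by blast
qed

lemma local_place_vol:
  fixes dx :: "'k::{field_char_0,metric_space} measure"
  assumes "local_place \<pi> q dx dk"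
  shows "local_field_haar.vol dx = real (qv TYPE('k)) powr (- real (dv TYPE('k)) / 2)"
proof -
  interpret local_place \<pi> q dx dk by (rule assms)
  show ?thesis unfolding vol_eq q_def ..
qed

theorem theorem6p4:
  fixes \<nn> :: "'f::field_char_0 set"
    and S :: "'f set set"
    and l :: "('f \<Rightarrow> real) \<Rightarrow> nat"
  assumes F: "number_field TYPE('f)" "totally_real TYPE('f)"
    and n: "ideal \<nn> int_ring" "\<nn> \<noteq> {0}" "squarefree_ideal \<nn>"
    and S: "finite S" "S \<subseteq> finite_places" "S \<inter> places_dividing \<nn> = {}"
    and l: "\<forall>v\<in>real_places. even (l v) \<and> l v \<ge> 4"
  shows
    "(\<forall>v\<in>real_places. \<forall>dk a z.
        is_haar_prob O2 dk \<and> a \<noteq> 0 \<and> a \<noteq> 1 \<and> \<bar>Re z\<bar> < 2 * real (l v) - 1 \<longrightarrow>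
        frakF_converges dk lborel (Phi_real (l v)) (phi_real z) a \<and>
        frakF dk lborel (Phi_real (l v)) (phi_real z) a =
          complex_of_real (4 * pi) / Gamma (of_nat (l v)) *
          (Gamma (of_nat (l v) + (z - 1) / 2) * Gamma (of_nat (l v) + (- z - 1) / 2) /
            (Gamma_R ((1 + z) / 2) * Gamma_R ((1 - z) / 2))) *
          (if a > 0 then 1 else 0) *
          complex_of_real (\<bar>a\<bar> powr (1 / 2) * inverse \<bar>a - 1\<bar>) *
          Legendre_P (1 - of_nat (l v)) ((z - 1) / 2)
            (complex_of_real ((\<bar>(a - 1) / (a + 1)\<bar> ^ 2) powr (- 1 / 2))))
     \<and>
     (\<forall>v \<in> finite_places - (S \<union> places_dividing \<nn>).
        \<forall>(\<iota> :: 'f \<Rightarrow> 'k::{field_char_0,complete_space})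
          (dk :: ('k^2^2) measure) (dx :: 'k measure) (a :: 'k) z.
        is_completion_at v \<iota> \<and> is_haar_prob GL2_val_ring dk \<and> is_haar_field dx \<and>
        a \<noteq> 0 \<and> a \<noteq> 1 \<longrightarrow>
        frakF_converges dk dx Phi_unram (phi_fin z) a \<and>
        frakF dk dx Phi_unram (phi_fin z) a =
          (if vabs a = 1 then 1 else 0) *
          complex_of_real (real (qv TYPE('k)) powr (- real (dv TYPE('k)) / 2)) *
          O1 0 z (inverse ((a - 1) ^ 2) * a) \<and>
        (vabs a = 1 \<and> vabs (a - 1) = 1 \<longrightarrow>
          frakF dk dx Phi_unram (phi_fin z) a =
            complex_of_real (real (qv TYPE('k)) powr (- real (dv TYPE('k)) / 2))))
     \<and>
     (\<forall>v \<in> places_dividing \<nn>.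
        \<forall>(\<iota> :: 'f \<Rightarrow> 'k::{field_char_0,complete_space})
          (dk :: ('k^2^2) measure) (dx :: 'k measure) (a :: 'k) z.
        is_completion_at v \<iota> \<and> is_haar_prob GL2_val_ring dk \<and> is_haar_field dx \<and>
        a \<noteq> 0 \<and> a \<noteq> 1 \<longrightarrow>
        frakF_converges dk dx Phi_n (phi_fin z) a \<and>
        frakF dk dx Phi_n (phi_fin z) a =
          (if vabs a = 1 then 1 else 0) *
          complex_of_real (real (qv TYPE('k)) powr (- real (dv TYPE('k)) / 2)) *
          O1 1 z (inverse ((a - 1) ^ 2) * a))
     \<and>
     (\<forall>v \<in> S.
        \<forall>(\<iota> :: 'f \<Rightarrow> 'k::{field_char_0,complete_space})
          (dk :: ('k^2^2) measure) (dx :: 'k measure) (a :: 'k) z s.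
        is_completion_at v \<iota> \<and> is_haar_prob GL2_val_ring dk \<and> is_haar_field dx \<and>
        a \<noteq> 0 \<and> a \<noteq> 1 \<and> 2 * Re s + 1 > \<bar>Re z\<bar> \<longrightarrow>
        frakF_converges dk dx (Phi_S s) (phi_fin z) a \<and>
        frakF dk dx (Phi_S s) (phi_fin z) a =
          complex_of_real (real (qv TYPE('k)) powr (- real (dv TYPE('k)) / 2)) *
          S1 z s (inverse ((a - 1) ^ 2) * a))"
proof (intro conjI ballI allI impI)
  fix v dk and a :: real and z
  assume v: "v \<in> real_places" and h: "is_haar_prob O2 dk \<and> a \<noteq> 0 \<and> a \<noteq> 1 \<and> \<bar>Re z\<bar> < 2 * real (l v) - 1"
  have lv: "even (l v)" "l v \<ge> 4" using l v by auto
  note R = frakF_real[of dk a "l v" z]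
  show "frakF_converges dk lborel (Phi_real (l v)) (phi_real z) a" using R(1) h lv by blast
  show "frakF dk lborel (Phi_real (l v)) (phi_real z) a =
          complex_of_real (4 * pi) / Gamma (of_nat (l v)) *
          (Gamma (of_nat (l v) + (z - 1) / 2) * Gamma (of_nat (l v) + (- z - 1) / 2) /
            (Gamma_R ((1 + z) / 2) * Gamma_R ((1 - z) / 2))) *
          (if a > 0 then 1 else 0) *
          complex_of_real (\<bar>a\<bar> powr (1 / 2) * inverse \<bar>a - 1\<bar>) *
          Legendre_P (1 - of_nat (l v)) ((z - 1) / 2)
            (complex_of_real ((\<bar>(a - 1) / (a + 1)\<bar> ^ 2) powr (- 1 / 2)))" using R(2) h lv by blast
next
  fix v and \<iota> :: "'f \<Rightarrow> 'k::{field_char_0,complete_space}" and dk :: "('k^2^2) measure" and dx :: "'k measure" and a :: 'k and z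
  assume v: "v \<in> finite_places - (S \<union> places_dividing \<nn>)"
    and h: "is_completion_at v \<iota> \<and> is_haar_prob GL2_val_ring dk \<and> is_haar_field dx \<and> a \<noteq> 0 \<and> a \<noteq> 1"
  obtain \<pi> :: 'k where p: "local_place \<pi> (real (qv TYPE('k))) dx dk" using completion_local_place v h by blast
  note R = local_place.frakF_unram[OF p, unfolded local_place_vol[OF p], of a z]
  show "frakF_converges dk dx Phi_unram (phi_fin z) a" using R(1) h by blast
  show "frakF dk dx Phi_unram (phi_fin z) a = (if vabs a = 1 then 1 else 0) *
          complex_of_real (real (qv TYPE('k)) powr (- real (dv TYPE('k)) / 2)) * O1 0 z (inverse ((a - 1) ^ 2) * a)" using R(2) h by blast
next
  fix v and \<iota> :: "'f \<Rightarrow> 'k::{field_char_0,complete_space}" and dk :: "('k^2^2) measure" and dx :: "'k measure" and a :: 'k and z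
  assume v: "v \<in> finite_places - (S \<union> places_dividing \<nn>)"
    and h: "is_completion_at v \<iota> \<and> is_haar_prob GL2_val_ring dk \<and> is_haar_field dx \<and> a \<noteq> 0 \<and> a \<noteq> 1"
    and u: "vabs a = 1 \<and> vabs (a - 1) = 1"
  obtain \<pi> :: 'k where p: "local_place \<pi> (real (qv TYPE('k))) dx dk" using completion_local_place v h by blast
  show "frakF dk dx Phi_unram (phi_fin z) a = complex_of_real (real (qv TYPE('k)) powr (- real (dv TYPE('k)) / 2))"
    using local_place.frakF_unram(3)[OF p, unfolded local_place_vol[OF p], of a z] h u by blast
next
  fix v and \<iota> :: "'f \<Rightarrow> 'k::{field_char_0,complete_space}" and dk :: "('k^2^2) measure" and dx :: "'k measure" and a :: 'k and z
  assume v: "v \<in> places_dividing \<nn>"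
    and h: "is_completion_at v \<iota> \<and> is_haar_prob GL2_val_ring dk \<and> is_haar_field dx \<and> a \<noteq> 0 \<and> a \<noteq> 1"
  have v': "v \<in> finite_places" using v by (simp add: places_dividing_def)
  obtain \<pi> :: 'k where p: "local_place \<pi> (real (qv TYPE('k))) dx dk" using completion_local_place v' h by blast
  note R = local_place.frakF_n[OF p, unfolded local_place_vol[OF p], of a z]
  show "frakF_converges dk dx Phi_n (phi_fin z) a" using R(1) h by blast
  show "frakF dk dx Phi_n (phi_fin z) a = (if vabs a = 1 then 1 else 0) *
          complex_of_real (real (qv TYPE('k)) powr (- real (dv TYPE('k)) / 2)) * O1 1 z (inverse ((a - 1) ^ 2) * a)" using R(2) h by blast
next
  fix v and \<iota> :: "'f \<Rightarrow> 'k::{field_char_0,complete_space}" and dk :: "('k^2^2) measure" and dx :: "'k measure" and a :: 'k and z s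
  assume v: "v \<in> S"
    and h: "is_completion_at v \<iota> \<and> is_haar_prob GL2_val_ring dk \<and> is_haar_field dx \<and> a \<noteq> 0 \<and> a \<noteq> 1 \<and> 2 * Re s + 1 > \<bar>Re z\<bar>"
  have v': "v \<in> finite_places" using v S by blast
  obtain \<pi> :: 'k where p: "local_place \<pi> (real (qv TYPE('k))) dx dk" using completion_local_place v' h by blast
  note R = local_place.frakF_S[OF p, unfolded local_place_vol[OF p], of a z s]
  show "frakF_converges dk dx (Phi_S s) (phi_fin z) a" using R(1) h by blast
  show "frakF dk dx (Phi_S s) (phi_fin z) a =
          complex_of_real (real (qv TYPE('k)) powr (- real (dv TYPE('k)) / 2)) * S1 z s (inverse ((a - 1) ^ 2) * a)" using R(2) h by blast
qed

end
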